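(* Let $\{X_n\}$ be a uniformly elliptic inhomogeneous Markov chain, let $\{f_n\}$ be a uniformly bounded sequence of measurable functions $f_n:\mathcal X_n\times\mathcal X_{n+1}\to\mathbb R$, and let $S_N,V_N,\sigma_N$ be as in the context. Suppose that $\lim_{N\to\infty}V_N=\infty$ and that there are $C>0$ and $\beta\in(0,1/2)$ such that $\|f_n\|_\infty\le Cn^{-\beta}$ for all $n\in\mathbb N$. Let $r\ge1$ be an integer satisfying $$r<\frac1{1-2\beta}.$$ Then $S_N$ admits an Edgeworth expansion of order $r$. In particular, if $V_N\to\infty$ and $\|f_n\|_\infty=O(n^{-1/2})$, then $S_N$ admits Edgeworth expansions of all orders.
   Context: Setting. $(\mathcal X_i,\mathcal F_i)$, $i\ge1$, are measurable spaces. For each $i$, $R_i(x,dy)$, $x\in\mathcal X_i$, is a measurable family of probability measures on $\mathcal X_{i+1}$. $\mu_1$ is any probability measure on $\mathcal X_1$, and $\{X_j\}_{j\ge1}$ is the Markov chain with $X_1\sim\mu_1$ and $\mathbb P(X_{j+1}\in A\mid X_j=x)=R_j(x,A)$. The chain is called uniformly elliptic (with constant $\varepsilon_0>0$) if there are probability measures $\mathfrak m_j$ on $\mathcal X_j$, $j>1$, and transition densities $p_j(x,y)\geq 0$ with $R_j(x,dy)=p_j(x,y)\,d\mathfrak m_{j+1}(y)$ such that for all $j\ge 1$: $\sup_{x,y}p_j(x,y)\le 1/\varepsilon_0$, and $\inf_{x,z}\int p_j(x,y)p_{j+1}(y,z)\,d\mathfrak m_{j+1}(y)\ge\varepsilon_0$.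 Notation. $Y_n=f_n(X_n,X_{n+1})$, $\|f_n\|_\infty$ is the essential supremum of $|Y_n|$, $S_N=\sum_{n=1}^N(Y_n-\mathbb E(Y_n))$, $V_N=\mathrm{Var}(S_N)$, $\sigma_N=\sqrt{V_N}$, $\hat S_N=(S_N-\mathbb E[S_N])/\sigma_N$. Edgeworth expansion of order $r$ (integer $r\ge1$): there are polynomials $P_{1,N},\dots,P_{r,N}$ with degrees not depending on $N$ and coefficients uniformly bounded in $N$ such that $\sup_{t\in\mathbb R}\big|\mathbb P(\hat S_N\le t)-\Phi(t)-\sum_{j=1}^r\sigma_N^{-j}P_{j,N}(t)\phi(t)\big|=o(\sigma_N^{-r})$ as $N\to\infty$, where $\Phi$ and $\phi(t)=\frac1{\sqrt{2\pi}}e^{-t^2/2}$ are the standard normal distribution function and density. *)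

theory Defs
  imports "HOL-Probability.Probability" "HOL-Library.Landau_Symbols"
    "HOL-Computational_Algebra.Polynomial"
begin

text \<open>
  The state space at time \<open>j \<ge> 1\<close> is the measurable space carried by \<open>S j\<close>; the measure part of
  \<open>S j\<close> is never used. The value of any sequence below at time \<open>0\<close> is irrelevant.
\<close>

text \<open>
  The conditioning \<open>\<sigma>\<close>-algebra is the one generated by \<open>X 1, \<dots>, X j\<close>, so that the last clause is
  the Markov property together with the transition law \<open>P(X (j+1) \<in> A | X j = x) = R j x A\<close>.
\<close>

definition is_markov_chain ::
  "'w measure \<Rightarrow> (nat \<Rightarrow> 'a measure) \<Rightarrow> 'a measure \<Rightarrow> (nat \<Rightarrow> 'a \<Rightarrow> 'a measure) \<Rightarrow>
    (nat \<Rightarrow> 'w \<Rightarrow> 'a) \<Rightarrow> bool"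
where
  "is_markov_chain M S \<mu>\<^sub>1 R X \<longleftrightarrow>
     prob_space M \<and>
     \<mu>\<^sub>1 \<in> space (prob_algebra (S 1)) \<and>
     (\<forall>j\<ge>1. R j \<in> S j \<rightarrow>\<^sub>M prob_algebra (S (Suc j))) \<and>
     (\<forall>j\<ge>1. X j \<in> M \<rightarrow>\<^sub>M S j) \<and>
     distr M (S 1) (X 1) = \<mu>\<^sub>1 \<and>
     (\<forall>j\<ge>1. \<forall>A\<in>sets (S (Suc j)).
        AE \<omega> in M.
          real_cond_exp M
            (vimage_algebra (space M) (\<lambda>\<omega>. \<lambda>i\<in>{1..j}. X i \<omega>) (PiM {1..j} S))
            (\<lambda>\<omega>. indicator A (X (Suc j) \<omega>)) \<omega>
          = measure (R j (X j \<omega>)) A)"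

definition uniformly_elliptic ::
  "(nat \<Rightarrow> 'a measure) \<Rightarrow> (nat \<Rightarrow> 'a \<Rightarrow> 'a measure) \<Rightarrow> bool"
where
  "uniformly_elliptic S R \<longleftrightarrow>
     (\<exists>\<epsilon>\<^sub>0>0. \<exists>m :: nat \<Rightarrow> 'a measure. \<exists>p :: nat \<Rightarrow> 'a \<Rightarrow> 'a \<Rightarrow> real.
        (\<forall>j>1. m j \<in> space (prob_algebra (S j))) \<and>
        (\<forall>j\<ge>1.
           case_prod (p j) \<in> borel_measurable (S j \<Otimes>\<^sub>M S (Suc j)) \<and>
           (\<forall>x\<in>space (S j). \<forall>y\<in>space (S (Suc j)). 0 \<le> p j x y \<and> p j x y \<le> 1 / \<epsilon>\<^sub>0) \<and>
           (\<forall>x\<in>space (S j). R j x = density (m (Suc j)) (\<lambda>y. ennreal (p j x y))) \<and>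
           (\<forall>x\<in>space (S j). \<forall>z\<in>space (S (Suc (Suc j))).
              \<epsilon>\<^sub>0 \<le> (LINT y|m (Suc j). p j x y * p (Suc j) y z))))"

definition chain_fun ::
  "(nat \<Rightarrow> 'w \<Rightarrow> 'a) \<Rightarrow> (nat \<Rightarrow> 'a \<Rightarrow> 'a \<Rightarrow> real) \<Rightarrow> nat \<Rightarrow> 'w \<Rightarrow> real"
where
  "chain_fun X f n \<omega> = f n (X n \<omega>) (X (Suc n) \<omega>)"

definition chain_fun_norm ::
  "'w measure \<Rightarrow> (nat \<Rightarrow> 'w \<Rightarrow> 'a) \<Rightarrow> (nat \<Rightarrow> 'a \<Rightarrow> 'a \<Rightarrow> real) \<Rightarrow> nat \<Rightarrow> ereal"
where
  "chain_fun_norm M X f n = esssup M (\<lambda>\<omega>. ereal \<bar>chain_fun X f n \<omega>\<bar>)"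

definition centered_sum ::
  "'w measure \<Rightarrow> (nat \<Rightarrow> 'w \<Rightarrow> 'a) \<Rightarrow> (nat \<Rightarrow> 'a \<Rightarrow> 'a \<Rightarrow> real) \<Rightarrow> nat \<Rightarrow> 'w \<Rightarrow> real"
where
  "centered_sum M X f N \<omega> =
     (\<Sum>n=1..N. chain_fun X f n \<omega> - prob_space.expectation M (chain_fun X f n))"

definition std_dev :: "'w measure \<Rightarrow> ('w \<Rightarrow> real) \<Rightarrow> real" where
  "std_dev M Z = sqrt (prob_space.variance M Z)"

definition normalized :: "'w measure \<Rightarrow> ('w \<Rightarrow> real) \<Rightarrow> 'w \<Rightarrow> real" where
  "normalized M Z \<omega> = (Z \<omega> - prob_space.expectation M Z) / std_dev M Z"

text \<open>
  \<open>T\<close> is a sequence of random variables. The real supremum below is always that of a bounded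
  function of \<open>t\<close>, because a polynomial times the Gaussian density is bounded.
\<close>

definition edgeworth_expansion ::
  "'w measure \<Rightarrow> (nat \<Rightarrow> 'w \<Rightarrow> real) \<Rightarrow> nat \<Rightarrow> bool"
where
  "edgeworth_expansion M T r \<longleftrightarrow>
     (\<exists>P :: nat \<Rightarrow> nat \<Rightarrow> real poly.
        (\<forall>j\<in>{1..r}. \<exists>d. \<forall>N. degree (P j N) = d) \<and>
        (\<exists>K. \<forall>j\<in>{1..r}. \<forall>N i. \<bar>coeff (P j N) i\<bar> \<le> K) \<and>
        (\<lambda>N. SUP t. \<bar>cdf (distr M borel (normalized M (T N))) t
                  - cdf std_normal_distribution t
                  - (\<Sum>j=1..r. poly (P j N) t * std_normal_density t / std_dev M (T N) ^ j)\<bar>)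
          \<in> o(\<lambda>N. 1 / std_dev M (T N) ^ r))"

end

theory Submission
  imports Defs "HOL-Complex_Analysis.Complex_Analysis" "HOL-Real_Asymp.Real_Asymp"
begin

text \<open>
  For a window of indices on which the summands are small compared with the ellipticity constant,
  write \<open>S = u(X\<^sub>a) + \<Sum> D\<^sub>n\<close> with martingale differences \<open>D\<^sub>n\<close> (Gordin), so that the variance of
  \<open>S\<close> is a sum of second moments. The backward recursion \<open>h\<^sub>n = P\<^sub>n(e\<^bsup>z D\<^sub>n\<^esup> h\<^sub>n\<^sub>+\<^sub>1)\<close> computes
  \<open>E e\<^bsup>z S\<^esup>\<close>, and the two-step \<open>L\<^sup>2\<close> contraction coming from ellipticity keeps \<open>h\<^sub>n\<close> close to its mean.
  The outcome is a holomorphic logarithm of \<open>E e\<^bsup>z S\<^esup>\<close> on the unit disc bounded by \<open>10 Var S\<close>; no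
  error additive in the number of summands appears.

  By Cauchy's estimates all cumulants of \<open>S\<^sub>N\<close> are \<open>O(V\<^sub>N)\<close>, which gives the expansion of the
  characteristic function for frequencies \<open>t\<close> of \<open>S\<^sub>N\<close> below a constant. For larger \<open>t\<close> apply the
  bound to \<open>t f\<^sub>n\<close> with \<open>n \<ge> a\<close>, where \<open>t a\<^bsup>-\<beta>\<^esup>\<close> is small. The discarded indices have variance
  \<open>O(a\<^bsup>1-2\<beta>\<^esup>)\<close>, which is \<open>o(V\<^sub>N)\<close> for \<open>t\<close> up to \<open>\<sigma>\<^sub>N\<^bsup>r-1+\<rho>\<^esup>\<close> with some \<open>\<rho> > 0\<close> exactly because
  \<open>r (1 - 2\<beta>) < 1\<close>. So the characteristic function of \<open>S\<^sub>N / \<sigma>\<^sub>N\<close> has Gaussian decay up to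
  \<open>\<sigma>\<^sub>N\<^bsup>r+\<rho>\<^esup>\<close>, and smoothing with a Gaussian of smaller scale than \<open>\<sigma>\<^sub>N\<^bsup>-r\<^esup>\<close> together with Levy
  inversion yields the expansion.
\<close>

section \<open>Elliptic Markov chains\<close>

text \<open>The variance may grow far more slowly than the sum of the squared sup norms of the
  summands, so an error measured by sup norms could swamp it. This is why the fluctuation of
  \<open>h\<close> is measured in mean square: the recursion is then fed by the second moments of
  the differences \<open>D\<close>, whose sum is at most the variance by orthogonality. Sup norms
  enter only as small factors that keep the perturbation below half of the gap \<epsilon>.
  Ellipticity controls two consecutive transitions, so a single step need not contract; hence the
  estimates that use it relate times n, n+1 and n+2. At high frequencies the early summands are not
  small, and being dependent on the later ones they cannot be factored out. They are kept as an
  arbitrary weight of modulus at most 1, measurable with respect to the past; since \<open>h\<close>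
  at time a is nearly constant, such a weight costs only a factor 2. The thresholds are explicit and
  not optimal: |D| \<le> \<epsilon>/100 closes the recursion, and since Gordin's differences are at
  most 18 b / \<epsilon> for summands bounded by b, the summands must satisfy b \<le>
  \<epsilon>^2/1800.\<close>

definition bdd_meas :: "'a measure \<Rightarrow> ('a \<Rightarrow> 'b::real_normed_vector) \<Rightarrow> bool" where
  "bdd_meas A F \<longleftrightarrow> F \<in> borel_measurable A \<and> bounded (F ` space A)"

lemma bdd_measI:
  assumes "F \<in> borel_measurable A" "\<And>x. x \<in> space A \<Longrightarrow> norm (F x) \<le> B"
  shows "bdd_meas A F"
  using assms by (auto simp: bdd_meas_def bounded_iff)

lemma bdd_measE:
  assumes "bdd_meas A F"
  obtains B where "F \<in> borel_measurable A" "0 \<le> B" "\<And>x. x \<in> space A \<Longrightarrow> norm (F x) \<le> B"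
proof -
  from assms obtain B where "F \<in> borel_measurable A" "\<And>x. x \<in> space A \<Longrightarrow> norm (F x) \<le> B"
    by (auto simp: bdd_meas_def bounded_iff)
  then show thesis by (intro that[of "max 0 B"]) (auto simp: le_max_iff_disj)
qed

lemma bdd_meas_measurable [measurable_dest]: "bdd_meas A F \<Longrightarrow> F \<in> borel_measurable A"
  by (simp add: bdd_meas_def)

named_theorems bdd_meas_intros

lemma bdd_meas_const [bdd_meas_intros]: "bdd_meas A (\<lambda>x. c)"
  by (rule bdd_measI[of _ _ "norm c"]) auto

lemma bdd_meas_compose:
  assumes "bdd_meas B F" "g \<in> A \<rightarrow>\<^sub>M B"
  shows "bdd_meas A (\<lambda>x. F (g x))"
proof -
  obtain C where "F \<in> borel_measurable B" "\<And>x. x \<in> space B \<Longrightarrow> norm (F x) \<le> C"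
    using assms(1) by (elim bdd_measE) blast
  with assms(2) show ?thesis
    by (intro bdd_measI[of _ _ C]) (auto dest: measurable_space)
qed

lemma bdd_meas_fst [bdd_meas_intros]: "bdd_meas A F \<Longrightarrow> bdd_meas (A \<Otimes>\<^sub>M B) (\<lambda>p. F (fst p))"
  by (erule bdd_meas_compose) measurable

lemma bdd_meas_snd [bdd_meas_intros]: "bdd_meas B F \<Longrightarrow> bdd_meas (A \<Otimes>\<^sub>M B) (\<lambda>p. F (snd p))"
  by (erule bdd_meas_compose) measurable

lemma bdd_meas_continuous:
  fixes F :: "'a \<Rightarrow> 'b::{second_countable_topology, heine_borel, real_normed_vector}"
    and \<phi> :: "'b \<Rightarrow> 'c::real_normed_vector"
  assumes "bdd_meas A F" "continuous_on UNIV \<phi>"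
  shows "bdd_meas A (\<lambda>x. \<phi> (F x))"
proof -
  have "compact (closure (F ` space A))"
    using assms(1) by (simp add: bdd_meas_def)
  then have "compact (\<phi> ` closure (F ` space A))"
    using compact_continuous_image[OF continuous_on_subset[OF assms(2) subset_UNIV]] by blast
  then have "bounded (\<phi> ` closure (F ` space A))"
    by (rule compact_imp_bounded)
  then have "bounded (\<phi> ` F ` space A)"
    by (rule bounded_subset) (rule image_mono[OF closure_subset])
  then have "bounded ((\<lambda>x. \<phi> (F x)) ` space A)"
    by (simp only: image_image)
  moreover have "(\<lambda>x. \<phi> (F x)) \<in> borel_measurable A"
    by (rule borel_measurable_continuous_on[OF assms(2) bdd_meas_measurable[OF assms(1)]])
  ultimately show ?thesis by (simp add: bdd_meas_def)
qed

lemma bdd_meas_norm [bdd_meas_intros]: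
  fixes F :: "'a \<Rightarrow> 'b::{second_countable_topology, heine_borel, real_normed_vector}"
  shows "bdd_meas A F \<Longrightarrow> bdd_meas A (\<lambda>x. norm (F x))"
  by (erule bdd_meas_continuous) (intro continuous_intros)

lemma bdd_meas_of_real [bdd_meas_intros]: "bdd_meas A F \<Longrightarrow> bdd_meas A (\<lambda>x. complex_of_real (F x))"
  by (erule bdd_meas_continuous) (intro continuous_intros)

lemma bdd_meas_Re [bdd_meas_intros]: "bdd_meas A F \<Longrightarrow> bdd_meas A (\<lambda>x. Re (F x))"
  by (erule bdd_meas_continuous) (intro continuous_intros)

lemma bdd_meas_Im [bdd_meas_intros]: "bdd_meas A F \<Longrightarrow> bdd_meas A (\<lambda>x. Im (F x))"
  by (erule bdd_meas_continuous) (intro continuous_intros)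

lemma bdd_meas_exp [bdd_meas_intros]:
  fixes F :: "'a \<Rightarrow> complex"
  shows "bdd_meas A F \<Longrightarrow> bdd_meas A (\<lambda>x. exp (F x))"
  by (erule bdd_meas_continuous) (intro continuous_intros)

lemma bdd_meas_uminus [bdd_meas_intros]:
  fixes F :: "'a \<Rightarrow> 'b::{second_countable_topology, heine_borel, real_normed_vector}"
  shows "bdd_meas A F \<Longrightarrow> bdd_meas A (\<lambda>x. - F x)"
  by (erule bdd_meas_continuous) (intro continuous_intros)

lemma bdd_meas_power [bdd_meas_intros]:
  fixes F :: "'a \<Rightarrow> 'b::{second_countable_topology, heine_borel, real_normed_field}"
  shows "bdd_meas A F \<Longrightarrow> bdd_meas A (\<lambda>x. F x ^ k)"
  by (erule bdd_meas_continuous) (intro continuous_intros)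

lemma bdd_meas_add [bdd_meas_intros]:
  fixes F G :: "'a \<Rightarrow> 'b::{second_countable_topology, real_normed_vector}"
  assumes "bdd_meas A F" "bdd_meas A G"
  shows "bdd_meas A (\<lambda>x. F x + G x)"
proof -
  obtain B where "F \<in> borel_measurable A" "\<And>x. x \<in> space A \<Longrightarrow> norm (F x) \<le> B"
    using assms(1) by (elim bdd_measE) blast
  moreover obtain C where "G \<in> borel_measurable A" "\<And>x. x \<in> space A \<Longrightarrow> norm (G x) \<le> C"
    using assms(2) by (elim bdd_measE) blast
  ultimately show ?thesis
    by (intro bdd_measI[of _ _ "B + C"]) (auto intro: norm_triangle_mono)
qed

lemma bdd_meas_diff [bdd_meas_intros]:
  fixes F G :: "'a \<Rightarrow> 'b::{second_countable_topology, heine_borel, real_normed_vector}"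
  assumes "bdd_meas A F" "bdd_meas A G"
  shows "bdd_meas A (\<lambda>x. F x - G x)"
  using bdd_meas_add[OF assms(1) bdd_meas_uminus[OF assms(2)]] by simp

lemma bdd_meas_mult [bdd_meas_intros]:
  fixes F G :: "'a \<Rightarrow> 'b::{second_countable_topology, real_normed_field}"
  assumes "bdd_meas A F" "bdd_meas A G"
  shows "bdd_meas A (\<lambda>x. F x * G x)"
proof -
  obtain B where "F \<in> borel_measurable A" "\<And>x. x \<in> space A \<Longrightarrow> norm (F x) \<le> B" "0 \<le> B"
    using assms(1) by (elim bdd_measE) blast
  moreover obtain C where "G \<in> borel_measurable A" "\<And>x. x \<in> space A \<Longrightarrow> norm (G x) \<le> C" "0 \<le> C"
    using assms(2) by (elim bdd_measE) blast
  ultimately show ?thesis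
    by (intro bdd_measI[of _ _ "B * C"]) (auto simp: norm_mult intro!: mult_mono)
qed

lemma bdd_meas_divide [bdd_meas_intros]:
  fixes F :: "'a \<Rightarrow> 'b::{second_countable_topology, real_normed_field}"
  assumes "bdd_meas A F"
  shows "bdd_meas A (\<lambda>x. F x / c)"
  using bdd_meas_mult[OF assms bdd_meas_const[of _ "inverse c"]] by (simp add: field_simps)

lemma bdd_meas_sum [bdd_meas_intros]:
  fixes F :: "'i \<Rightarrow> 'a \<Rightarrow> 'b::{second_countable_topology, real_normed_vector}"
  assumes "\<And>i. i \<in> I \<Longrightarrow> bdd_meas A (F i)"
  shows "bdd_meas A (\<lambda>x. \<Sum>i\<in>I. F i x)"
  using assms
proof (induction I rule: infinite_finite_induct)
  case (insert i I)
  then show ?case by (simp add: bdd_meas_add)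
qed (auto intro: bdd_meas_const)

section \<open>Integrals and second moments of bounded functions\<close>

lemma (in finite_measure) integrable_bdd_meas:
  fixes F :: "'a \<Rightarrow> 'b::{second_countable_topology, banach}"
  shows "bdd_meas M F \<Longrightarrow> integrable M F"
  by (elim bdd_measE, intro integrable_const_bound) auto

lemma (in prob_space) norm_integral_le:
  fixes F :: "'a \<Rightarrow> 'b::{second_countable_topology, banach}"
  assumes "\<And>x. x \<in> space M \<Longrightarrow> norm (F x) \<le> B" "0 \<le> B"
  shows "norm (\<integral>x. F x \<partial>M) \<le> B"
proof (cases "integrable M F")
  case True
  have "norm (\<integral>x. F x \<partial>M) \<le> (\<integral>x. norm (F x) \<partial>M)" by simp
  also have "\<dots> \<le> (\<integral>x. B \<partial>M)"
    using True assms by (intro integral_mono_AE) auto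
  finally show ?thesis by (simp add: prob_space)
next
  case False
  then show ?thesis using assms(2) by (simp add: not_integrable_integral_eq)
qed

lemma (in prob_space) square_integral_norm_le:
  fixes F :: "'a \<Rightarrow> complex"
  assumes "bdd_meas M F"
  shows "(cmod (\<integral>x. F x \<partial>M))\<^sup>2 \<le> (\<integral>x. (cmod (F x))\<^sup>2 \<partial>M)"
proof -
  define G where "G = (\<lambda>x. cmod (F x))"
  have G: "bdd_meas M G" unfolding G_def using assms by (intro bdd_meas_intros)
  have "cmod (\<integral>x. F x \<partial>M) \<le> (\<integral>x. G x \<partial>M)" by (simp add: G_def)
  then have "(cmod (\<integral>x. F x \<partial>M))\<^sup>2 \<le> (\<integral>x. G x \<partial>M)\<^sup>2"
    by (intro power_mono) auto
  also have "\<dots> \<le> (\<integral>x. (G x)\<^sup>2 \<partial>M)"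
  proof -
    have i: "integrable M G" "integrable M (\<lambda>x. (G x)\<^sup>2)"
      using G by (auto intro!: integrable_bdd_meas bdd_meas_intros)
    have "0 \<le> variance G" by simp
    also have "\<dots> = (\<integral>x. (G x)\<^sup>2 \<partial>M) - (\<integral>x. G x \<partial>M)\<^sup>2"
      by (rule variance_eq[OF i])
    finally show ?thesis by simp
  qed
  finally show ?thesis by (simp add: G_def)
qed

lemma (in prob_space) integral_centered_norm_le:
  fixes F :: "'a \<Rightarrow> complex"
  assumes F: "bdd_meas M F"
  shows "(\<integral>x. (cmod (F x - (\<integral>x. F x \<partial>M)))\<^sup>2 \<partial>M) \<le> (\<integral>x. (cmod (F x))\<^sup>2 \<partial>M)"
proof -
  define m where "m = (\<integral>x. F x \<partial>M)"
  have i: "integrable M F" "integrable M (\<lambda>x. (cmod (F x))\<^sup>2)"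
     "integrable M (\<lambda>x. Re (cnj m * F x))"
    using F by (auto intro!: integrable_bdd_meas bdd_meas_intros)
  have "(cmod (F x - m))\<^sup>2 = (cmod (F x))\<^sup>2 - 2 * Re (cnj m * F x) + (cmod m)\<^sup>2" for x
    unfolding cmod_power2 by (simp add: power2_eq_square algebra_simps)
  then have "(\<integral>x. (cmod (F x - m))\<^sup>2 \<partial>M) =
      (\<integral>x. (cmod (F x))\<^sup>2 \<partial>M) - 2 * (\<integral>x. Re (cnj m * F x) \<partial>M) + (cmod m)\<^sup>2"
    using i by (simp add: prob_space)
  also have "(\<integral>x. Re (cnj m * F x) \<partial>M) = Re (cnj m * m)"
    using i(1) by (subst integral_Re) (auto simp: m_def)
  also have "\<dots> = (cmod m)\<^sup>2"
    unfolding cmod_power2 by (simp add: power2_eq_square algebra_simps)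
  finally show ?thesis by (simp add: m_def)
qed

text \<open>Time starts at 0 here. The field \<open>markov\<close> is a disintegration of the joint
  law of the whole past and the next state, so that later arguments only integrate out one state at
  a time and never mention conditional expectations. The field \<open>minorization\<close> is the
  two-step Doeblin condition, tested on nonnegative functions. The bound 1/2 on \<epsilon> leaves
  room in the numerical estimates.\<close>

locale elliptic_chain = prob_space M for M :: "'w measure" +
  fixes S :: "nat \<Rightarrow> 'a measure" and K :: "nat \<Rightarrow> 'a \<Rightarrow> 'a measure" and X :: "nat \<Rightarrow> 'w \<Rightarrow> 'a"
    and Fn :: "nat \<Rightarrow> 'w measure" and \<nu> :: "nat \<Rightarrow> 'a measure" and \<epsilon> :: real
  assumes kernel [measurable]: "\<And>n. K n \<in> S n \<rightarrow>\<^sub>M prob_algebra (S (Suc n))"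
    and filt: "\<And>n. subalgebra M (Fn n)"
    and filt_mono: "\<And>m n. m \<le> n \<Longrightarrow> subalgebra (Fn n) (Fn m)"
    and adapted: "\<And>k n. k \<le> n \<Longrightarrow> X k \<in> Fn n \<rightarrow>\<^sub>M S k"
    and markov: "\<And>n (G :: 'w \<times> 'a \<Rightarrow> complex). bdd_meas (Fn n \<Otimes>\<^sub>M S (Suc n)) G \<Longrightarrow>
      (\<integral>\<omega>. G (\<omega>, X (Suc n) \<omega>) \<partial>M) = (\<integral>\<omega>. (\<integral>y. G (\<omega>, y) \<partial>K n (X n \<omega>)) \<partial>M)"
    and \<nu>: "\<And>n. \<nu> n \<in> space (prob_algebra (S (Suc (Suc n))))"
    and \<epsilon>: "0 < \<epsilon>" "\<epsilon> \<le> 1 / 2"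
    and minorization: "\<And>n x (g :: 'a \<Rightarrow> real). x \<in> space (S n) \<Longrightarrow> bdd_meas (S (Suc (Suc n))) g \<Longrightarrow>
      (\<And>y. y \<in> space (S (Suc (Suc n))) \<Longrightarrow> 0 \<le> g y) \<Longrightarrow>
      \<epsilon> * (\<integral>y. g y \<partial>\<nu> n) \<le> (\<integral>y. (\<integral>z. g z \<partial>K (Suc n) y) \<partial>K n x)"
begin

section \<open>Transition operators and one-step conditioning\<close>

abbreviation "S2 n \<equiv> S n \<Otimes>\<^sub>M S (Suc n)"
abbreviation "X2 n \<omega> \<equiv> (X n \<omega>, X (Suc n) \<omega>)"

lemma X_past: "k \<le> n \<Longrightarrow> X k \<in> Fn n \<rightarrow>\<^sub>M S k"
  by (rule adapted)

lemma Fn_sub: "F \<in> Fn n \<rightarrow>\<^sub>M A \<Longrightarrow> F \<in> M \<rightarrow>\<^sub>M A"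
  using measurable_from_subalg[OF filt] by auto

lemma X_measurable [measurable]: "X n \<in> M \<rightarrow>\<^sub>M S n"
  using Fn_sub[OF X_past[of n n]] by simp

lemma X_space: "\<omega> \<in> space M \<Longrightarrow> X n \<omega> \<in> space (S n)"
  using X_measurable by (rule measurable_space)

lemma X2_measurable [measurable]: "(\<lambda>\<omega>. X2 n \<omega>) \<in> M \<rightarrow>\<^sub>M S2 n"
  by measurable

lemma bdd_meas_Fn_M: "bdd_meas (Fn n) F \<Longrightarrow> bdd_meas M F"
  using filt[of n] by (auto simp: bdd_meas_def subalgebra_def intro: Fn_sub)

lemma bdd_meas_Fn_mono:
  assumes "bdd_meas (Fn m) F" "m \<le> n"
  shows "bdd_meas (Fn n) F"
proof -
  have sub: "subalgebra (Fn n) (Fn m)" using assms(2) by (rule filt_mono)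
  show ?thesis
    using measurable_from_subalg[OF sub bdd_meas_measurable[OF assms(1)]] assms(1) sub
    by (simp add: bdd_meas_def subalgebra_def)
qed

lemma bdd_meas_X [bdd_meas_intros]: "bdd_meas (S n) F \<Longrightarrow> bdd_meas M (\<lambda>\<omega>. F (X n \<omega>))"
  by (erule bdd_meas_compose) measurable

lemma bdd_meas_X2 [bdd_meas_intros]: "bdd_meas (S2 n) F \<Longrightarrow> bdd_meas M (\<lambda>\<omega>. F (X2 n \<omega>))"
  by (erule bdd_meas_compose) measurable

lemma bdd_meas_X_past: "bdd_meas (S k) F \<Longrightarrow> k \<le> n \<Longrightarrow> bdd_meas (Fn n) (\<lambda>\<omega>. F (X k \<omega>))"
  by (erule bdd_meas_compose) (rule X_past)

lemma bdd_meas_X2_past: "bdd_meas (S2 k) F \<Longrightarrow> k < n \<Longrightarrow> bdd_meas (Fn n) (\<lambda>\<omega>. F (X2 k \<omega>))"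
  by (erule bdd_meas_compose) (intro measurable_Pair X_past; simp)

lemma
  assumes "x \<in> space (S n)"
  shows prob_K: "prob_space (K n x)" and sets_K: "sets (K n x) = sets (S (Suc n))"
    and space_K: "space (K n x) = space (S (Suc n))"
proof -
  have "K n x \<in> space (prob_algebra (S (Suc n)))"
    using kernel assms by (rule measurable_space)
  then show "prob_space (K n x)" "sets (K n x) = sets (S (Suc n))"
    by (auto simp: space_prob_algebra)
  then show "space (K n x) = space (S (Suc n))" by (auto dest: sets_eq_imp_space_eq)
qed

text \<open>The conditional expectation of F(X_n, X_{n+1}) given X_n = x. It acts on functions of
  pairs because each summand depends on two consecutive states.\<close>

definition P :: "nat \<Rightarrow> ('a \<times> 'a \<Rightarrow> 'b::{banach, second_countable_topology}) \<Rightarrow> 'a \<Rightarrow> 'b" where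
  "P n F x = (\<integral>y. F (x, y) \<partial>K n x)"

lemma bdd_meas_section:
  assumes "bdd_meas (S2 n) F" "x \<in> space (S n)"
  shows "bdd_meas (K n x) (\<lambda>y. F (x, y))"
  using assms(1) by (rule bdd_meas_compose)
    (simp add: measurable_cong_sets[OF sets_K[OF assms(2)] refl] assms(2))

lemma integrable_section:
  fixes F :: "_ \<Rightarrow> 'b::{banach, second_countable_topology}"
  assumes "bdd_meas (S2 n) F" "x \<in> space (S n)"
  shows "integrable (K n x) (\<lambda>y. F (x, y))"
proof -
  interpret K: prob_space "K n x" by (rule prob_K) fact
  show ?thesis by (rule K.integrable_bdd_meas[OF bdd_meas_section[OF assms]])
qed

lemma norm_P_le:
  assumes "\<And>y. y \<in> space (S (Suc n)) \<Longrightarrow> norm (F (x, y)) \<le> B" "x \<in> space (S n)" "0 \<le> B"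
  shows "norm (P n F x) \<le> B"
proof -
  interpret K: prob_space "K n x" by (rule prob_K) fact
  show ?thesis unfolding P_def using assms by (intro K.norm_integral_le) (auto simp: space_K)
qed

lemma bdd_meas_P [bdd_meas_intros]:
  assumes "bdd_meas (S2 n) F"
  shows "bdd_meas (S n) (P n F)"
proof -
  obtain B where B: "F \<in> borel_measurable (S2 n)" "0 \<le> B"
    "\<And>x. x \<in> space (S2 n) \<Longrightarrow> norm (F x) \<le> B" using assms by (elim bdd_measE) blast
  have "(\<lambda>x. \<integral>y. F (x, y) \<partial>K n x) \<in> borel_measurable (S n)"
  proof -
    note B(1)[measurable] measurable_prob_algebraD[OF kernel[of n], measurable] measurable_distr2[measurable]
    \<comment> \<open>Pushing the kernel forward to the product space makes the integrand
      independent of x; only the measure varies, and measurability of kernel integrals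
      applies.\<close>
    have "(\<lambda>x. \<integral>p. F p \<partial>distr (K n x) (S2 n) (\<lambda>y. (x, y))) \<in> borel_measurable (S n)"
      by measurable
    also have "?this \<longleftrightarrow> ?thesis"
      by (intro measurable_cong integral_distr)
        (auto simp: measurable_cong_sets[OF sets_K refl])
    finally show ?thesis .
  qed
  with B show ?thesis
    by (intro bdd_measI[of _ _ B]) (auto simp: P_def[abs_def] space_pair_measure intro!: norm_P_le[unfolded P_def])
qed

lemma P_cong: "(\<And>y. y \<in> space (S (Suc n)) \<Longrightarrow> F (x, y) = G (x, y)) \<Longrightarrow> x \<in> space (S n) \<Longrightarrow> P n F x = P n G x"
  unfolding P_def by (intro Bochner_Integration.integral_cong) (auto simp: space_K)

lemma P_add:
  "bdd_meas (S2 n) F \<Longrightarrow> bdd_meas (S2 n) G \<Longrightarrow> x \<in> space (S n) \<Longrightarrow>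
    P n (\<lambda>p. F p + G p) x = P n F x + P n G x"
  unfolding P_def by (intro Bochner_Integration.integral_add integrable_section)

lemma P_diff:
  "bdd_meas (S2 n) F \<Longrightarrow> bdd_meas (S2 n) G \<Longrightarrow> x \<in> space (S n) \<Longrightarrow>
    P n (\<lambda>p. F p - G p) x = P n F x - P n G x"
  unfolding P_def by (intro Bochner_Integration.integral_diff integrable_section)

lemma P_const [simp]: "x \<in> space (S n) \<Longrightarrow> P n (\<lambda>p. c) x = c"
  using prob_space.prob_space[OF prob_K] by (simp add: P_def)

lemma P_fst: "x \<in> space (S n) \<Longrightarrow> P n (\<lambda>p. u (fst p)) x = u x"
  using prob_space.prob_space[OF prob_K] by (simp add: P_def)

lemma P_mult_left:
  fixes F :: "_ \<Rightarrow> 'b::{banach, second_countable_topology, real_normed_field}"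
  shows "P n (\<lambda>p. c * F p) x = c * P n F x"
  unfolding P_def by simp

lemma P_of_real: "P n (\<lambda>p. complex_of_real (F p)) x = of_real (P n F x)"
  unfolding P_def by simp

lemma P_Re: "bdd_meas (S2 n) F \<Longrightarrow> x \<in> space (S n) \<Longrightarrow> P n (\<lambda>p. Re (F p)) x = Re (P n F x)"
  unfolding P_def by (intro integral_Re integrable_section)

lemma P_Re_mult:
  assumes "bdd_meas (S2 n) F" "x \<in> space (S n)"
  shows "P n (\<lambda>p. 2 * Re (c * F p)) x = 2 * Re (c * P n F x)"
  using P_Re[OF bdd_meas_mult[OF bdd_meas_const assms(1)] assms(2), of c] by (simp only: P_mult_left)

lemma norm_P_square_le:
  fixes F :: "_ \<Rightarrow> complex"
  assumes "bdd_meas (S2 n) F" "x \<in> space (S n)"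
  shows "(cmod (P n F x))\<^sup>2 \<le> P n (\<lambda>p. (cmod (F p))\<^sup>2) x"
proof -
  interpret K: prob_space "K n x" by (rule prob_K) fact
  show ?thesis unfolding P_def by (rule K.square_integral_norm_le[OF bdd_meas_section[OF assms]])
qed

lemma integrable_X:
  fixes F :: "_ \<Rightarrow> 'b::{banach, second_countable_topology}"
  shows "bdd_meas (S n) F \<Longrightarrow> integrable M (\<lambda>\<omega>. F (X n \<omega>))"
  by (intro integrable_bdd_meas bdd_meas_intros)

lemma integrable_X2:
  fixes F :: "_ \<Rightarrow> 'b::{banach, second_countable_topology}"
  shows "bdd_meas (S2 n) F \<Longrightarrow> integrable M (\<lambda>\<omega>. F (X2 n \<omega>))"
  by (intro integrable_bdd_meas bdd_meas_intros)

text \<open>A bounded factor from the past rides along while the next state is integrated out. This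
  is the single conditioning step behind the martingale identities for exponential and second
  moments.\<close>

lemma markov_mult:
  fixes F :: "_ \<Rightarrow> complex"
  assumes \<psi>: "bdd_meas (Fn n) \<psi>" and F: "bdd_meas (S2 n) F"
  shows "(\<integral>\<omega>. \<psi> \<omega> * F (X2 n \<omega>) \<partial>M) = (\<integral>\<omega>. \<psi> \<omega> * P n F (X n \<omega>) \<partial>M)"
proof -
  have X: "(\<lambda>p. (X n (fst p), snd p)) \<in> Fn n \<Otimes>\<^sub>M S (Suc n) \<rightarrow>\<^sub>M S2 n"
    using X_past[of n n] by measurable
  have "bdd_meas (Fn n \<Otimes>\<^sub>M S (Suc n)) (\<lambda>p. \<psi> (fst p) * F (X n (fst p), snd p))"
    by (intro bdd_meas_intros \<psi> bdd_meas_compose[OF F X])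
  from markov[OF this] show ?thesis by (simp add: P_def)
qed

lemma markov_eq:
  fixes F :: "_ \<Rightarrow> complex"
  assumes F: "bdd_meas (S2 n) F"
  shows "(\<integral>\<omega>. F (X2 n \<omega>) \<partial>M) = (\<integral>\<omega>. P n F (X n \<omega>) \<partial>M)"
  using markov_mult[OF bdd_meas_const[of _ 1] F] by simp

lemma markov_mult_real:
  fixes F :: "_ \<Rightarrow> real"
  assumes \<psi>: "bdd_meas (Fn n) \<psi>" and F: "bdd_meas (S2 n) F"
  shows "(\<integral>\<omega>. \<psi> \<omega> * F (X2 n \<omega>) \<partial>M) = (\<integral>\<omega>. \<psi> \<omega> * P n F (X n \<omega>) \<partial>M)"
  using markov_mult[OF bdd_meas_of_real[OF \<psi>] bdd_meas_of_real[OF F]]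
  by (simp add: P_of_real flip: of_real_mult)

lemma markov_eq_real:
  fixes F :: "_ \<Rightarrow> real"
  assumes F: "bdd_meas (S2 n) F"
  shows "(\<integral>\<omega>. F (X2 n \<omega>) \<partial>M) = (\<integral>\<omega>. P n F (X n \<omega>) \<partial>M)"
  using markov_mult_real[OF bdd_meas_const[of _ 1] F] by simp

lemma integral_norm_P_square_le:
  fixes F :: "_ \<Rightarrow> complex"
  assumes F: "bdd_meas (S2 n) F"
  shows "(\<integral>\<omega>. (cmod (P n F (X n \<omega>)))\<^sup>2 \<partial>M) \<le> (\<integral>\<omega>. (cmod (F (X2 n \<omega>)))\<^sup>2 \<partial>M)"
proof -
  have "(\<integral>\<omega>. (cmod (P n F (X n \<omega>)))\<^sup>2 \<partial>M) \<le> (\<integral>\<omega>. P n (\<lambda>p. (cmod (F p))\<^sup>2) (X n \<omega>) \<partial>M)"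
    by (intro integral_mono_AE AE_I2 norm_P_square_le X_space integrable_bdd_meas bdd_meas_intros F)
  also have "\<dots> = (\<integral>\<omega>. (cmod (F (X2 n \<omega>)))\<^sup>2 \<partial>M)"
    by (rule markov_eq_real[symmetric]) (intro bdd_meas_intros F)
  finally show ?thesis .
qed

section \<open>Minorization and contraction over two steps\<close>

abbreviation "Q n w \<equiv> P n (\<lambda>p. w (snd p))"

lemma
  shows prob_\<nu>: "prob_space (\<nu> n)" and sets_\<nu>: "sets (\<nu> n) = sets (S (Suc (Suc n)))"
    and space_\<nu>: "space (\<nu> n) = space (S (Suc (Suc n)))"
  using \<nu>[of n] by (auto simp: space_prob_algebra dest: sets_eq_imp_space_eq)

lemma integrable_\<nu>:
  fixes F :: "_ \<Rightarrow> 'b::{banach, second_countable_topology}"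
  assumes "bdd_meas (S (Suc (Suc n))) F"
  shows "integrable (\<nu> n) F"
proof -
  interpret \<nu>: prob_space "\<nu> n" by (rule prob_\<nu>)
  have "bdd_meas (\<nu> n) F"
    using assms by (simp add: bdd_meas_def space_\<nu> measurable_cong_sets[OF sets_\<nu> refl])
  then show ?thesis by (rule \<nu>.integrable_bdd_meas)
qed

lemma minorization_QQ:
  fixes g :: "'a \<Rightarrow> real"
  assumes "x \<in> space (S n)" "bdd_meas (S (Suc (Suc n))) g"
    "\<And>y. y \<in> space (S (Suc (Suc n))) \<Longrightarrow> 0 \<le> g y"
  shows "\<epsilon> * (\<integral>y. g y \<partial>\<nu> n) \<le> Q n (Q (Suc n) g) x"
  using minorization[OF assms] by (simp add: P_def)

lemma QQ_diff:
  fixes g k :: "'a \<Rightarrow> 'b::{banach, second_countable_topology, heine_borel}"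
  assumes "x \<in> space (S n)" "bdd_meas (S (Suc (Suc n))) g" "bdd_meas (S (Suc (Suc n))) k"
  shows "Q n (Q (Suc n) (\<lambda>y. g y - k y)) x = Q n (Q (Suc n) g) x - Q n (Q (Suc n) k) x"
proof -
  have "Q n (Q (Suc n) (\<lambda>y. g y - k y)) x = P n (\<lambda>p. Q (Suc n) g (snd p) - Q (Suc n) k (snd p)) x"
    by (intro P_cong P_diff assms bdd_meas_intros) simp
  also have "\<dots> = Q n (Q (Suc n) g) x - Q n (Q (Suc n) k) x"
    by (intro P_diff assms bdd_meas_intros)
  finally show ?thesis .
qed

lemma QQ_const: "x \<in> space (S n) \<Longrightarrow> Q n (Q (Suc n) (\<lambda>y. c)) x = c"
  using P_cong[of n "\<lambda>p. Q (Suc n) (\<lambda>y. c) (snd p)" x "\<lambda>p. c"] by simp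

text \<open>Doeblin's oscillation argument: the minorization is applied to the nonnegative functions
  \<open>u - g\<close> and \<open>g - l\<close>. This sup-norm form is used for Gordin's corrector;
  the mean-square form below is used for \<open>h\<close>.\<close>

lemma QQ_range:
  fixes g :: "'a \<Rightarrow> real"
  assumes g: "bdd_meas (S (Suc (Suc n))) g"
    and lu: "\<And>y. y \<in> space (S (Suc (Suc n))) \<Longrightarrow> l \<le> g y \<and> g y \<le> u"
  shows "\<exists>m. \<forall>x\<in>space (S n). m \<le> Q n (Q (Suc n) g) x \<and> Q n (Q (Suc n) g) x \<le> m + (1 - \<epsilon>) * (u - l)"
proof (intro exI ballI)
  interpret \<nu>: prob_space "\<nu> n" by (rule prob_\<nu>)
  fix x assume x: "x \<in> space (S n)"
  have "\<epsilon> * (\<integral>y. u - g y \<partial>\<nu> n) \<le> Q n (Q (Suc n) (\<lambda>y. u - g y)) x"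
    using x lu by (intro minorization_QQ bdd_meas_intros g) auto
  also have "Q n (Q (Suc n) (\<lambda>y. u - g y)) x = u - Q n (Q (Suc n) g) x"
    using QQ_diff[OF x bdd_meas_const g, of u] x by (simp add: QQ_const)
  finally have 1: "\<epsilon> * (u - (\<integral>y. g y \<partial>\<nu> n)) \<le> u - Q n (Q (Suc n) g) x"
    by (simp add: integrable_\<nu>[OF g] \<nu>.prob_space)
  have "\<epsilon> * (\<integral>y. g y - l \<partial>\<nu> n) \<le> Q n (Q (Suc n) (\<lambda>y. g y - l)) x"
    using x lu by (intro minorization_QQ bdd_meas_intros g) auto
  also have "Q n (Q (Suc n) (\<lambda>y. g y - l)) x = Q n (Q (Suc n) g) x - l"
    using QQ_diff[OF x g bdd_meas_const, of l] x by (simp add: QQ_const)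
  finally have 2: "\<epsilon> * ((\<integral>y. g y \<partial>\<nu> n) - l) \<le> Q n (Q (Suc n) g) x - l"
    by (simp add: integrable_\<nu>[OF g] \<nu>.prob_space)
  let ?m = "\<epsilon> * (\<integral>y. g y \<partial>\<nu> n) + (1 - \<epsilon>) * l"
  from 1 2 show "?m \<le> Q n (Q (Suc n) g) x \<and> Q n (Q (Suc n) g) x \<le> ?m + (1 - \<epsilon>) * (u - l)"
    by (simp add: algebra_simps)
qed

text \<open>Cauchy--Schwarz for the positive functional \<open>w \<mapsto> Q (Q w) x - \<epsilon> * \<nu> w\<close>, whose mass is \<open>1 - \<epsilon>\<close>.\<close>

lemma QQ_square_le:
  fixes w :: "'a \<Rightarrow> complex"
  assumes w: "bdd_meas (S (Suc (Suc n))) w" and x: "x \<in> space (S n)"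
  shows "(cmod (Q n (Q (Suc n) w) x - \<epsilon> * (\<integral>y. w y \<partial>\<nu> n)))\<^sup>2
    \<le> (1 - \<epsilon>) * Q n (Q (Suc n) (\<lambda>y. (cmod (w y))\<^sup>2)) x"
proof -
  interpret \<nu>: prob_space "\<nu> n" by (rule prob_\<nu>)
  define q where "q = Q n (Q (Suc n) w) x - \<epsilon> * (\<integral>y. w y \<partial>\<nu> n)"
  \<comment> \<open>The mean of w under the functional, once its mass 1 - \<epsilon> is normalised.
    Positivity of the functional on |w - a|^2, expanded with this a, is Cauchy-Schwarz.\<close>
  define a where "a = q / (1 - \<epsilon>)"
  define W where "W = (\<lambda>y. (cmod (w y))\<^sup>2)"
  define V where "V = (\<lambda>y. 2 * Re (cnj a * w y) - (cmod a)\<^sup>2)"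
  have bW: "bdd_meas (S (Suc (Suc n))) W" and bV: "bdd_meas (S (Suc (Suc n))) V"
    unfolding W_def V_def by (intro bdd_meas_intros w)+
  have g: "(cmod (w y - a))\<^sup>2 = W y - V y" for y
    unfolding W_def V_def cmod_power2 by (simp add: power2_eq_square algebra_simps)
  have "\<epsilon> * (\<integral>y. W y - V y \<partial>\<nu> n) \<le> Q n (Q (Suc n) (\<lambda>y. W y - V y)) x"
    unfolding g[symmetric] by (intro minorization_QQ x bdd_meas_intros w) auto
  then have "\<epsilon> * ((\<integral>y. W y \<partial>\<nu> n) - (\<integral>y. V y \<partial>\<nu> n)) \<le> Q n (Q (Suc n) W) x - Q n (Q (Suc n) V) x"
    using QQ_diff[OF x bW bV] by (simp add: bW bV integrable_\<nu>)
  moreover have "Q n (Q (Suc n) V) x = 2 * Re (cnj a * Q n (Q (Suc n) w) x) - (cmod a)\<^sup>2"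
  proof -
    have "Q n (Q (Suc n) V) x = Q n (Q (Suc n) (\<lambda>y. 2 * Re (cnj a * w y))) x - (cmod a)\<^sup>2"
      unfolding V_def using QQ_diff[OF x _ bdd_meas_const, of "\<lambda>y. 2 * Re (cnj a * w y)" "(cmod a)\<^sup>2"]
      by (simp add: QQ_const x bdd_meas_intros w)
    also have "Q n (Q (Suc n) (\<lambda>y. 2 * Re (cnj a * w y))) x = P n (\<lambda>p. 2 * Re (cnj a * Q (Suc n) w (snd p))) x"
      by (intro P_cong x) (simp only: snd_conv, intro P_Re_mult bdd_meas_intros w)
    also have "\<dots> = 2 * Re (cnj a * Q n (Q (Suc n) w) x)"
      by (intro P_Re_mult bdd_meas_intros w x)
    finally show ?thesis .
  qed
  moreover have "(\<integral>y. V y \<partial>\<nu> n) = 2 * Re (cnj a * (\<integral>y. w y \<partial>\<nu> n)) - (cmod a)\<^sup>2"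
  proof -
    have "(\<integral>y. V y \<partial>\<nu> n) = (\<integral>y. 2 * Re (cnj a * w y) \<partial>\<nu> n) - (cmod a)\<^sup>2"
      unfolding V_def by (subst Bochner_Integration.integral_diff)
        (auto intro!: bdd_meas_intros w integrable_\<nu> simp: \<nu>.prob_space)
    also have "(\<integral>y. 2 * Re (cnj a * w y) \<partial>\<nu> n) = 2 * Re (\<integral>y. cnj a * w y \<partial>\<nu> n)"
      by (subst integral_mult_right_zero, subst integral_Re) (auto intro!: bdd_meas_intros w integrable_\<nu>)
    finally show ?thesis by simp
  qed
  moreover have "0 \<le> (\<integral>y. W y \<partial>\<nu> n)" by (simp add: W_def)
  ultimately have "2 * Re (cnj a * q) - (1 - \<epsilon>) * (cmod a)\<^sup>2 \<le> Q n (Q (Suc n) W) x - \<epsilon> * (\<integral>y. W y \<partial>\<nu> n)"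
    by (simp add: q_def algebra_simps)
  also have "\<dots> \<le> Q n (Q (Suc n) W) x"
    using \<epsilon> by (simp add: W_def)
  finally have "2 * Re (cnj a * q) - (1 - \<epsilon>) * (cmod a)\<^sup>2 \<le> Q n (Q (Suc n) W) x" .
  moreover have "Re (cnj a * q) = (cmod q)\<^sup>2 / (1 - \<epsilon>)"
  proof -
    have "cnj a * q = of_real ((cmod q)\<^sup>2 / (1 - \<epsilon>))"
      using complex_norm_square[of q] by (simp add: a_def mult.commute)
    then show ?thesis by simp
  qed
  moreover have "(cmod a)\<^sup>2 = (cmod q)\<^sup>2 / (1 - \<epsilon>)\<^sup>2"
  proof -
    have "cmod (1 - complex_of_real \<epsilon>) = 1 - \<epsilon>"
      using \<epsilon> norm_of_real[of "1 - \<epsilon>", where 'a=complex] by simp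
    then show ?thesis by (simp add: a_def norm_divide power_divide)
  qed
  ultimately have "2 * ((cmod q)\<^sup>2 / (1 - \<epsilon>)) - (1 - \<epsilon>) * ((cmod q)\<^sup>2 / (1 - \<epsilon>)\<^sup>2) \<le> Q n (Q (Suc n) W) x"
    by simp
  also have "2 * ((cmod q)\<^sup>2 / (1 - \<epsilon>)) - (1 - \<epsilon>) * ((cmod q)\<^sup>2 / (1 - \<epsilon>)\<^sup>2) = (cmod q)\<^sup>2 / (1 - \<epsilon>)"
    using \<epsilon> by (simp add: power2_eq_square)
  finally have "(cmod q)\<^sup>2 \<le> (1 - \<epsilon>) * Q n (Q (Suc n) W) x"
    using \<epsilon> by (simp add: pos_divide_le_eq mult.commute)
  then show ?thesis by (simp only: q_def W_def)
qed

text \<open>The pointwise bound concerns \<open>Q (Q w)\<close> minus a constant. Since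
  \<open>Q (Q w)\<close> has mean zero along the chain, subtracting a constant can only increase its
  second moment, so the bound passes to \<open>Q (Q w)\<close> itself. Averaging the right side by
  the Markov property gives the second moment two steps later.\<close>

lemma contraction_QQ:
  fixes w :: "'a \<Rightarrow> complex"
  assumes w: "bdd_meas (S (Suc (Suc n))) w" and zero: "(\<integral>\<omega>. w (X (Suc (Suc n)) \<omega>) \<partial>M) = 0"
  shows "(\<integral>\<omega>. (cmod (Q n (Q (Suc n) w) (X n \<omega>)))\<^sup>2 \<partial>M)
    \<le> (1 - \<epsilon>) * (\<integral>\<omega>. (cmod (w (X (Suc (Suc n)) \<omega>)))\<^sup>2 \<partial>M)"
proof -
  define e where "e = \<epsilon> * (\<integral>y. w y \<partial>\<nu> n)"
  define Y where "Y = (\<lambda>\<omega>. Q n (Q (Suc n) w) (X n \<omega>))"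
  have EQQ: "(\<integral>\<omega>. Q n (Q (Suc n) g) (X n \<omega>) \<partial>M) = (\<integral>\<omega>. g (X (Suc (Suc n)) \<omega>) \<partial>M)"
    if "bdd_meas (S (Suc (Suc n))) g" for g :: "'a \<Rightarrow> complex"
    using markov_eq[of n "\<lambda>p. Q (Suc n) g (snd p)"] markov_eq[of "Suc n" "\<lambda>p. g (snd p)"]
    by (simp add: bdd_meas_intros that)
  have EQQr: "(\<integral>\<omega>. Q n (Q (Suc n) g) (X n \<omega>) \<partial>M) = (\<integral>\<omega>. g (X (Suc (Suc n)) \<omega>) \<partial>M)"
    if "bdd_meas (S (Suc (Suc n))) g" for g :: "'a \<Rightarrow> real"
    using markov_eq_real[of n "\<lambda>p. Q (Suc n) g (snd p)"] markov_eq_real[of "Suc n" "\<lambda>p. g (snd p)"]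
    by (simp add: bdd_meas_intros that)
  have Y0: "(\<integral>\<omega>. Y \<omega> \<partial>M) = 0" unfolding Y_def using EQQ[OF w] zero by simp
  have bY: "bdd_meas M Y" unfolding Y_def by (intro bdd_meas_intros w)
  have "(\<integral>\<omega>. Y \<omega> - e \<partial>M) = - e"
    using Y0 by (simp add: integrable_bdd_meas[OF bY] prob_space)
  with integral_centered_norm_le[of "\<lambda>\<omega>. Y \<omega> - e"]
  have "(\<integral>\<omega>. (cmod (Y \<omega>))\<^sup>2 \<partial>M) \<le> (\<integral>\<omega>. (cmod (Y \<omega> - e))\<^sup>2 \<partial>M)"
    by (simp add: bdd_meas_intros bY)
  also have "\<dots> \<le> (\<integral>\<omega>. (1 - \<epsilon>) * Q n (Q (Suc n) (\<lambda>y. (cmod (w y))\<^sup>2)) (X n \<omega>) \<partial>M)"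
    unfolding Y_def e_def
    using QQ_square_le[OF w] by (intro integral_mono_AE AE_I2 integrable_bdd_meas bdd_meas_intros w) (auto simp: X_space)
  also have "\<dots> = (1 - \<epsilon>) * (\<integral>\<omega>. (cmod (w (X (Suc (Suc n)) \<omega>)))\<^sup>2 \<partial>M)"
    by (simp, subst EQQr) (auto intro!: bdd_meas_intros w)
  finally show ?thesis by (simp add: Y_def)
qed

end

section \<open>Exponential moments of small martingale differences\<close>

lemma norm_exp_minus_1_le:
  fixes z :: complex
  assumes "cmod z \<le> 1/2"
  shows "cmod (exp z - 1) \<le> 2 * cmod z" "cmod (exp z - 1 - z) \<le> 2 * (cmod z)\<^sup>2"
proof -
  have "exp \<bar>Re z\<bar> \<le> exp (1/2)"
    using assms abs_Re_le_cmod[of z] by simp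
  also have "exp (1/2 :: real) \<le> 2" using exp_bound_half[of "1/2 :: real"] by simp
  finally have e: "exp \<bar>Re z\<bar> \<le> 2" .
  show "cmod (exp z - 1) \<le> 2 * cmod z"
    using Taylor_exp[of z 0] mult_right_mono[OF e norm_ge_zero[of z]] by simp
  show "cmod (exp z - 1 - z) \<le> 2 * (cmod z)\<^sup>2"
    using Taylor_exp[of z 1] mult_right_mono[OF e zero_le_power2[of "cmod z"]]
    by (simp add: power2_eq_square algebra_simps)
qed

text \<open>Young's inequality with a free weight: a small \<eta> leaves the contraction factor
  almost intact and charges the large constant 1 + 1/\<eta> to the perturbation. The two sides
  differ by a square, apart from the triangle inequality.\<close>

lemma cmod_add_square_le:
  assumes "0 < \<eta>"
  shows "(cmod (a + b))\<^sup>2 \<le> (1 + \<eta>) * (cmod a)\<^sup>2 + (1 + 1/\<eta>) * (cmod b)\<^sup>2"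
proof -
  have "(cmod (a + b))\<^sup>2 \<le> (cmod a + cmod b)\<^sup>2"
    by (intro power_mono norm_triangle_ineq) auto
  also have "\<dots> = (1 + \<eta>) * (cmod a)\<^sup>2 + (1 + 1/\<eta>) * (cmod b)\<^sup>2
      - (\<eta> * cmod a - cmod b)\<^sup>2 / \<eta>"
    using assms by (simp add: field_simps power2_eq_square)
  also have "\<dots> \<le> (1 + \<eta>) * (cmod a)\<^sup>2 + (1 + 1/\<eta>) * (cmod b)\<^sup>2"
    using assms by simp
  finally show ?thesis .
qed

lemma cmod_one_plus_square_ge: "1 - 2 * cmod \<rho> \<le> (cmod (1 + \<rho>))\<^sup>2"
proof -
  have "1 - cmod \<rho> \<le> cmod (1 + \<rho>)"
    using norm_diff_ineq[of 1 \<rho>] by simp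
  then show ?thesis
  proof (cases "cmod \<rho> \<le> 1")
    case True
    with \<open>1 - cmod \<rho> \<le> cmod (1 + \<rho>)\<close> have "(1 - cmod \<rho>)\<^sup>2 \<le> (cmod (1 + \<rho>))\<^sup>2"
      by (intro power_mono) auto
    moreover have "1 - 2 * cmod \<rho> \<le> (1 - cmod \<rho>)\<^sup>2" by (simp add: power2_eq_square algebra_simps)
    ultimately show ?thesis by linarith
  next
    case False
    then show ?thesis by (intro order_trans[OF _ zero_le_power2]) simp
  qed
qed

text \<open>What is left of e^{zD} (1 + w) after removing 1 + w, which the recursion carries along,
  and z D, which a martingale difference averages to zero. It is of second order in D and w
  jointly.\<close>

definition incr :: "complex \<Rightarrow> ('b \<Rightarrow> real) \<Rightarrow> ('b \<Rightarrow> complex) \<Rightarrow> 'b \<Rightarrow> complex" where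
  "incr z D w p = exp (z * D p) * (1 + w p) - (1 + w p) - z * D p"

lemma bdd_meas_incr [bdd_meas_intros]:
  "bdd_meas A D \<Longrightarrow> bdd_meas A w \<Longrightarrow> bdd_meas A (incr z D w)"
  unfolding incr_def[abs_def] by (intro bdd_meas_intros)

lemma norm_incr_le:
  assumes "cmod z \<le> 1" "\<bar>D p\<bar> \<le> d" "d \<le> 1/2"
  shows "cmod (incr z D w p) \<le> 2 * (D p)\<^sup>2 + 2 * \<bar>D p\<bar> * cmod (w p)"
proof -
  have zD: "cmod (z * D p) \<le> \<bar>D p\<bar>"
    using assms(1) mult_right_mono[of "cmod z" 1 "\<bar>D p\<bar>"] by (simp add: norm_mult)
  with assms have h: "cmod (z * D p) \<le> 1/2" by linarith
  have "incr z D w p = (exp (z * D p) - 1 - z * D p) + (exp (z * D p) - 1) * w p"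
    by (simp add: incr_def algebra_simps)
  then have "cmod (incr z D w p) \<le> cmod (exp (z * D p) - 1 - z * D p) + cmod (exp (z * D p) - 1) * cmod (w p)"
    using norm_triangle_ineq by (metis norm_mult)
  also have "\<dots> \<le> 2 * (cmod (z * D p))\<^sup>2 + 2 * cmod (z * D p) * cmod (w p)"
    using h by (intro add_mono mult_right_mono norm_exp_minus_1_le) auto
  also have "\<dots> \<le> 2 * (\<bar>D p\<bar>)\<^sup>2 + 2 * \<bar>D p\<bar> * cmod (w p)"
    using zD by (intro add_mono mult_left_mono mult_right_mono power_mono) auto
  finally show ?thesis by simp
qed

lemma norm_incr_le':
  assumes "cmod z \<le> 1" "\<bar>D p\<bar> \<le> d" "d \<le> 1/2"
  shows "cmod (incr z D w p) \<le> 3 * (D p)\<^sup>2 + (cmod (w p))\<^sup>2"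
proof -
  have "2 * \<bar>D p\<bar> * cmod (w p) \<le> (D p)\<^sup>2 + (cmod (w p))\<^sup>2"
    using sum_squares_bound[of "\<bar>D p\<bar>" "cmod (w p)"] by simp
  with norm_incr_le[where D = D and p = p, OF assms, of w] show ?thesis by linarith
qed

lemma norm_incr_square_le:
  assumes "cmod z \<le> 1" "\<bar>D p\<bar> \<le> d" "d \<le> 1/2"
  shows "(cmod (incr z D w p))\<^sup>2 \<le> 8 * d\<^sup>2 * (D p)\<^sup>2 + 8 * d\<^sup>2 * (cmod (w p))\<^sup>2"
proof -
  have "(cmod (incr z D w p))\<^sup>2 \<le> (2 * (D p)\<^sup>2 + 2 * \<bar>D p\<bar> * cmod (w p))\<^sup>2"
    using norm_incr_le[where D = D and p = p, OF assms, of w] by (intro power_mono) auto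
  also have "\<dots> = (D p)\<^sup>2 * (2 * \<bar>D p\<bar> + 2 * cmod (w p))\<^sup>2"
    by (cases "D p \<ge> 0") (auto simp: power2_eq_square algebra_simps)
  also have "\<dots> \<le> d\<^sup>2 * (8 * (D p)\<^sup>2 + 8 * (cmod (w p))\<^sup>2)"
  proof (intro mult_mono)
    show "(D p)\<^sup>2 \<le> d\<^sup>2" using power_mono[OF assms(2), of 2] by simp
    show "(2 * \<bar>D p\<bar> + 2 * cmod (w p))\<^sup>2 \<le> 8 * (D p)\<^sup>2 + 8 * (cmod (w p))\<^sup>2"
      using sum_squares_bound[of "\<bar>D p\<bar>" "cmod (w p)"]
      by (simp add: power2_eq_square algebra_simps)
  qed auto
  finally show ?thesis by (simp add: algebra_simps)
qed

context elliptic_chain begin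

text \<open>The mean must be of the order of the second moments, because it enters the logarithm
  directly. The centred part enters the recursion for \<alpha> after Young's inequality and must
  carry the small factor d^2 to offset the 1/\<epsilon> lost there; centring and applying
  \<open>P\<close> only decrease the second moment.\<close>

lemma
  assumes z: "cmod z \<le> 1" and D: "bdd_meas (S2 n) D" "\<And>p. p \<in> space (S2 n) \<Longrightarrow> \<bar>D p\<bar> \<le> d" "d \<le> 1/2"
    and w: "bdd_meas (S (Suc n)) w"
  defines "R \<equiv> incr z D (\<lambda>p. w (snd p))"
    and "v \<equiv> (\<integral>\<omega>. (D (X2 n \<omega>))\<^sup>2 \<partial>M)" and "\<alpha> \<equiv> (\<integral>\<omega>. (cmod (w (X (Suc n) \<omega>)))\<^sup>2 \<partial>M)"
  shows norm_integral_incr_le: "cmod (\<integral>\<omega>. R (X2 n \<omega>) \<partial>M) \<le> 3 * v + \<alpha>"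
    and integral_P_incr_le: "(\<integral>\<omega>. (cmod (P n R (X n \<omega>) - (\<integral>\<omega>. R (X2 n \<omega>) \<partial>M)))\<^sup>2 \<partial>M) \<le> 8 * d\<^sup>2 * (v + \<alpha>)"
proof -
  have b: "bdd_meas (S2 n) R" unfolding R_def by (intro bdd_meas_intros D w)
  have sp: "X2 n \<omega> \<in> space (S2 n)" if "\<omega> \<in> space M" for \<omega>
    using that by (auto simp: space_pair_measure X_space)
  have bv: "bdd_meas M (\<lambda>\<omega>. (D (X2 n \<omega>))\<^sup>2)" by (intro bdd_meas_intros D)
  have b\<alpha>: "bdd_meas M (\<lambda>\<omega>. (cmod (w (X (Suc n) \<omega>)))\<^sup>2)" by (intro bdd_meas_intros w)
  have "cmod (\<integral>\<omega>. R (X2 n \<omega>) \<partial>M) \<le> (\<integral>\<omega>. cmod (R (X2 n \<omega>)) \<partial>M)" by simp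
  also have "\<dots> \<le> (\<integral>\<omega>. 3 * (D (X2 n \<omega>))\<^sup>2 + (cmod (w (X (Suc n) \<omega>)))\<^sup>2 \<partial>M)"
  proof (intro integral_mono_AE AE_I2)
    fix \<omega> assume "\<omega> \<in> space M"
    then show "cmod (R (X2 n \<omega>)) \<le> 3 * (D (X2 n \<omega>))\<^sup>2 + (cmod (w (X (Suc n) \<omega>)))\<^sup>2"
      using norm_incr_le'[where D = D and p = "X2 n \<omega>", OF z D(2,3), of "\<lambda>p. w (snd p)"] by (simp add: R_def sp)
  qed (intro integrable_bdd_meas bdd_meas_intros b D w)+
  also have "\<dots> = 3 * v + \<alpha>"
    unfolding v_def \<alpha>_def by (simp add: integrable_bdd_meas bv b\<alpha>)
  finally show "cmod (\<integral>\<omega>. R (X2 n \<omega>) \<partial>M) \<le> 3 * v + \<alpha>" .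
  have "(\<integral>\<omega>. (cmod (P n R (X n \<omega>) - (\<integral>\<omega>. R (X2 n \<omega>) \<partial>M)))\<^sup>2 \<partial>M) \<le> (\<integral>\<omega>. (cmod (P n R (X n \<omega>)))\<^sup>2 \<partial>M)"
    unfolding markov_eq[OF b] by (intro integral_centered_norm_le bdd_meas_intros b)
  also have "\<dots> \<le> (\<integral>\<omega>. (cmod (R (X2 n \<omega>)))\<^sup>2 \<partial>M)"
    by (rule integral_norm_P_square_le[OF b])
  also have "\<dots> \<le> (\<integral>\<omega>. 8 * d\<^sup>2 * (D (X2 n \<omega>))\<^sup>2 + 8 * d\<^sup>2 * (cmod (w (X (Suc n) \<omega>)))\<^sup>2 \<partial>M)"
  proof (intro integral_mono_AE AE_I2)
    fix \<omega> assume "\<omega> \<in> space M"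
    then show "(cmod (R (X2 n \<omega>)))\<^sup>2 \<le> 8 * d\<^sup>2 * (D (X2 n \<omega>))\<^sup>2 + 8 * d\<^sup>2 * (cmod (w (X (Suc n) \<omega>)))\<^sup>2"
      using norm_incr_square_le[where D = D and p = "X2 n \<omega>", OF z D(2,3), of "\<lambda>p. w (snd p)"] by (simp add: R_def sp)
  qed (intro integrable_bdd_meas bdd_meas_intros b D w)+
  also have "\<dots> = 8 * d\<^sup>2 * (v + \<alpha>)"
    unfolding v_def \<alpha>_def by (simp add: integrable_bdd_meas bv b\<alpha> algebra_simps)
  finally show "(\<integral>\<omega>. (cmod (P n R (X n \<omega>) - (\<integral>\<omega>. R (X2 n \<omega>) \<partial>M)))\<^sup>2 \<partial>M) \<le> 8 * d\<^sup>2 * (v + \<alpha>)" .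
qed

end

text \<open>The differences vanish from N on, so the recursions hold at every n and end in the
  constant 1 without separate boundary cases. The bound \<epsilon>/100 is the smallness relative to
  the gap that all later estimates consume.\<close>

locale elliptic_martingale = elliptic_chain +
  fixes D :: "nat \<Rightarrow> 'b \<times> 'b \<Rightarrow> real" and N :: nat
  assumes D_meas: "bdd_meas (S2 n) (D n)"
    and D_le: "p \<in> space (S2 n) \<Longrightarrow> \<bar>D n p\<bar> \<le> \<epsilon> / 100"
    and P_D: "x \<in> space (S n) \<Longrightarrow> P n (D n) x = 0"
    and D_N: "N \<le> n \<Longrightarrow> D n p = 0"
begin

text \<open>Indexed by the number of steps left before N, which turns the backward recursion into a
  primitive one.\<close>

primrec hb :: "complex \<Rightarrow> nat \<Rightarrow> 'b \<Rightarrow> complex" where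
  "hb z 0 = (\<lambda>x. 1)"
| "hb z (Suc j) = P (N - Suc j) (\<lambda>p. exp (z * D (N - Suc j) p) * hb z j (snd p))"

definition h :: "complex \<Rightarrow> nat \<Rightarrow> 'b \<Rightarrow> complex" where "h z n = hb z (N - n)"

lemma bdd_meas_h [bdd_meas_intros]: "bdd_meas (S n) (h z n)"
proof -
  have "bdd_meas (S (N - j)) (hb z j)" if "j \<le> N" for j
    using that
  proof (induction j)
    case (Suc j)
    then have "Suc (N - Suc j) = N - j" by simp
    with Suc show ?case
      by (auto intro!: bdd_meas_intros D_meas simp del: of_nat_Suc)
  qed (simp add: bdd_meas_const)
  from this[of "N - n"] show ?thesis
    by (cases "n \<le> N") (auto simp: h_def bdd_meas_const)
qed

lemma h_rec:
  assumes "x \<in> space (S n)"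
  shows "h z n x = P n (\<lambda>p. exp (z * D n p) * h z (Suc n) (snd p)) x"
proof (cases "n < N")
  case True
  then obtain j where j: "N = Suc (n + j)" using less_iff_Suc_add by auto
  then have "N - n = Suc j" "N - Suc n = j" "N - Suc j = n" by auto
  then show ?thesis by (simp add: h_def)
next
  case False
  then show ?thesis using assms by (simp add: h_def D_N)
qed

lemma h_N: "N \<le> n \<Longrightarrow> h z n x = 1"
  by (simp add: h_def)

text \<open>The normalisation h = c (1 + w) splits off the mean c. Then \<alpha> is the squared
  relative fluctuation of h in mean square, and \<rho> is the relative change of c over one step, so
  that c becomes a product of factors 1 + \<rho>. The function w is meaningful only where c is
  nonzero; this is carried as a hypothesis up to \<open>core_bounds_aux\<close>.\<close>

definition v :: "nat \<Rightarrow> real" where "v n = (\<integral>\<omega>. (D n (X2 n \<omega>))\<^sup>2 \<partial>M)"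
definition c :: "complex \<Rightarrow> nat \<Rightarrow> complex" where "c z n = (\<integral>\<omega>. h z n (X n \<omega>) \<partial>M)"
definition w :: "complex \<Rightarrow> nat \<Rightarrow> 'b \<Rightarrow> complex" where "w z n x = h z n x / c z n - 1"
definition \<alpha> :: "complex \<Rightarrow> nat \<Rightarrow> real" where "\<alpha> z n = (\<integral>\<omega>. (cmod (w z n (X n \<omega>)))\<^sup>2 \<partial>M)"
definition R :: "complex \<Rightarrow> nat \<Rightarrow> 'b \<times> 'b \<Rightarrow> complex" where "R z n = incr z (D n) (\<lambda>p. w z (Suc n) (snd p))"
definition \<rho> :: "complex \<Rightarrow> nat \<Rightarrow> complex" where "\<rho> z n = (\<integral>\<omega>. R z n (X2 n \<omega>) \<partial>M)"

lemma bdd_meas_w [bdd_meas_intros]: "bdd_meas (S n) (w z n)"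
  unfolding w_def[abs_def] by (intro bdd_meas_intros)

lemma bdd_meas_R [bdd_meas_intros]: "bdd_meas (S2 n) (R z n)"
  unfolding R_def by (intro bdd_meas_intros D_meas)

lemma \<rho>_eq: "\<rho> z n = (\<integral>\<omega>. P n (R z n) (X n \<omega>) \<partial>M)"
  unfolding \<rho>_def by (intro markov_eq bdd_meas_intros)

lemma c_N: "N \<le> n \<Longrightarrow> c z n = 1" by (simp add: c_def h_N prob_space)
lemma w_N: "N \<le> n \<Longrightarrow> w z n x = 0" by (simp add: w_def h_N c_N)
lemma \<alpha>_N: "N \<le> n \<Longrightarrow> \<alpha> z n = 0" by (simp add: \<alpha>_def w_N)
lemma v_N: "N \<le> n \<Longrightarrow> v n = 0" by (simp add: v_def D_N)
lemma v_nonneg: "0 \<le> v n" by (simp add: v_def)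
lemma \<alpha>_nonneg: "0 \<le> \<alpha> z n" by (simp add: \<alpha>_def)

lemma v_le: "v n \<le> (\<epsilon> / 100)\<^sup>2"
proof -
  have "v n \<le> (\<integral>\<omega>. (\<epsilon> / 100)\<^sup>2 \<partial>M)"
    unfolding v_def
  proof (intro integral_mono_AE AE_I2)
    fix \<omega> assume "\<omega> \<in> space M"
    then have "\<bar>D n (X2 n \<omega>)\<bar> \<le> \<epsilon> / 100" by (intro D_le) (auto simp: space_pair_measure X_space)
    from power_mono[OF this, of 2] show "(D n (X2 n \<omega>))\<^sup>2 \<le> (\<epsilon> / 100)\<^sup>2" by simp
  qed (auto intro!: integrable_bdd_meas bdd_meas_intros D_meas)
  then show ?thesis by (simp add: prob_space)
qed

lemma \<epsilon>_le': "\<epsilon> / 100 \<le> 1 / 2" using \<epsilon> by simp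

lemma norm_\<rho>_le: "cmod z \<le> 1 \<Longrightarrow> cmod (\<rho> z n) \<le> 3 * v n + \<alpha> z (Suc n)"
  unfolding \<rho>_def R_def v_def \<alpha>_def
  by (intro norm_integral_incr_le[OF _ D_meas D_le \<epsilon>_le'] bdd_meas_intros)

lemma P_R_square_le:
  "cmod z \<le> 1 \<Longrightarrow> (\<integral>\<omega>. (cmod (P n (R z n) (X n \<omega>) - \<rho> z n))\<^sup>2 \<partial>M) \<le> 8 * (\<epsilon>/100)\<^sup>2 * (v n + \<alpha> z (Suc n))"
  unfolding \<rho>_def R_def v_def \<alpha>_def
  by (intro integral_P_incr_le[OF _ D_meas D_le \<epsilon>_le'] bdd_meas_intros)

lemma integral_w: "c z n \<noteq> 0 \<Longrightarrow> (\<integral>\<omega>. w z n (X n \<omega>) \<partial>M) = 0"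
proof -
  assume "c z n \<noteq> 0"
  then have "(\<integral>\<omega>. w z n (X n \<omega>) \<partial>M) = (\<integral>\<omega>. h z n (X n \<omega>) \<partial>M) / c z n - 1"
    unfolding w_def by (subst Bochner_Integration.integral_diff)
      (auto intro!: integrable_bdd_meas bdd_meas_intros simp: prob_space)
  also have "\<dots> = 0" using \<open>c z n \<noteq> 0\<close> by (simp flip: c_def)
  finally show ?thesis .
qed

text \<open>The linear term z D disappears under \<open>P\<close> by the martingale property. Hence
  D contributes only through the second-order remainder \<open>R\<close>, which is what makes all
  bounds proportional to second moments.\<close>

lemma h_expand:
  assumes "c z (Suc n) \<noteq> 0" "x \<in> space (S n)"
  shows "h z n x = c z (Suc n) * (1 + Q n (w z (Suc n)) x + P n (R z n) x)"
proof -
  have "exp (z * D n p) * h z (Suc n) (snd p) = c z (Suc n) * (1 + w z (Suc n) (snd p) + R z n p + z * D n p)" for p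
    using assms(1) by (simp add: R_def incr_def w_def field_simps)
  then have "h z n x = c z (Suc n) * P n (\<lambda>p. 1 + w z (Suc n) (snd p) + R z n p + z * D n p) x"
    using assms by (simp add: h_rec P_mult_left)
  also have "P n (\<lambda>p. 1 + w z (Suc n) (snd p) + R z n p + z * D n p) x
      = P n (\<lambda>p. 1) x + Q n (w z (Suc n)) x + P n (R z n) x + P n (\<lambda>p. z * D n p) x"
    using assms by (simp only: P_add bdd_meas_intros D_meas)
  also have "P n (\<lambda>p. z * D n p) x = 0"
    using assms by (simp only: P_mult_left P_of_real P_D) simp
  finally show ?thesis using assms by simp
qed

lemma c_rec:
  assumes "c z (Suc n) \<noteq> 0"
  shows "c z n = c z (Suc n) * (1 + \<rho> z n)"
proof -
  have "c z n = (\<integral>\<omega>. c z (Suc n) * (1 + Q n (w z (Suc n)) (X n \<omega>) + P n (R z n) (X n \<omega>)) \<partial>M)"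
    unfolding c_def[of z n] using h_expand[OF assms] by (intro Bochner_Integration.integral_cong) (auto simp: X_space)
  also have "\<dots> = c z (Suc n) * (1 + (\<integral>\<omega>. Q n (w z (Suc n)) (X n \<omega>) \<partial>M) + \<rho> z n)"
  proof -
    have "integrable M (\<lambda>\<omega>. Q n (w z (Suc n)) (X n \<omega>))" "integrable M (\<lambda>\<omega>. P n (R z n) (X n \<omega>))"
      by (intro integrable_bdd_meas bdd_meas_intros)+
    then show ?thesis by (simp add: \<rho>_eq prob_space)
  qed
  also have "(\<integral>\<omega>. Q n (w z (Suc n)) (X n \<omega>) \<partial>M) = (\<integral>\<omega>. w z (Suc n) (X (Suc n) \<omega>) \<partial>M)"
    using markov_eq[of n "\<lambda>p. w z (Suc n) (snd p)"] by (simp add: bdd_meas_intros)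
  also have "\<dots> = 0" using assms by (rule integral_w)
  finally show ?thesis by simp
qed

lemma w_rec:
  assumes "c z (Suc n) \<noteq> 0" "c z n \<noteq> 0" "x \<in> space (S n)"
  shows "(1 + \<rho> z n) * w z n x = Q n (w z (Suc n)) x + (P n (R z n) x - \<rho> z n)"
  using assms c_rec[OF assms(1)] h_expand[OF assms(1,3)] by (simp add: w_def field_simps)

text \<open>The recursion behind the whole estimate: by the two-step \<open>L\<^sup>2\<close> contraction, \<open>\<alpha>\<close> is
  dominated by the variances \<open>v\<close> up to a geometric factor.\<close>

lemma \<alpha>_rec:
  assumes z: "cmod z \<le> 1" and c: "c z n \<noteq> 0" "c z (Suc n) \<noteq> 0" "c z (Suc (Suc n)) \<noteq> 0"
    and \<rho>: "cmod (\<rho> z n) \<le> \<epsilon>/2000" "cmod (\<rho> z (Suc n)) \<le> \<epsilon>/2000"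
  shows "(1 - \<epsilon>/500) * \<alpha> z n \<le> (1 - \<epsilon>/2 + \<epsilon>/200) * \<alpha> z (Suc (Suc n)) + \<epsilon>/200 * \<alpha> z (Suc n)
    + \<epsilon>/200 * (v n + v (Suc n))"
proof -
  \<comment> \<open>Young's inequality is used twice, and (1 + \<epsilon>/4)^2 (1 - \<epsilon>)
    \<le> 1 - \<epsilon>/2 keeps half of the gap. The price is a factor 6/\<epsilon> on the
    perturbation, which the \<epsilon>^2 in \<open>e_le\<close> turns into a small multiple of
    \<epsilon>.\<close>
  define \<eta> where "\<eta> = \<epsilon>/4"
  have \<eta>: "0 < \<eta>" using \<epsilon> by (simp add: \<eta>_def)
  define e where "e m = (\<integral>\<omega>. (cmod (P m (R z m) (X m \<omega>) - \<rho> z m))\<^sup>2 \<partial>M)" for m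
  define p where "p m = (\<integral>\<omega>. (cmod (Q m (w z (Suc m)) (X m \<omega>)))\<^sup>2 \<partial>M)" for m
  define q where "q = (\<integral>\<omega>. (cmod (Q n (Q (Suc n) (w z (Suc (Suc n)))) (X n \<omega>)))\<^sup>2 \<partial>M)"
  have e_le: "e m \<le> 8 * (\<epsilon>/100)\<^sup>2 * (v m + \<alpha> z (Suc m))" for m
    unfolding e_def using z by (rule P_R_square_le)
  have "(cmod (1 + \<rho> z n))\<^sup>2 * \<alpha> z n = (\<integral>\<omega>. (cmod ((1 + \<rho> z n) * w z n (X n \<omega>)))\<^sup>2 \<partial>M)"
    by (simp add: \<alpha>_def norm_mult power_mult_distrib)
  also have "\<dots> \<le> (\<integral>\<omega>. (1 + \<eta>) * (cmod (Q n (w z (Suc n)) (X n \<omega>)))\<^sup>2 + (1 + 1/\<eta>) * (cmod (P n (R z n) (X n \<omega>) - \<rho> z n))\<^sup>2 \<partial>M)"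
  proof (intro integral_mono_AE AE_I2)
    fix \<omega> assume "\<omega> \<in> space M"
    then show "(cmod ((1 + \<rho> z n) * w z n (X n \<omega>)))\<^sup>2 \<le> (1 + \<eta>) * (cmod (Q n (w z (Suc n)) (X n \<omega>)))\<^sup>2 + (1 + 1/\<eta>) * (cmod (P n (R z n) (X n \<omega>) - \<rho> z n))\<^sup>2"
      using c w_rec cmod_add_square_le[OF \<eta>] by (simp add: X_space)
  qed (intro integrable_bdd_meas bdd_meas_intros)+
  also have "\<dots> = (1 + \<eta>) * p n + (1 + 1/\<eta>) * e n"
    unfolding p_def e_def by (subst Bochner_Integration.integral_add)
      (auto intro!: integrable_bdd_meas bdd_meas_intros)
  finally have 1: "(cmod (1 + \<rho> z n))\<^sup>2 * \<alpha> z n \<le> (1 + \<eta>) * p n + (1 + 1/\<eta>) * e n" .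
  \<comment> \<open>The relation \<open>w_rec\<close> is used once more, now at n+1 and under
    \<open>Q n\<close>, so that the two-step operator acts on w at n+2; \<open>?T\<close> is the
    centred perturbation picked up on the way.\<close>
  let ?T = "\<lambda>y. P (Suc n) (R z (Suc n)) y - \<rho> z (Suc n)"
  have PT: "(\<integral>\<omega>. (cmod (Q n ?T (X n \<omega>)))\<^sup>2 \<partial>M) \<le> e (Suc n)"
    using integral_norm_P_square_le[of n "\<lambda>p. ?T (snd p)"] by (simp add: e_def bdd_meas_intros)
  have Qw: "(1 + \<rho> z (Suc n)) * Q n (w z (Suc n)) x = Q n (Q (Suc n) (w z (Suc (Suc n)))) x + Q n ?T x"
    if "x \<in> space (S n)" for x
  proof -
    have "(1 + \<rho> z (Suc n)) * Q n (w z (Suc n)) x = P n (\<lambda>p. (1 + \<rho> z (Suc n)) * w z (Suc n) (snd p)) x"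
      by (simp add: P_mult_left)
    also have "\<dots> = P n (\<lambda>p. Q (Suc n) (w z (Suc (Suc n))) (snd p) + ?T (snd p)) x"
      using c w_rec that by (intro P_cong) auto
    also have "\<dots> = Q n (Q (Suc n) (w z (Suc (Suc n)))) x + Q n ?T x"
      using that by (intro P_add bdd_meas_intros)
    finally show ?thesis .
  qed
  have "(cmod (1 + \<rho> z (Suc n)))\<^sup>2 * p n = (\<integral>\<omega>. (cmod ((1 + \<rho> z (Suc n)) * Q n (w z (Suc n)) (X n \<omega>)))\<^sup>2 \<partial>M)"
    by (simp add: p_def norm_mult power_mult_distrib)
  also have "\<dots> \<le> (\<integral>\<omega>. (1 + \<eta>) * (cmod (Q n (Q (Suc n) (w z (Suc (Suc n)))) (X n \<omega>)))\<^sup>2 + (1 + 1/\<eta>) * (cmod (Q n ?T (X n \<omega>)))\<^sup>2 \<partial>M)"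
  proof (intro integral_mono_AE AE_I2)
    fix \<omega> assume "\<omega> \<in> space M"
    then show "(cmod ((1 + \<rho> z (Suc n)) * Q n (w z (Suc n)) (X n \<omega>)))\<^sup>2 \<le> (1 + \<eta>) * (cmod (Q n (Q (Suc n) (w z (Suc (Suc n)))) (X n \<omega>)))\<^sup>2 + (1 + 1/\<eta>) * (cmod (Q n ?T (X n \<omega>)))\<^sup>2"
      using Qw cmod_add_square_le[OF \<eta>] by (simp add: X_space)
  qed (intro integrable_bdd_meas bdd_meas_intros)+
  also have "\<dots> = (1 + \<eta>) * q + (1 + 1/\<eta>) * (\<integral>\<omega>. (cmod (Q n ?T (X n \<omega>)))\<^sup>2 \<partial>M)"
    unfolding q_def by (subst Bochner_Integration.integral_add)
      (auto intro!: integrable_bdd_meas bdd_meas_intros)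
  also have "\<dots> \<le> (1 + \<eta>) * ((1 - \<epsilon>) * \<alpha> z (Suc (Suc n))) + (1 + 1/\<eta>) * e (Suc n)"
    using \<eta> PT contraction_QQ[OF bdd_meas_w integral_w[OF c(3)]]
    by (intro add_mono mult_left_mono) (auto simp: q_def \<alpha>_def)
  finally have 2: "(cmod (1 + \<rho> z (Suc n)))\<^sup>2 * p n \<le> (1 + \<eta>) * ((1 - \<epsilon>) * \<alpha> z (Suc (Suc n))) + (1 + 1/\<eta>) * e (Suc n)" .
  \<comment> \<open>A lower bound for |1 + \<rho>|^2, from |\<rho>| \<le> \<epsilon>/2000. It is
    spent once for each of the two steps, and s^2 \<ge> 1 - \<epsilon>/500.\<close>
  define s where "s = 1 - \<epsilon>/1000"
  have s: "0 < s" "s \<le> 1" using \<epsilon> by (auto simp: s_def)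
  have s1: "s \<le> (cmod (1 + \<rho> z n))\<^sup>2" "s \<le> (cmod (1 + \<rho> z (Suc n)))\<^sup>2"
    using \<rho> cmod_one_plus_square_ge[of "\<rho> z n"] cmod_one_plus_square_ge[of "\<rho> z (Suc n)"] by (auto simp: s_def)
  have p0: "0 \<le> p n" and e0: "0 \<le> e m" for m by (auto simp: p_def e_def)
  have "s * (s * \<alpha> z n) \<le> s * ((1 + \<eta>) * p n + (1 + 1/\<eta>) * e n)"
    using 1 s1(1) s \<alpha>_nonneg by (intro mult_left_mono order_trans[OF mult_right_mono 1]) auto
  also have "\<dots> = (1 + \<eta>) * (s * p n) + s * ((1 + 1/\<eta>) * e n)" by (simp add: algebra_simps)
  also have "\<dots> \<le> (1 + \<eta>) * ((1 + \<eta>) * ((1 - \<epsilon>) * \<alpha> z (Suc (Suc n))) + (1 + 1/\<eta>) * e (Suc n)) + 1 * ((1 + 1/\<eta>) * e n)"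
    using 2 s1(2) s p0 e0 \<eta> by (intro add_mono mult_left_mono mult_right_mono order_trans[OF mult_right_mono 2]) auto
  also have "\<dots> = ((1 + \<eta>)\<^sup>2 * (1 - \<epsilon>)) * \<alpha> z (Suc (Suc n)) + ((1 + \<eta>) * (1 + 1/\<eta>)) * e (Suc n) + (1 + 1/\<eta>) * e n"
    by (simp add: power2_eq_square algebra_simps)
  also have "\<dots> \<le> (1 - \<epsilon>/2) * \<alpha> z (Suc (Suc n)) + (6/\<epsilon>) * e (Suc n) + (6/\<epsilon>) * e n"
  proof (intro add_mono mult_right_mono \<alpha>_nonneg e0)
    have e2: "\<epsilon> * \<epsilon> \<le> \<epsilon> * (1/2)" using \<epsilon> by (intro mult_left_mono) auto
    have "(1 + \<eta>)\<^sup>2 * (1 - \<epsilon>) = 1 - \<epsilon>/2 - 7/16 * (\<epsilon> * \<epsilon>) - \<epsilon> * (\<epsilon> * \<epsilon>) / 16"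
      by (simp add: \<eta>_def power2_eq_square field_simps)
    moreover have "0 \<le> \<epsilon> * \<epsilon>" "0 \<le> \<epsilon> * (\<epsilon> * \<epsilon>)" using \<epsilon> by simp_all
    ultimately show "(1 + \<eta>)\<^sup>2 * (1 - \<epsilon>) \<le> 1 - \<epsilon>/2" by linarith
    have "(1 + \<eta>) * (1 + 1/\<eta>) = (2 * \<epsilon> + 4 + \<epsilon> * \<epsilon> / 4) / \<epsilon>"
      using \<epsilon> by (simp add: \<eta>_def field_simps)
    also have "\<dots> \<le> 6/\<epsilon>" using \<epsilon> e2 by (intro divide_right_mono) linarith+
    finally show "(1 + \<eta>) * (1 + 1/\<eta>) \<le> 6/\<epsilon>" .
    show "1 + 1/\<eta> \<le> 6/\<epsilon>" using \<epsilon> by (simp add: \<eta>_def field_simps)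
  qed
  also have "\<dots> \<le> (1 - \<epsilon>/2) * \<alpha> z (Suc (Suc n)) + (6/\<epsilon>) * (8 * (\<epsilon>/100)\<^sup>2 * (v (Suc n) + \<alpha> z (Suc (Suc n))))
      + (6/\<epsilon>) * (8 * (\<epsilon>/100)\<^sup>2 * (v n + \<alpha> z (Suc n)))"
    using \<epsilon> by (intro add_mono mult_left_mono e_le order_refl) auto
  also have "\<dots> = (1 - \<epsilon>/2) * \<alpha> z (Suc (Suc n)) + 48 * \<epsilon> / 10000 * (v (Suc n) + \<alpha> z (Suc (Suc n)) + v n + \<alpha> z (Suc n))"
    using \<epsilon> by (simp add: power2_eq_square field_simps)
  also have "\<dots> \<le> (1 - \<epsilon>/2) * \<alpha> z (Suc (Suc n)) + \<epsilon>/200 * (v (Suc n) + \<alpha> z (Suc (Suc n)) + v n + \<alpha> z (Suc n))"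
    using \<epsilon> \<alpha>_nonneg v_nonneg by (intro add_mono mult_right_mono order_refl) (auto intro!: add_nonneg_nonneg)
  finally have "s * (s * \<alpha> z n) \<le> (1 - \<epsilon>/2) * \<alpha> z (Suc (Suc n)) + \<epsilon>/200 * (v (Suc n) + \<alpha> z (Suc (Suc n)) + v n + \<alpha> z (Suc n))" .
  moreover have "(1 - \<epsilon>/500) * \<alpha> z n \<le> s * (s * \<alpha> z n)"
  proof -
    have "1 - \<epsilon>/500 \<le> s * s" by (simp add: s_def algebra_simps)
    then have "(1 - \<epsilon>/500) * \<alpha> z n \<le> (s * s) * \<alpha> z n" by (intro mult_right_mono \<alpha>_nonneg)
    then show ?thesis by (simp only: mult.assoc)
  qed
  ultimately show ?thesis by (simp add: algebra_simps)
qed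

end

text \<open>The second-order remainder of the exponential is bounded pointwise, uniformly because Z
  is bounded, and then integrated. The weight Y makes the lemma applicable to its own derivative,
  which gives second derivatives.\<close>

lemma (in prob_space) has_field_derivative_exp_moment:
  fixes Y :: "'a \<Rightarrow> complex" and Z :: "'a \<Rightarrow> real" and z :: complex
  assumes Y: "bdd_meas M Y" and Z: "bdd_meas M Z"
  shows "((\<lambda>z. \<integral>\<omega>. Y \<omega> * exp (z * Z \<omega>) \<partial>M) has_field_derivative (\<integral>\<omega>. Y \<omega> * Z \<omega> * exp (z * Z \<omega>) \<partial>M)) (at z)"
proof -
  obtain C where C: "0 \<le> C" "\<And>\<omega>. \<omega> \<in> space M \<Longrightarrow> cmod (Y \<omega>) \<le> C"
    using Y by (elim bdd_measE) blast
  obtain B where B: "0 \<le> B" "\<And>\<omega>. \<omega> \<in> space M \<Longrightarrow> \<bar>Z \<omega>\<bar> \<le> B"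
    using Z by (elim bdd_measE) auto
  define f where "f z = (\<integral>\<omega>. Y \<omega> * exp (z * Z \<omega>) \<partial>M)" for z :: complex
  define D where "D = (\<integral>\<omega>. Y \<omega> * Z \<omega> * exp (z * Z \<omega>) \<partial>M)"
  define E where "E = C * exp (cmod z * B) * (2 * B\<^sup>2)"
  have E: "0 \<le> E" using C by (simp add: E_def)
  have est: "cmod ((f (z + k) - f z) / k - D) \<le> cmod k * E" if k: "k \<noteq> 0" "cmod k * (B + 1) < 1/2" for k :: complex
  proof -
    have "cmod k * B \<le> cmod k * (B + 1)" by (intro mult_left_mono) auto
    with k have kB: "cmod k * B \<le> 1/2" by linarith
    have "f (z + k) - f z - k * D = (\<integral>\<omega>. Y \<omega> * exp ((z + k) * Z \<omega>) - Y \<omega> * exp (z * Z \<omega>) - k * (Y \<omega> * Z \<omega> * exp (z * Z \<omega>)) \<partial>M)"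
    proof -
      have "integrable M (\<lambda>\<omega>. Y \<omega> * exp ((z + k) * Z \<omega>))" "integrable M (\<lambda>\<omega>. Y \<omega> * exp (z * Z \<omega>))"
        "integrable M (\<lambda>\<omega>. Y \<omega> * Z \<omega> * exp (z * Z \<omega>))"
        by (intro integrable_bdd_meas bdd_meas_intros Y Z)+
      then show ?thesis by (simp add: f_def D_def)
    qed
    also have "cmod \<dots> \<le> (cmod k)\<^sup>2 * E"
    proof (rule norm_integral_le)
      fix \<omega> assume \<omega>: "\<omega> \<in> space M"
      have le: "cmod (k * Z \<omega>) \<le> cmod k * B"
        using B(2)[OF \<omega>] by (simp add: norm_mult mult_left_mono)
      have "Y \<omega> * exp ((z + k) * Z \<omega>) - Y \<omega> * exp (z * Z \<omega>) - k * (Y \<omega> * Z \<omega> * exp (z * Z \<omega>))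
        = Y \<omega> * exp (z * Z \<omega>) * (exp (k * Z \<omega>) - 1 - k * Z \<omega>)"
        by (simp add: algebra_simps exp_add)
      also have "cmod \<dots> \<le> (C * exp (cmod z * B)) * (2 * (cmod k * B)\<^sup>2)"
        unfolding norm_mult[of "Y \<omega> * exp (z * Z \<omega>)"]
      proof (rule mult_mono)
        have "cmod (z * Z \<omega>) \<le> cmod z * B" using B(2)[OF \<omega>] by (simp add: norm_mult mult_left_mono)
        then have "cmod (exp (z * Z \<omega>)) \<le> exp (cmod z * B)"
          using norm_exp[of "z * Z \<omega>"] by (meson exp_le_cancel_iff order_trans)
        then show "cmod (Y \<omega> * exp (z * Z \<omega>)) \<le> C * exp (cmod z * B)"
          using C \<omega> by (simp add: norm_mult mult_mono)
        have "cmod (exp (k * Z \<omega>) - 1 - k * Z \<omega>) \<le> 2 * (cmod (k * Z \<omega>))\<^sup>2"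
          using le kB by (intro norm_exp_minus_1_le) linarith
        also have "\<dots> \<le> 2 * (cmod k * B)\<^sup>2"
          using le by (intro mult_left_mono power_mono) auto
        finally show "cmod (exp (k * Z \<omega>) - 1 - k * Z \<omega>) \<le> 2 * (cmod k * B)\<^sup>2" .
      qed (use C in auto)
      also have "\<dots> = (cmod k)\<^sup>2 * E" by (simp add: E_def power_mult_distrib)
      finally show "cmod (Y \<omega> * exp ((z + k) * Z \<omega>) - Y \<omega> * exp (z * Z \<omega>) - k * (Y \<omega> * Z \<omega> * exp (z * Z \<omega>))) \<le> (cmod k)\<^sup>2 * E" .
    qed (use E in simp)
    finally have "cmod (f (z + k) - f z - k * D) \<le> (cmod k)\<^sup>2 * E" .
    moreover have "(f (z + k) - f z) / k - D = (f (z + k) - f z - k * D) / k"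
      using k by (simp add: field_simps)
    ultimately show ?thesis
      using k by (simp add: norm_divide pos_divide_le_eq power2_eq_square algebra_simps)
  qed
  have "((\<lambda>k. (f (z + k) - f z) / k - D) \<longlongrightarrow> 0) (at 0)"
  proof (rule Lim_null_comparison)
    show "((\<lambda>k. cmod k * E) \<longlongrightarrow> 0) (at 0)" by (auto intro!: tendsto_eq_intros)
    have "\<forall>\<^sub>F k in at 0. dist k 0 < 1 / (2 * (B + 1)) \<and> k \<noteq> (0 :: complex)"
      using B by (auto simp: eventually_at intro!: exI[of _ "1 / (2 * (B + 1))"])
    then show "\<forall>\<^sub>F k in at 0. cmod ((f (z + k) - f z) / k - D) \<le> cmod k * E"
      by eventually_elim (use B est in \<open>auto simp: field_simps\<close>)
  qed
  then have "(f has_field_derivative D) (at z)"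
    by (simp add: DERIV_def LIM_zero_cancel)
  then show ?thesis by (simp add: f_def[abs_def] D_def)
qed

lemma (in prob_space) holomorphic_exp_moment:
  fixes Z :: "'a \<Rightarrow> real"
  assumes "bdd_meas M Z"
  shows "(\<lambda>z :: complex. \<integral>\<omega>. exp (z * Z \<omega>) \<partial>M) holomorphic_on A"
  using has_field_derivative_exp_moment[OF bdd_meas_const assms, of 1]
  by (intro holomorphic_onI) (auto simp: field_differentiable_def intro: has_field_derivative_at_within)

lemma sum_Suc_shift_le:
  fixes g :: "nat \<Rightarrow> real"
  assumes "\<And>n. 0 \<le> g n" "g N = 0"
  shows "(\<Sum>n=a..<N. g (Suc n)) \<le> (\<Sum>n=a..<N. g n)"
proof (cases "a < N")
  case True
  have "(\<Sum>n=a..<N. g (Suc n)) = (\<Sum>n=Suc a..<Suc N. g n)" by (simp only: sum.shift_bounds_Suc_ivl)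
  also have "\<dots> = (\<Sum>n=Suc a..<N. g n)" using True assms(2) by simp
  also have "\<dots> \<le> (\<Sum>n=a..<N. g n)" using assms(1) by (intro sum_mono2) auto
  finally show ?thesis .
qed simp

section \<open>From the recursion to a holomorphic logarithm\<close>

context elliptic_martingale begin

lemma \<rho>_small: "cmod z \<le> 1 \<Longrightarrow> \<alpha> z (Suc n) \<le> (\<epsilon>/100)\<^sup>2 \<Longrightarrow> cmod (\<rho> z n) \<le> \<epsilon>/2000"
proof -
  assume "cmod z \<le> 1" "\<alpha> z (Suc n) \<le> (\<epsilon>/100)\<^sup>2"
  then have "cmod (\<rho> z n) \<le> 4 * (\<epsilon>/100)\<^sup>2"
    using norm_\<rho>_le[of z n] v_le[of n] by linarith
  also have "\<dots> = \<epsilon> * (4 * \<epsilon> / 10000)" by (simp add: power2_eq_square)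
  also have "\<dots> \<le> \<epsilon> * (1/2000)" using \<epsilon> by (intro mult_left_mono) auto
  finally show ?thesis by simp
qed

text \<open>Nonvanishing of c and smallness of \<alpha> have to be proved together, backwards from
  N: the bound on \<alpha> makes \<rho> small, hence 1 + \<rho> and the earlier c are nonzero, and
  only then does the recursion for \<alpha> apply there. The form N \<le> n + j makes the induction
  hypothesis available at both n+1 and n+2.\<close>

lemma core_bounds_aux: "cmod z \<le> 1 \<Longrightarrow> N \<le> n + j \<Longrightarrow> c z n \<noteq> 0 \<and> \<alpha> z n \<le> (\<epsilon>/100)\<^sup>2"
proof (induction j arbitrary: n)
  case 0
  then show ?case by (simp add: c_N \<alpha>_N)
next
  case (Suc j)
  let ?B = "(\<epsilon>/100)\<^sup>2"
  have IH1: "c z (Suc n) \<noteq> 0" "\<alpha> z (Suc n) \<le> ?B" and IH2: "c z (Suc (Suc n)) \<noteq> 0" "\<alpha> z (Suc (Suc n)) \<le> ?B"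
    using Suc.IH[of "Suc n"] Suc.IH[of "Suc (Suc n)"] Suc.prems by auto
  have \<rho>: "cmod (\<rho> z n) \<le> \<epsilon>/2000" "cmod (\<rho> z (Suc n)) \<le> \<epsilon>/2000"
    using \<rho>_small Suc.prems IH1 IH2 by auto
  then have "1 + \<rho> z n \<noteq> 0" using \<epsilon> by (auto simp: add_eq_0_iff)
  with IH1 have c: "c z n \<noteq> 0" by (simp add: c_rec)
  have "(1 - \<epsilon>/500) * \<alpha> z n \<le> (1 - \<epsilon>/2 + \<epsilon>/200) * \<alpha> z (Suc (Suc n)) + \<epsilon>/200 * \<alpha> z (Suc n) + \<epsilon>/200 * (v n + v (Suc n))"
    using Suc.prems c IH1 IH2 \<rho> by (intro \<alpha>_rec)
  also have "\<dots> \<le> (1 - \<epsilon>/2 + \<epsilon>/200) * ?B + \<epsilon>/200 * ?B + \<epsilon>/200 * (?B + ?B)"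
    using \<epsilon> IH1 IH2 v_le by (intro add_mono mult_left_mono) auto
  also have "\<dots> = (1 - \<epsilon>/2 + \<epsilon>/50) * ?B" by (simp add: algebra_simps)
  also have "\<dots> \<le> (1 - \<epsilon>/500) * ?B" using \<epsilon> by (intro mult_right_mono) auto
  finally have "\<alpha> z n \<le> ?B" using \<epsilon> by (subst (asm) mult_le_cancel_left_pos) auto
  with c show ?case by simp
qed

lemma
  assumes "cmod z \<le> 1"
  shows c_nonzero: "c z n \<noteq> 0" and \<alpha>_le: "\<alpha> z n \<le> (\<epsilon>/100)\<^sup>2" and \<rho>_le: "cmod (\<rho> z n) \<le> \<epsilon>/2000"
  using core_bounds_aux[OF assms, of n N] core_bounds_aux[OF assms, of "Suc n" N] \<rho>_small[OF assms] by auto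

text \<open>Summing the recursion, the terms at n+1 and n+2 are again bounded by the full sum, since
  \<alpha> vanishes from N on. The contraction leaves a multiple of \<epsilon> on the left, and the
  perturbation on the right is also a multiple of \<epsilon>, so the final constant does not depend
  on the ellipticity.\<close>

lemma sum_\<alpha>_le:
  assumes z: "cmod z \<le> 1"
  shows "(\<Sum>n=a..<N. \<alpha> z n) \<le> (\<Sum>n=a..<N. v n)"
proof -
  let ?A = "\<Sum>n=a..<N. \<alpha> z n" and ?V = "\<Sum>n=a..<N. v n"
  have s: "(\<Sum>n=a..<N. \<alpha> z (Suc n)) \<le> ?A" "(\<Sum>n=a..<N. v (Suc n)) \<le> ?V"
    by (intro sum_Suc_shift_le; simp add: \<alpha>_nonneg v_nonneg \<alpha>_N v_N)+
  have s2: "(\<Sum>n=a..<N. \<alpha> z (Suc (Suc n))) \<le> ?A"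
    by (rule order_trans[OF sum_Suc_shift_le s(1)]) (simp_all add: \<alpha>_nonneg \<alpha>_N)
  have "(1 - \<epsilon>/500) * ?A = (\<Sum>n=a..<N. (1 - \<epsilon>/500) * \<alpha> z n)" by (simp add: sum_distrib_left)
  also have "\<dots> \<le> (\<Sum>n=a..<N. (1 - \<epsilon>/2 + \<epsilon>/200) * \<alpha> z (Suc (Suc n)) + \<epsilon>/200 * \<alpha> z (Suc n) + \<epsilon>/200 * (v n + v (Suc n)))"
    by (intro sum_mono \<alpha>_rec z c_nonzero \<rho>_le)
  also have "\<dots> = (1 - \<epsilon>/2 + \<epsilon>/200) * (\<Sum>n=a..<N. \<alpha> z (Suc (Suc n))) + \<epsilon>/200 * (\<Sum>n=a..<N. \<alpha> z (Suc n)) + \<epsilon>/200 * (?V + (\<Sum>n=a..<N. v (Suc n)))"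
    by (simp only: sum.distrib sum_distrib_left[symmetric])
  also have "\<dots> \<le> (1 - \<epsilon>/2 + \<epsilon>/200) * ?A + \<epsilon>/200 * ?A + \<epsilon>/200 * (?V + ?V)"
    using \<epsilon> s s2 by (intro add_mono mult_left_mono) auto
  \<comment> \<open>61/125 = 1/2 - 1/100 - 1/500: the gap \<epsilon>/2 less the two terms
    \<epsilon>/200 and the loss from 1 - \<epsilon>/500.\<close>
  finally have "\<epsilon> * (61/125 * ?A) \<le> \<epsilon> * (1/100 * ?V)" by (simp add: algebra_simps)
  then have "61/125 * ?A \<le> 1/100 * ?V" using \<epsilon> by simp
  moreover have "0 \<le> ?A" "0 \<le> ?V" by (auto intro: sum_nonneg \<alpha>_nonneg v_nonneg)
  ultimately show ?thesis by linarith
qed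

lemma sum_\<rho>_le:
  assumes z: "cmod z \<le> 1"
  shows "(\<Sum>n=a..<N. cmod (\<rho> z n)) \<le> 4 * (\<Sum>n=a..<N. v n)"
proof -
  have "(\<Sum>n=a..<N. cmod (\<rho> z n)) \<le> (\<Sum>n=a..<N. 3 * v n + \<alpha> z (Suc n))"
    by (intro sum_mono norm_\<rho>_le z)
  also have "\<dots> = 3 * (\<Sum>n=a..<N. v n) + (\<Sum>n=a..<N. \<alpha> z (Suc n))"
    by (simp add: sum.distrib sum_distrib_left)
  also have "(\<Sum>n=a..<N. \<alpha> z (Suc n)) \<le> (\<Sum>n=a..<N. \<alpha> z n)"
    by (intro sum_Suc_shift_le; simp add: \<alpha>_nonneg \<alpha>_N)
  also have "\<dots> \<le> (\<Sum>n=a..<N. v n)" by (rule sum_\<alpha>_le[OF z])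
  finally show ?thesis by simp
qed

lemma c_eq_prod:
  assumes z: "cmod z \<le> 1" and "a \<le> N"
  shows "c z a = (\<Prod>n=a..<N. 1 + \<rho> z n)"
  using \<open>a \<le> N\<close>
proof (induction a rule: inc_induct)
  case base
  then show ?case by (simp add: c_N)
next
  case (step n)
  then show ?case using c_rec[OF c_nonzero[OF z], of n] by (simp add: prod.atLeast_Suc_lessThan mult.commute)
qed

definition T :: "nat \<Rightarrow> 'a \<Rightarrow> real" where "T a \<omega> = (\<Sum>k=a..<N. D k (X2 k \<omega>))"

lemma bdd_meas_T [bdd_meas_intros]: "bdd_meas M (T a)"
  unfolding T_def[abs_def] by (intro bdd_meas_intros D_meas)

lemma bdd_meas_D_sum_past:
  assumes "j \<le> n"
  shows "bdd_meas (Fn n) (\<lambda>\<omega>. \<Sum>k=a..<j. D k (X2 k \<omega>))"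
  using assms by (intro bdd_meas_sum bdd_meas_X2_past D_meas) auto

text \<open>The mean of the weight times the exponential of the sum up to j times h at j does not
  depend on j: one Markov step undoes one step of the recursion. The two sides are the cases j = N
  and j = a.\<close>

lemma expectation_exp_T:
  fixes z :: complex
  assumes \<psi>: "bdd_meas (Fn a) \<psi>" and a: "a \<le> N"
  shows "(\<integral>\<omega>. \<psi> \<omega> * exp (z * T a \<omega>) \<partial>M) = (\<integral>\<omega>. \<psi> \<omega> * h z a (X a \<omega>) \<partial>M)"
proof -
  have "(\<integral>\<omega>. \<psi> \<omega> * exp (z * (\<Sum>k=a..<j. D k (X2 k \<omega>))) * h z j (X j \<omega>) \<partial>M) = (\<integral>\<omega>. \<psi> \<omega> * h z a (X a \<omega>) \<partial>M)"
    if "a \<le> j" "j \<le> N" for j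
    using that
  proof (induction j rule: dec_induct)
    case base
    then show ?case by simp
  next
    case (step j)
    define \<psi>' where "\<psi>' \<omega> = \<psi> \<omega> * exp (z * (\<Sum>k=a..<j. D k (X2 k \<omega>)))" for \<omega>
    have \<psi>': "bdd_meas (Fn j) \<psi>'"
      unfolding \<psi>'_def by (intro bdd_meas_Fn_mono[OF \<psi>] bdd_meas_mult bdd_meas_exp bdd_meas_const bdd_meas_of_real bdd_meas_D_sum_past step order_refl)
    have "(\<integral>\<omega>. \<psi> \<omega> * exp (z * (\<Sum>k=a..<Suc j. D k (X2 k \<omega>))) * h z (Suc j) (X (Suc j) \<omega>) \<partial>M)
      = (\<integral>\<omega>. \<psi>' \<omega> * (exp (z * D j (X2 j \<omega>)) * h z (Suc j) (snd (X2 j \<omega>))) \<partial>M)"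
      using step.hyps by (simp add: \<psi>'_def sum.atLeastLessThan_Suc exp_add ring_distribs mult_ac)
    also have "\<dots> = (\<integral>\<omega>. \<psi>' \<omega> * P j (\<lambda>p. exp (z * D j p) * h z (Suc j) (snd p)) (X j \<omega>) \<partial>M)"
      by (intro markov_mult[OF \<psi>', of "\<lambda>p. exp (z * D j p) * h z (Suc j) (snd p)"] bdd_meas_intros D_meas)
    also have "\<dots> = (\<integral>\<omega>. \<psi>' \<omega> * h z j (X j \<omega>) \<partial>M)"
      using h_rec by (intro Bochner_Integration.integral_cong) (auto simp: X_space)
    also have "\<dots> = (\<integral>\<omega>. \<psi> \<omega> * h z a (X a \<omega>) \<partial>M)" using step by (simp add: \<psi>'_def)
    finally show ?case .
  qed
  from this[OF a order_refl] show ?thesis by (simp add: T_def h_N)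
qed

lemma c_eq: "a \<le> N \<Longrightarrow> c z a = (\<integral>\<omega>. exp (z * T a \<omega>) \<partial>M)" for z :: complex
  using expectation_exp_T[OF bdd_meas_const, of a 1 z] by (simp add: c_def)

lemma expectation_D: "(\<integral>\<omega>. D j (X2 j \<omega>) \<partial>M) = 0"
proof -
  have "(\<integral>\<omega>. D j (X2 j \<omega>) \<partial>M) = (\<integral>\<omega>. P j (D j) (X j \<omega>) \<partial>M)" by (rule markov_eq_real[OF D_meas])
  also have "\<dots> = (\<integral>\<omega>. 0 \<partial>M)" by (intro Bochner_Integration.integral_cong) (auto simp: P_D X_space)
  finally show ?thesis by simp
qed

lemma expectation_T: "(\<integral>\<omega>. T a \<omega> \<partial>M) = 0"
  unfolding T_def by (subst Bochner_Integration.integral_sum)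
    (auto simp: expectation_D intro!: integrable_bdd_meas bdd_meas_intros D_meas)

text \<open>Each difference is orthogonal to everything in its past, including the initial term, so
  second moments add exactly. This is how a bound by the sum of the v becomes a bound by the
  variance.\<close>

lemma expectation_T_square:
  assumes u: "bdd_meas (S a) u" and a: "a \<le> N"
  shows "(\<integral>\<omega>. (u (X a \<omega>) + T a \<omega>)\<^sup>2 \<partial>M) = (\<integral>\<omega>. (u (X a \<omega>))\<^sup>2 \<partial>M) + (\<Sum>k=a..<N. v k)"
proof -
  have "(\<integral>\<omega>. (u (X a \<omega>) + (\<Sum>k=a..<j. D k (X2 k \<omega>)))\<^sup>2 \<partial>M) = (\<integral>\<omega>. (u (X a \<omega>))\<^sup>2 \<partial>M) + (\<Sum>k=a..<j. v k)"
    if "a \<le> j" "j \<le> N" for j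
    using that
  proof (induction j rule: dec_induct)
    case base
    then show ?case by simp
  next
    case (step j)
    define A where "A \<omega> = u (X a \<omega>) + (\<Sum>k=a..<j. D k (X2 k \<omega>))" for \<omega>
    have A: "bdd_meas (Fn j) A"
      unfolding A_def by (intro bdd_meas_add bdd_meas_X_past u bdd_meas_D_sum_past step order_refl)
    have A': "bdd_meas M A" using A by (rule bdd_meas_Fn_M)
    have cross: "(\<integral>\<omega>. A \<omega> * D j (X2 j \<omega>) \<partial>M) = 0"
    proof -
      have "(\<integral>\<omega>. A \<omega> * D j (X2 j \<omega>) \<partial>M) = (\<integral>\<omega>. A \<omega> * P j (D j) (X j \<omega>) \<partial>M)"
        by (rule markov_mult_real[OF A D_meas])
      also have "\<dots> = (\<integral>\<omega>. 0 \<partial>M)" by (intro Bochner_Integration.integral_cong) (auto simp: P_D X_space)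
      finally show ?thesis by simp
    qed
    have "(\<integral>\<omega>. (u (X a \<omega>) + (\<Sum>k=a..<Suc j. D k (X2 k \<omega>)))\<^sup>2 \<partial>M)
      = (\<integral>\<omega>. (A \<omega>)\<^sup>2 + 2 * (A \<omega> * D j (X2 j \<omega>)) + (D j (X2 j \<omega>))\<^sup>2 \<partial>M)"
      using step.hyps by (intro Bochner_Integration.integral_cong)
        (auto simp: A_def sum.atLeastLessThan_Suc power2_eq_square algebra_simps)
    also have "\<dots> = (\<integral>\<omega>. (A \<omega>)\<^sup>2 \<partial>M) + 2 * (\<integral>\<omega>. A \<omega> * D j (X2 j \<omega>) \<partial>M) + v j"
    proof -
      have "integrable M (\<lambda>\<omega>. (A \<omega>)\<^sup>2)" "integrable M (\<lambda>\<omega>. A \<omega> * D j (X2 j \<omega>))" "integrable M (\<lambda>\<omega>. (D j (X2 j \<omega>))\<^sup>2)"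
        by (intro integrable_bdd_meas bdd_meas_intros A' D_meas)+
      then show ?thesis by (simp add: v_def)
    qed
    finally show ?case using step cross by (simp add: A_def)
  qed
  from this[OF a order_refl] show ?thesis by (simp add: T_def)
qed

text \<open>Given the past, the exponential averages to c (1 + w) at X_a, and E|1 + w| \<le> 2 since
  w is small in mean square. So the summands before a may stay in a characteristic function as a
  weight.\<close>

lemma norm_expectation_past_le:
  fixes z :: complex
  assumes z: "cmod z \<le> 1" and \<psi>: "bdd_meas (Fn a) \<psi>" and \<psi>1: "\<And>\<omega>. \<omega> \<in> space M \<Longrightarrow> cmod (\<psi> \<omega>) \<le> 1" and a: "a \<le> N"
  shows "cmod (\<integral>\<omega>. \<psi> \<omega> * exp (z * T a \<omega>) \<partial>M) \<le> 2 * cmod (\<integral>\<omega>. exp (z * T a \<omega>) \<partial>M)"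
proof -
  have "(\<integral>\<omega>. \<psi> \<omega> * exp (z * T a \<omega>) \<partial>M) = (\<integral>\<omega>. c z a * (\<psi> \<omega> * (1 + w z a (X a \<omega>))) \<partial>M)"
    unfolding expectation_exp_T[OF \<psi> a] using c_nonzero[OF z, of a]
    by (intro Bochner_Integration.integral_cong) (auto simp: w_def)
  also have "\<dots> = c z a * (\<integral>\<omega>. \<psi> \<omega> * (1 + w z a (X a \<omega>)) \<partial>M)" by simp
  also have "cmod \<dots> \<le> cmod (c z a) * 2"
  proof (unfold norm_mult, intro mult_left_mono)
    have "cmod (\<integral>\<omega>. \<psi> \<omega> * (1 + w z a (X a \<omega>)) \<partial>M) \<le> (\<integral>\<omega>. cmod (\<psi> \<omega> * (1 + w z a (X a \<omega>))) \<partial>M)" by simp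
    also have "\<dots> \<le> (\<integral>\<omega>. 3/2 + (cmod (w z a (X a \<omega>)))\<^sup>2 / 2 \<partial>M)"
    proof (intro integral_mono_AE AE_I2)
      fix \<omega> assume \<omega>: "\<omega> \<in> space M"
      have "cmod (\<psi> \<omega> * (1 + w z a (X a \<omega>))) \<le> 1 * cmod (1 + w z a (X a \<omega>))"
        unfolding norm_mult by (intro mult_right_mono \<psi>1 \<omega>) auto
      also have "\<dots> \<le> 1 + cmod (w z a (X a \<omega>))" using norm_triangle_ineq[of 1 "w z a (X a \<omega>)"] by simp
      also have "\<dots> \<le> 3/2 + (cmod (w z a (X a \<omega>)))\<^sup>2 / 2"
        using sum_squares_bound[of 1 "cmod (w z a (X a \<omega>))"] by simp
      finally show "cmod (\<psi> \<omega> * (1 + w z a (X a \<omega>))) \<le> 3/2 + (cmod (w z a (X a \<omega>)))\<^sup>2 / 2" .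
    qed (intro integrable_bdd_meas bdd_meas_intros bdd_meas_Fn_M[OF \<psi>])+
    also have "\<dots> = 3/2 + \<alpha> z a / 2"
    proof -
      have "integrable M (\<lambda>\<omega>. (cmod (w z a (X a \<omega>)))\<^sup>2)" by (intro integrable_bdd_meas bdd_meas_intros)
      then show ?thesis by (simp add: \<alpha>_def prob_space)
    qed
    also have "\<dots> \<le> 2"
    proof -
      have "(\<epsilon>/100)\<^sup>2 \<le> 1" using \<epsilon> by (intro power_le_one) auto
      with \<alpha>_le[OF z, of a] show ?thesis by simp
    qed
    finally show "cmod (\<integral>\<omega>. \<psi> \<omega> * (1 + w z a (X a \<omega>)) \<partial>M) \<le> 2" .
  qed simp
  finally show ?thesis using a by (simp add: c_eq)
qed

text \<open>Realness on the real axis passes to the logarithm and from there to its Taylor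
  coefficients.\<close>

lemma c_of_real:
  assumes "a \<le> N"
  shows "\<exists>r>0. c (of_real x) a = of_real r"
proof (intro exI conjI)
  have b: "bdd_meas M (\<lambda>\<omega>. exp (x * T a \<omega>))"
    using bdd_meas_continuous[OF bdd_meas_mult[OF bdd_meas_const bdd_meas_T[of a]], of exp x]
    by (simp add: continuous_on_exp)
  show "c (of_real x) a = of_real (\<integral>\<omega>. exp (x * T a \<omega>) \<partial>M)"
    using assms by (simp add: c_eq exp_of_real[symmetric] flip: of_real_mult integral_complex_of_real)
  have "0 \<le> (\<integral>\<omega>. exp (x * T a \<omega>) \<partial>M)" by simp
  moreover have "(\<integral>\<omega>. exp (x * T a \<omega>) \<partial>M) \<noteq> 0"
    using \<open>c (of_real x) a = _\<close> integral_nonneg_eq_0_iff_AE[OF integrable_bdd_meas[OF b]] AE_False by simp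
  ultimately show "0 < (\<integral>\<omega>. exp (x * T a \<omega>) \<partial>M)" by linarith
qed

lemma holomorphic_c: "a \<le> N \<Longrightarrow> (\<lambda>z. c z a) holomorphic_on A"
  using holomorphic_exp_moment[OF bdd_meas_T[of a]] by (simp add: c_eq)

text \<open>The logarithm is assembled factor by factor, so that each summand is a principal logarithm
  near \<open>1\<close>.\<close>

theorem log_moment:
  assumes a: "a \<le> N" and u: "bdd_meas (S a) u" "\<And>x. x \<in> space (S a) \<Longrightarrow> \<bar>u x\<bar> \<le> \<epsilon>/100"
    and u0: "(\<integral>\<omega>. u (X a \<omega>) \<partial>M) = 0"
  defines "Z \<equiv> \<lambda>\<omega>. u (X a \<omega>) + T a \<omega>"
  shows "\<exists>L. L holomorphic_on ball 0 1 \<and> (\<forall>z\<in>ball 0 1. exp (L z) = (\<integral>\<omega>. exp (z * Z \<omega>) \<partial>M)) \<and>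
    (\<forall>z\<in>ball 0 1. cmod (L z) \<le> 10 * (\<integral>\<omega>. (Z \<omega>)\<^sup>2 \<partial>M)) \<and> (\<forall>x. \<bar>x\<bar> < 1 \<longrightarrow> L (of_real x) \<in> \<real>)"
proof -
  define \<phi> where "\<phi> z = (\<integral>\<omega>. exp (z * Z \<omega>) \<partial>M)" for z :: complex
  \<comment> \<open>The counterpart of \<rho> for the initial term u(X_a). That term is not a
    martingale difference, but it has mean zero, so its linear contribution drops out as
    well.\<close>
  define q where "q z = (\<integral>\<omega>. incr z u (w z a) (X a \<omega>) \<partial>M)" for z
  define L where "L z = Ln (1 + q z) + (\<Sum>n=a..<N. Ln (1 + \<rho> z n))" for z
  define v0 where "v0 = (\<integral>\<omega>. (u (X a \<omega>))\<^sup>2 \<partial>M)"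
  have bZ: "bdd_meas M Z" unfolding Z_def by (intro bdd_meas_intros u)
  have bu: "bdd_meas M (\<lambda>\<omega>. u (X a \<omega>))" by (intro bdd_meas_intros u)
  have v0: "0 \<le> v0" "v0 \<le> (\<epsilon>/100)\<^sup>2"
  proof -
    have "v0 \<le> (\<integral>\<omega>. (\<epsilon>/100)\<^sup>2 \<partial>M)"
      unfolding v0_def
    proof (intro integral_mono_AE AE_I2)
      fix \<omega> assume "\<omega> \<in> space M"
      then show "(u (X a \<omega>))\<^sup>2 \<le> (\<epsilon>/100)\<^sup>2"
        using power_mono[OF u(2)[OF X_space], of \<omega> 2] by simp
    qed (auto intro!: integrable_bdd_meas bdd_meas_intros u)
    then show "v0 \<le> (\<epsilon>/100)\<^sup>2" by (simp add: prob_space)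
  qed (simp add: v0_def)
  have \<phi>_eq: "\<phi> z = c z a * (1 + q z)" if z: "cmod z \<le> 1" for z
  proof -
    have "\<phi> z = (\<integral>\<omega>. exp (z * u (X a \<omega>)) * h z a (X a \<omega>) \<partial>M)"
      unfolding \<phi>_def Z_def using expectation_exp_T[of a "\<lambda>\<omega>. exp (z * u (X a \<omega>))" z] a
      by (simp add: exp_add ring_distribs bdd_meas_intros bdd_meas_X_past u)
    also have "\<dots> = (\<integral>\<omega>. c z a * (1 + w z a (X a \<omega>) + incr z u (w z a) (X a \<omega>) + z * u (X a \<omega>)) \<partial>M)"
      using c_nonzero[OF z, of a] by (intro Bochner_Integration.integral_cong) (auto simp: incr_def w_def field_simps)
    also have "\<dots> = c z a * (1 + (\<integral>\<omega>. w z a (X a \<omega>) \<partial>M) + q z + z * (\<integral>\<omega>. u (X a \<omega>) \<partial>M))"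
    proof -
      have "integrable M (\<lambda>\<omega>. w z a (X a \<omega>))" "integrable M (\<lambda>\<omega>. incr z u (w z a) (X a \<omega>))"
        "integrable M (\<lambda>\<omega>. u (X a \<omega>))"
        by (intro integrable_bdd_meas bdd_meas_intros u)+
      then show ?thesis by (simp add: q_def prob_space)
    qed
    finally show ?thesis using integral_w[OF c_nonzero[OF z], of a] u0 by simp
  qed
  have q_le: "cmod (q z) \<le> 3 * v0 + \<alpha> z a" if z: "cmod z \<le> 1" for z
  proof -
    have "cmod (q z) \<le> (\<integral>\<omega>. cmod (incr z u (w z a) (X a \<omega>)) \<partial>M)" by (simp add: q_def)
    also have "\<dots> \<le> (\<integral>\<omega>. 3 * (u (X a \<omega>))\<^sup>2 + (cmod (w z a (X a \<omega>)))\<^sup>2 \<partial>M)"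
    proof (intro integral_mono_AE AE_I2)
      fix \<omega> assume "\<omega> \<in> space M"
      then show "cmod (incr z u (w z a) (X a \<omega>)) \<le> 3 * (u (X a \<omega>))\<^sup>2 + (cmod (w z a (X a \<omega>)))\<^sup>2"
        using norm_incr_le'[where D = u and p = "X a \<omega>", OF z u(2) \<epsilon>_le'] by (simp add: X_space)
    qed (intro integrable_bdd_meas bdd_meas_intros u)+
    also have "\<dots> = 3 * v0 + \<alpha> z a"
    proof -
      have "integrable M (\<lambda>\<omega>. (u (X a \<omega>))\<^sup>2)" "integrable M (\<lambda>\<omega>. (cmod (w z a (X a \<omega>)))\<^sup>2)"
        by (intro integrable_bdd_meas bdd_meas_intros u)+
      then show ?thesis by (simp add: v0_def \<alpha>_def)
    qed
    finally show ?thesis .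
  qed
  have small: "cmod (q z) < 1/2" if z: "cmod z \<le> 1" for z
  proof -
    have "cmod (q z) \<le> 4 * (\<epsilon>/100)\<^sup>2" using q_le[OF z] v0 \<alpha>_le[OF z, of a] by linarith
    also have "\<dots> \<le> 4 * (1/100)\<^sup>2" using \<epsilon> by (intro mult_left_mono power_mono) auto
    finally show ?thesis by (simp add: power2_eq_square)
  qed
  have \<rho>_small': "cmod (\<rho> z n) < 1/2" if z: "cmod z \<le> 1" for z n
    using \<rho>_le[OF z, of n] \<epsilon> by linarith
  have EZ: "(\<integral>\<omega>. (Z \<omega>)\<^sup>2 \<partial>M) = v0 + (\<Sum>k=a..<N. v k)"
    unfolding Z_def v0_def by (rule expectation_T_square[OF u(1) a])
  have ne: "1 + \<zeta> \<noteq> 0" "0 < Re (1 + \<zeta>)" if "cmod \<zeta> < 1/2" for \<zeta>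
    using that abs_Re_le_cmod[of \<zeta>] by (auto simp: add_eq_0_iff)
  have expL: "exp (L z) = \<phi> z" if "cmod z \<le> 1" for z
    using that small[OF that] \<rho>_small'[OF that] ne
    by (simp add: L_def exp_add exp_sum \<phi>_eq c_eq_prod[OF that a] mult.commute)
  have L_le: "cmod (L z) \<le> 10 * (\<integral>\<omega>. (Z \<omega>)\<^sup>2 \<partial>M)" if z: "cmod z \<le> 1" for z
  proof -
    have "cmod (L z) \<le> cmod (Ln (1 + q z)) + (\<Sum>n=a..<N. cmod (Ln (1 + \<rho> z n)))"
      unfolding L_def by (intro order_trans[OF norm_triangle_ineq] add_mono norm_sum order_refl)
    \<comment> \<open>|Ln (1 + \<zeta>)| \<le> 2 |\<zeta>| for |\<zeta>| < 1/2. The total is 6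
      \<open>v0\<close> plus 2 + 8 times the sum of the v, which explains the constant 10.\<close>
    also have "\<dots> \<le> 2 * cmod (q z) + (\<Sum>n=a..<N. 2 * cmod (\<rho> z n))"
      using small[OF z] \<rho>_small'[OF z] by (intro add_mono sum_mono norm_Ln_le) auto
    also have "\<dots> = 2 * cmod (q z) + 2 * (\<Sum>n=a..<N. cmod (\<rho> z n))" by (simp add: sum_distrib_left)
    also have "\<dots> \<le> 2 * (3 * v0 + \<alpha> z a) + 2 * (4 * (\<Sum>n=a..<N. v n))"
      using q_le[OF z] sum_\<rho>_le[OF z] by (intro add_mono mult_left_mono) auto
    also have "\<alpha> z a \<le> (\<Sum>n=a..<N. v n)"
    proof (cases "a < N")
      case True
      then have "\<alpha> z a \<le> (\<Sum>n=a..<N. \<alpha> z n)" by (intro member_le_sum) (auto simp: \<alpha>_nonneg)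
      with sum_\<alpha>_le[OF z, of a] show ?thesis by linarith
    qed (simp add: \<alpha>_N)
    finally show ?thesis using v0 by (simp add: EZ)
  qed
  have \<phi>_holo: "\<phi> holomorphic_on A" for A
    unfolding \<phi>_def[abs_def] by (rule holomorphic_exp_moment[OF bZ])
  \<comment> \<open>By definition q and \<rho> are integrals involving the normalised w, where the
    dependence on z is awkward. Holomorphy is read off instead from 1 + q and 1 + \<rho> as
    quotients of exponential moments.\<close>
  have "(\<lambda>z. Ln (1 + q z)) holomorphic_on ball 0 1"
  proof (rule holomorphic_transform[of "\<lambda>z. Ln (\<phi> z / c z a)"])
    show "(\<lambda>z. Ln (\<phi> z / c z a)) holomorphic_on ball 0 1"
    proof (intro holomorphic_intros \<phi>_holo holomorphic_c a)
      fix z :: complex assume "z \<in> ball 0 1"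
      then have z: "cmod z \<le> 1" by simp
      then show "c z a \<noteq> 0" by (rule c_nonzero)
      then have "\<phi> z / c z a = 1 + q z" using \<phi>_eq[OF z] by simp
      then show "\<phi> z / c z a \<notin> \<real>\<^sub>\<le>\<^sub>0" using ne(2)[OF small[OF z]] by (auto simp: complex_nonpos_Reals_iff)
    qed
  qed (use \<phi>_eq c_nonzero in auto)
  moreover have "(\<lambda>z. Ln (1 + \<rho> z n)) holomorphic_on ball 0 1" if "n < N" for n
  proof (rule holomorphic_transform[of "\<lambda>z. Ln (c z n / c z (Suc n))"])
    show "(\<lambda>z. Ln (c z n / c z (Suc n))) holomorphic_on ball 0 1"
    proof (intro holomorphic_intros holomorphic_c)
      fix z :: complex assume "z \<in> ball 0 1"
      then have z: "cmod z \<le> 1" by simp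
      then show "c z (Suc n) \<noteq> 0" by (rule c_nonzero)
      then have "c z n / c z (Suc n) = 1 + \<rho> z n" using c_rec[of z n] by simp
      then show "c z n / c z (Suc n) \<notin> \<real>\<^sub>\<le>\<^sub>0" using ne(2)[OF \<rho>_small'[OF z, of n]] by (auto simp: complex_nonpos_Reals_iff)
    qed (use that in auto)
  qed (use c_rec[of _ n] c_nonzero in auto)
  ultimately have "L holomorphic_on ball 0 1"
    unfolding L_def[abs_def] by (intro holomorphic_on_add holomorphic_on_sum) auto
  moreover have "L (of_real x) \<in> \<real>" if x: "\<bar>x\<bar> < 1" for x
  proof -
    have x': "cmod (of_real x) \<le> 1" using x by simp
    have pos: "Ln (1 + \<zeta>) \<in> \<real>" if "1 + \<zeta> = of_real r" "0 < r" for \<zeta> r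
      using that by (simp add: Ln_of_real)
    have "1 + \<rho> (of_real x) n \<in> \<real>" if n: "n < N" for n
    proof -
      obtain r s where "c (of_real x) n = of_real r" "c (of_real x) (Suc n) = of_real s"
        using c_of_real[of n x] c_of_real[of "Suc n" x] n by auto
      then show ?thesis using c_rec[OF c_nonzero[OF x', of "Suc n"]] c_nonzero[OF x', of "Suc n"]
        by (metis Reals_divide Reals_of_real nonzero_mult_div_cancel_left)
    qed
    moreover have "1 + q (of_real x) \<in> \<real>"
    proof -
      obtain r where "c (of_real x) a = of_real r"
        using c_of_real[of a x] a by auto
      moreover have "\<phi> (of_real x) = of_real (\<integral>\<omega>. exp (x * Z \<omega>) \<partial>M)"
        unfolding \<phi>_def by (simp add: exp_of_real[symmetric] flip: of_real_mult integral_complex_of_real)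
      ultimately show ?thesis using \<phi>_eq[OF x'] c_nonzero[OF x', of a]
        by (metis Reals_divide Reals_of_real nonzero_mult_div_cancel_left)
    qed
    moreover have "Ln y \<in> \<real>" if "y \<in> \<real>" "0 < Re y" for y
      using that by (auto elim!: Reals_cases simp: Ln_of_real)
    ultimately show ?thesis
      unfolding L_def using ne(2) small[OF x'] \<rho>_small'[OF x']
      by (intro Reals_add sum_in_Reals) auto
  qed
  ultimately show ?thesis
    using expL L_le unfolding \<phi>_def by (intro exI[of _ L]) auto
qed

end

section \<open>Cumulants\<close>

definition taylor_coeff :: "(complex \<Rightarrow> complex) \<Rightarrow> nat \<Rightarrow> complex" where
  "taylor_coeff L k = (deriv ^^ k) L 0 / fact k"

text \<open>Cauchy's estimate on the circle of radius 1/2 gives the powers of 2; for |z| \<le> 1/4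
  the tail is dominated by a geometric series of ratio at most 1/2, whence the factor 2. Both bounds
  are linear in B, which is going to be a multiple of the variance.\<close>

lemma
  assumes L: "L holomorphic_on ball 0 1" and B: "\<And>z. cmod z < 1 \<Longrightarrow> cmod (L z) \<le> B"
  shows norm_taylor_coeff_le: "cmod (taylor_coeff L k) \<le> B * 2 ^ k"
    and taylor_remainder: "cmod z \<le> 1/4 \<Longrightarrow>
      cmod (L z - (\<Sum>k<m. taylor_coeff L k * z ^ k)) \<le> 2 * B * (2 * cmod z) ^ m"
proof -
  have B0: "0 \<le> B" using order_trans[OF norm_ge_zero B[of 0]] by simp
  have le: "cmod (taylor_coeff L k) \<le> B * 2 ^ k" for k
  proof -
    have "cmod ((deriv ^^ k) L 0) \<le> fact k * B / (1/2) ^ k"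
    proof (rule Cauchy_inequality)
      show "L holomorphic_on ball 0 (1/2)" by (rule holomorphic_on_subset[OF L]) auto
      show "continuous_on (cball 0 (1/2)) L"
        by (rule continuous_on_subset[OF holomorphic_on_imp_continuous_on[OF L]]) auto
    qed (use B in auto)
    then show ?thesis by (simp add: taylor_coeff_def norm_divide field_simps)
  qed
  then show "cmod (taylor_coeff L k) \<le> B * 2 ^ k" .
  assume z: "cmod z \<le> 1/4"
  define q where "q = 2 * cmod z"
  have q: "0 \<le> q" "q \<le> 1/2" "q < 1" using z by (auto simp: q_def)
  have sums: "(\<lambda>k. taylor_coeff L k * z ^ k) sums L z"
    using holomorphic_power_series[OF L, of z] z by (simp add: taylor_coeff_def)
  then have "(\<lambda>k. taylor_coeff L (k + m) * z ^ (k + m)) sums (L z - (\<Sum>k<m. taylor_coeff L k * z ^ k))"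
    by (rule sums_split_initial_segment)
  then have "L z - (\<Sum>k<m. taylor_coeff L k * z ^ k) = (\<Sum>k. taylor_coeff L (k + m) * z ^ (k + m))"
    by (simp add: sums_iff)
  also have "cmod \<dots> \<le> (\<Sum>k. B * q ^ m * q ^ k)"
  proof (rule norm_suminf_le)
    fix k
    have "cmod (taylor_coeff L (k + m) * z ^ (k + m)) \<le> B * 2 ^ (k + m) * cmod z ^ (k + m)"
      unfolding norm_mult norm_power by (intro mult_right_mono le) simp
    also have "\<dots> = B * q ^ m * q ^ k" by (simp add: q_def power_add power_mult_distrib)
    finally show "cmod (taylor_coeff L (k + m) * z ^ (k + m)) \<le> B * q ^ m * q ^ k" .
    show "summable (\<lambda>k. B * q ^ m * q ^ k)" using q by (intro summable_mult summable_geometric) auto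
  qed
  also have "\<dots> = B * q ^ m * (1 / (1 - q))"
    using q by (simp add: suminf_mult summable_geometric suminf_geometric)
  also have "\<dots> \<le> B * q ^ m * 2"
    using q B0 by (intro mult_left_mono mult_nonneg_nonneg) (auto simp: field_simps)
  finally show "cmod (L z - (\<Sum>k<m. taylor_coeff L k * z ^ k)) \<le> 2 * B * (2 * cmod z) ^ m"
    by (simp add: q_def)
qed

text \<open>Difference quotients along the real axis are real, and the real line is closed in the
  plane.\<close>

lemma deriv_in_Reals:
  assumes "f holomorphic_on ball 0 1" "\<And>x. \<bar>x\<bar> < 1 \<Longrightarrow> f (of_real x) \<in> \<real>" "\<bar>x\<bar> < 1"
  shows "deriv f (of_real x) \<in> \<real>"
proof -
  have "(f has_field_derivative deriv f (of_real x)) (at (of_real x))"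
    using assms by (intro holomorphic_derivI[of _ "ball 0 1"]) auto
  then have "((\<lambda>k. (f (of_real x + k) - f (of_real x)) / k) \<longlongrightarrow> deriv f (of_real x)) (at 0)"
    by (simp add: DERIV_def)
  moreover have "filterlim (complex_of_real) (at 0) (at 0)"
    by (auto simp: filterlim_at eventually_at_filter intro!: tendsto_eq_intros)
  ultimately have "((\<lambda>t. (f (of_real x + of_real t) - f (of_real x)) / of_real t) \<longlongrightarrow> deriv f (of_real x)) (at (0::real))"
    by (rule filterlim_compose)
  moreover have "\<forall>\<^sub>F t in at (0::real). (f (of_real x + of_real t) - f (of_real x)) / of_real t \<in> \<real>"
  proof -
    have "\<forall>\<^sub>F t in at (0::real). \<bar>t\<bar> < 1 - \<bar>x\<bar>"
      using assms(3) by (auto simp: eventually_at dist_real_def intro!: exI[of _ "1 - \<bar>x\<bar>"])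
    then show ?thesis
    proof eventually_elim
      fix t assume "\<bar>t\<bar> < 1 - \<bar>x\<bar>"
      then have "\<bar>x + t\<bar> < 1" by linarith
      from assms(2)[OF this] assms(2)[OF assms(3)]
      show "(f (of_real x + of_real t) - f (of_real x)) / of_real t \<in> \<real>"
        by (intro Reals_divide Reals_diff) auto
    qed
  qed
  ultimately show ?thesis
    using Lim_in_closed_set[OF closed_complex_Reals] by (metis trivial_limit_at)
qed

lemma taylor_coeff_in_Reals:
  assumes "L holomorphic_on ball 0 1" "\<And>x. \<bar>x\<bar> < 1 \<Longrightarrow> L (of_real x) \<in> \<real>"
  shows "taylor_coeff L k \<in> \<real>"
proof -
  have *: "(deriv ^^ k) L (of_real x) \<in> \<real>" if "\<bar>x\<bar> < 1" for x
    using that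
  proof (induction k arbitrary: x)
    case (Suc k)
    then show ?case
      using deriv_in_Reals[of "(deriv ^^ k) L" x] holomorphic_higher_deriv[OF assms(1)] by simp
  qed (use assms in simp)
  have "(deriv ^^ k) L 0 \<in> \<real>" using *[of 0] by simp
  moreover have "fact k \<in> (\<real> :: complex set)" using Reals_of_nat[of "fact k"] by simp
  ultimately show ?thesis unfolding taylor_coeff_def by (rule Reals_divide)
qed

text \<open>Differentiating exp L = \<phi> gives L' \<phi> = \<phi>'. At 0, where \<phi> = 1 and
  \<phi>' = 0, this gives L' = 0, and differentiating once more gives L'' = \<phi>''.\<close>

lemma (in prob_space) log_moment_coeffs:
  fixes Z :: "'a \<Rightarrow> real" and L :: "complex \<Rightarrow> complex"
  assumes Z: "bdd_meas M Z" and EZ: "expectation Z = 0"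
    and L: "L holomorphic_on ball 0 1" "\<And>z :: complex. cmod z < 1 \<Longrightarrow> exp (L z) = (\<integral>\<omega>. exp (z * Z \<omega>) \<partial>M)"
    and real: "\<And>x. \<bar>x\<bar> < 1 \<Longrightarrow> L (of_real x) \<in> \<real>"
  shows "taylor_coeff L 0 = 0" "taylor_coeff L 1 = 0" "taylor_coeff L 2 = (\<integral>\<omega>. (Z \<omega>)\<^sup>2 \<partial>M) / 2"
proof -
  define \<phi> where "\<phi> = (\<lambda>z :: complex. \<integral>\<omega>. exp (z * Z \<omega>) \<partial>M)"
  define \<phi>1 where "\<phi>1 = (\<lambda>z :: complex. \<integral>\<omega>. Z \<omega> * exp (z * Z \<omega>) \<partial>M)"
  define \<phi>2 where "\<phi>2 = (\<lambda>z :: complex. \<integral>\<omega>. (Z \<omega>)\<^sup>2 * exp (z * Z \<omega>) \<partial>M)"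
  have d\<phi>: "(\<phi> has_field_derivative \<phi>1 z) (at z)" for z
    using has_field_derivative_exp_moment[OF bdd_meas_const Z, of 1 z] by (simp add: \<phi>_def \<phi>1_def)
  have d\<phi>1: "(\<phi>1 has_field_derivative \<phi>2 z) (at z)" for z
    using has_field_derivative_exp_moment[OF bdd_meas_of_real[OF Z] Z, of z]
    by (simp add: \<phi>1_def \<phi>2_def power2_eq_square)
  have \<phi>0: "\<phi> 0 = 1" "\<phi>1 0 = 0" "\<phi>2 0 = (\<integral>\<omega>. (Z \<omega>)\<^sup>2 \<partial>M)"
    using EZ by (simp_all add: \<phi>_def \<phi>1_def \<phi>2_def prob_space flip: of_real_power)
  \<comment> \<open>exp (L 0) = 1 alone fixes L 0 only up to a multiple of 2 pi i; realness selects
    0.\<close>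
  obtain r where r: "L 0 = of_real r" using real[of 0] by (auto elim: Reals_cases)
  have "exp (L 0) = 1" using L(2)[of 0] \<phi>0 by (simp add: \<phi>_def)
  then have "exp r = 1" unfolding r by (metis exp_of_real of_real_eq_1_iff)
  with r have L0: "L 0 = 0" by simp
  then show "taylor_coeff L 0 = 0" by (simp add: taylor_coeff_def)
  have dL: "(L has_field_derivative deriv L z) (at z)" if "cmod z < 1" for z
    using that by (intro holomorphic_derivI[OF L(1)]) auto
  have eq: "deriv L z * \<phi> z = \<phi>1 z" if z: "cmod z < 1" for z
  proof -
    have "((\<lambda>z. exp (L z)) has_field_derivative exp (L z) * deriv L z) (at z)"
      using dL[OF z] by (auto intro!: derivative_eq_intros)
    then have "(\<phi> has_field_derivative exp (L z) * deriv L z) (at z)"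
      by (rule has_field_derivative_transform_within_open[of _ _ _ "ball 0 1"]) (use z L in \<open>auto simp: \<phi>_def\<close>)
    with d\<phi>[of z] have "exp (L z) * deriv L z = \<phi>1 z" by (rule DERIV_unique[rotated])
    then show ?thesis using L(2)[OF z] by (simp add: \<phi>_def mult.commute)
  qed
  have L1: "deriv L 0 = 0" using eq[of 0] \<phi>0 by simp
  then show "taylor_coeff L 1 = 0" by (simp add: taylor_coeff_def)
  have "(deriv L has_field_derivative deriv (deriv L) 0) (at 0)"
    using holomorphic_deriv[OF L(1)] by (intro holomorphic_derivI[of _ "ball 0 1"]) auto
  then have "((\<lambda>z. deriv L z * \<phi> z) has_field_derivative deriv (deriv L) 0) (at 0)"
    using d\<phi>[of 0] \<phi>0 L1 by (auto intro!: derivative_eq_intros)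
  then have "(\<phi>1 has_field_derivative deriv (deriv L) 0) (at 0)"
    by (rule has_field_derivative_transform_within_open[of _ _ _ "ball 0 1"]) (use eq in auto)
  with d\<phi>1[of 0] have "deriv (deriv L) 0 = \<phi>2 0" by (rule DERIV_unique[rotated])
  then show "taylor_coeff L 2 = (\<integral>\<omega>. (Z \<omega>)\<^sup>2 \<partial>M) / 2"
    using \<phi>0 by (simp add: taylor_coeff_def numeral_2_eq_2)
qed

text \<open>The choice \<open>\<eta> = 1/640\<close> makes the cubic remainder at most half of the quadratic term.\<close>

lemma (in prob_space) norm_char_le_of_log_moment:
  fixes Z :: "'a \<Rightarrow> real" and L :: "complex \<Rightarrow> complex"
  assumes Z: "bdd_meas M Z" and EZ: "expectation Z = 0"
    and L: "L holomorphic_on ball 0 1" "\<And>z :: complex. cmod z < 1 \<Longrightarrow> exp (L z) = (\<integral>\<omega>. exp (z * Z \<omega>) \<partial>M)"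
    and real: "\<And>x. \<bar>x\<bar> < 1 \<Longrightarrow> L (of_real x) \<in> \<real>"
    and B: "\<And>z. cmod z < 1 \<Longrightarrow> cmod (L z) \<le> 10 * expectation (\<lambda>\<omega>. (Z \<omega>)\<^sup>2)"
    and \<eta>: "\<eta> = 1/640"
  shows "cmod (\<integral>\<omega>. exp (\<i> * \<eta> * Z \<omega>) \<partial>M) \<le> exp (- \<eta>\<^sup>2 * expectation (\<lambda>\<omega>. (Z \<omega>)\<^sup>2) / 4)"
proof -
  define V where "V = expectation (\<lambda>\<omega>. (Z \<omega>)\<^sup>2)"
  define z where "z = \<i> * complex_of_real \<eta>"
  have z: "cmod z = \<eta>" using \<eta> by (simp add: z_def norm_mult)
  have "cmod (L z - (\<Sum>k<3. taylor_coeff L k * z ^ k)) \<le> 2 * (10 * V) * (2 * cmod z) ^ 3"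
    unfolding V_def by (rule taylor_remainder[OF L(1) B]) (use z \<eta> in auto)
  also have "(\<Sum>k<3. taylor_coeff L k * z ^ k) = - (of_real (\<eta>\<^sup>2 * V / 2))"
  proof -
    have "{..<3} = {0, 1, 2 :: nat}" by auto
    then show ?thesis
      using log_moment_coeffs[OF Z EZ L real] by (simp add: V_def z_def power_mult_distrib)
  qed
  \<comment> \<open>The left side is 160 \<eta>^3 V, and 160 \<eta> = 1/4 for the chosen
    \<eta>.\<close>
  also have "2 * (10 * V) * (2 * cmod z) ^ 3 = \<eta>\<^sup>2 * V / 4"
    unfolding z using \<eta> by (simp add: power3_eq_cube power2_eq_square)
  finally have "cmod (L z + of_real (\<eta>\<^sup>2 * V / 2)) \<le> \<eta>\<^sup>2 * V / 4" by simp
  then have "Re (L z + of_real (\<eta>\<^sup>2 * V / 2)) \<le> \<eta>\<^sup>2 * V / 4"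
    using complex_Re_le_cmod order_trans by blast
  then have "Re (L z) \<le> - (\<eta>\<^sup>2 * V / 4)"
    unfolding plus_complex.sel Re_complex_of_real by linarith
  then have "cmod (exp (L z)) \<le> exp (- \<eta>\<^sup>2 * V / 4)" by simp
  moreover have "cmod z < 1" using z \<eta> by simp
  ultimately show ?thesis using L(2)[of z] unfolding z_def V_def by simp
qed

section \<open>Martingale decomposition\<close>

text \<open>The bounds b decrease, so a single smallness condition at index a covers all later
  indices.\<close>

locale elliptic_sum = elliptic_chain +
  fixes g :: "nat \<Rightarrow> 'b \<times> 'b \<Rightarrow> real" and b :: "nat \<Rightarrow> real" and N :: nat
  assumes g_meas: "\<And>n. bdd_meas (S2 n) (g n)"
    and g_le: "\<And>n p. p \<in> space (S2 n) \<Longrightarrow> \<bar>g n p\<bar> \<le> b n"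
    and b_mono: "\<And>m n. m \<le> n \<Longrightarrow> b n \<le> b m"
begin

lemma X2_space: "\<omega> \<in> space M \<Longrightarrow> X2 n \<omega> \<in> space (S2 n)"
  by (auto simp: space_pair_measure X_space)

lemma b_nonneg: "0 \<le> b n"
proof -
  obtain \<omega> where "\<omega> \<in> space M" using not_empty by auto
  from g_le[OF X2_space[OF this]] show ?thesis by (rule order_trans[OF abs_ge_zero])
qed

definition G :: "nat \<Rightarrow> 'b \<times> 'b \<Rightarrow> real" where
  "G n p = (if n < N then g n p - (\<integral>\<omega>. g n (X2 n \<omega>) \<partial>M) else 0)"

lemma bdd_meas_G [bdd_meas_intros]: "bdd_meas (S2 n) (G n)"
  unfolding G_def[abs_def] using g_meas by (cases "n < N") (auto intro!: bdd_meas_intros)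

lemma abs_expectation_g_le: "\<bar>\<integral>\<omega>. g n (X2 n \<omega>) \<partial>M\<bar> \<le> b n"
  using norm_integral_le[of "\<lambda>\<omega>. g n (X2 n \<omega>)" "b n"] g_le X2_space b_nonneg by auto

lemma G_le:
  assumes "p \<in> space (S2 n)"
  shows "\<bar>G n p\<bar> \<le> 2 * b n"
  using g_le[OF assms] abs_expectation_g_le[of n] b_nonneg[of n] by (auto simp: G_def)

lemma expectation_G: "(\<integral>\<omega>. G n (X2 n \<omega>) \<partial>M) = 0"
proof -
  have "integrable M (\<lambda>\<omega>. g n (X2 n \<omega>))" by (rule integrable_X2[OF g_meas])
  then show ?thesis by (cases "n < N") (auto simp: G_def prob_space)
qed

text \<open>Gordin's corrector: \<open>u n x\<close> is the conditional expectation, given X_n = x,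
  of the centred sum over the indices from n to N - 1. As for \<open>hb\<close>, the recursion runs
  over the number of steps left.\<close>

primrec ub :: "nat \<Rightarrow> 'b \<Rightarrow> real" where
  "ub 0 = (\<lambda>x. 0)"
| "ub (Suc j) = P (N - Suc j) (\<lambda>p. G (N - Suc j) p + ub j (snd p))"

definition u :: "nat \<Rightarrow> 'b \<Rightarrow> real" where "u n = ub (N - n)"

lemma bdd_meas_u [bdd_meas_intros]: "bdd_meas (S n) (u n)"
proof -
  have "bdd_meas (S (N - j)) (ub j)" if "j \<le> N" for j
    using that
  proof (induction j)
    case (Suc j)
    then have "Suc (N - Suc j) = N - j" by simp
    with Suc show ?case by (auto intro!: bdd_meas_intros)
  qed (simp add: bdd_meas_const)
  from this[of "N - n"] show ?thesis
    by (cases "n \<le> N") (auto simp: u_def bdd_meas_const)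
qed

lemma u_N: "N \<le> n \<Longrightarrow> u n x = 0"
  by (simp add: u_def)

lemma u_rec:
  assumes "x \<in> space (S n)"
  shows "u n x = P n (\<lambda>p. G n p + u (Suc n) (snd p)) x"
proof (cases "n < N")
  case True
  then obtain j where j: "N = Suc (n + j)" using less_iff_Suc_add by auto
  then have "N - n = Suc j" "N - Suc n = j" "N - Suc j = n" by auto
  then show ?thesis by (simp add: u_def)
next
  case False
  then show ?thesis using assms by (simp add: u_def G_def)
qed

lemma expectation_u: "(\<integral>\<omega>. u n (X n \<omega>) \<partial>M) = 0"
proof -
  have "(\<integral>\<omega>. u n (X n \<omega>) \<partial>M) = 0" if "N \<le> n + j" for n j
    using that
  proof (induction j arbitrary: n)
    case (Suc j)
    have "(\<integral>\<omega>. u n (X n \<omega>) \<partial>M) = (\<integral>\<omega>. P n (\<lambda>p. G n p + u (Suc n) (snd p)) (X n \<omega>) \<partial>M)"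
      by (intro Bochner_Integration.integral_cong) (auto simp: u_rec X_space)
    also have "\<dots> = (\<integral>\<omega>. G n (X2 n \<omega>) + u (Suc n) (snd (X2 n \<omega>)) \<partial>M)"
      by (rule markov_eq_real[symmetric]) (intro bdd_meas_intros)
    also have "\<dots> = (\<integral>\<omega>. G n (X2 n \<omega>) \<partial>M) + (\<integral>\<omega>. u (Suc n) (X (Suc n) \<omega>) \<partial>M)"
      by (simp add: integrable_X integrable_X2 bdd_meas_intros)
    also have "\<dots> = 0" using Suc by (simp add: expectation_G)
    finally show ?case .
  qed (simp add: u_N)
  from this[of n N] show ?thesis by simp
qed

lemma u_rec2:
  assumes x: "x \<in> space (S n)"
  shows "u n x = P n (G n) x + Q n (P (Suc n) (G (Suc n))) x + Q n (Q (Suc n) (u (Suc (Suc n)))) x"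
proof -
  have "u n x = P n (G n) x + Q n (u (Suc n)) x"
    unfolding u_rec[OF x] by (intro P_add x bdd_meas_intros)
  also have "Q n (u (Suc n)) x = P n (\<lambda>p. P (Suc n) (G (Suc n)) (snd p) + Q (Suc n) (u (Suc (Suc n))) (snd p)) x"
  proof (intro P_cong x)
    fix y assume y: "y \<in> space (S (Suc n))"
    show "u (Suc n) (snd (x, y)) = P (Suc n) (G (Suc n)) (snd (x, y)) + Q (Suc n) (u (Suc (Suc n))) (snd (x, y))"
      unfolding snd_conv u_rec[OF y] by (intro P_add y bdd_meas_intros)
  qed
  also have "\<dots> = Q n (P (Suc n) (G (Suc n))) x + Q n (Q (Suc n) (u (Suc (Suc n)))) x"
    by (intro P_add x bdd_meas_intros)
  finally show ?thesis by simp
qed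

lemma P_G_le: "x \<in> space (S n) \<Longrightarrow> \<bar>P n (G n) x\<bar> \<le> 2 * b n"
  using norm_P_le[of n "G n" x "2 * b n"] G_le b_nonneg[of n] by (auto simp: space_pair_measure)

text \<open>Oscillation is estimated rather than size, because constants are not contracted.
  Expanding two steps, the two new terms are each at most 2 b in modulus, so the oscillations
  satisfy o_n \<le> 8 b_n + (1 - \<epsilon>) o_{n+2}; the fixed point of this inequality is 8 b /
  \<epsilon>.\<close>

lemma u_range_aux: "N \<le> n + j \<Longrightarrow> \<exists>l. \<forall>x\<in>space (S n). l \<le> u n x \<and> u n x \<le> l + 8 * b n / \<epsilon>"
proof (induction j arbitrary: n)
  case 0
  then show ?case using b_nonneg[of n] \<epsilon> by (intro exI[of _ 0]) (auto simp: u_N)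
next
  case (Suc j)
  define o2 where "o2 = 8 * b (Suc (Suc n)) / \<epsilon>"
  obtain l where "\<forall>x\<in>space (S (Suc (Suc n))). l \<le> u (Suc (Suc n)) x \<and> u (Suc (Suc n)) x \<le> l + o2"
    using Suc.IH[of "Suc (Suc n)"] Suc.prems by (auto simp: o2_def)
  then obtain m where m: "\<And>x. x \<in> space (S n) \<Longrightarrow> m \<le> Q n (Q (Suc n) (u (Suc (Suc n)))) x"
    "\<And>x. x \<in> space (S n) \<Longrightarrow> Q n (Q (Suc n) (u (Suc (Suc n)))) x \<le> m + (1 - \<epsilon>) * o2"
    using QQ_range[OF bdd_meas_u, of n l "l + o2"] by auto
  have o2: "(1 - \<epsilon>) * o2 \<le> (1 - \<epsilon>) * (8 * b n / \<epsilon>)"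
    unfolding o2_def using \<epsilon> b_mono[of n "Suc (Suc n)"] by (intro mult_left_mono divide_right_mono) auto
  also have "\<dots> = 8 * b n / \<epsilon> - 8 * b n" using \<epsilon> by (simp add: field_simps)
  finally have o3: "(1 - \<epsilon>) * o2 \<le> 8 * b n / \<epsilon> - 8 * b n" .
  show ?case
  proof (intro exI[of _ "m - 4 * b n"] ballI)
    fix x assume x: "x \<in> space (S n)"
    have 1: "\<bar>P n (G n) x\<bar> \<le> 2 * b n" by (rule P_G_le[OF x])
    have "\<bar>Q n (P (Suc n) (G (Suc n))) x\<bar> \<le> 2 * b (Suc n)"
      using norm_P_le[of n "\<lambda>p. P (Suc n) (G (Suc n)) (snd p)" x "2 * b (Suc n)"] P_G_le b_nonneg[of "Suc n"] x by auto
    with b_mono[of n "Suc n"] have 2: "\<bar>Q n (P (Suc n) (G (Suc n))) x\<bar> \<le> 2 * b n" by simp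
    from 1 2 m[OF x] o3 show "m - 4 * b n \<le> u n x \<and> u n x \<le> m - 4 * b n + 8 * b n / \<epsilon>"
      unfolding u_rec2[OF x] by linarith
  qed
qed

text \<open>Mean zero along the chain forces 0 into the interval that contains the range of u, so
  the length of that interval bounds |u|.\<close>

lemma u_le:
  assumes "x \<in> space (S n)"
  shows "\<bar>u n x\<bar> \<le> 8 * b n / \<epsilon>"
proof -
  obtain l where l: "\<And>x. x \<in> space (S n) \<Longrightarrow> l \<le> u n x \<and> u n x \<le> l + 8 * b n / \<epsilon>"
    using u_range_aux[of n N] by auto
  have i: "integrable M (\<lambda>\<omega>. u n (X n \<omega>))" by (intro integrable_X bdd_meas_intros)
  have "(\<integral>\<omega>. l \<partial>M) \<le> (\<integral>\<omega>. u n (X n \<omega>) \<partial>M)"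
    using l X_space i by (intro integral_mono_AE) auto
  moreover have "(\<integral>\<omega>. u n (X n \<omega>) \<partial>M) \<le> (\<integral>\<omega>. l + 8 * b n / \<epsilon> \<partial>M)"
    using l X_space i by (intro integral_mono_AE) auto
  ultimately have "l \<le> 0" "0 \<le> l + 8 * b n / \<epsilon>" by (auto simp: expectation_u prob_space)
  with l[OF assms] show ?thesis by linarith
qed

text \<open>Differences before a are replaced by 0, so that the smallness required of a martingale
  has to hold only from a on. This freedom in a is what makes high frequencies accessible.\<close>

definition Dm :: "nat \<Rightarrow> nat \<Rightarrow> 'b \<times> 'b \<Rightarrow> real" where
  "Dm a n p = (if n < a then 0 else G n p + u (Suc n) (snd p) - u n (fst p))"

lemma bdd_meas_Dm: "bdd_meas (S2 n) (Dm a n)"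
  unfolding Dm_def[abs_def] by (cases "n < a") (auto intro!: bdd_meas_intros)

lemma Dm_le:
  assumes p: "p \<in> space (S2 n)"
  shows "\<bar>Dm a n p\<bar> \<le> 18 * b n / \<epsilon>"
proof -
  have "fst p \<in> space (S n)" "snd p \<in> space (S (Suc n))" using p by (auto simp: space_pair_measure)
  then have "\<bar>u n (fst p)\<bar> \<le> 8 * b n / \<epsilon>" "\<bar>u (Suc n) (snd p)\<bar> \<le> 8 * b (Suc n) / \<epsilon>" by (simp_all add: u_le)
  moreover have "8 * b (Suc n) / \<epsilon> \<le> 8 * b n / \<epsilon>" using b_mono[of n "Suc n"] \<epsilon> by (intro divide_right_mono) auto
  moreover have "\<bar>G n p\<bar> \<le> 2 * b n" by (rule G_le[OF p])
  moreover have "2 * b n \<le> 2 * b n / \<epsilon>" using \<epsilon> b_nonneg[of n] mult_left_mono[of \<epsilon> 1 "b n"] by (simp add: field_simps)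
  moreover have "18 * b n / \<epsilon> = 2 * b n / \<epsilon> + 8 * b n / \<epsilon> + 8 * b n / \<epsilon>" by (simp add: add_divide_distrib[symmetric])
  moreover have "0 \<le> 18 * b n / \<epsilon>" using \<epsilon> b_nonneg[of n] by simp
  ultimately show ?thesis unfolding Dm_def by (cases "n < a") auto
qed

lemma P_Dm:
  assumes "x \<in> space (S n)"
  shows "P n (Dm a n) x = 0"
proof (cases "n < a")
  case False
  have "P n (Dm a n) x = P n (\<lambda>p. (G n p + u (Suc n) (snd p)) - u n (fst p)) x"
    using False by (intro P_cong assms) (simp add: Dm_def)
  also have "\<dots> = P n (\<lambda>p. G n p + u (Suc n) (snd p)) x - P n (\<lambda>p. u n (fst p)) x"
    using assms by (intro P_diff bdd_meas_intros)
  also have "\<dots> = 0" using assms by (simp add: P_fst u_rec)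
  finally show ?thesis .
qed (simp add: Dm_def[abs_def] assms)

text \<open>1800 = 18 * 100: the bound 18 b / \<epsilon> on the differences becomes
  \<epsilon>/100.\<close>

lemma elliptic_martingale_Dm:
  assumes "b a \<le> \<epsilon>\<^sup>2 / 1800"
  shows "elliptic_martingale M S K X Fn \<nu> \<epsilon> (Dm a) N"
proof unfold_locales
  fix n p assume p: "p \<in> space (S2 n)"
  show "\<bar>Dm a n p\<bar> \<le> \<epsilon> / 100"
  proof (cases "n < a")
    case False
    then have "b n \<le> \<epsilon>\<^sup>2 / 1800" using b_mono[of a n] assms by simp
    then have "18 * b n / \<epsilon> \<le> 18 * (\<epsilon>\<^sup>2 / 1800) / \<epsilon>" using \<epsilon> by (intro divide_right_mono) auto
    then show ?thesis using Dm_le[OF p, of a] \<epsilon> by (simp add: power2_eq_square)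
  qed (use \<epsilon> in \<open>simp add: Dm_def\<close>)
qed (auto simp: bdd_meas_Dm P_Dm, simp add: Dm_def G_def u_N)

definition Z :: "nat \<Rightarrow> 'a \<Rightarrow> real" where
  "Z a \<omega> = (\<Sum>k=a..<N. g k (X2 k \<omega>) - (\<integral>\<omega>. g k (X2 k \<omega>) \<partial>M))"

text \<open>The corrector terms telescope, and the corrector vanishes at N, so only its value at a
  survives.\<close>

lemma Z_eq:
  assumes "a \<le> N"
  shows "Z a \<omega> = u a (X a \<omega>) + (\<Sum>k=a..<N. Dm a k (X2 k \<omega>))"
proof -
  have "(\<Sum>k=a..<N. Dm a k (X2 k \<omega>)) = (\<Sum>k=a..<N. (g k (X2 k \<omega>) - (\<integral>\<omega>. g k (X2 k \<omega>) \<partial>M)) + (u (Suc k) (X (Suc k) \<omega>) - u k (X k \<omega>)))"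
    by (intro sum.cong) (auto simp: Dm_def G_def)
  also have "\<dots> = Z a \<omega> + (\<Sum>k=a..<N. u (Suc k) (X (Suc k) \<omega>) - u k (X k \<omega>))"
    by (simp add: sum.distrib Z_def)
  also have "(\<Sum>k=a..<N. u (Suc k) (X (Suc k) \<omega>) - u k (X k \<omega>)) = - u a (X a \<omega>)"
    using sum_Suc_diff'[OF assms, of "\<lambda>k. u k (X k \<omega>)"] by (simp add: u_N)
  finally show ?thesis by simp
qed

lemma expectation_Z: "(\<integral>\<omega>. Z a \<omega> \<partial>M) = 0"
proof -
  have "integrable M (\<lambda>\<omega>. g k (X2 k \<omega>))" for k by (rule integrable_X2[OF g_meas])
  then show ?thesis unfolding Z_def
    by (subst Bochner_Integration.integral_sum) (auto simp: prob_space)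
qed

theorem Z_log_moment:
  assumes a: "a \<le> N" and b: "b a \<le> \<epsilon>\<^sup>2 / 1800"
  shows "\<exists>L. L holomorphic_on ball 0 1 \<and> (\<forall>z\<in>ball 0 1. exp (L z) = (\<integral>\<omega>. exp (z * Z a \<omega>) \<partial>M)) \<and>
    (\<forall>z\<in>ball 0 1. cmod (L z) \<le> 10 * (\<integral>\<omega>. (Z a \<omega>)\<^sup>2 \<partial>M)) \<and> (\<forall>x. \<bar>x\<bar> < 1 \<longrightarrow> L (of_real x) \<in> \<real>)"
proof -
  interpret mart: elliptic_martingale M S K X Fn \<nu> \<epsilon> "Dm a" N by (rule elliptic_martingale_Dm[OF b])
  have "\<bar>u a x\<bar> \<le> \<epsilon> / 100" if "x \<in> space (S a)" for x
  proof -
    have "8 * b a / \<epsilon> \<le> 8 * (\<epsilon>\<^sup>2 / 1800) / \<epsilon>" using \<epsilon> b by (intro divide_right_mono) auto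
    with u_le[OF that] \<epsilon> show ?thesis by (simp add: power2_eq_square)
  qed
  from mart.log_moment[OF a bdd_meas_u this expectation_u] show ?thesis
    by (simp add: Z_eq[OF a] mart.T_def)
qed

text \<open>The corrector term u(X_a) is moved into the past weight, and the decay comes from the
  pure martingale part. That part has smaller variance than \<open>Z a\<close>, but only by E u^2
  \<le> 1, which is absorbed by enlarging the constant from 2 to 3.\<close>

theorem char_Z_past_le:
  assumes a: "a \<le> N" and b: "b a \<le> \<epsilon>\<^sup>2 / 1800" and \<eta>: "\<eta> = 1/640"
    and \<psi>: "bdd_meas (Fn a) \<psi>" "\<And>\<omega>. \<omega> \<in> space M \<Longrightarrow> cmod (\<psi> \<omega>) \<le> 1"
  shows "cmod (\<integral>\<omega>. \<psi> \<omega> * exp (\<i> * \<eta> * Z a \<omega>) \<partial>M) \<le> 3 * exp (- \<eta>\<^sup>2 * (\<integral>\<omega>. (Z a \<omega>)\<^sup>2 \<partial>M) / 4)"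
proof -
  interpret mart: elliptic_martingale M S K X Fn \<nu> \<epsilon> "Dm a" N by (rule elliptic_martingale_Dm[OF b])
  define V where "V = (\<integral>\<omega>. (mart.T a \<omega>)\<^sup>2 \<partial>M)"
  have "\<exists>L. L holomorphic_on ball 0 1 \<and> (\<forall>z\<in>ball 0 1. exp (L z) = (\<integral>\<omega>. exp (z * mart.T a \<omega>) \<partial>M)) \<and>
    (\<forall>z\<in>ball 0 1. cmod (L z) \<le> 10 * V) \<and> (\<forall>x. \<bar>x\<bar> < 1 \<longrightarrow> L (of_real x) \<in> \<real>)"
    using mart.log_moment[OF a bdd_meas_const, of 0] \<epsilon> by (simp add: V_def)
  then obtain L where L: "L holomorphic_on ball 0 1" "\<And>z. cmod z < 1 \<Longrightarrow> exp (L z) = (\<integral>\<omega>. exp (z * mart.T a \<omega>) \<partial>M)"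
    "\<And>z. cmod z < 1 \<Longrightarrow> cmod (L z) \<le> 10 * V" "\<And>x. \<bar>x\<bar> < 1 \<Longrightarrow> L (of_real x) \<in> \<real>"
    by auto
  have T: "cmod (\<integral>\<omega>. exp (\<i> * \<eta> * mart.T a \<omega>) \<partial>M) \<le> exp (- \<eta>\<^sup>2 * V / 4)"
    unfolding V_def using L
    by (intro norm_char_le_of_log_moment[OF mart.bdd_meas_T mart.expectation_T L(1) L(2) L(4) _ \<eta>]) (auto simp: V_def)
  define \<psi>' where "\<psi>' \<omega> = \<psi> \<omega> * exp (\<i> * \<eta> * u a (X a \<omega>))" for \<omega>
  have "bdd_meas (Fn a) \<psi>'"
    unfolding \<psi>'_def by (intro bdd_meas_mult \<psi> bdd_meas_exp bdd_meas_of_real bdd_meas_const bdd_meas_X_past bdd_meas_u order_refl)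
  moreover have "cmod (\<psi>' \<omega>) \<le> 1" if "\<omega> \<in> space M" for \<omega>
    using \<psi>(2)[OF that] by (simp add: \<psi>'_def norm_mult)
  moreover have "cmod (\<i> * \<eta>) \<le> 1" using \<eta> by (simp add: norm_mult)
  ultimately have "cmod (\<integral>\<omega>. \<psi>' \<omega> * exp (\<i> * \<eta> * mart.T a \<omega>) \<partial>M) \<le> 2 * cmod (\<integral>\<omega>. exp (\<i> * \<eta> * mart.T a \<omega>) \<partial>M)"
    using a by (intro mart.norm_expectation_past_le)
  also have "\<dots> \<le> 2 * exp (- \<eta>\<^sup>2 * V / 4)" using T by simp
  also have "\<dots> \<le> 2 * exp (- \<eta>\<^sup>2 * ((\<integral>\<omega>. (Z a \<omega>)\<^sup>2 \<partial>M) - 1) / 4)"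
  proof -
    have "(\<integral>\<omega>. (Z a \<omega>)\<^sup>2 \<partial>M) = (\<integral>\<omega>. (u a (X a \<omega>))\<^sup>2 \<partial>M) + V"
      using mart.expectation_T_square[OF bdd_meas_u a] mart.expectation_T_square[OF bdd_meas_const a, of 0]
      by (simp add: Z_eq[OF a] mart.T_def V_def)
    moreover have "(\<integral>\<omega>. (u a (X a \<omega>))\<^sup>2 \<partial>M) \<le> (\<integral>\<omega>. 1 \<partial>M)"
    proof (intro integral_mono_AE AE_I2)
      fix \<omega> assume "\<omega> \<in> space M"
      then have "\<bar>u a (X a \<omega>)\<bar> \<le> 8 * b a / \<epsilon>" by (simp add: u_le X_space)
      also have "\<dots> \<le> 8 * (\<epsilon>\<^sup>2 / 1800) / \<epsilon>" using \<epsilon> b by (intro divide_right_mono) auto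
      also have "\<dots> \<le> 1" using \<epsilon> by (simp add: power2_eq_square)
      finally show "(u a (X a \<omega>))\<^sup>2 \<le> 1" by (simp add: abs_square_le_1)
    qed (intro integrable_bdd_meas bdd_meas_intros)+
    ultimately have "(\<integral>\<omega>. (Z a \<omega>)\<^sup>2 \<partial>M) - 1 \<le> V" by (simp add: prob_space)
    then have "\<eta>\<^sup>2 * ((\<integral>\<omega>. (Z a \<omega>)\<^sup>2 \<partial>M) - 1) \<le> \<eta>\<^sup>2 * V" by (intro mult_left_mono) auto
    then show ?thesis by simp
  qed
  also have "\<dots> = 2 * exp (\<eta>\<^sup>2 / 4) * exp (- \<eta>\<^sup>2 * (\<integral>\<omega>. (Z a \<omega>)\<^sup>2 \<partial>M) / 4)"
    by (simp add: exp_add[symmetric] diff_divide_distrib algebra_simps)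
  also have "\<dots> \<le> 3 * exp (- \<eta>\<^sup>2 * (\<integral>\<omega>. (Z a \<omega>)\<^sup>2 \<partial>M) / 4)"
  proof (intro mult_right_mono)
    have "exp (\<eta>\<^sup>2 / 4) \<le> 1 + 2 * (\<eta>\<^sup>2 / 4)"
      using exp_bound_lemma[of "\<eta>\<^sup>2 / 4"] unfolding \<eta> by (simp add: power2_eq_square)
    then show "2 * exp (\<eta>\<^sup>2 / 4) \<le> 3" unfolding \<eta> by (simp add: power2_eq_square)
  qed simp
  finally show ?thesis by (simp add: \<psi>'_def Z_eq[OF a] mart.T_def exp_add ring_distribs mult.assoc)
qed

text \<open>Orthogonality reduces the variance to the sup bounds of the corrector and the
  differences. Here sup norms suffice, since the bound is meant for the initial block of indices
  that is given up at high frequencies.\<close>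

theorem variance_Z_le:
  assumes b: "b 0 \<le> \<epsilon>\<^sup>2 / 1800"
  shows "(\<integral>\<omega>. (Z 0 \<omega>)\<^sup>2 \<partial>M) \<le> (8 * b 0 / \<epsilon>)\<^sup>2 + (\<Sum>k<N. (18 * b k / \<epsilon>)\<^sup>2)"
proof -
  interpret mart: elliptic_martingale M S K X Fn \<nu> \<epsilon> "Dm 0" N by (rule elliptic_martingale_Dm[OF b])
  have "(\<integral>\<omega>. (Z 0 \<omega>)\<^sup>2 \<partial>M) = (\<integral>\<omega>. (u 0 (X 0 \<omega>))\<^sup>2 \<partial>M) + (\<Sum>k=0..<N. mart.v k)"
    using mart.expectation_T_square[OF bdd_meas_u, of 0] by (simp add: Z_eq mart.T_def)
  also have "\<dots> \<le> (8 * b 0 / \<epsilon>)\<^sup>2 + (\<Sum>k=0..<N. (18 * b k / \<epsilon>)\<^sup>2)"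
  proof (intro add_mono sum_mono)
    have "(\<integral>\<omega>. (u 0 (X 0 \<omega>))\<^sup>2 \<partial>M) \<le> (\<integral>\<omega>. (8 * b 0 / \<epsilon>)\<^sup>2 \<partial>M)"
    proof (intro integral_mono_AE AE_I2)
      fix \<omega> assume "\<omega> \<in> space M"
      then show "(u 0 (X 0 \<omega>))\<^sup>2 \<le> (8 * b 0 / \<epsilon>)\<^sup>2" using power_mono[OF u_le[OF X_space], of \<omega> 0 2] by simp
    qed (intro integrable_bdd_meas bdd_meas_intros)+
    then show "(\<integral>\<omega>. (u 0 (X 0 \<omega>))\<^sup>2 \<partial>M) \<le> (8 * b 0 / \<epsilon>)\<^sup>2" by (simp add: prob_space)
    fix k
    have "mart.v k \<le> (\<integral>\<omega>. (18 * b k / \<epsilon>)\<^sup>2 \<partial>M)"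
      unfolding mart.v_def
    proof (intro integral_mono_AE AE_I2)
      fix \<omega> assume "\<omega> \<in> space M"
      then show "(Dm 0 k (X2 k \<omega>))\<^sup>2 \<le> (18 * b k / \<epsilon>)\<^sup>2"
        using power_mono[OF Dm_le[OF X2_space], of \<omega> 0 k 2] by simp
    qed (intro integrable_bdd_meas bdd_meas_intros bdd_meas_Dm)+
    then show "mart.v k \<le> (18 * b k / \<epsilon>)\<^sup>2" by (simp add: prob_space)
  qed
  finally show ?thesis by (simp add: atLeast0LessThan)
qed

end

section \<open>Gaussian smoothing and Levy inversion\<close>

text \<open>The probabilists' Hermite polynomials, through their three-term recurrence.\<close>

fun hermite :: "nat \<Rightarrow> real poly" where
  "hermite 0 = 1"
| "hermite (Suc 0) = [:0, 1:]"
| "hermite (Suc (Suc n)) = [:0, 1:] * hermite (Suc n) - smult (real (Suc n)) (hermite n)"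

text \<open>The integrand of Fourier inversion at x for (i s)^j e^{-s^2/2}, which is the transform
  of the j-th Hermite polynomial times the normal density.\<close>

definition gauss_pow :: "real \<Rightarrow> nat \<Rightarrow> real \<Rightarrow> complex" where
  "gauss_pow x j s = iexp (- (s * x)) * (\<i> * s) ^ j * complex_of_real (exp (- s\<^sup>2 / 2))"

lemma norm_gauss_pow: "cmod (gauss_pow x j s) = \<bar>s\<bar> ^ j * exp (- s\<^sup>2 / 2)"
  by (simp add: gauss_pow_def norm_mult norm_power)

lemma integrable_abs_pow_gauss: "integrable lborel (\<lambda>s::real. \<bar>s\<bar> ^ j * exp (- s\<^sup>2 / 2))"
proof -
  have "integrable lborel (\<lambda>s. sqrt (2 * pi) * (std_normal_density s * \<bar>s\<bar> ^ j))"
    by (intro integrable_mult_right integrable_std_normal_moment_abs)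
  then show ?thesis by (simp add: std_normal_density_def mult_ac)
qed

lemma gauss_pow_measurable [measurable]: "gauss_pow x j \<in> borel_measurable borel"
  unfolding gauss_pow_def[abs_def] by measurable

lemma integrable_gauss_pow: "integrable lborel (gauss_pow x j)"
  by (rule Bochner_Integration.integrable_bound[OF integrable_abs_pow_gauss[of j]])
    (auto simp: norm_gauss_pow abs_mult)

text \<open>The Gaussian is its own transform: up to normalisation the integral is the
  characteristic function of the normal law at -x.\<close>

lemma integral_gauss_pow_0: "(LBINT s. gauss_pow x 0 s) = 2 * pi * std_normal_density x"
proof -
  have "char std_normal_distribution (- x) = (CLBINT s. std_normal_density s *\<^sub>R iexp (- x * s))"
    unfolding char_def by (subst integral_density) (auto simp: normal_density_nonneg)
  also have "\<dots> = (CLBINT s. (1 / sqrt (2 * pi)) * gauss_pow x 0 s)"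
    by (intro Bochner_Integration.integral_cong) (auto simp: gauss_pow_def std_normal_density_def scaleR_conv_of_real mult_ac exp_of_real)
  also have "\<dots> = (1 / sqrt (2 * pi)) * (LBINT s. gauss_pow x 0 s)" by simp
  finally have "(1 / sqrt (2 * pi)) * (LBINT s. gauss_pow x 0 s) = of_real (exp (- x\<^sup>2 / 2))"
    by (simp add: char_std_normal_distribution)
  then have "(LBINT s. gauss_pow x 0 s) = of_real (sqrt (2 * pi) * exp (- x\<^sup>2 / 2))"
    by (simp add: field_simps)
  also have "sqrt (2 * pi) * exp (- x\<^sup>2 / 2) = 2 * pi * std_normal_density x"
    by (simp add: std_normal_density_def real_div_sqrt field_simps)
  finally show ?thesis by simp
qed

lemma gauss_pow_tendsto_0:
  "(gauss_pow x j \<longlongrightarrow> 0) at_top" "(gauss_pow x j \<longlongrightarrow> 0) at_bot"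
proof -
  have "((\<lambda>s::real. \<bar>s\<bar> ^ j * exp (- s\<^sup>2 / 2)) \<longlongrightarrow> 0) at_top" by real_asymp
  then show "(gauss_pow x j \<longlongrightarrow> 0) at_top"
    by (intro tendsto_norm_zero_cancel[of "gauss_pow x j"]) (simp add: norm_gauss_pow)
  have "((\<lambda>s::real. \<bar>s\<bar> ^ j * exp (- s\<^sup>2 / 2)) \<longlongrightarrow> 0) at_bot" by real_asymp
  then show "(gauss_pow x j \<longlongrightarrow> 0) at_bot"
    by (intro tendsto_norm_zero_cancel[of "gauss_pow x j"]) (simp add: norm_gauss_pow)
qed

lemma gauss_pow_deriv:
  "(gauss_pow x j has_vector_derivative
     (- \<i> * x * gauss_pow x j s + \<i> * j * gauss_pow x (j - 1) s + \<i> * gauss_pow x (Suc j) s)) (at s)"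
proof -
  \<comment> \<open>The derivative is computed for a complex variable and then restricted to the
    real line.\<close>
  define F where "F = (\<lambda>z :: complex. exp (- \<i> * z * x) * (\<i> * z) ^ j * exp (- z\<^sup>2 / 2))"
  have "(F has_field_derivative (- \<i> * x * F s + \<i> * j * (exp (- \<i> * s * x) * (\<i> * s) ^ (j - 1) * exp (- (of_real s)\<^sup>2 / 2))
      - s * F s)) (at (of_real s))"
  proof -
    define W where "W = (\<lambda>z :: complex. (\<i> * z) ^ j)"
    have W: "(W has_field_derivative (\<i> * j * (\<i> * s) ^ (j - 1))) (at (of_real s))"
      unfolding W_def by (rule derivative_eq_intros refl)+ simp
    have F: "F = (\<lambda>z. exp (- \<i> * z * x) * W z * exp (- z\<^sup>2 / 2))" by (simp add: F_def W_def)
    show ?thesis unfolding F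
      by (auto intro!: derivative_eq_intros W simp: algebra_simps)
  qed
  from has_vector_derivative_real_field[OF this]
  have "((\<lambda>s. F (of_real s)) has_vector_derivative (- \<i> * x * F s + \<i> * j * (exp (- \<i> * s * x) * (\<i> * s) ^ (j - 1) * exp (- (of_real s)\<^sup>2 / 2))
      - s * F s)) (at s)" .
  moreover have "F (of_real s) = gauss_pow x j s" for s
    by (simp add: F_def gauss_pow_def exp_of_real[symmetric] mult_ac)
  moreover have "exp (- \<i> * s * x) * (\<i> * s) ^ (j - 1) * exp (- (of_real s)\<^sup>2 / 2) = gauss_pow x (j - 1) s"
    by (simp add: gauss_pow_def exp_of_real[symmetric] mult_ac)
  moreover have "\<i> * gauss_pow x (Suc j) s = - s * gauss_pow x j s"
    by (simp add: gauss_pow_def algebra_simps)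
  ultimately show ?thesis by (simp add: algebra_simps)
qed

text \<open>The integral of the derivative of \<open>gauss_pow\<close> vanishes; dividing by i
  leaves the Hermite recurrence. For j = 0 the factor j kills the term with the truncated difference
  j - 1.\<close>

lemma integral_gauss_pow_rec:
  "(LBINT s. gauss_pow x (Suc j) s) = x * (LBINT s. gauss_pow x j s) - j * (LBINT s. gauss_pow x (j - 1) s)"
proof -
  let ?f = "\<lambda>s. - \<i> * x * gauss_pow x j s + \<i> * j * gauss_pow x (j - 1) s + \<i> * gauss_pow x (Suc j) s"
  have int: "integrable lborel ?f"
    by (simp add: integrable_gauss_pow)
  have "(CLBINT s=-\<infinity>..\<infinity>. ?f s) = 0 - 0"
  proof (rule interval_integral_FTC_integrable)
    show "(gauss_pow x j has_vector_derivative ?f s) (at s)" for s by (rule gauss_pow_deriv)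
    have "isCont (gauss_pow x k) s" for k s
      by (rule has_vector_derivative_continuous[OF gauss_pow_deriv])
    then show "isCont ?f s" for s by (intro isCont_add isCont_mult continuous_const)
    show "set_integrable lborel (einterval (-\<infinity>) \<infinity>) ?f" using int by (simp add: set_integrable_def)
    show "((gauss_pow x j \<circ> real_of_ereal) \<longlongrightarrow> 0) (at_right (-\<infinity>))"
      using gauss_pow_tendsto_0[of x j] by (simp add: ereal_tendsto_simps)
    show "((gauss_pow x j \<circ> real_of_ereal) \<longlongrightarrow> 0) (at_left \<infinity>)"
      using gauss_pow_tendsto_0[of x j] by (simp add: ereal_tendsto_simps)
  qed simp
  also have "(CLBINT s=-\<infinity>..\<infinity>. ?f s) = (LBINT s. ?f s)"
    by (simp add: interval_lebesgue_integral_def set_lebesgue_integral_def)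
  also have "\<dots> = - \<i> * x * (LBINT s. gauss_pow x j s) + \<i> * j * (LBINT s. gauss_pow x (j - 1) s) + \<i> * (LBINT s. gauss_pow x (Suc j) s)"
    by (simp add: integrable_gauss_pow)
  finally have "\<i> * (LBINT s. gauss_pow x (Suc j) s) = \<i> * (x * (LBINT s. gauss_pow x j s) - j * (LBINT s. gauss_pow x (j - 1) s))"
    by (simp add: algebra_simps)
  then show ?thesis by simp
qed

lemma integral_gauss_pow: "(LBINT s. gauss_pow x j s) = 2 * pi * (poly (hermite j) x * std_normal_density x)"
proof (induction j rule: hermite.induct)
  case 1
  then show ?case using integral_gauss_pow_0[of x] by simp
next
  case 2
  then show ?case using integral_gauss_pow_rec[of x 0] integral_gauss_pow_0[of x] by simp
next
  case (3 n)
  then show ?case using integral_gauss_pow_rec[of x "Suc n"] by (simp add: algebra_simps)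
qed

section \<open>Inversion for integrable characteristic functions\<close>

definition levy_kernel :: "real \<Rightarrow> real \<Rightarrow> real \<Rightarrow> complex" where
  "levy_kernel a b s = (iexp (- (s * a)) - iexp (- (s * b))) / (\<i> * s)"

lemma levy_kernel_measurable [measurable]: "levy_kernel a b \<in> borel_measurable borel"
  unfolding levy_kernel_def[abs_def] by measurable

lemma norm_levy_kernel_le: "a \<le> b \<Longrightarrow> cmod (levy_kernel a b s) \<le> b - a"
  using Levy_Inversion_aux2[of "- b" "- a" s] by (cases "s = 0") (auto simp: levy_kernel_def)

text \<open>Unlike the bound b - a, this one is uniform in the endpoints and survives letting a tend
  to minus infinity. It is the reason why differences of transforms are later measured after
  division by |s|.\<close>

lemma norm_levy_kernel_le2: "\<bar>s\<bar> * cmod (levy_kernel a b s) \<le> 2"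
proof -
  have "cmod (iexp (- (s * a)) - iexp (- (s * b))) \<le> cmod (iexp (- (s * a))) + cmod (iexp (- (s * b)))"
    by (rule norm_triangle_ineq4)
  then have "cmod (iexp (- (s * a)) - iexp (- (s * b))) \<le> 2" by simp
  then show ?thesis by (cases "s = 0") (simp_all add: levy_kernel_def norm_divide norm_mult)
qed

lemma integrable_levy_kernel_mult:
  assumes "integrable lborel f" "a \<le> b"
  shows "integrable lborel (\<lambda>s. levy_kernel a b s * f s)"
proof (rule Bochner_Integration.integrable_bound)
  show "integrable lborel (\<lambda>s. (b - a) * cmod (f s))"
    using assms by (intro integrable_mult_right integrable_norm)
  show "AE s in lborel. cmod (levy_kernel a b s * f s) \<le> norm ((b - a) * cmod (f s))"
    using assms(2) norm_levy_kernel_le[OF assms(2)]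
    by (intro AE_I2) (simp add: norm_mult abs_mult mult_right_mono)
  show "(\<lambda>s. levy_kernel a b s * f s) \<in> borel_measurable lborel"
    using borel_measurable_integrable[OF assms(1)] by measurable
qed

lemma tendsto_integral_symmetric:
  fixes f :: "real \<Rightarrow> complex"
  assumes f: "integrable lborel f"
  shows "(\<lambda>n. CLBINT s=-real n..real n. f s) \<longlonglongrightarrow> (LBINT s. f s)"
proof -
  note borel_measurable_integrable[OF f, measurable]
  have "(\<lambda>n. LBINT s. indicator {-real n<..<real n} s *\<^sub>R f s) \<longlonglongrightarrow> (LBINT s. f s)"
  proof (rule integral_dominated_convergence[where w = "\<lambda>s. cmod (f s)"])
    show "AE s in lborel. (\<lambda>n. indicator {-real n<..<real n} s *\<^sub>R f s) \<longlonglongrightarrow> f s"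
    proof (intro AE_I2 tendsto_eventually)
      fix s :: real
      obtain n0 :: nat where "\<bar>s\<bar> < n0" using reals_Archimedean2 by blast
      then show "\<forall>\<^sub>F n in sequentially. indicator {-real n<..<real n} s *\<^sub>R f s = f s"
        by (intro eventually_sequentiallyI[of n0]) (auto simp: indicator_def)
    qed
  qed (use f in \<open>auto simp: indicator_def\<close>)
  moreover have "(CLBINT s=-real n..real n. f s) = (LBINT s. indicator {-real n<..<real n} s *\<^sub>R f s)" for n
    by (simp add: interval_lebesgue_integral_def set_lebesgue_integral_def)
  ultimately show ?thesis by simp
qed

text \<open>Integrability turns the limit of truncated integrals in Levy's theorem into one
  absolutely convergent integral, so two laws can be compared under the integral sign.\<close>

lemma (in real_distribution) levy_inversion_integrable:
  assumes "a \<le> b" "measure M {a} = 0" "measure M {b} = 0" "integrable lborel (char M)"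
  shows "2 * pi * measure M {a<..b} = (LBINT s. levy_kernel a b s * char M s)"
proof -
  have "(\<lambda>n. 1 / (2 * pi) * (CLBINT s=-real n..real n. levy_kernel a b s * char M s))
      \<longlonglongrightarrow> of_real (measure M {a<..b})"
    using Levy_Inversion[OF assms(1-3)] by (simp add: levy_kernel_def)
  moreover have "(\<lambda>n. 1 / (2 * pi) * (CLBINT s=-real n..real n. levy_kernel a b s * char M s))
      \<longlonglongrightarrow> 1 / (2 * pi) * (LBINT s. levy_kernel a b s * char M s)"
    by (intro tendsto_intros tendsto_integral_symmetric integrable_levy_kernel_mult assms)
  ultimately have "of_real (measure M {a<..b}) = 1 / (2 * pi) * (LBINT s. levy_kernel a b s * char M s)"
    by (rule LIMSEQ_unique)
  then show ?thesis by (simp add: field_simps)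
qed

text \<open>The transform of the signed Edgeworth measure, whose distribution function is
  \<open>edge_cdf\<close>. A power (i s)^k belongs to the k-th Hermite polynomial times the density,
  and the primitive of that is minus the (k-1)-st times the density; this accounts for the sign and
  the index shift in \<open>edge_cdf\<close>.\<close>

definition edge_char :: "(nat \<Rightarrow> real) \<Rightarrow> nat \<Rightarrow> real \<Rightarrow> complex" where
  "edge_char q m s = complex_of_real (exp (- s\<^sup>2 / 2)) * (1 + (\<Sum>k=1..m. q k * (\<i> * s) ^ k))"

definition edge_cdf :: "(nat \<Rightarrow> real) \<Rightarrow> nat \<Rightarrow> real \<Rightarrow> real" where
  "edge_cdf q m x = cdf std_normal_distribution x
     - (\<Sum>k=1..m. q k * poly (hermite (k - 1)) x) * std_normal_density x"

lemma edge_char_eq: "edge_char q m s = gauss_pow 0 0 s + (\<Sum>k=1..m. q k * gauss_pow 0 k s)"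
  by (simp add: edge_char_def gauss_pow_def sum_distrib_left ring_distribs mult_ac)

lemma integrable_edge_char: "integrable lborel (edge_char q m)"
  unfolding edge_char_eq[abs_def]
  by (intro Bochner_Integration.integrable_add Bochner_Integration.integrable_sum integrable_mult_right integrable_gauss_pow)

lemma measure_std_normal_singleton: "measure std_normal_distribution {x} = 0"
proof -
  have "emeasure std_normal_distribution {x} = 0"
    by (subst emeasure_density) (auto simp: nn_integral_0_iff_AE intro!: AE_I[of _ _ "{x}"] split: split_indicator)
  then show ?thesis by (simp add: measure_def)
qed

text \<open>Levy inversion for the signed measure. Away from s = 0 the denominator of the kernel
  cancels one factor i s, which leaves the difference of two Hermite integrals with index k - 1; the
  single point s = 0, where the kernel is 0 by the convention for division, is negligible.\<close>

lemma edge_cdf_diff: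
  assumes "a \<le> b"
  shows "2 * pi * (edge_cdf q m b - edge_cdf q m a) = (LBINT s. levy_kernel a b s * edge_char q m s)"
proof -
  interpret N: real_distribution std_normal_distribution by (rule real_dist_normal_dist)
  have g0: "gauss_pow 0 0 = char std_normal_distribution"
    by (simp add: fun_eq_iff gauss_pow_def char_std_normal_distribution exp_of_real[symmetric])
  have \<Phi>: "2 * pi * (cdf std_normal_distribution b - cdf std_normal_distribution a) = (LBINT s. levy_kernel a b s * gauss_pow 0 0 s)"
    using N.levy_inversion_integrable[OF assms measure_std_normal_singleton measure_std_normal_singleton]
      integrable_gauss_pow[of 0 0] assms
    by (cases "a = b") (auto simp: g0 N.cdf_diff_eq)
  have pw: "(LBINT s. levy_kernel a b s * gauss_pow 0 k s) = 2 * pi * (poly (hermite (k - 1)) a * std_normal_density a - poly (hermite (k - 1)) b * std_normal_density b)"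
    if k: "k \<in> {1..m}" for k
  proof -
    have "(LBINT s. levy_kernel a b s * gauss_pow 0 k s) = (LBINT s. gauss_pow a (k - 1) s - gauss_pow b (k - 1) s)"
    proof (intro integral_cong_AE)
      show "AE s in lborel. levy_kernel a b s * gauss_pow 0 k s = gauss_pow a (k - 1) s - gauss_pow b (k - 1) s"
      proof (rule AE_I[of _ _ "{0}"])
        show "{s \<in> space lborel. levy_kernel a b s * gauss_pow 0 k s \<noteq> gauss_pow a (k - 1) s - gauss_pow b (k - 1) s} \<subseteq> {0}"
        proof safe
          fix s :: real assume neq: "levy_kernel a b s * gauss_pow 0 k s \<noteq> gauss_pow a (k - 1) s - gauss_pow b (k - 1) s"
          obtain j where j: "k = Suc j" using k by (cases k) auto
          have gen: "(E1 - E2) / c * (1 * c ^ Suc j * G) = E1 * c ^ j * G - E2 * c ^ j * G" if "c \<noteq> 0" for E1 E2 G c :: complex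
            using that by (simp add: field_simps)
          have e0: "iexp (- (s * 0)) = 1" by simp
          show "s = 0"
          proof (rule ccontr)
            assume "s \<noteq> 0"
            then have "\<i> * s \<noteq> 0" by simp
            from neq show False
              unfolding levy_kernel_def gauss_pow_def j e0 diff_Suc_1 gen[OF \<open>\<i> * s \<noteq> 0\<close>] by simp
          qed
        qed
      qed auto
    qed measurable
    also have "\<dots> = (LBINT s. gauss_pow a (k - 1) s) - (LBINT s. gauss_pow b (k - 1) s)"
      by (intro Bochner_Integration.integral_diff integrable_gauss_pow)
    finally show ?thesis by (simp add: integral_gauss_pow algebra_simps)
  qed
  have "(LBINT s. levy_kernel a b s * edge_char q m s) =
    (LBINT s. levy_kernel a b s * gauss_pow 0 0 s + (\<Sum>k=1..m. q k * (levy_kernel a b s * gauss_pow 0 k s)))"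
    unfolding edge_char_eq by (simp add: ring_distribs sum_distrib_left mult_ac)
  also have "\<dots> = (LBINT s. levy_kernel a b s * gauss_pow 0 0 s) + (\<Sum>k=1..m. q k * (LBINT s. levy_kernel a b s * gauss_pow 0 k s))"
  proof -
    have "integrable lborel (\<lambda>s. levy_kernel a b s * gauss_pow 0 k s)" for k
      by (intro integrable_levy_kernel_mult integrable_gauss_pow assms)
    then show ?thesis by (simp add: Bochner_Integration.integral_add Bochner_Integration.integral_sum)
  qed
  also have "(\<Sum>k=1..m. q k * (LBINT s. levy_kernel a b s * gauss_pow 0 k s)) =
      (\<Sum>k=1..m. complex_of_real (q k * (2 * pi * (poly (hermite (k - 1)) a * std_normal_density a - poly (hermite (k - 1)) b * std_normal_density b))))"
    by (intro sum.cong refl) (simp only: pw of_real_mult)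
  finally show ?thesis
    unfolding \<Phi>[symmetric]
    by (simp add: edge_cdf_def algebra_simps sum_subtractf sum_distrib_left sum_distrib_right flip: of_real_add of_real_sum of_real_mult of_real_diff)
qed

text \<open>Prices the horizontal shift that undoes the smoothing.\<close>

lemma edge_cdf_lipschitz:
  assumes "a \<le> b"
  shows "\<bar>edge_cdf q m b - edge_cdf q m a\<bar> \<le> (b - a) * (LBINT s. cmod (edge_char q m s))"
proof -
  have "2 * pi * \<bar>edge_cdf q m b - edge_cdf q m a\<bar> = cmod (of_real (2 * pi * (edge_cdf q m b - edge_cdf q m a)))"
    by (simp add: abs_mult del: of_real_mult)
  also have "\<dots> = cmod (LBINT s. levy_kernel a b s * edge_char q m s)"
    using edge_cdf_diff[OF assms] by simp
  also have "\<dots> \<le> (LBINT s. cmod (levy_kernel a b s * edge_char q m s))" by simp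
  also have "\<dots> \<le> (LBINT s. (b - a) * cmod (edge_char q m s))"
    using assms norm_levy_kernel_le[OF assms]
    by (intro integral_mono integrable_mult_right integrable_norm integrable_levy_kernel_mult integrable_edge_char)
      (auto simp: norm_mult mult_right_mono)
  finally have *: "2 * pi * \<bar>edge_cdf q m b - edge_cdf q m a\<bar> \<le> (b - a) * (LBINT s. cmod (edge_char q m s))" by simp
  have "1 * \<bar>edge_cdf q m b - edge_cdf q m a\<bar> \<le> 2 * pi * \<bar>edge_cdf q m b - edge_cdf q m a\<bar>"
    using pi_ge_two by (intro mult_right_mono) auto
  with * show ?thesis by simp
qed

lemma poly_gauss_tendsto_0: "((\<lambda>x. poly p x * std_normal_density x) \<longlongrightarrow> 0) at_bot"
proof -
  have "((\<lambda>x. \<Sum>i\<le>degree p. coeff p i * (x ^ i * std_normal_density x)) \<longlongrightarrow> (\<Sum>i\<le>degree p. coeff p i * 0)) at_bot"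
  proof (intro tendsto_intros)
    fix i show "((\<lambda>x::real. x ^ i * std_normal_density x) \<longlongrightarrow> 0) at_bot"
      unfolding std_normal_density_def by real_asymp
  qed
  then show ?thesis by (simp add: poly_altdef sum_distrib_right mult.assoc)
qed

lemma edge_cdf_at_bot: "(edge_cdf q m \<longlongrightarrow> 0) at_bot"
proof -
  interpret N: real_distribution std_normal_distribution by (rule real_dist_normal_dist)
  define p where "p = (\<Sum>k=1..m. smult (q k) (hermite (k - 1)))"
  have "((\<lambda>x. cdf std_normal_distribution x - poly p x * std_normal_density x) \<longlongrightarrow> 0 - 0) at_bot"
    by (intro tendsto_diff N.cdf_lim_at_bot poly_gauss_tendsto_0)
  then show ?thesis by (simp add: edge_cdf_def[abs_def] p_def poly_sum)
qed

section \<open>Smoothing by a small independent Gaussian\<close>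

definition normal_tail :: "real \<Rightarrow> real" where
  "normal_tail t = measure std_normal_distribution {z. t < \<bar>z\<bar>}"

text \<open>Markov's inequality for the moment of order 2k. With t a small power of the standard
  deviation, a large k yields any polynomial rate.\<close>

lemma normal_tail_le:
  assumes "0 < t"
  shows "normal_tail t \<le> fact (2 * k) / (2 ^ k * fact k) / t ^ (2 * k)"
proof -
  interpret N: real_distribution std_normal_distribution by (rule real_dist_normal_dist)
  have "normal_tail t \<le> measure std_normal_distribution {z \<in> space std_normal_distribution. t ^ (2 * k) \<le> z ^ (2 * k)}"
    unfolding normal_tail_def
  proof (intro N.finite_measure_mono subsetI CollectI conjI)
    fix z assume "z \<in> {z. t < \<bar>z\<bar>}"
    then have "t ^ (2 * k) \<le> \<bar>z\<bar> ^ (2 * k)" using assms by (intro power_mono) auto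
    then show "t ^ (2 * k) \<le> z ^ (2 * k)" by (simp add: power_even_abs)
  qed auto
  also have "\<dots> \<le> (LINT z|std_normal_distribution. z ^ (2 * k)) / t ^ (2 * k)"
    using assms by (intro integral_Markov_inequality_measure[where A = "{}"] std_normal_distribution_even_moments) auto
  finally show ?thesis by (simp add: std_normal_distribution_even_moments)
qed

locale gauss_smoothing = real_distribution \<mu> for \<mu> :: "real measure" +
  fixes \<tau> :: real
  assumes \<tau>: "0 < \<tau>"
begin

sublocale N: real_distribution std_normal_distribution by (rule real_dist_normal_dist)
sublocale pair: pair_prob_space \<mu> std_normal_distribution ..

abbreviation "PM \<equiv> \<mu> \<Otimes>\<^sub>M std_normal_distribution"

lemma sets_PM [measurable_cong]: "sets PM = sets (borel \<Otimes>\<^sub>M borel)"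
  by (intro sets_pair_measure_cong) auto

definition smoothed :: "real measure" where
  "smoothed = distr PM borel (\<lambda>p. fst p + \<tau> * snd p)"

lemma smooth_measurable [measurable]: "(\<lambda>p. fst p + \<tau> * snd p) \<in> borel_measurable PM"
  by measurable

lemma real_distribution_smoothed: "real_distribution smoothed"
  unfolding smoothed_def by (intro pair.real_distribution_distr) measurable

lemma char_smoothed: "char smoothed s = char \<mu> s * exp (- (\<tau> * s)\<^sup>2 / 2)"
proof -
  have "char smoothed s = (CLINT p|PM. iexp (s * (fst p + \<tau> * snd p)))"
    unfolding char_def smoothed_def by (subst integral_distr) auto
  also have "\<dots> = (CLINT p|PM. case p of (x, z) \<Rightarrow> iexp (s * x) * iexp (s * \<tau> * z))"
    by (intro Bochner_Integration.integral_cong) (auto simp: exp_add ring_distribs mult_ac)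
  also have "\<dots> = (CLINT x|\<mu>. (CLINT z|std_normal_distribution. iexp (s * x) * iexp (s * \<tau> * z)))"
  proof -
    have "integrable PM (\<lambda>(x, z). iexp (s * x) * iexp (s * \<tau> * z))"
      by (intro pair.P.integrable_const_bound[where B = 1]) (auto simp: norm_mult)
    from pair.integral_fst'[OF this] show ?thesis by simp
  qed
  also have "\<dots> = char \<mu> s * char std_normal_distribution (s * \<tau>)"
    by (simp add: char_def)
  finally show ?thesis by (simp add: char_std_normal_distribution mult.commute)
qed

text \<open>The smoothed law has no atoms, so the inversion formula holds for every pair of
  endpoints.\<close>

lemma smoothed_singleton: "measure smoothed {a} = 0"
proof -
  have "emeasure smoothed {a} = emeasure PM ((\<lambda>p. fst p + \<tau> * snd p) -` {a} \<inter> space PM)"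
    unfolding smoothed_def by (subst emeasure_distr) auto
  also have "\<dots> = (\<integral>\<^sup>+ x. emeasure std_normal_distribution (Pair x -` ((\<lambda>p. fst p + \<tau> * snd p) -` {a} \<inter> space PM)) \<partial>\<mu>)"
    by (intro N.emeasure_pair_measure_alt measurable_sets[OF smooth_measurable]) auto
  also have "\<dots> = (\<integral>\<^sup>+ x. 0 \<partial>\<mu>)"
  proof (intro nn_integral_cong)
    fix x
    have "Pair x -` ((\<lambda>p. fst p + \<tau> * snd p) -` {a} \<inter> space PM) = {(a - x) / \<tau>}"
      using \<tau> by (auto simp: space_pair_measure field_simps)
    then show "emeasure std_normal_distribution (Pair x -` ((\<lambda>p. fst p + \<tau> * snd p) -` {a} \<inter> space PM)) = 0"
      using measure_std_normal_singleton by (simp add: N.emeasure_eq_measure)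
  qed
  finally show ?thesis by (simp add: measure_def)
qed

lemma strip_sets:
  "{p. fst p \<le> x} \<in> sets PM" "{p. t < \<bar>snd p\<bar>} \<in> sets PM" "{p. fst p + \<tau> * snd p \<le> x} \<in> sets PM"
proof -
  have "{p \<in> space PM. fst p \<le> x} \<in> sets PM" "{p \<in> space PM. t < \<bar>snd p\<bar>} \<in> sets PM"
    "{p \<in> space PM. fst p + \<tau> * snd p \<le> x} \<in> sets PM" by measurable
  then show "{p. fst p \<le> x} \<in> sets PM" "{p. t < \<bar>snd p\<bar>} \<in> sets PM" "{p. fst p + \<tau> * snd p \<le> x} \<in> sets PM"
    by (simp_all add: space_pair_measure)
qed

lemma measure_PM_times:
  "A \<in> sets borel \<Longrightarrow> B \<in> sets borel \<Longrightarrow> measure PM (A \<times> B) = measure \<mu> A * measure std_normal_distribution B"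
  unfolding measure_def by (subst N.emeasure_pair_measure_Times) (auto simp: enn2real_mult)

lemma measure_fst_le: "measure PM {p. fst p \<le> x} = cdf \<mu> x"
proof -
  have "measure PM {p. fst p \<le> x} = measure PM ({..x} \<times> UNIV)" by (intro arg_cong[where f = "measure PM"]) auto
  also have "\<dots> = measure \<mu> {..x} * measure std_normal_distribution UNIV"
    by (rule measure_PM_times) auto
  also have "measure std_normal_distribution UNIV = 1" using N.prob_space by simp
  finally show ?thesis by (simp add: cdf_def)
qed

lemma measure_snd_tail: "measure PM {p. t < \<bar>snd p\<bar>} = normal_tail t"
proof -
  have "measure PM {p. t < \<bar>snd p\<bar>} = measure PM (UNIV \<times> {z. t < \<bar>z\<bar>})" by (intro arg_cong[where f = "measure PM"]) auto
  also have "\<dots> = measure \<mu> UNIV * measure std_normal_distribution {z. t < \<bar>z\<bar>}"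
    by (rule measure_PM_times) auto
  also have "measure \<mu> UNIV = 1" using prob_space by simp
  finally show ?thesis by (simp add: normal_tail_def)
qed

lemma cdf_smoothed: "cdf smoothed x = measure PM {p. fst p + \<tau> * snd p \<le> x}"
  unfolding cdf_def smoothed_def
  by (subst measure_distr) (auto intro!: arg_cong[where f = "measure PM"] simp: space_pair_measure)

text \<open>Unless the Gaussian exceeds t in modulus, smoothing moves a point by at most \<tau>
  t.\<close>

lemma cdf_le_smoothed: "cdf \<mu> x \<le> cdf smoothed (x + \<tau> * t) + normal_tail t"
proof -
  have "{p. fst p \<le> x} \<subseteq> {p. fst p + \<tau> * snd p \<le> x + \<tau> * t} \<union> {p. t < \<bar>snd p\<bar>}"
    using \<tau> by (auto intro!: add_mono mult_left_mono)
  then have "measure PM {p. fst p \<le> x} \<le> measure PM ({p. fst p + \<tau> * snd p \<le> x + \<tau> * t} \<union> {p. t < \<bar>snd p\<bar>})"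
    by (rule pair.P.finite_measure_mono) (intro sets.Un strip_sets)
  also have "\<dots> \<le> measure PM {p. fst p + \<tau> * snd p \<le> x + \<tau> * t} + measure PM {p. t < \<bar>snd p\<bar>}"
    by (intro measure_Un_le strip_sets)
  finally show ?thesis by (simp add: measure_fst_le measure_snd_tail cdf_smoothed)
qed

lemma smoothed_le_cdf: "cdf smoothed (x - \<tau> * t) \<le> cdf \<mu> x + normal_tail t"
proof -
  have "{p. fst p + \<tau> * snd p \<le> x - \<tau> * t} \<subseteq> {p. fst p \<le> x} \<union> {p. t < \<bar>snd p\<bar>}"
  proof
    fix p assume "p \<in> {p. fst p + \<tau> * snd p \<le> x - \<tau> * t}"
    moreover have "\<tau> * (- t) \<le> \<tau> * snd p" if "\<bar>snd p\<bar> \<le> t"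
      using \<tau> that by (intro mult_left_mono) auto
    ultimately show "p \<in> {p. fst p \<le> x} \<union> {p. t < \<bar>snd p\<bar>}"
      by (cases "t < \<bar>snd p\<bar>") auto
  qed
  then have "measure PM {p. fst p + \<tau> * snd p \<le> x - \<tau> * t} \<le> measure PM ({p. fst p \<le> x} \<union> {p. t < \<bar>snd p\<bar>})"
    by (rule pair.P.finite_measure_mono) (intro sets.Un strip_sets)
  also have "\<dots> \<le> measure PM {p. fst p \<le> x} + measure PM {p. t < \<bar>snd p\<bar>}"
    by (intro measure_Un_le strip_sets)
  finally show ?thesis by (simp add: measure_fst_le measure_snd_tail cdf_smoothed)
qed

text \<open>The smoothed law and the signed measure are compared by inversion on (a, b] with a
  tending to minus infinity. As the kernel is at most 2/|s|, it is enough that H dominates the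
  difference of the transforms divided by |s|. Passing back to \<mu> costs a shift by \<tau> t in
  either direction and one normal tail.\<close>

theorem smoothing_inequality:
  assumes H: "integrable lborel H"
    and le: "\<And>s. cmod (char \<mu> s * exp (- (\<tau> * s)\<^sup>2 / 2) - edge_char q m s) \<le> \<bar>s\<bar> * H s"
    and t: "0 \<le> t"
  shows "\<bar>cdf \<mu> x - edge_cdf q m x\<bar>
    \<le> (LBINT s. H s) + \<tau> * t * (LBINT s. cmod (edge_char q m s)) + normal_tail t"
proof -
  interpret sm: real_distribution smoothed by (rule real_distribution_smoothed)
  let ?d = "\<lambda>s. char smoothed s - edge_char q m s"
  have int_c: "integrable lborel (char smoothed)"
  proof (rule Bochner_Integration.integrable_bound)
    have "integrable lborel (\<lambda>s. exp (- s\<^sup>2 / 2) :: real)" using integrable_abs_pow_gauss[of 0] by simp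
    from lborel_integrable_real_affine[OF this, of \<tau> 0] \<tau>
    show "integrable lborel (\<lambda>s. exp (- (\<tau> * s)\<^sup>2 / 2) :: real)" by simp
    show "AE s in lborel. cmod (char smoothed s) \<le> norm (exp (- (\<tau> * s)\<^sup>2 / 2) :: real)"
      unfolding char_smoothed using cmod_char_le_1 by (intro AE_I2) (simp add: norm_mult mult_le_cancel_right1)
  qed simp
  have int_d: "integrable lborel ?d" by (intro Bochner_Integration.integrable_diff int_c integrable_edge_char)
  define E where "E y = cdf smoothed y - edge_cdf q m y" for y
  have diff: "\<bar>E b - E a\<bar> \<le> (LBINT s. H s)" if "a \<le> b" for a b
  proof (cases "a = b")
    case True
    have "0 \<le> H s" if "s \<noteq> 0" for s using order_trans[OF norm_ge_zero le[of s]] that by (simp add: zero_le_mult_iff)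
    then have "0 \<le> (LBINT s. H s)" by (intro integral_nonneg_AE AE_I[of _ _ "{0}"]) auto
    with True show ?thesis by simp
  next
    case False
    with that have ab: "a < b" by simp
    have "2 * pi * (cdf smoothed b - cdf smoothed a) = (LBINT s. levy_kernel a b s * char smoothed s)"
      using sm.levy_inversion_integrable[OF that smoothed_singleton smoothed_singleton int_c] ab
      by (simp add: sm.cdf_diff_eq)
    moreover have "2 * pi * (edge_cdf q m b - edge_cdf q m a) = (LBINT s. levy_kernel a b s * edge_char q m s)"
      by (rule edge_cdf_diff[OF that])
    moreover have "(LBINT s. levy_kernel a b s * ?d s) = (LBINT s. levy_kernel a b s * char smoothed s) - (LBINT s. levy_kernel a b s * edge_char q m s)"
      using that unfolding right_diff_distrib
      by (intro Bochner_Integration.integral_diff integrable_levy_kernel_mult int_c integrable_edge_char)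
    moreover have "2 * pi * (E b - E a) = 2 * pi * (cdf smoothed b - cdf smoothed a) - 2 * pi * (edge_cdf q m b - edge_cdf q m a)"
      by (simp add: E_def algebra_simps)
    ultimately have "complex_of_real (2 * pi * (E b - E a)) = (LBINT s. levy_kernel a b s * ?d s)"
      by (simp only: of_real_diff)
    moreover have "cmod (LBINT s. levy_kernel a b s * ?d s) \<le> (LBINT s. 2 * H s)"
    proof -
      have "cmod (LBINT s. levy_kernel a b s * ?d s) \<le> (LBINT s. cmod (levy_kernel a b s * ?d s))" by simp
      also have "\<dots> \<le> (LBINT s. 2 * H s)"
      proof (rule integral_mono_AE)
        show "AE s in lborel. cmod (levy_kernel a b s * ?d s) \<le> 2 * H s"
        proof (rule AE_I[of _ _ "{0}"])
          show "{s \<in> space lborel. \<not> cmod (levy_kernel a b s * ?d s) \<le> 2 * H s} \<subseteq> {0}"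
          proof safe
            fix s :: real assume *: "\<not> cmod (levy_kernel a b s * ?d s) \<le> 2 * H s"
            show "s = 0"
            proof (rule ccontr)
              assume "s \<noteq> 0"
              then have H0: "0 \<le> H s" using order_trans[OF norm_ge_zero le[of s]] by (simp add: zero_le_mult_iff)
              have "cmod (levy_kernel a b s * ?d s) \<le> cmod (levy_kernel a b s) * (\<bar>s\<bar> * H s)"
                using le[of s] by (simp add: norm_mult char_smoothed mult_left_mono)
              also have "\<dots> = (\<bar>s\<bar> * cmod (levy_kernel a b s)) * H s" by simp
              also have "\<dots> \<le> 2 * H s" using H0 norm_levy_kernel_le2 by (intro mult_right_mono)
              finally show False using * by simp
            qed
          qed
        qed auto
      qed (auto intro!: integrable_mult_right H integrable_norm integrable_levy_kernel_mult int_d that)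
      finally show ?thesis .
    qed
    moreover have "cmod (complex_of_real (2 * pi * (E b - E a))) = 2 * pi * \<bar>E b - E a\<bar>"
      by (simp add: abs_mult norm_mult del: of_real_mult of_real_diff)
    ultimately have "2 * pi * \<bar>E b - E a\<bar> \<le> 2 * (LBINT s. H s)" by simp
    \<comment> \<open>The factor 2 coming from the kernel is absorbed by 2 pi \<ge> 2.\<close>
    moreover have "2 * \<bar>E b - E a\<bar> \<le> 2 * pi * \<bar>E b - E a\<bar>"
      using pi_ge_two by (intro mult_right_mono) auto
    ultimately have "2 * \<bar>E b - E a\<bar> \<le> 2 * (LBINT s. H s)" by (rule order_trans[rotated])
    then show ?thesis by simp
  qed
  have E_le: "\<bar>E b\<bar> \<le> (LBINT s. H s)" for b
  proof -
    have "((\<lambda>a. \<bar>E b - E a\<bar>) \<longlongrightarrow> \<bar>E b - (0 - 0)\<bar>) at_bot"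
      unfolding E_def[of "_ :: real"] by (intro tendsto_intros sm.cdf_lim_at_bot edge_cdf_at_bot)
    moreover have "\<forall>\<^sub>F a in at_bot. \<bar>E b - E a\<bar> \<le> (LBINT s. H s)"
      using eventually_le_at_bot[of b] by eventually_elim (rule diff)
    ultimately show ?thesis using tendsto_upperbound by force
  qed
  let ?L = "LBINT s. cmod (edge_char q m s)"
  have \<tau>t: "0 \<le> \<tau> * t" using \<tau> t by simp
  have "\<bar>edge_cdf q m (x + \<tau> * t) - edge_cdf q m x\<bar> \<le> \<tau> * t * ?L"
    using edge_cdf_lipschitz[of x "x + \<tau> * t" q m] \<tau>t by simp
  moreover have "\<bar>edge_cdf q m x - edge_cdf q m (x - \<tau> * t)\<bar> \<le> \<tau> * t * ?L"
    using edge_cdf_lipschitz[of "x - \<tau> * t" x q m] \<tau>t by simp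
  ultimately show ?thesis
    using cdf_le_smoothed[of x t] smoothed_le_cdf[of x t] E_le[of "x + \<tau> * t"] E_le[of "x - \<tau> * t"]
    unfolding E_def by linarith
qed

end

section \<open>The formal expansion\<close>

text \<open>With w = 1/\<sigma> and \<kappa> k the cumulant of order k + 2 divided by (k + 2)! and
  the variance, this is the part of the logarithm of the normalised characteristic function beyond
  the Gaussian term, cut off at order r in w.\<close>

definition cum_exp :: "(nat \<Rightarrow> real) \<Rightarrow> nat \<Rightarrow> real \<Rightarrow> complex \<Rightarrow> complex" where
  "cum_exp \<kappa> r w z = (\<Sum>k=1..r. of_real (\<kappa> k) * of_real w ^ k * z ^ (k + 2))"

text \<open>The choices, one index from each factor of the m-th power of \<open>cum_exp\<close>,
  that contribute to the power j of w.\<close>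

definition cum_tuples :: "nat \<Rightarrow> nat \<Rightarrow> nat \<Rightarrow> (nat \<Rightarrow> nat) set" where
  "cum_tuples r j m = {g \<in> {..<m} \<rightarrow>\<^sub>E {1..r}. (\<Sum>l<m. g l) = j}"

definition edge_coeff :: "(nat \<Rightarrow> real) \<Rightarrow> nat \<Rightarrow> nat \<Rightarrow> nat \<Rightarrow> real" where
  "edge_coeff \<kappa> r j m = (\<Sum>g\<in>cum_tuples r j m. \<Prod>l<m. \<kappa> (g l)) / fact m"

text \<open>A factor with index k carries w^k z^(k+2). Multiplying m of them out and grouping by the
  total index j, which lies between 1 and r * r, gives the exponents j and j + 2 m.\<close>

lemma cum_exp_power:
  assumes m: "m \<in> {1..r}"
  shows "cum_exp \<kappa> r w z ^ m / fact m = (\<Sum>j=1..r*r. complex_of_real (edge_coeff \<kappa> r j m) * of_real w ^ j * z ^ (j + 2 * m))"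
proof -
  let ?G = "{..<m} \<rightarrow>\<^sub>E {1..r}"
  have fin: "finite ?G" by (intro finite_PiE) auto
  have img: "(\<lambda>g. \<Sum>l<m. g l) ` ?G \<subseteq> {1..r*r}"
  proof (rule image_subsetI)
    fix g assume g: "g \<in> ?G"
    have g1: "1 \<le> g l \<and> g l \<le> r" if "l < m" for l using PiE_mem[OF g, of l] that by simp
    have "1 \<le> m" using m by auto
    also have "m = (\<Sum>l<m. 1)" by simp
    also have "\<dots> \<le> (\<Sum>l<m. g l)" by (intro sum_mono) (use g1 in simp)
    finally have lower: "1 \<le> (\<Sum>l<m. g l)" .
    have "(\<Sum>l<m. g l) \<le> (\<Sum>l<m. r)" by (intro sum_mono) (use g1 in simp)
    also have "\<dots> \<le> r * r" using m by simp
    finally show "(\<Sum>l<m. g l) \<in> {1..r*r}" using lower by simp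
  qed
  define W where "W = complex_of_real w"
  define c where "c k = complex_of_real (\<kappa> k)" for k
  have "cum_exp \<kappa> r w z ^ m = (\<Prod>l<m. \<Sum>k=1..r. c k * W ^ k * z ^ (k + 2))"
    by (simp add: cum_exp_def W_def c_def)
  also have "\<dots> = (\<Sum>g\<in>?G. \<Prod>l<m. c (g l) * W ^ g l * z ^ (g l + 2))"
    by (rule prod_sum_PiE) auto
  also have "\<dots> = (\<Sum>g\<in>?G. (\<Prod>l<m. c (g l)) * W ^ (\<Sum>l<m. g l) * z ^ ((\<Sum>l<m. g l) + 2 * m))"
  proof (intro sum.cong refl)
    fix g :: "nat \<Rightarrow> nat"
    have "(\<Sum>l<m. g l + 2) = (\<Sum>l<m. g l) + 2 * m" by (simp only: sum.distrib) simp
    then show "(\<Prod>l<m. c (g l) * W ^ g l * z ^ (g l + 2)) =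
        (\<Prod>l<m. c (g l)) * W ^ (\<Sum>l<m. g l) * z ^ ((\<Sum>l<m. g l) + 2 * m)"
      by (simp only: prod.distrib power_sum[symmetric])
  qed
  also have "\<dots> = (\<Sum>j=1..r*r. \<Sum>g\<in>{g \<in> ?G. (\<Sum>l<m. g l) = j}. (\<Prod>l<m. c (g l)) * W ^ (\<Sum>l<m. g l) * z ^ ((\<Sum>l<m. g l) + 2 * m))"
    by (rule sum.group[OF fin _ img, symmetric]) simp
  also have "\<dots> = (\<Sum>j=1..r*r. \<Sum>g\<in>cum_tuples r j m. (\<Prod>l<m. c (g l)) * W ^ j * z ^ (j + 2 * m))"
    by (intro sum.cong) (auto simp: cum_tuples_def)
  also have "\<dots> = (\<Sum>j=1..r*r. of_real (\<Sum>g\<in>cum_tuples r j m. \<Prod>l<m. \<kappa> (g l)) * W ^ j * z ^ (j + 2 * m))"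
    by (simp add: sum_distrib_right c_def)
  finally have eq: "cum_exp \<kappa> r w z ^ m = (\<Sum>j=1..r*r. of_real (\<Sum>g\<in>cum_tuples r j m. \<Prod>l<m. \<kappa> (g l)) * W ^ j * z ^ (j + 2 * m))" .
  show ?thesis
    unfolding eq by (subst sum_divide_distrib) (simp add: edge_coeff_def W_def)
qed

lemma cum_tuples_mem: "g \<in> cum_tuples r j m \<Longrightarrow> l < m \<Longrightarrow> g l \<in> {1..r}"
  unfolding cum_tuples_def using PiE_mem[of g "{..<m}" "\<lambda>_. {1..r}" l] by simp

lemma edge_coeff_le:
  assumes \<kappa>: "\<And>k. k \<in> {1..r} \<Longrightarrow> \<bar>\<kappa> k\<bar> \<le> \<Lambda>" and \<Lambda>: "1 \<le> \<Lambda>" and m: "m \<in> {1..r}"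
  shows "\<bar>edge_coeff \<kappa> r j m\<bar> \<le> (r * \<Lambda>) ^ r"
proof -
  have r: "1 \<le> real r" using m by auto
  have fin: "finite ({..<m} \<rightarrow>\<^sub>E {1..r})" by (intro finite_PiE) auto
  have "\<bar>\<Sum>g\<in>cum_tuples r j m. \<Prod>l<m. \<kappa> (g l)\<bar> \<le> (\<Sum>g\<in>cum_tuples r j m. \<Lambda> ^ m)"
  proof (rule order_trans[OF sum_abs], rule sum_mono)
    fix g assume g: "g \<in> cum_tuples r j m"
    have "\<bar>\<Prod>l<m. \<kappa> (g l)\<bar> = (\<Prod>l<m. \<bar>\<kappa> (g l)\<bar>)" by (simp add: abs_prod)
    also have "\<dots> \<le> (\<Prod>l<m. \<Lambda>)" using \<kappa>[OF cum_tuples_mem[OF g]] by (intro prod_mono) simp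
    finally show "\<bar>\<Prod>l<m. \<kappa> (g l)\<bar> \<le> \<Lambda> ^ m" by simp
  qed
  also have "\<dots> = real (card (cum_tuples r j m)) * \<Lambda> ^ m" by simp
  also have "\<dots> \<le> real r ^ m * \<Lambda> ^ m"
  proof (rule mult_right_mono)
    have "card (cum_tuples r j m) \<le> card ({..<m} \<rightarrow>\<^sub>E {1..r})"
      by (rule card_mono[OF fin]) (simp only: cum_tuples_def Collect_restrict)
    also have "\<dots> = r ^ m" by (simp add: card_PiE)
    finally show "real (card (cum_tuples r j m)) \<le> real r ^ m" by (metis of_nat_le_iff of_nat_power)
  qed (use \<Lambda> in simp)
  also have "\<dots> = (r * \<Lambda>) ^ m" by (simp add: power_mult_distrib)
  also have "\<dots> \<le> (r * \<Lambda>) ^ r"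
    using m r \<Lambda> mult_mono[OF r \<Lambda>] by (intro power_increasing) auto
  finally have *: "\<bar>\<Sum>g\<in>cum_tuples r j m. \<Prod>l<m. \<kappa> (g l)\<bar> \<le> (r * \<Lambda>) ^ r" .
  have "\<bar>edge_coeff \<kappa> r j m\<bar> \<le> \<bar>\<Sum>g\<in>cum_tuples r j m. \<Prod>l<m. \<kappa> (g l)\<bar> / 1"
    unfolding edge_coeff_def abs_divide by (intro divide_left_mono) auto
  with * show ?thesis by simp
qed

text \<open>The part of exp (\<open>cum_exp\<close>) up to order r in w. Each factor contributes at
  least one power of w, so powers of \<open>cum_exp\<close> beyond the r-th cannot
  contribute.\<close>

definition edge_sum :: "(nat \<Rightarrow> real) \<Rightarrow> nat \<Rightarrow> real \<Rightarrow> complex \<Rightarrow> complex" where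
  "edge_sum \<kappa> r w z = 1 + (\<Sum>j=1..r. of_real (w ^ j) * (\<Sum>m=1..r. of_real (edge_coeff \<kappa> r j m) * z ^ (j + 2 * m)))"

lemma norm_exp_minus_1_le_of_le_1:
  fixes z :: complex
  assumes "cmod z \<le> 1"
  shows "cmod (exp z - 1) \<le> 3 * cmod z"
proof -
  have "exp \<bar>Re z\<bar> \<le> exp 1" using assms abs_Re_le_cmod[of z] by simp
  also have "exp 1 \<le> (3 :: real)" by (rule exp_le)
  finally show ?thesis
    using Taylor_exp[of z 0] mult_right_mono[of "exp \<bar>Re z\<bar>" 3 "cmod z"] by simp
qed

lemma power_le_one_plus:
  fixes s :: real
  assumes "0 \<le> s" "1 \<le> i" "i \<le> Suc p"
  shows "s ^ i \<le> s * (1 + s) ^ p"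
proof -
  have "s ^ i = s * s ^ (i - 1)" using assms by (cases i) auto
  also have "\<dots> \<le> s * (1 + s) ^ (i - 1)" using assms by (intro mult_left_mono power_mono) auto
  also have "\<dots> \<le> s * (1 + s) ^ p" using assms by (intro mult_left_mono power_increasing) auto
  finally show ?thesis .
qed

text \<open>Three errors of order w^(r+1) add up: omitting Rm, cutting the exponential series after
  the r-th power, and omitting powers of w beyond r. A factor |s| is kept in front because the
  smoothing inequality divides by it, and (r + 2)^2 is an exponent that accommodates the polynomial
  growth of all three.\<close>

lemma expansion_bound:
  fixes \<Lambda> B w s :: real and Rm :: complex
  assumes r: "1 \<le> r" and \<kappa>: "\<And>k. k \<in> {1..r} \<Longrightarrow> \<bar>\<kappa> k\<bar> \<le> \<Lambda>" and \<Lambda>: "1 \<le> \<Lambda>" and B: "0 \<le> B"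
    and w: "0 \<le> w" "w \<le> 1" and small: "r * \<Lambda> * w * (1 + \<bar>s\<bar>) ^ (r + 2) \<le> 1"
    and Rm: "cmod Rm \<le> B * w ^ (r + 1) * \<bar>s\<bar> ^ (r + 3)" "cmod Rm \<le> 1"
  shows "cmod (exp (cum_exp \<kappa> r w (\<i> * s) + Rm) - edge_sum \<kappa> r w (\<i> * s))
    \<le> (9 * B + 3 * (r * \<Lambda>) ^ (r + 1) + (r * r * r) * (r * \<Lambda>) ^ r) * w ^ (r + 1) * \<bar>s\<bar> * (1 + \<bar>s\<bar>) ^ ((r + 2)\<^sup>2)"
proof -
  define p where "p = (r + 2)\<^sup>2"
  define a where "a = \<bar>s\<bar>"
  define U where "U = w ^ (r + 1) * (a * (1 + a) ^ p)"
  define E where "E = cum_exp \<kappa> r w (\<i> * s)"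
  define Tm where "Tm = (\<Sum>m\<le>r. E ^ m / fact m)"
  have a: "0 \<le> a" and U: "0 \<le> U" using w by (simp_all add: a_def U_def)
  have ps: "r + 3 \<le> Suc p" "(r + 2) * (r + 1) \<le> Suc p" "r * r + 2 * r \<le> Suc p"
    by (auto simp: p_def power2_eq_square algebra_simps)
  have norm_z: "cmod (\<i> * s) = a" by (simp add: a_def norm_mult)
  have E0: "cmod E \<le> r * \<Lambda> * w * (a * (1 + a) ^ (r + 1))"
  proof -
    have "cmod E \<le> (\<Sum>k=1..r. \<Lambda> * (w * (a * (1 + a) ^ (r + 1))))"
      unfolding E_def cum_exp_def
    proof (rule order_trans[OF norm_sum], rule sum_mono)
      fix k assume k: "k \<in> {1..r}"
      have "cmod (of_real (\<kappa> k) * of_real w ^ k * (\<i> * s) ^ (k + 2)) = \<bar>\<kappa> k\<bar> * (w ^ k * a ^ (k + 2))"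
        using w norm_z by (simp add: norm_mult norm_power a_def)
      also have "\<dots> \<le> \<Lambda> * (w * (a * (1 + a) ^ (r + 1)))"
      proof (intro mult_mono \<kappa> k)
        show "w ^ k \<le> w" using power_decreasing[of 1 k w] k w by simp
        show "a ^ (k + 2) \<le> a * (1 + a) ^ (r + 1)" using k a by (intro power_le_one_plus) auto
      qed (use w a \<Lambda> in auto)
      finally show "cmod (of_real (\<kappa> k) * of_real w ^ k * (\<i> * s) ^ (k + 2)) \<le> \<Lambda> * (w * (a * (1 + a) ^ (r + 1)))" .
    qed
    also have "\<dots> = r * \<Lambda> * w * (a * (1 + a) ^ (r + 1))" by simp
    finally show ?thesis .
  qed
  have E1: "cmod E \<le> 1"
  proof -
    have "a * (1 + a) ^ (r + 1) \<le> (1 + a) * (1 + a) ^ (r + 1)" using a by (intro mult_right_mono) auto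
    also have "\<dots> = (1 + a) ^ (r + 2)" by simp
    finally have "r * \<Lambda> * w * (a * (1 + a) ^ (r + 1)) \<le> r * \<Lambda> * w * (1 + a) ^ (r + 2)"
      using \<Lambda> w by (intro mult_left_mono) auto
    with E0 small show ?thesis by (simp add: a_def)
  qed
  have expE: "cmod (exp E) \<le> 3"
  proof -
    have "cmod (exp E) \<le> exp (cmod E)" by (rule norm_exp)
    also have "\<dots> \<le> exp 1" using E1 by simp
    also have "\<dots> \<le> 3" by (rule exp_le)
    finally show ?thesis .
  qed
  have 1: "cmod (exp (E + Rm) - exp E) \<le> 9 * B * U"
  proof -
    have "exp (E + Rm) - exp E = exp E * (exp Rm - 1)" by (simp add: exp_add algebra_simps)
    then have "cmod (exp (E + Rm) - exp E) = cmod (exp E) * cmod (exp Rm - 1)" by (simp add: norm_mult)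
    also have "\<dots> \<le> 3 * (3 * cmod Rm)"
      using expE Rm by (intro mult_mono norm_exp_minus_1_le_of_le_1) auto
    also have "\<dots> \<le> 9 * (B * w ^ (r + 1) * a ^ (r + 3))" using Rm by (simp add: a_def)
    also have "\<dots> \<le> 9 * (B * w ^ (r + 1) * (a * (1 + a) ^ p))"
      using ps a w B by (intro mult_left_mono power_le_one_plus) auto
    finally show ?thesis by (simp add: U_def mult_ac)
  qed
  have 2: "cmod (exp E - Tm) \<le> 3 * (r * \<Lambda>) ^ (r + 1) * U"
  proof -
    have "cmod (exp E - Tm) \<le> exp \<bar>Re E\<bar> * cmod E ^ Suc r / fact r"
      unfolding Tm_def by (rule Taylor_exp)
    also have "\<dots> \<le> exp \<bar>Re E\<bar> * cmod E ^ Suc r / 1" by (intro divide_left_mono) auto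
    also have "\<dots> \<le> 3 * (r * \<Lambda> * w * (a * (1 + a) ^ (r + 1))) ^ Suc r"
    proof (simp only: div_by_1, intro mult_mono power_mono E0)
      have "exp \<bar>Re E\<bar> \<le> exp 1" using E1 abs_Re_le_cmod[of E] by simp
      then show "exp \<bar>Re E\<bar> \<le> 3" using exp_le by linarith
    qed auto
    also have "\<dots> = 3 * (r * \<Lambda>) ^ (r + 1) * (w ^ (r + 1) * (a ^ (r + 1) * (1 + a) ^ ((r + 1) * (r + 1))))"
      by (simp only: power_mult_distrib power_mult[symmetric] Suc_eq_plus1 mult_ac)
    also have "\<dots> \<le> 3 * (r * \<Lambda>) ^ (r + 1) * (w ^ (r + 1) * (a * (1 + a) ^ p))"
    proof (intro mult_left_mono)
      have "a ^ (r + 1) * (1 + a) ^ ((r + 1) * (r + 1)) \<le> (a * (1 + a) ^ r) * (1 + a) ^ ((r + 1) * (r + 1))"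
        using a by (intro mult_right_mono power_le_one_plus) auto
      also have "\<dots> = a * (1 + a) ^ (r + (r + 1) * (r + 1))" by (simp only: power_add mult.assoc)
      also have "\<dots> \<le> a * (1 + a) ^ p"
        using a by (intro mult_left_mono power_increasing) (auto simp: p_def power2_eq_square algebra_simps)
      finally show "a ^ (r + 1) * (1 + a) ^ ((r + 1) * (r + 1)) \<le> a * (1 + a) ^ p" .
    qed (use w \<Lambda> in auto)
    finally show ?thesis by (simp add: U_def)
  qed
  define F where "F j m = complex_of_real (edge_coeff \<kappa> r j m) * of_real w ^ j * (\<i> * s) ^ (j + 2 * m)" for j m
  have Tm: "Tm = 1 + (\<Sum>m=1..r. \<Sum>j=1..r*r. F j m)"
  proof -
    have "{..r} = insert 0 {1..r}" by auto
    then have "Tm = 1 + (\<Sum>m=1..r. E ^ m / fact m)" by (simp add: Tm_def)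
    also have "(\<Sum>m=1..r. E ^ m / fact m) = (\<Sum>m=1..r. \<Sum>j=1..r*r. F j m)"
      unfolding E_def F_def by (intro sum.cong refl cum_exp_power)
    finally show ?thesis .
  qed
  have split: "{1..n} = {1..r} \<union> {r+1..n}" if "r \<le> n" for n using that by auto
  have rr: "{1..r*r} = {1..r} \<union> {r+1..r*r}" "{1..r} \<inter> {r+1..r*r} = {}"
    by (rule split) auto
  have "edge_sum \<kappa> r w (\<i> * s) = 1 + (\<Sum>m=1..r. \<Sum>j=1..r. F j m)"
    unfolding edge_sum_def F_def
    by (subst sum.swap) (simp add: sum_distrib_left mult_ac)
  then have "Tm - edge_sum \<kappa> r w (\<i> * s) = (\<Sum>m=1..r. \<Sum>j=r+1..r*r. F j m)"
    unfolding Tm rr(1) by (subst sum.union_disjoint) (auto simp: rr(2)[simplified] sum.distrib)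
  also have "cmod \<dots> \<le> (\<Sum>m=1..r. \<Sum>j=r+1..r*r. (r * \<Lambda>) ^ r * U)"
  proof (rule order_trans[OF norm_sum], rule sum_mono, rule order_trans[OF norm_sum], rule sum_mono)
    fix m j assume m: "m \<in> {1..r}" and j: "j \<in> {r+1..r*r}"
    have "cmod (F j m) = \<bar>edge_coeff \<kappa> r j m\<bar> * (w ^ j * a ^ (j + 2 * m))"
      using w norm_z by (simp add: F_def norm_mult norm_power a_def)
    also have "\<dots> \<le> (r * \<Lambda>) ^ r * (w ^ (r + 1) * (a * (1 + a) ^ p))"
    proof (intro mult_mono)
      show "\<bar>edge_coeff \<kappa> r j m\<bar> \<le> (r * \<Lambda>) ^ r" by (rule edge_coeff_le[OF \<kappa> \<Lambda> m])
      show "w ^ j \<le> w ^ (r + 1)" using j w by (intro power_decreasing) auto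
      have "j + 2 * m \<le> r * r + 2 * r" using m j by auto
      then show "a ^ (j + 2 * m) \<le> a * (1 + a) ^ p"
        using ps(3) m a by (intro power_le_one_plus) auto
    qed (use w a \<Lambda> in auto)
    finally show "cmod (F j m) \<le> (r * \<Lambda>) ^ r * U" by (simp add: U_def)
  qed
  also have "\<dots> = real (r * (r * r - r)) * ((r * \<Lambda>) ^ r * U)" by simp
  also have "\<dots> \<le> (r * r * r) * ((r * \<Lambda>) ^ r * U)"
    using U \<Lambda> by (intro mult_right_mono) (auto simp: of_nat_diff algebra_simps)
  finally have 3: "cmod (Tm - edge_sum \<kappa> r w (\<i> * s)) \<le> (r * r * r) * (r * \<Lambda>) ^ r * U" by simp
  have "exp (E + Rm) - edge_sum \<kappa> r w (\<i> * s) = (exp (E + Rm) - exp E) + (exp E - Tm) + (Tm - edge_sum \<kappa> r w (\<i> * s))" by simp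
  also have "cmod \<dots> \<le> 9 * B * U + 3 * (r * \<Lambda>) ^ (r + 1) * U + (r * r * r) * (r * \<Lambda>) ^ r * U"
    by (intro norm_triangle_le add_mono 1 2 3)
  also have "\<dots> = (9 * B + 3 * (r * \<Lambda>) ^ (r + 1) + (r * r * r) * (r * \<Lambda>) ^ r) * U" by (simp only: ring_distribs)
  finally show ?thesis by (simp add: E_def U_def p_def a_def mult_ac)
qed

text \<open>The terms are regrouped by the exponent k = j + 2 m of z, the form required by
  \<open>edge_char\<close>. The power j of w is kept apart because it tells which Edgeworth
  polynomial a term belongs to.\<close>

definition edge_weight :: "(nat \<Rightarrow> real) \<Rightarrow> nat \<Rightarrow> nat \<Rightarrow> nat \<Rightarrow> real" where
  "edge_weight \<kappa> r j k = (\<Sum>m=1..r. if j + 2 * m = k then edge_coeff \<kappa> r j m else 0)"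

definition edge_weights :: "(nat \<Rightarrow> real) \<Rightarrow> nat \<Rightarrow> real \<Rightarrow> nat \<Rightarrow> real" where
  "edge_weights \<kappa> r w k = (\<Sum>j=1..r. w ^ j * edge_weight \<kappa> r j k)"

text \<open>Since j and m are at most r, the exponents j + 2 m do not exceed 3 r.\<close>

lemma edge_char_eq_edge_sum:
  "edge_char (edge_weights \<kappa> r w) (3 * r) s = complex_of_real (exp (- s\<^sup>2 / 2)) * edge_sum \<kappa> r w (\<i> * s)"
proof -
  define z where "z = \<i> * complex_of_real s"
  define c where "c j m = complex_of_real (w ^ j) * complex_of_real (edge_coeff \<kappa> r j m)" for j m
  have "(\<Sum>k=1..3*r. of_real (edge_weights \<kappa> r w k) * z ^ k)
      = (\<Sum>k=1..3*r. \<Sum>j=1..r. \<Sum>m=1..r. if j + 2 * m = k then c j m * z ^ k else 0)"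
    by (simp add: edge_weights_def edge_weight_def c_def sum_distrib_left sum_distrib_right if_distrib if_distribR cong: if_cong)
  also have "\<dots> = (\<Sum>j=1..r. \<Sum>k=1..3*r. \<Sum>m=1..r. if j + 2 * m = k then c j m * z ^ k else 0)"
    by (rule sum.swap)
  also have "\<dots> = (\<Sum>j=1..r. \<Sum>m=1..r. \<Sum>k=1..3*r. if j + 2 * m = k then c j m * z ^ k else 0)"
    by (intro sum.cong refl sum.swap)
  also have "\<dots> = (\<Sum>j=1..r. \<Sum>m=1..r. c j m * z ^ (j + 2 * m))"
    by (intro sum.cong refl, subst sum.delta') auto
  also have "1 + \<dots> = edge_sum \<kappa> r w z"
    by (simp add: edge_sum_def c_def sum_distrib_left mult.assoc)
  finally show ?thesis by (simp add: edge_char_def z_def)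
qed

lemma edge_weight_le:
  assumes \<kappa>: "\<And>k. k \<in> {1..r} \<Longrightarrow> \<bar>\<kappa> k\<bar> \<le> \<Lambda>" and \<Lambda>: "1 \<le> \<Lambda>"
  shows "\<bar>edge_weight \<kappa> r j k\<bar> \<le> r * (r * \<Lambda>) ^ r"
proof -
  have "\<bar>edge_weight \<kappa> r j k\<bar> \<le> (\<Sum>m=1..r. (r * \<Lambda>) ^ r)"
    unfolding edge_weight_def
    using edge_coeff_le[OF \<kappa> \<Lambda>] \<Lambda> by (intro order_trans[OF sum_abs] sum_mono) auto
  then show ?thesis by simp
qed

lemma edge_weights_le:
  assumes \<kappa>: "\<And>k. k \<in> {1..r} \<Longrightarrow> \<bar>\<kappa> k\<bar> \<le> \<Lambda>" and \<Lambda>: "1 \<le> \<Lambda>" and w: "0 \<le> w" "w \<le> 1"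
  shows "\<bar>edge_weights \<kappa> r w k\<bar> \<le> r * (r * (r * \<Lambda>) ^ r)"
proof -
  have "\<bar>edge_weights \<kappa> r w k\<bar> \<le> (\<Sum>j=1..r. r * (r * \<Lambda>) ^ r)"
    unfolding edge_weights_def
  proof (intro order_trans[OF sum_abs] sum_mono)
    fix j assume "j \<in> {1..r}"
    have "\<bar>w ^ j * edge_weight \<kappa> r j k\<bar> = w ^ j * \<bar>edge_weight \<kappa> r j k\<bar>"
      using w by (simp add: abs_mult)
    also have "\<dots> \<le> 1 * (r * (r * \<Lambda>) ^ r)"
      using w by (intro mult_mono edge_weight_le \<kappa> \<Lambda> power_le_one) auto
    finally show "\<bar>w ^ j * edge_weight \<kappa> r j k\<bar> \<le> r * (r * \<Lambda>) ^ r" by simp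
  qed
  then show ?thesis by simp
qed

definition edge_char_bound :: "nat \<Rightarrow> real \<Rightarrow> real" where
  "edge_char_bound r \<Lambda> = 1 + (\<Sum>k=1..3*r. (r * (r * (r * \<Lambda>) ^ r)) * (1 + 4 ^ k * fact k))"

lemma edge_char_bound_ge_1: "1 \<le> \<Lambda> \<Longrightarrow> 1 \<le> edge_char_bound r \<Lambda>"
  unfolding edge_char_bound_def by (simp add: sum_nonneg)

lemma abs_power_le_exp: "\<bar>s\<bar> ^ k \<le> (1 + 4 ^ k * fact k) * exp (s\<^sup>2 / 4)" for s :: real
proof -
  have "\<bar>s\<bar> ^ k \<le> 1 + (s\<^sup>2) ^ k"
  proof (cases "\<bar>s\<bar> \<le> 1")
    case True
    then have "\<bar>s\<bar> ^ k \<le> 1" by (intro power_le_one) auto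
    then show ?thesis by (simp add: add_increasing2)
  next
    case False
    then have "\<bar>s\<bar> \<le> s\<^sup>2" using self_le_power[of "\<bar>s\<bar>" 2] by simp
    then have "\<bar>s\<bar> ^ k \<le> (s\<^sup>2) ^ k" by (intro power_mono) auto
    then show ?thesis by simp
  qed
  also have "(s\<^sup>2) ^ k = 4 ^ k * fact k * ((s\<^sup>2 / 4) ^ k / fact k)" by (simp add: power_divide)
  also have "\<dots> \<le> 4 ^ k * fact k * exp (s\<^sup>2 / 4)"
  proof (intro mult_left_mono)
    have *: "(\<Sum>n\<in>{k}. (s\<^sup>2 / 4) ^ n /\<^sub>R fact n) \<le> exp (s\<^sup>2 / 4)"
      unfolding exp_def by (intro sum_le_suminf summable_exp_generic) auto
    have "(s\<^sup>2 / 4) ^ k / fact k = (\<Sum>n\<in>{k}. (s\<^sup>2 / 4) ^ n /\<^sub>R fact n)"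
      by (simp add: divide_inverse_commute[of "(s\<^sup>2 / 4) ^ k"])
    with * show "(s\<^sup>2 / 4) ^ k / fact k \<le> exp (s\<^sup>2 / 4)" by (simp only:)
  qed auto
  also have "1 + 4 ^ k * fact k * exp (s\<^sup>2 / 4) \<le> (1 + 4 ^ k * fact k) * exp (s\<^sup>2 / 4)"
    by (simp add: ring_distribs)
  finally show ?thesis by simp
qed

text \<open>Half of the Gaussian exponent pays for the polynomial factor, because |s|^k is at most a
  constant times exp (s^2/4).\<close>

lemma norm_edge_char_le:
  assumes \<kappa>: "\<And>k. k \<in> {1..r} \<Longrightarrow> \<bar>\<kappa> k\<bar> \<le> \<Lambda>" and \<Lambda>: "1 \<le> \<Lambda>" and w: "0 \<le> w" "w \<le> 1"
  shows "cmod (edge_char (edge_weights \<kappa> r w) (3 * r) s) \<le> edge_char_bound r \<Lambda> * exp (- s\<^sup>2 / 4)"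
proof -
  let ?Q = "r * (r * (r * \<Lambda>) ^ r)"
  have "cmod (1 + (\<Sum>k=1..3*r. edge_weights \<kappa> r w k * (\<i> * s) ^ k)) \<le> 1 + (\<Sum>k=1..3*r. ?Q * ((1 + 4 ^ k * fact k) * exp (s\<^sup>2 / 4)))"
  proof (intro norm_triangle_le add_mono order_trans[OF norm_sum] sum_mono)
    fix k
    have "cmod (edge_weights \<kappa> r w k * (\<i> * s) ^ k) = \<bar>edge_weights \<kappa> r w k\<bar> * \<bar>s\<bar> ^ k"
      by (simp add: norm_mult norm_power)
    also have "\<dots> \<le> ?Q * ((1 + 4 ^ k * fact k) * exp (s\<^sup>2 / 4))"
      using \<Lambda> by (intro mult_mono edge_weights_le \<kappa> w abs_power_le_exp) auto
    finally show "cmod (edge_weights \<kappa> r w k * (\<i> * s) ^ k) \<le> ?Q * ((1 + 4 ^ k * fact k) * exp (s\<^sup>2 / 4))" .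
  qed simp
  also have "\<dots> \<le> exp (s\<^sup>2 / 4) + (\<Sum>k=1..3*r. ?Q * ((1 + 4 ^ k * fact k) * exp (s\<^sup>2 / 4)))" by simp
  also have "\<dots> = edge_char_bound r \<Lambda> * exp (s\<^sup>2 / 4)"
    by (simp add: edge_char_bound_def ring_distribs sum_distrib_right sum_distrib_left sum.distrib mult_ac)
  finally have "cmod (edge_char (edge_weights \<kappa> r w) (3 * r) s) \<le> exp (- s\<^sup>2 / 2) * (edge_char_bound r \<Lambda> * exp (s\<^sup>2 / 4))"
    unfolding edge_char_def norm_mult by (intro mult_mono) auto
  also have "\<dots> = edge_char_bound r \<Lambda> * (exp (- s\<^sup>2 / 2) * exp (s\<^sup>2 / 4))" by simp
  also have "exp (- s\<^sup>2 / 2) * exp (s\<^sup>2 / 4) = exp (- s\<^sup>2 / 4)"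
    unfolding exp_add[symmetric] by (rule arg_cong[where f = exp]) simp
  finally show ?thesis .
qed

section \<open>The error for one law and its asymptotics\<close>

definition gauss_mass :: real where "gauss_mass = (LBINT s. exp (- s\<^sup>2 / 2))"

lemma
  assumes "0 < c"
  shows integrable_gauss_scaled: "integrable lborel (\<lambda>s::real. exp (- (c * s)\<^sup>2 / 2))"
    and integral_gauss_scaled: "(LBINT s. exp (- (c * s)\<^sup>2 / 2)) = gauss_mass / c"
proof -
  have i: "integrable lborel (\<lambda>s. exp (- s\<^sup>2 / 2) :: real)" using integrable_abs_pow_gauss[of 0] by simp
  from lborel_integrable_real_affine[OF i, of c 0] assms
  show "integrable lborel (\<lambda>s::real. exp (- (c * s)\<^sup>2 / 2))" by simp
  show "(LBINT s. exp (- (c * s)\<^sup>2 / 2)) = gauss_mass / c"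
    using lborel_integral_real_affine[of c "\<lambda>s. exp (- s\<^sup>2 / 2) :: real" 0] assms
    by (simp add: gauss_mass_def field_simps)
qed

definition edge_const :: "nat \<Rightarrow> real \<Rightarrow> real \<Rightarrow> real" where
  "edge_const r \<Lambda> B = 9 * B + 3 * (r * \<Lambda>) ^ (r + 1) + (r * r * r) * (r * \<Lambda>) ^ r"

text \<open>There are three ranges of frequencies: up to W the expansion is valid, from W to T the
  characteristic function has Gaussian decay, and beyond T only the smoothing factor helps. The
  signed measure is Gaussian small outside the first range, and inside it smoothing changes the
  transform by a relative error of at most (\<tau> s)^2/2.\<close>

lemma (in gauss_smoothing) edgeworth_error:
  fixes \<kappa> :: "nat \<Rightarrow> real" and \<Lambda> B w W T t :: real
  assumes r: "1 \<le> r" and \<kappa>: "\<And>k. k \<in> {1..r} \<Longrightarrow> \<bar>\<kappa> k\<bar> \<le> \<Lambda>" and \<Lambda>: "1 \<le> \<Lambda>" and B: "0 \<le> B"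
    and w: "0 \<le> w" "w \<le> 1" and W: "1 \<le> W" and T: "0 \<le> T" and t: "0 \<le> t"
    and small: "r * \<Lambda> * w * (1 + W) ^ (r + 2) \<le> 1" "B * w ^ (r + 1) * W ^ (r + 3) \<le> 1"
    and H1: "\<And>s. \<bar>s\<bar> \<le> W \<Longrightarrow> \<exists>Rm. char \<mu> s = complex_of_real (exp (- s\<^sup>2 / 2)) * exp (cum_exp \<kappa> r w (\<i> * s) + Rm) \<and>
        cmod Rm \<le> B * w ^ (r + 1) * \<bar>s\<bar> ^ (r + 3)"
    and H2: "\<And>s. \<bar>s\<bar> \<le> T \<Longrightarrow> cmod (char \<mu> s) \<le> 3 * exp (- s\<^sup>2 / 16)"
  shows "\<bar>cdf \<mu> x - edge_cdf (edge_weights \<kappa> r w) (3 * r) x\<bar> \<le>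
    2 * W * (edge_const r \<Lambda> B * w ^ (r + 1) * (1 + W) ^ ((r + 2)\<^sup>2) + edge_char_bound r \<Lambda> * \<tau>\<^sup>2)
    + (3 + edge_char_bound r \<Lambda>) * exp (- W\<^sup>2 / 32) * (4 * gauss_mass)
    + exp (- 3 * (\<tau> * T)\<^sup>2 / 8) * (2 * gauss_mass / \<tau>)
    + \<tau> * t * (edge_char_bound r \<Lambda> * (4 * gauss_mass)) + normal_tail t"
proof -
  define C where "C = edge_const r \<Lambda> B"
  define Mg where "Mg = edge_char_bound r \<Lambda>"
  define p where "p = (r + 2)\<^sup>2"
  define q where "q = edge_weights \<kappa> r w"
  define c1 where "c1 = C * w ^ (r + 1) * (1 + W) ^ p + Mg * \<tau>\<^sup>2"
  define c2 where "c2 = (3 + Mg) * exp (- W\<^sup>2 / 32)"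
  define c3 where "c3 = exp (- 3 * (\<tau> * T)\<^sup>2 / 8)"
  \<comment> \<open>exp (-s^2/16) is the square of exp (-s^2/32), and exp (-(\<tau> s)^2/2) = exp
    (-3 (\<tau> s)^2/8) exp (-(\<tau> s)^2/8). One factor is bounded by its value at W or T and
    gives c2 or c3; the other is left to be integrated.\<close>
  define H where "H s = c1 * indicator {-W..W} s + c2 * exp (- (1/4 * s)\<^sup>2 / 2) + c3 * exp (- (\<tau> / 2 * s)\<^sup>2 / 2)" for s
  have C: "0 \<le> C" using B \<Lambda> by (simp add: C_def edge_const_def)
  have Mg: "1 \<le> Mg" unfolding Mg_def by (rule edge_char_bound_ge_1[OF \<Lambda>])
  have g_le: "cmod (edge_char q (3 * r) s) \<le> Mg * exp (- s\<^sup>2 / 4)" for s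
    unfolding q_def Mg_def by (rule norm_edge_char_le[OF \<kappa> \<Lambda> w])
  have c: "0 \<le> c1" "0 \<le> c2" "0 \<le> c3" using C Mg w W by (auto simp: c1_def c2_def c3_def)
  have int: "integrable lborel (\<lambda>s. c1 * indicator {-W..W} s)" "integrable lborel (\<lambda>s. c2 * exp (- (1/4 * s)\<^sup>2 / 2))"
    "integrable lborel (\<lambda>s. c3 * exp (- (\<tau> / 2 * s)\<^sup>2 / 2))"
  proof -
    show "integrable lborel (\<lambda>s. c1 * indicator {-W..W} s)"
      by (intro integrable_mult_right integrable_real_indicator) (auto simp: emeasure_lborel_Icc_eq)
    show "integrable lborel (\<lambda>s. c2 * exp (- (1/4 * s)\<^sup>2 / 2))"
      by (rule integrable_mult_right, rule integrable_gauss_scaled) simp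
    show "integrable lborel (\<lambda>s. c3 * exp (- (\<tau> / 2 * s)\<^sup>2 / 2))"
      by (rule integrable_mult_right, rule integrable_gauss_scaled) (use \<tau> in simp)
  qed
  have H: "integrable lborel H" unfolding H_def[abs_def] by (intro Bochner_Integration.integrable_add int)
  have "(LBINT s. H s) = c1 * (LBINT s. indicator {-W..W} s) + c2 * (LBINT s. exp (- (1/4 * s)\<^sup>2 / 2)) + c3 * (LBINT s. exp (- (\<tau> / 2 * s)\<^sup>2 / 2))"
    unfolding H_def using int by simp
  also have "(LBINT s. indicator {-W..W} s :: real) = 2 * W" using W by simp
  also have "(LBINT s. exp (- (1/4 * s)\<^sup>2 / 2)) = 4 * gauss_mass" by (subst integral_gauss_scaled) auto
  also have "(LBINT s. exp (- (\<tau> / 2 * s)\<^sup>2 / 2)) = 2 * gauss_mass / \<tau>" using \<tau> by (subst integral_gauss_scaled) auto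
  finally have intH: "(LBINT s. H s) = c1 * (2 * W) + c2 * (4 * gauss_mass) + c3 * (2 * gauss_mass / \<tau>)" .
  have intg: "(LBINT s. cmod (edge_char q (3 * r) s)) \<le> Mg * (4 * gauss_mass)"
  proof -
    have "(LBINT s. cmod (edge_char q (3 * r) s)) \<le> (LBINT s. Mg * exp (- (1/4 * s)\<^sup>2 / 2))"
    proof (intro integral_mono integrable_norm integrable_edge_char integrable_mult_right integrable_gauss_scaled)
      fix s :: real
      have "exp (- s\<^sup>2 / 4) \<le> exp (- (1/4 * s)\<^sup>2 / 2)" by (simp add: power_mult_distrib power_divide)
      then have "Mg * exp (- s\<^sup>2 / 4) \<le> Mg * exp (- (1/4 * s)\<^sup>2 / 2)" using Mg by (intro mult_left_mono) auto
      with g_le[of s] show "cmod (edge_char q (3 * r) s) \<le> Mg * exp (- (1/4 * s)\<^sup>2 / 2)" by linarith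
    qed simp
    also have "\<dots> = Mg * (4 * gauss_mass)" using integral_gauss_scaled[of "1/4"] by simp
    finally show ?thesis .
  qed
  have le: "cmod (char \<mu> s * exp (- (\<tau> * s)\<^sup>2 / 2) - edge_char q (3 * r) s) \<le> \<bar>s\<bar> * H s" for s
  proof -
    define e where "e = exp (- (\<tau> * s)\<^sup>2 / 2)"
    have e: "0 < e" "e \<le> 1" by (auto simp: e_def)
    have e': "1 - e \<le> (\<tau> * s)\<^sup>2 / 2" using exp_ge_add_one_self[of "- (\<tau> * s)\<^sup>2 / 2"] by (simp add: e_def)
    show ?thesis
    proof (cases "\<bar>s\<bar> \<le> W")
      case True
      obtain Rm where Rm: "char \<mu> s = complex_of_real (exp (- s\<^sup>2 / 2)) * exp (cum_exp \<kappa> r w (\<i> * s) + Rm)"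
        "cmod Rm \<le> B * w ^ (r + 1) * \<bar>s\<bar> ^ (r + 3)" using H1[OF True] by auto
      have "B * w ^ (r + 1) * \<bar>s\<bar> ^ (r + 3) \<le> B * w ^ (r + 1) * W ^ (r + 3)"
        using True B w by (intro mult_left_mono power_mono) auto
      then have Rm1: "cmod Rm \<le> 1" using Rm small by linarith
      have "r * \<Lambda> * w * (1 + \<bar>s\<bar>) ^ (r + 2) \<le> r * \<Lambda> * w * (1 + W) ^ (r + 2)"
        using True \<Lambda> w by (intro mult_left_mono power_mono) auto
      then have sm: "r * \<Lambda> * w * (1 + \<bar>s\<bar>) ^ (r + 2) \<le> 1" using small by linarith
      have g: "edge_char q (3 * r) s = complex_of_real (exp (- s\<^sup>2 / 2)) * edge_sum \<kappa> r w (\<i> * s)"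
        unfolding q_def by (rule edge_char_eq_edge_sum)
      have "char \<mu> s - edge_char q (3 * r) s = complex_of_real (exp (- s\<^sup>2 / 2)) * (exp (cum_exp \<kappa> r w (\<i> * s) + Rm) - edge_sum \<kappa> r w (\<i> * s))"
        unfolding Rm(1) g by (simp add: algebra_simps)
      then have "cmod (char \<mu> s - edge_char q (3 * r) s) = exp (- s\<^sup>2 / 2) * cmod (exp (cum_exp \<kappa> r w (\<i> * s) + Rm) - edge_sum \<kappa> r w (\<i> * s))"
        by (simp add: norm_mult)
      also have "\<dots> \<le> 1 * (C * w ^ (r + 1) * \<bar>s\<bar> * (1 + \<bar>s\<bar>) ^ p)"
        unfolding C_def edge_const_def p_def
        by (intro mult_mono expansion_bound r \<kappa> \<Lambda> B w sm Rm(2) Rm1) auto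
      also have "\<dots> \<le> C * w ^ (r + 1) * \<bar>s\<bar> * (1 + W) ^ p"
        unfolding mult_1 using True C w by (intro mult_left_mono power_mono) auto
      finally have 1: "cmod (char \<mu> s - edge_char q (3 * r) s) \<le> C * w ^ (r + 1) * \<bar>s\<bar> * (1 + W) ^ p" .
      have 2: "cmod (edge_char q (3 * r) s) * (1 - e) \<le> Mg * \<tau>\<^sup>2 * \<bar>s\<bar>"
      proof -
        have "cmod (edge_char q (3 * r) s) * (1 - e) \<le> Mg * exp (- s\<^sup>2 / 4) * ((\<tau> * s)\<^sup>2 / 2)"
          using g_le e e' Mg by (intro mult_mono) auto
        also have "\<dots> = Mg * \<tau>\<^sup>2 * \<bar>s\<bar> * (\<bar>s\<bar> * exp (- s\<^sup>2 / 4) / 2)"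
          by (simp add: power2_eq_square mult_ac abs_mult[symmetric])
        also have "\<dots> \<le> Mg * \<tau>\<^sup>2 * \<bar>s\<bar> * 1"
        proof (intro mult_left_mono)
          have "\<bar>s\<bar> \<le> 1 + s\<^sup>2 / 4" using zero_le_power2[of "\<bar>s\<bar> / 2 - 1"] by (simp add: power2_eq_square field_simps)
          also have "\<dots> \<le> exp (s\<^sup>2 / 4)" by (rule exp_ge_add_one_self)
          finally have "\<bar>s\<bar> * exp (- (s\<^sup>2 / 4)) \<le> exp (s\<^sup>2 / 4) * exp (- (s\<^sup>2 / 4))" by (intro mult_right_mono) auto
          then have "\<bar>s\<bar> * exp (- (s\<^sup>2 / 4)) \<le> 1" by (simp add: exp_minus)
          then show "\<bar>s\<bar> * exp (- s\<^sup>2 / 4) / 2 \<le> 1" by simp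
        qed (use Mg in auto)
        finally show ?thesis by simp
      qed
      have "char \<mu> s * e - edge_char q (3 * r) s = (char \<mu> s - edge_char q (3 * r) s) * e - edge_char q (3 * r) s * of_real (1 - e)"
        by (simp add: algebra_simps)
      also have "cmod \<dots> \<le> cmod (char \<mu> s - edge_char q (3 * r) s) * e + cmod (edge_char q (3 * r) s) * (1 - e)"
      proof (rule order_trans[OF norm_triangle_ineq4])
        have "cmod (complex_of_real (1 - e)) = 1 - e" using e by (simp only: norm_of_real)
        then show "cmod ((char \<mu> s - edge_char q (3 * r) s) * e) + cmod (edge_char q (3 * r) s * of_real (1 - e))
          \<le> cmod (char \<mu> s - edge_char q (3 * r) s) * e + cmod (edge_char q (3 * r) s) * (1 - e)"
          using e by (simp add: norm_mult del: of_real_diff)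
      qed
      also have "\<dots> \<le> cmod (char \<mu> s - edge_char q (3 * r) s) * 1 + cmod (edge_char q (3 * r) s) * (1 - e)"
        using e by (intro add_mono mult_left_mono) auto
      also have "\<dots> \<le> C * w ^ (r + 1) * \<bar>s\<bar> * (1 + W) ^ p + Mg * \<tau>\<^sup>2 * \<bar>s\<bar>"
        unfolding mult_1_right by (intro add_mono 1 2)
      also have "\<dots> = \<bar>s\<bar> * (c1 * indicator {-W..W} s)"
      proof -
        have "indicator {-W..W} s = (1 :: real)" using True by (auto simp: indicator_def)
        then show ?thesis by (simp add: c1_def algebra_simps)
      qed
      also have "\<dots> \<le> \<bar>s\<bar> * H s" using c by (intro mult_left_mono) (auto simp: H_def)
      finally show ?thesis by (simp add: e_def)
    next
      case False
      then have s1: "1 \<le> \<bar>s\<bar>" and Ws: "W\<^sup>2 \<le> s\<^sup>2" using W power_mono[of W "\<bar>s\<bar>" 2] by auto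
      have ex16: "exp (- s\<^sup>2 / 16) \<le> exp (- W\<^sup>2 / 32) * exp (- (1/4 * s)\<^sup>2 / 2)"
        unfolding exp_add[symmetric] using Ws by (simp add: power_mult_distrib power_divide)
      have ex4: "exp (- s\<^sup>2 / 4) \<le> exp (- s\<^sup>2 / 16)" by simp
      have ce: "cmod (char \<mu> s * e) \<le> 3 * exp (- s\<^sup>2 / 16) + c3 * exp (- (\<tau> / 2 * s)\<^sup>2 / 2)"
      proof (cases "\<bar>s\<bar> \<le> T")
        case True
        have "cmod (char \<mu> s * e) = cmod (char \<mu> s) * e" using e by (simp add: norm_mult)
        also have "\<dots> \<le> cmod (char \<mu> s) * 1" using e by (intro mult_left_mono) auto
        also have "\<dots> \<le> 3 * exp (- s\<^sup>2 / 16)" using H2[OF True] by simp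
        finally show ?thesis using c by (simp add: add_increasing2)
      next
        case False
        have "cmod (char \<mu> s * e) = cmod (char \<mu> s) * e" using e by (simp add: norm_mult)
        also have "\<dots> \<le> 1 * e" using e by (intro mult_right_mono cmod_char_le_1) auto
        also have "\<dots> = exp (- 3 * (\<tau> * s)\<^sup>2 / 8) * exp (- (\<tau> / 2 * s)\<^sup>2 / 2)"
          unfolding e_def exp_add[symmetric] by (simp add: power_mult_distrib power_divide)
        also have "\<dots> \<le> c3 * exp (- (\<tau> / 2 * s)\<^sup>2 / 2)"
        proof (intro mult_right_mono)
          have "(\<tau> * T)\<^sup>2 \<le> (\<tau> * \<bar>s\<bar>)\<^sup>2" using False T \<tau> by (intro power_mono mult_left_mono) auto
          then show "exp (- 3 * (\<tau> * s)\<^sup>2 / 8) \<le> c3" by (simp add: c3_def power_mult_distrib mult.commute)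
        qed simp
        finally show ?thesis by (simp add: add_increasing)
      qed
      have "cmod (char \<mu> s * e - edge_char q (3 * r) s) \<le> cmod (char \<mu> s * e) + cmod (edge_char q (3 * r) s)"
        by (rule norm_triangle_ineq4)
      also have "\<dots> \<le> (3 * exp (- s\<^sup>2 / 16) + c3 * exp (- (\<tau> / 2 * s)\<^sup>2 / 2)) + Mg * exp (- s\<^sup>2 / 16)"
        using Mg ex4 by (intro add_mono ce order_trans[OF g_le] mult_left_mono) auto
      also have "\<dots> = (3 + Mg) * exp (- s\<^sup>2 / 16) + c3 * exp (- (\<tau> / 2 * s)\<^sup>2 / 2)" by (simp add: algebra_simps)
      also have "\<dots> \<le> (3 + Mg) * (exp (- W\<^sup>2 / 32) * exp (- (1/4 * s)\<^sup>2 / 2)) + c3 * exp (- (\<tau> / 2 * s)\<^sup>2 / 2)"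
        using Mg ex16 c(3) by (intro add_mono mult_left_mono) auto
      also have "\<dots> = H s"
      proof -
        have "indicator {-W..W} s = (0 :: real)" using False by (auto simp: indicator_def)
        then show ?thesis by (simp add: H_def c2_def)
      qed
      also have "\<dots> \<le> \<bar>s\<bar> * H s"
        using s1 c mult_right_mono[OF s1, of "H s"] by (simp add: H_def)
      finally show ?thesis by (simp add: e_def)
    qed
  qed
  have "\<bar>cdf \<mu> x - edge_cdf q (3 * r) x\<bar> \<le> (LBINT s. H s) + \<tau> * t * (LBINT s. cmod (edge_char q (3 * r) s)) + normal_tail t"
    using le by (intro smoothing_inequality[OF H _ t])
  also have "\<dots> \<le> (c1 * (2 * W) + c2 * (4 * gauss_mass) + c3 * (2 * gauss_mass / \<tau>)) + \<tau> * t * (Mg * (4 * gauss_mass)) + normal_tail t"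
    unfolding intH using \<tau> t intg c by (intro add_mono mult_left_mono) auto
  finally show ?thesis
    by (simp add: c1_def c2_def c3_def q_def Mg_def C_def p_def mult_ac)
qed

text \<open>The window is \<open>\<bar>s\<bar> \<le> W\<close> with \<open>W ^ ((r + 2)\<^sup>2 + 2) = \<sigma>\<close>, the Gaussian smoothing has
  scale \<open>\<tau> = \<sigma> powr - (r + \<rho> / 2)\<close>, and the decay of the characteristic functions is used up
  to \<open>T = \<sigma> powr (r + \<rho>)\<close>; the extra power \<open>\<rho>\<close> is what makes every term \<open>o(\<sigma> ^ - r)\<close>.\<close>

theorem edgeworth_asymptotic:
  fixes \<mu> :: "nat \<Rightarrow> real measure" and \<sigma> :: "nat \<Rightarrow> real" and \<kappa> :: "nat \<Rightarrow> nat \<Rightarrow> real" and \<Lambda> B \<rho> \<delta> e :: real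
  assumes dist: "\<And>N. real_distribution (\<mu> N)" and \<sigma>: "filterlim \<sigma> at_top sequentially"
    and r: "1 \<le> r" and \<rho>: "0 < \<rho>" and \<Lambda>: "1 \<le> \<Lambda>" and B: "0 \<le> B" and \<delta>: "0 < \<delta>"
    and \<kappa>: "\<And>N k. k \<in> {1..r} \<Longrightarrow> \<bar>\<kappa> N k\<bar> \<le> \<Lambda>"
    and H1: "\<forall>\<^sub>F N in sequentially. \<forall>s. \<bar>s\<bar> \<le> \<delta> * \<sigma> N \<longrightarrow> (\<exists>Rm.
        char (\<mu> N) s = complex_of_real (exp (- s\<^sup>2 / 2)) * exp (cum_exp (\<kappa> N) r (1 / \<sigma> N) (\<i> * s) + Rm) \<and>
        cmod Rm \<le> B * (1 / \<sigma> N) ^ (r + 1) * \<bar>s\<bar> ^ (r + 3))"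
    and H2: "\<forall>\<^sub>F N in sequentially. \<forall>s. \<bar>s\<bar> \<le> \<sigma> N powr (r + \<rho>) \<longrightarrow> cmod (char (\<mu> N) s) \<le> 3 * exp (- s\<^sup>2 / 16)"
    and e: "0 < e"
  shows "\<forall>\<^sub>F N in sequentially. \<forall>x. \<bar>cdf (\<mu> N) x - edge_cdf (edge_weights (\<kappa> N) r (1 / \<sigma> N)) (3 * r) x\<bar> \<le> e / \<sigma> N ^ r"
proof -
  define p where "p = (r + 2)\<^sup>2"
  define C where "C = edge_const r \<Lambda> B"
  define Mg where "Mg = edge_char_bound r \<Lambda>"
  define \<theta> where "\<theta> = 1 / (real p + 2)"
  define W where "W x = x powr \<theta>" for x :: real
  define \<tau> where "\<tau> x = x powr (- (r + \<rho>/2))" for x :: real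
  define T where "T x = x powr (r + \<rho>)" for x :: real
  \<comment> \<open>Any exponent below \<rho>/2 keeps \<tau> t of smaller order than \<sigma>^(-r).
    A positive power is still enough for the normal tail: the 2k-th moment gives \<sigma>^(-k
    \<rho>/2), and the k chosen next satisfies k \<rho>/2 > r.\<close>
  define t where "t x = x powr (\<rho>/4)" for x :: real
  obtain k :: nat where k: "2 * r / \<rho> < k" using reals_Archimedean2 by blast
  define Ck :: real where "Ck = fact (2 * k) / (2 ^ k * fact k)"
  have p: "r + 2 < p" using r by (simp add: p_def power2_eq_square)
  have C: "0 \<le> C" using B \<Lambda> by (simp add: C_def edge_const_def)
  have Mg: "1 \<le> Mg" unfolding Mg_def by (rule edge_char_bound_ge_1[OF \<Lambda>])
  have \<theta>: "0 < \<theta>" "\<theta> < 1" by (auto simp: \<theta>_def)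
  have W_top: "filterlim W at_top at_top" unfolding W_def using \<theta> by real_asymp
  have W_pow: "W x ^ (p + 2) = x" if "1 \<le> x" for x
  proof -
    have "W x ^ (p + 2) = (x powr \<theta>) powr real (p + 2)"
      using that by (subst powr_realpow) (auto simp: W_def)
    also have "\<dots> = x powr (\<theta> * real (p + 2))" by (rule powr_powr)
    also have "\<theta> * real (p + 2) = 1" by (simp add: \<theta>_def field_simps)
    finally show ?thesis using that by simp
  qed
  have W1: "1 \<le> W x" if "1 \<le> x" for x using that \<theta> by (simp add: W_def ge_one_powr_ge_zero)
  have pz: "((\<lambda>x::real. x powr b) \<longlongrightarrow> 0) at_top" if "b < 0" for b
    using that by (rule tendsto_neg_powr) (rule filterlim_ident)
  have xr: "x ^ r = x powr r" if "1 \<le> x" for x :: real using that by (simp add: powr_realpow)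
  have ev1: "\<forall>\<^sub>F x :: real in at_top. 1 \<le> x" by (rule eventually_ge_at_top)
  have invW: "((\<lambda>x. c / W x ^ n) \<longlongrightarrow> 0) at_top" if "0 < n" for c n
    using that by (intro tendsto_divide_0[OF tendsto_const] filterlim_at_top_imp_at_infinity filterlim_pow_at_top W_top)
  \<comment> \<open>\<open>L1\<close> to \<open>L6\<close> treat the terms of the error bound one at
    a time, multiplied by x^r, as functions of a real x that is replaced by \<sigma> at the end.
    Here W^(p+1)/x = 1/W because W^(p+2) = x.\<close>
  have L1: "((\<lambda>x. 2 * W x * (C * (1 / x) ^ (r + 1) * (1 + W x) ^ p) * x ^ r) \<longlongrightarrow> 0) at_top"
  proof (rule tendsto_sandwich[OF _ _ tendsto_const])
    show "((\<lambda>x. (C * 2 ^ (p + 1)) / W x ^ 1) \<longlongrightarrow> 0) at_top" by (rule invW) simp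
    show "\<forall>\<^sub>F x in at_top. 0 \<le> 2 * W x * (C * (1 / x) ^ (r + 1) * (1 + W x) ^ p) * x ^ r"
      using ev1 by eventually_elim (use C in \<open>simp add: W_def\<close>)
    show "\<forall>\<^sub>F x in at_top. 2 * W x * (C * (1 / x) ^ (r + 1) * (1 + W x) ^ p) * x ^ r \<le> (C * 2 ^ (p + 1)) / W x ^ 1"
      using ev1
    proof eventually_elim
      fix x :: real assume x: "1 \<le> x"
      have Wp: "0 < W x" using W1[OF x] by linarith
      have "2 * W x * (C * (1 / x) ^ (r + 1) * (1 + W x) ^ p) * x ^ r = 2 * W x * C * (1 + W x) ^ p / x"
        using x by (simp add: power_divide field_simps)
      also have "\<dots> \<le> 2 * W x * C * (2 * W x) ^ p / x"
        using x W1[OF x] C by (intro divide_right_mono mult_left_mono power_mono) auto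
      also have "\<dots> = (C * 2 ^ (p + 1)) * W x ^ (p + 1) / W x ^ (p + 2)"
        using W_pow[OF x] by (simp add: power_mult_distrib mult_ac)
      also have "\<dots> = (C * 2 ^ (p + 1)) / W x ^ 1" using Wp by (simp add: field_simps)
      finally show "2 * W x * (C * (1 / x) ^ (r + 1) * (1 + W x) ^ p) * x ^ r \<le> (C * 2 ^ (p + 1)) / W x ^ 1" .
    qed
  qed
  have L2: "((\<lambda>x. 2 * W x * (Mg * (\<tau> x)\<^sup>2) * x ^ r) \<longlongrightarrow> 0) at_top"
  proof (rule Lim_transform_eventually)
    show "((\<lambda>x. 2 * Mg * x powr (\<theta> - r - \<rho>)) \<longlongrightarrow> 0) at_top"
      using \<theta> r \<rho> by (intro tendsto_mult_right_zero pz) auto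
    show "\<forall>\<^sub>F x in at_top. 2 * Mg * x powr (\<theta> - r - \<rho>) = 2 * W x * (Mg * (\<tau> x)\<^sup>2) * x ^ r"
      using ev1
    proof eventually_elim
      fix x :: real assume x: "1 \<le> x"
      have "W x * (\<tau> x)\<^sup>2 * x ^ r = x powr (\<theta> + - (r + \<rho>/2) + - (r + \<rho>/2) + r)"
        unfolding powr_add W_def \<tau>_def xr[OF x] power2_eq_square by simp
      also have "\<theta> + - (r + \<rho>/2) + - (r + \<rho>/2) + r = \<theta> - r - \<rho>" by simp
      finally show "2 * Mg * x powr (\<theta> - r - \<rho>) = 2 * W x * (Mg * (\<tau> x)\<^sup>2) * x ^ r" by (simp add: mult_ac)
    qed
  qed
  have L3: "((\<lambda>x. (3 + Mg) * exp (- (W x)\<^sup>2 / 32) * (4 * gauss_mass) * x ^ r) \<longlongrightarrow> 0) at_top"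
  proof (rule Lim_transform_eventually)
    have "((\<lambda>y::real. exp (- y\<^sup>2 / 32) * y ^ n) \<longlongrightarrow> 0) at_top" for n by real_asymp
    from filterlim_compose[OF this W_top]
    show "((\<lambda>x. (3 + Mg) * (4 * gauss_mass) * (exp (- (W x)\<^sup>2 / 32) * W x ^ ((p + 2) * r))) \<longlongrightarrow> 0) at_top"
      by (rule tendsto_mult_right_zero)
    show "\<forall>\<^sub>F x in at_top. (3 + Mg) * (4 * gauss_mass) * (exp (- (W x)\<^sup>2 / 32) * W x ^ ((p + 2) * r)) = (3 + Mg) * exp (- (W x)\<^sup>2 / 32) * (4 * gauss_mass) * x ^ r"
    proof -
      have "W x ^ ((p + 2) * r) = x ^ r" if "1 \<le> x" for x using that by (simp only: power_mult W_pow)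
      then show ?thesis using ev1 by (elim eventually_mono) (simp only: mult_ac)
    qed
  qed
  have L4: "((\<lambda>x. exp (- 3 * (\<tau> x * T x)\<^sup>2 / 8) * (2 * gauss_mass / \<tau> x) * x ^ r) \<longlongrightarrow> 0) at_top"
  proof (rule Lim_transform_eventually)
    \<comment> \<open>Chosen so that (x^\<rho>)^c = x^(2r + \<rho>/2), which is the growth of x^r /
      \<tau>. In terms of u = x^\<rho> only exp (-3u/8) u^c remains.\<close>
    define c where "c = (2 * r + \<rho>/2) / \<rho>"
    have "((\<lambda>u::real. exp (- (3/8) * u) * u powr c) \<longlongrightarrow> 0) at_top" by real_asymp
    moreover have "filterlim (\<lambda>x::real. x powr \<rho>) at_top at_top" using \<rho> by real_asymp
    ultimately have "((\<lambda>x. exp (- (3/8) * (x powr \<rho>)) * (x powr \<rho>) powr c) \<longlongrightarrow> 0) at_top"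
      by (rule filterlim_compose)
    then show "((\<lambda>x. 2 * gauss_mass * (exp (- (3/8) * (x powr \<rho>)) * (x powr \<rho>) powr c)) \<longlongrightarrow> 0) at_top"
      by (rule tendsto_mult_right_zero)
    show "\<forall>\<^sub>F x in at_top. 2 * gauss_mass * (exp (- (3/8) * (x powr \<rho>)) * (x powr \<rho>) powr c)
      = exp (- 3 * (\<tau> x * T x)\<^sup>2 / 8) * (2 * gauss_mass / \<tau> x) * x ^ r"
      using ev1
    proof eventually_elim
      fix x :: real assume x: "1 \<le> x"
      have "\<tau> x * T x = x powr (\<rho>/2)" unfolding \<tau>_def T_def powr_add[symmetric] by simp
      then have "(\<tau> x * T x)\<^sup>2 = x powr \<rho>" by (simp add: power2_eq_square flip: powr_add)
      then have e1: "exp (- 3 * (\<tau> x * T x)\<^sup>2 / 8) = exp (- (3/8) * (x powr \<rho>))" by simp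
      have "(x powr \<rho>) powr c = x powr (2 * r + \<rho>/2)" using \<rho> by (simp add: powr_powr c_def)
      also have "\<dots> = x powr (r + \<rho>/2) * x powr r" unfolding powr_add[symmetric] by simp
      finally have e2: "(x powr \<rho>) powr c = x powr (r + \<rho>/2) * x powr r" .
      have e3: "2 * gauss_mass / \<tau> x = 2 * gauss_mass * x powr (r + \<rho>/2)"
        unfolding \<tau>_def powr_minus by (simp only: divide_inverse inverse_inverse_eq)
      show "2 * gauss_mass * (exp (- (3/8) * (x powr \<rho>)) * (x powr \<rho>) powr c)
        = exp (- 3 * (\<tau> x * T x)\<^sup>2 / 8) * (2 * gauss_mass / \<tau> x) * x ^ r"
        unfolding e1 e2 e3 xr[OF x] by (simp only: mult_ac)
    qed
  qed
  have L5: "((\<lambda>x. \<tau> x * t x * (Mg * (4 * gauss_mass)) * x ^ r) \<longlongrightarrow> 0) at_top"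
  proof (rule Lim_transform_eventually)
    show "((\<lambda>x. (Mg * (4 * gauss_mass)) * x powr (- \<rho>/4)) \<longlongrightarrow> 0) at_top"
      using \<rho> by (intro tendsto_mult_right_zero pz) auto
    show "\<forall>\<^sub>F x in at_top. (Mg * (4 * gauss_mass)) * x powr (- \<rho>/4) = \<tau> x * t x * (Mg * (4 * gauss_mass)) * x ^ r"
      using ev1
    proof eventually_elim
      fix x :: real assume x: "1 \<le> x"
      have "\<tau> x * t x * x ^ r = x powr (- (r + \<rho>/2) + \<rho>/4 + r)"
        unfolding powr_add \<tau>_def t_def xr[OF x] by simp
      also have "- (r + \<rho>/2) + \<rho>/4 + r = - \<rho>/4" by simp
      finally show "(Mg * (4 * gauss_mass)) * x powr (- \<rho>/4) = \<tau> x * t x * (Mg * (4 * gauss_mass)) * x ^ r" by (simp add: mult_ac)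
    qed
  qed
  have L6: "((\<lambda>x. Ck / t x ^ (2 * k) * x ^ r) \<longlongrightarrow> 0) at_top"
  proof (rule Lim_transform_eventually)
    have "r - k * \<rho> / 2 < 0" using k \<rho> by (simp add: field_simps)
    then show "((\<lambda>x. Ck * x powr (r - k * \<rho> / 2)) \<longlongrightarrow> 0) at_top"
      by (intro tendsto_mult_right_zero pz)
    show "\<forall>\<^sub>F x in at_top. Ck * x powr (r - k * \<rho> / 2) = Ck / t x ^ (2 * k) * x ^ r"
      using ev1
    proof eventually_elim
      fix x :: real assume x: "1 \<le> x"
      have "t x ^ (2 * k) = x powr (k * \<rho> / 2)"
        using x by (simp add: t_def powr_powr mult_ac flip: powr_realpow)
      then show "Ck * x powr (r - k * \<rho> / 2) = Ck / t x ^ (2 * k) * x ^ r"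
        unfolding xr[OF x] by (simp add: powr_diff)
    qed
  qed
  define D where "D x = 2 * W x * (C * (1 / x) ^ (r + 1) * (1 + W x) ^ p + Mg * (\<tau> x)\<^sup>2)
    + (3 + Mg) * exp (- (W x)\<^sup>2 / 32) * (4 * gauss_mass)
    + exp (- 3 * (\<tau> x * T x)\<^sup>2 / 8) * (2 * gauss_mass / \<tau> x)
    + \<tau> x * t x * (Mg * (4 * gauss_mass)) + Ck / t x ^ (2 * k)" for x
  have "((\<lambda>x. D x * x ^ r) \<longlongrightarrow> 0 + 0 + 0 + 0 + 0 + 0) at_top"
    using tendsto_add[OF tendsto_add[OF tendsto_add[OF tendsto_add[OF tendsto_add[OF L1 L2] L3] L4] L5] L6]
    by (simp add: D_def ring_distribs)
  then have "\<forall>\<^sub>F x in at_top. D x * x ^ r < e" by (rule order_tendstoD) (simp add: e)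
  moreover have "\<forall>\<^sub>F x in at_top. r * \<Lambda> * (1 / x) * (1 + W x) ^ (r + 2) < 1"
  proof (rule order_tendstoD)
    show "((\<lambda>x. r * \<Lambda> * (1 / x) * (1 + W x) ^ (r + 2)) \<longlongrightarrow> 0) at_top"
    proof (rule tendsto_sandwich[OF _ _ tendsto_const])
      show "((\<lambda>x. (r * \<Lambda> * 2 ^ (r + 2)) / W x ^ 1) \<longlongrightarrow> 0) at_top" by (rule invW) simp
      show "\<forall>\<^sub>F x in at_top. 0 \<le> r * \<Lambda> * (1 / x) * (1 + W x) ^ (r + 2)"
        using ev1 by eventually_elim (use \<Lambda> in \<open>simp add: W_def\<close>)
      show "\<forall>\<^sub>F x in at_top. r * \<Lambda> * (1 / x) * (1 + W x) ^ (r + 2) \<le> (r * \<Lambda> * 2 ^ (r + 2)) / W x ^ 1"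
        using ev1
      proof eventually_elim
        fix x :: real assume x: "1 \<le> x"
        have Wp: "0 < W x" using W1[OF x] by linarith
        have "r * \<Lambda> * (1 / x) * (1 + W x) ^ (r + 2) \<le> r * \<Lambda> * (1 / x) * (2 * W x) ^ (r + 2)"
          using x W1[OF x] \<Lambda> by (intro mult_left_mono power_mono) auto
        also have "\<dots> = (r * \<Lambda> * 2 ^ (r + 2)) * (W x ^ (r + 2) / W x ^ (p + 2))"
          using W_pow[OF x] by (simp add: power_mult_distrib mult_ac)
        also have "W x ^ (r + 2) / W x ^ (p + 2) \<le> 1 / W x ^ 1"
        proof -
          have "W x ^ (r + 2) * W x ^ 1 \<le> W x ^ (p + 2)"
            unfolding power_add[symmetric] using W1[OF x] p by (intro power_increasing) auto
          then show ?thesis using Wp by (simp add: field_simps)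
        qed
        finally show "r * \<Lambda> * (1 / x) * (1 + W x) ^ (r + 2) \<le> (r * \<Lambda> * 2 ^ (r + 2)) / W x ^ 1"
          using \<Lambda> by (simp add: mult_left_mono)
      qed
    qed
  qed simp
  moreover have "\<forall>\<^sub>F x in at_top. B * (1 / x) ^ (r + 1) * W x ^ (r + 3) < 1"
  proof (rule order_tendstoD)
    show "((\<lambda>x. B * (1 / x) ^ (r + 1) * W x ^ (r + 3)) \<longlongrightarrow> 0) at_top"
    proof (rule tendsto_sandwich[OF _ _ tendsto_const])
      show "((\<lambda>x. B / W x ^ 1) \<longlongrightarrow> 0) at_top" by (rule invW) simp
      show "\<forall>\<^sub>F x in at_top. 0 \<le> B * (1 / x) ^ (r + 1) * W x ^ (r + 3)"
        using ev1 by eventually_elim (use B in \<open>simp add: W_def\<close>)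
      show "\<forall>\<^sub>F x in at_top. B * (1 / x) ^ (r + 1) * W x ^ (r + 3) \<le> B / W x ^ 1"
        using ev1
      proof eventually_elim
        fix x :: real assume x: "1 \<le> x"
        have Wp: "0 < W x" using W1[OF x] by linarith
        have "(1 / x) ^ (r + 1) \<le> (1 / x) ^ 1" using x by (intro power_decreasing) auto
        then have "B * (1 / x) ^ (r + 1) * W x ^ (r + 3) \<le> B * (1 / x) ^ 1 * W x ^ (r + 3)"
          using B Wp by (intro mult_right_mono mult_left_mono) auto
        also have "\<dots> = B * (W x ^ (r + 3) / W x ^ (p + 2))" using W_pow[OF x] by simp
        also have "\<dots> \<le> B * (1 / W x ^ 1)"
        proof (rule mult_left_mono[OF _ B])
          have "W x ^ (r + 3) * W x ^ 1 \<le> W x ^ (p + 2)"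
            unfolding power_add[symmetric] using W1[OF x] p by (intro power_increasing) auto
          then show "W x ^ (r + 3) / W x ^ (p + 2) \<le> 1 / W x ^ 1" using Wp by (simp add: field_simps)
        qed
        finally show "B * (1 / x) ^ (r + 1) * W x ^ (r + 3) \<le> B / W x ^ 1" by simp
      qed
    qed
  qed simp
  moreover have "\<forall>\<^sub>F x in at_top. W x \<le> \<delta> * x" unfolding W_def using \<theta> \<delta> by real_asymp
  ultimately have "\<forall>\<^sub>F x in at_top. 1 \<le> x \<and> D x * x ^ r < e \<and> r * \<Lambda> * (1 / x) * (1 + W x) ^ (r + 2) < 1 \<and>
      B * (1 / x) ^ (r + 1) * W x ^ (r + 3) < 1 \<and> W x \<le> \<delta> * x"
    using ev1 by eventually_elim simp
  from eventually_compose_filterlim[OF this \<sigma>]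
  show ?thesis using H1 H2
  proof eventually_elim
    fix N
    define x where "x = \<sigma> N"
    assume "1 \<le> \<sigma> N \<and> D (\<sigma> N) * \<sigma> N ^ r < e \<and> r * \<Lambda> * (1 / \<sigma> N) * (1 + W (\<sigma> N)) ^ (r + 2) < 1 \<and>
      B * (1 / \<sigma> N) ^ (r + 1) * W (\<sigma> N) ^ (r + 3) < 1 \<and> W (\<sigma> N) \<le> \<delta> * \<sigma> N"
    then have x: "1 \<le> x" "D x * x ^ r < e" "r * \<Lambda> * (1 / x) * (1 + W x) ^ (r + 2) \<le> 1"
      "B * (1 / x) ^ (r + 1) * W x ^ (r + 3) \<le> 1" "W x \<le> \<delta> * x" by (auto simp: x_def)
    assume h1: "\<forall>s. \<bar>s\<bar> \<le> \<delta> * \<sigma> N \<longrightarrow> (\<exists>Rm.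
        char (\<mu> N) s = complex_of_real (exp (- s\<^sup>2 / 2)) * exp (cum_exp (\<kappa> N) r (1 / \<sigma> N) (\<i> * s) + Rm) \<and>
        cmod Rm \<le> B * (1 / \<sigma> N) ^ (r + 1) * \<bar>s\<bar> ^ (r + 3))"
    assume h2: "\<forall>s. \<bar>s\<bar> \<le> \<sigma> N powr (r + \<rho>) \<longrightarrow> cmod (char (\<mu> N) s) \<le> 3 * exp (- s\<^sup>2 / 16)"
    interpret \<mu>N: real_distribution "\<mu> N" by (rule dist)
    interpret \<mu>N: gauss_smoothing "\<mu> N" "\<tau> x"
      by unfold_locales (use x in \<open>simp add: \<tau>_def\<close>)
    show "\<forall>y. \<bar>cdf (\<mu> N) y - edge_cdf (edge_weights (\<kappa> N) r (1 / \<sigma> N)) (3 * r) y\<bar> \<le> e / \<sigma> N ^ r"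
    proof
      fix y
      have t: "0 < t x" using x by (simp add: t_def)
      have "\<bar>cdf (\<mu> N) y - edge_cdf (edge_weights (\<kappa> N) r (1 / x)) (3 * r) y\<bar> \<le>
        2 * W x * (edge_const r \<Lambda> B * (1 / x) ^ (r + 1) * (1 + W x) ^ ((r + 2)\<^sup>2) + edge_char_bound r \<Lambda> * (\<tau> x)\<^sup>2)
        + (3 + edge_char_bound r \<Lambda>) * exp (- (W x)\<^sup>2 / 32) * (4 * gauss_mass)
        + exp (- 3 * (\<tau> x * T x)\<^sup>2 / 8) * (2 * gauss_mass / \<tau> x)
        + \<tau> x * t x * (edge_char_bound r \<Lambda> * (4 * gauss_mass)) + normal_tail (t x)"
      proof (rule \<mu>N.edgeworth_error[OF r \<kappa> \<Lambda> B])
        fix s assume "\<bar>s\<bar> \<le> W x"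
        then show "\<exists>Rm. char (\<mu> N) s = complex_of_real (exp (- s\<^sup>2 / 2)) * exp (cum_exp (\<kappa> N) r (1 / x) (\<i> * s) + Rm) \<and>
          cmod Rm \<le> B * (1 / x) ^ (r + 1) * \<bar>s\<bar> ^ (r + 3)"
          using h1 x(5) unfolding x_def by (meson order_trans)
      next
        fix s assume "\<bar>s\<bar> \<le> T x"
        then show "cmod (char (\<mu> N) s) \<le> 3 * exp (- s\<^sup>2 / 16)" using h2 by (simp add: T_def x_def)
      qed (use x W1 t in \<open>auto simp: T_def\<close>)
      also have "\<dots> \<le> D x"
        using normal_tail_le[OF t, of k] by (simp add: D_def C_def Mg_def p_def Ck_def)
      also have "\<dots> \<le> e / x ^ r" using x by (simp add: field_simps)
      finally show "\<bar>cdf (\<mu> N) y - edge_cdf (edge_weights (\<kappa> N) r (1 / \<sigma> N)) (3 * r) y\<bar> \<le> e / \<sigma> N ^ r"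
        by (simp add: x_def)
    qed
  qed
qed

section \<open>Chains with decaying summands\<close>

text \<open>Comparison with the integral, one term at a time: by the mean value theorem each term is
  at most an increment of n^\<gamma> / \<gamma>, and the increments telescope.\<close>

lemma sum_powr_le:
  fixes \<gamma> :: real
  assumes "0 < \<gamma>" "\<gamma> < 1"
  shows "(\<Sum>k<n. real (Suc k) powr (\<gamma> - 1)) \<le> real n powr \<gamma> / \<gamma>"
proof (induction n)
  case (Suc n)
  have "real (Suc n) powr (\<gamma> - 1) \<le> (real (Suc n) powr \<gamma> - real n powr \<gamma>) / \<gamma>"
  proof (cases "n = 0")
    case False
    have "\<exists>\<xi>. real n < \<xi> \<and> \<xi> < real (Suc n) \<and> real (Suc n) powr \<gamma> - real n powr \<gamma> = (real (Suc n) - real n) * (\<gamma> * \<xi> powr (\<gamma> - 1))"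
      using False by (intro MVT2) (auto intro!: derivative_eq_intros)
    then obtain \<xi> where \<xi>: "real n < \<xi>" "\<xi> < real (Suc n)" "real (Suc n) powr \<gamma> - real n powr \<gamma> = \<gamma> * \<xi> powr (\<gamma> - 1)"
      by auto
    have "real (Suc n) powr (\<gamma> - 1) \<le> \<xi> powr (\<gamma> - 1)"
      using \<xi> assms False by (intro powr_mono2') auto
    then show ?thesis using \<xi> assms by (simp add: field_simps)
  qed (use assms in \<open>simp add: field_simps\<close>)
  then show ?case using Suc by (simp add: diff_divide_distrib)
qed simp

text \<open>Time starts at 0, so index n stands for time n + 1 of the original chain; hence
  \<open>Suc n\<close> in the decay.\<close>

locale decaying_sum = elliptic_chain +
  fixes g :: "nat \<Rightarrow> 'b \<times> 'b \<Rightarrow> real" and C \<beta> :: real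
  assumes g_meas: "\<And>n. bdd_meas (S2 n) (g n)"
    and g_le: "\<And>n p. p \<in> space (S2 n) \<Longrightarrow> \<bar>g n p\<bar> \<le> C * real (Suc n) powr - \<beta>"
    and C: "0 < C" and \<beta>: "0 < \<beta>" "\<beta> < 1/2"
begin

definition Y :: "nat \<Rightarrow> 'a \<Rightarrow> real" where "Y k \<omega> = g k (X2 k \<omega>) - (\<integral>\<omega>. g k (X2 k \<omega>) \<partial>M)"
definition Zs :: "nat \<Rightarrow> nat \<Rightarrow> 'a \<Rightarrow> real" where "Zs N a \<omega> = (\<Sum>k=a..<N. Y k \<omega>)"
definition V :: "nat \<Rightarrow> real" where "V N = (\<integral>\<omega>. (Zs N 0 \<omega>)\<^sup>2 \<partial>M)"
definition sd :: "nat \<Rightarrow> real" where "sd N = sqrt (V N)"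

lemma bdd_meas_Y [bdd_meas_intros]: "bdd_meas M (Y k)"
  unfolding Y_def[abs_def] by (intro bdd_meas_intros g_meas)

lemma bdd_meas_Zs [bdd_meas_intros]: "bdd_meas M (Zs N a)"
  unfolding Zs_def[abs_def] by (intro bdd_meas_intros)

text \<open>Scaling all summands by s brings any frequency into the unit disc. The smallness
  condition then becomes a condition on the first index used, which the decay can always
  satisfy.\<close>

lemma elliptic_sum_scaled:
  "elliptic_sum M S K X Fn \<nu> \<epsilon> (\<lambda>n p. s * g n p) (\<lambda>n. \<bar>s\<bar> * (C * real (Suc n) powr - \<beta>))"
proof unfold_locales
  show "bdd_meas (S2 n) (\<lambda>p. s * g n p)" for n by (intro bdd_meas_intros g_meas)
  show "\<bar>s * g n p\<bar> \<le> \<bar>s\<bar> * (C * real (Suc n) powr - \<beta>)" if "p \<in> space (S2 n)" for n p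
    using g_le[OF that] by (simp add: abs_mult mult_left_mono)
  show "\<bar>s\<bar> * (C * real (Suc n) powr - \<beta>) \<le> \<bar>s\<bar> * (C * real (Suc m) powr - \<beta>)" if "m \<le> n" for m n
    using that C \<beta> by (intro mult_left_mono powr_mono2') auto
qed

lemma elliptic_sum_Z_scaled: "elliptic_sum.Z M X (\<lambda>n p. s * g n p) N a \<omega> = s * Zs N a \<omega>"
proof -
  interpret es: elliptic_sum M S K X Fn \<nu> \<epsilon> "\<lambda>n p. s * g n p" "\<lambda>n. \<bar>s\<bar> * (C * real (Suc n) powr - \<beta>)" N
    by (rule elliptic_sum_scaled)
  show ?thesis by (simp add: es.Z_def Zs_def Y_def sum_distrib_left right_diff_distrib)
qed

lemma expectation_Zs: "(\<integral>\<omega>. Zs N a \<omega> \<partial>M) = 0"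
proof -
  interpret es: elliptic_sum M S K X Fn \<nu> \<epsilon> "\<lambda>n p. 1 * g n p" "\<lambda>n. \<bar>1\<bar> * (C * real (Suc n) powr - \<beta>)" N
    by (rule elliptic_sum_scaled)
  have "es.Z a = Zs N a" by (rule ext) (use elliptic_sum_Z_scaled[of 1 N a] in simp)
  with es.expectation_Z[of a] show ?thesis by simp
qed

lemma Zs_log_moment:
  assumes s: "0 < s" "s * C \<le> \<epsilon>\<^sup>2 / 1800"
  shows "\<exists>L. L holomorphic_on ball 0 1 \<and> (\<forall>z\<in>ball 0 1. exp (L z) = (\<integral>\<omega>. exp (z * of_real (s * Zs N 0 \<omega>)) \<partial>M)) \<and>
    (\<forall>z\<in>ball 0 1. cmod (L z) \<le> 10 * s\<^sup>2 * V N) \<and> (\<forall>x. \<bar>x\<bar> < 1 \<longrightarrow> L (of_real x) \<in> \<real>)"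
proof -
  interpret es: elliptic_sum M S K X Fn \<nu> \<epsilon> "\<lambda>n p. s * g n p" "\<lambda>n. \<bar>s\<bar> * (C * real (Suc n) powr - \<beta>)" N
    by (rule elliptic_sum_scaled)
  have "\<bar>s\<bar> * (C * real (Suc 0) powr - \<beta>) \<le> \<epsilon>\<^sup>2 / 1800" using s by simp
  from es.Z_log_moment[OF le0 this] show ?thesis
    by (simp add: elliptic_sum_Z_scaled power_mult_distrib V_def mult.assoc)
qed

text \<open>The summands before a become the past weight. The others are scaled by 640 t, so that
  evaluation at \<eta> = 1/640 produces the frequency t.\<close>

lemma char_Zs_le:
  assumes a: "a \<le> N" and t: "\<bar>t\<bar> * (640 * C) * real (Suc a) powr - \<beta> \<le> \<epsilon>\<^sup>2 / 1800"
  shows "cmod (\<integral>\<omega>. exp (\<i> * of_real (t * Zs N 0 \<omega>)) \<partial>M) \<le> 3 * exp (- t\<^sup>2 * (\<integral>\<omega>. (Zs N a \<omega>)\<^sup>2 \<partial>M) / 4)"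
proof -
  define \<eta> :: real where "\<eta> = 1/640"
  define s where "s = 640 * t"
  have \<eta>s: "\<eta> * s = t" by (simp add: \<eta>_def s_def)
  interpret es: elliptic_sum M S K X Fn \<nu> \<epsilon> "\<lambda>n p. s * g n p" "\<lambda>n. \<bar>s\<bar> * (C * real (Suc n) powr - \<beta>)" N
    by (rule elliptic_sum_scaled)
  have b: "\<bar>s\<bar> * (C * real (Suc a) powr - \<beta>) \<le> \<epsilon>\<^sup>2 / 1800" using t by (simp add: s_def abs_mult mult_ac)
  define \<psi> where "\<psi> \<omega> = exp (\<i> * of_real (t * Zs a 0 \<omega>))" for \<omega>
  have "bdd_meas (Fn a) (Zs a 0)"
    unfolding Zs_def[abs_def] Y_def by (intro bdd_meas_sum bdd_meas_diff bdd_meas_const bdd_meas_X2_past g_meas) auto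
  then have \<psi>: "bdd_meas (Fn a) \<psi>" unfolding \<psi>_def
    by (intro bdd_meas_exp bdd_meas_mult bdd_meas_of_real bdd_meas_const)
  have split: "t * Zs N 0 \<omega> = t * Zs a 0 \<omega> + \<eta> * (s * Zs N a \<omega>)" for \<omega>
  proof -
    have "Zs N 0 \<omega> = Zs a 0 \<omega> + Zs N a \<omega>"
      unfolding Zs_def using a by (simp add: sum.atLeastLessThan_concat)
    then show ?thesis by (simp add: \<eta>s[symmetric] algebra_simps)
  qed
  have "(\<integral>\<omega>. exp (\<i> * of_real (t * Zs N 0 \<omega>)) \<partial>M) = (\<integral>\<omega>. \<psi> \<omega> * exp (\<i> * \<eta> * es.Z a \<omega>) \<partial>M)"
    unfolding split \<psi>_def elliptic_sum_Z_scaled by (simp add: exp_add[symmetric] algebra_simps)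
  also have "cmod \<dots> \<le> 3 * exp (- \<eta>\<^sup>2 * (\<integral>\<omega>. (es.Z a \<omega>)\<^sup>2 \<partial>M) / 4)"
    by (rule es.char_Z_past_le[OF a b \<eta>_def \<psi>]) (simp add: \<psi>_def)
  also have "- \<eta>\<^sup>2 * (\<integral>\<omega>. (es.Z a \<omega>)\<^sup>2 \<partial>M) = - t\<^sup>2 * (\<integral>\<omega>. (Zs N a \<omega>)\<^sup>2 \<partial>M)"
    by (simp add: elliptic_sum_Z_scaled power_mult_distrib \<eta>s[symmetric])
  finally show ?thesis .
qed

lemma V_nonneg: "0 \<le> V N" by (simp add: V_def)

text \<open>A fixed scaling makes all summands small from index 0 on, so
  \<open>variance_Z_le\<close> applies, and the variance is scaled back by s^2. The squared bounds
  are of order (k+1)^(-2 \<beta>), and summing them gives the exponent.\<close>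

lemma V_upper: "\<exists>Kv>0. \<forall>n. V n \<le> Kv * real (Suc n) powr (1 - 2 * \<beta>)"
proof -
  define s where "s = \<epsilon>\<^sup>2 / (1800 * C)"
  have s: "0 < s" using \<epsilon> C by (simp add: s_def)
  define \<gamma> where "\<gamma> = 1 - 2 * \<beta>"
  have \<gamma>: "0 < \<gamma>" "\<gamma> < 1" using \<beta> by (auto simp: \<gamma>_def)
  have "V n \<le> ((8 * C / \<epsilon>)\<^sup>2 + (18 * C / \<epsilon>)\<^sup>2 / \<gamma>) * real (Suc n) powr \<gamma>" for n
  proof -
    interpret es: elliptic_sum M S K X Fn \<nu> \<epsilon> "\<lambda>n p. s * g n p" "\<lambda>n. \<bar>s\<bar> * (C * real (Suc n) powr - \<beta>)" n
      by (rule elliptic_sum_scaled)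
    have b: "\<bar>s\<bar> * (C * real (Suc 0) powr - \<beta>) \<le> \<epsilon>\<^sup>2 / 1800" using s C by (simp add: s_def)
    have "s\<^sup>2 * V n = (\<integral>\<omega>. (es.Z 0 \<omega>)\<^sup>2 \<partial>M)" by (simp add: elliptic_sum_Z_scaled power_mult_distrib V_def)
    also have "\<dots> \<le> (8 * (\<bar>s\<bar> * (C * real (Suc 0) powr - \<beta>)) / \<epsilon>)\<^sup>2 + (\<Sum>k<n. (18 * (\<bar>s\<bar> * (C * real (Suc k) powr - \<beta>)) / \<epsilon>)\<^sup>2)"
      by (rule es.variance_Z_le[OF b])
    also have "\<dots> = s\<^sup>2 * ((8 * C / \<epsilon>)\<^sup>2 + (18 * C / \<epsilon>)\<^sup>2 * (\<Sum>k<n. real (Suc k) powr (\<gamma> - 1)))"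
    proof -
      have p: "(real (Suc k) powr - \<beta>)\<^sup>2 = real (Suc k) powr (\<gamma> - 1)" for k
        unfolding power2_eq_square powr_add[symmetric] \<gamma>_def by simp
      show ?thesis
        unfolding power_divide power_mult_distrib p
        by (simp add: sum_distrib_left sum_divide_distrib algebra_simps)
    qed
    finally have "V n \<le> (8 * C / \<epsilon>)\<^sup>2 + (18 * C / \<epsilon>)\<^sup>2 * (\<Sum>k<n. real (Suc k) powr (\<gamma> - 1))"
      using s by (simp add: mult_le_cancel_left_pos)
    also have "\<dots> \<le> (8 * C / \<epsilon>)\<^sup>2 * real (Suc n) powr \<gamma> + (18 * C / \<epsilon>)\<^sup>2 * (real (Suc n) powr \<gamma> / \<gamma>)"
    proof (intro add_mono mult_left_mono)
      have "1 \<le> real (Suc n) powr \<gamma>" using \<gamma> by (simp add: ge_one_powr_ge_zero)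
      then show "(8 * C / \<epsilon>)\<^sup>2 \<le> (8 * C / \<epsilon>)\<^sup>2 * real (Suc n) powr \<gamma>"
        using mult_left_mono[of 1 "real (Suc n) powr \<gamma>" "(8 * C / \<epsilon>)\<^sup>2"] by simp
      have "real n powr \<gamma> \<le> real (Suc n) powr \<gamma>" using \<gamma> by (intro powr_mono2) auto
      then show "(\<Sum>k<n. real (Suc k) powr (\<gamma> - 1)) \<le> real (Suc n) powr \<gamma> / \<gamma>"
        using sum_powr_le[OF \<gamma>, of n] \<gamma> divide_right_mono[of "real n powr \<gamma>" "real (Suc n) powr \<gamma>" \<gamma>] by linarith
    qed simp
    finally show ?thesis by (simp add: algebra_simps)
  qed
  moreover have "0 < (8 * C / \<epsilon>)\<^sup>2 + (18 * C / \<epsilon>)\<^sup>2 / \<gamma>"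
    using \<gamma> C \<epsilon> by (intro add_pos_nonneg) auto
  ultimately show ?thesis unfolding \<gamma>_def by blast
qed

lemma V_split: "a \<le> N \<Longrightarrow> V N \<le> 2 * V a + 2 * (\<integral>\<omega>. (Zs N a \<omega>)\<^sup>2 \<partial>M)"
proof -
  assume a: "a \<le> N"
  have "V N \<le> (\<integral>\<omega>. 2 * (Zs a 0 \<omega>)\<^sup>2 + 2 * (Zs N a \<omega>)\<^sup>2 \<partial>M)"
    unfolding V_def
  proof (intro integral_mono_AE AE_I2 integrable_bdd_meas bdd_meas_intros)
    fix \<omega>
    have "Zs N 0 \<omega> = Zs a 0 \<omega> + Zs N a \<omega>"
      unfolding Zs_def using a by (simp add: sum.atLeastLessThan_concat)
    then show "(Zs N 0 \<omega>)\<^sup>2 \<le> 2 * (Zs a 0 \<omega>)\<^sup>2 + 2 * (Zs N a \<omega>)\<^sup>2"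
      using sum_squares_bound[of "Zs a 0 \<omega>" "Zs N a \<omega>"] by (simp add: power2_eq_square algebra_simps)
  qed
  also have "\<dots> = 2 * V a + 2 * (\<integral>\<omega>. (Zs N a \<omega>)\<^sup>2 \<partial>M)"
  proof -
    have "integrable M (\<lambda>\<omega>. (Zs a 0 \<omega>)\<^sup>2)" "integrable M (\<lambda>\<omega>. (Zs N a \<omega>)\<^sup>2)"
      by (intro integrable_bdd_meas bdd_meas_intros)+
    then show ?thesis by (simp add: V_def)
  qed
  finally show ?thesis .
qed

definition law :: "nat \<Rightarrow> real measure" where "law N = distr M borel (\<lambda>\<omega>. Zs N 0 \<omega> / sd N)"

lemma real_distribution_law: "real_distribution (law N)"
  unfolding law_def by (intro real_distribution_distr borel_measurable_divide borel_measurable_const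
    bdd_meas_measurable[OF bdd_meas_Zs])

lemma char_law: "char (law N) s = (\<integral>\<omega>. exp (\<i> * of_real (s / sd N * Zs N 0 \<omega>)) \<partial>M)"
proof -
  have "(\<lambda>\<omega>. Zs N 0 \<omega> / sd N) \<in> borel_measurable M"
    using bdd_meas_measurable[OF bdd_meas_Zs] by measurable
  then show ?thesis unfolding char_def law_def by (subst integral_distr) auto
qed

text \<open>Indices below \<open>a = \<lceil>(c t) powr (1/\<beta>)\<rceil>\<close> are given up; their variance is negligible because
  \<open>(r - 1 + \<rho>) (1 - 2 \<beta>) / \<beta> < 2\<close>, which is where the restriction on \<open>r\<close> enters.\<close>

lemma law_decay:
  assumes V: "filterlim V at_top sequentially" and r: "1 \<le> r"
    and \<rho>: "0 < \<rho>" "(r - 1 + \<rho>) * (1 - 2 * \<beta>) < 2 * \<beta>"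
  shows "\<forall>\<^sub>F N in sequentially. \<forall>s. \<bar>s\<bar> \<le> sd N powr (r + \<rho>) \<longrightarrow> cmod (char (law N) s) \<le> 3 * exp (- s\<^sup>2 / 16)"
proof -
  obtain Kv where Kv: "0 < Kv" "\<And>n. V n \<le> Kv * real (Suc n) powr (1 - 2 * \<beta>)" using V_upper by auto
  define \<gamma> where "\<gamma> = 1 - 2 * \<beta>"
  \<comment> \<open>With this c the smallness condition of \<open>char_Zs_le\<close> reads c |t|
    \<le> (a+1)^\<beta>. As |t| \<le> x^(r-1+\<rho>), it suffices that a is about c^(1/\<beta>) x^q,
    and q \<gamma> < 2 makes the variance before a of smaller order than x^2.\<close>
  define c where "c = 640 * C * 1800 / \<epsilon>\<^sup>2"
  define q where "q = (r - 1 + \<rho>) / \<beta>"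
  have c: "0 < c" using C \<epsilon> by (simp add: c_def)
  have \<gamma>: "0 < \<gamma>" "\<gamma> < 1" using \<beta> by (auto simp: \<gamma>_def)
  have q: "0 < q" "q * \<gamma> < 2" using \<rho> r \<beta> by (auto simp: q_def \<gamma>_def field_simps)
  have sd_top: "filterlim sd at_top sequentially"
    unfolding sd_def by (intro filterlim_compose[OF sqrt_at_top V])
  have "((\<lambda>x::real. Kv * (c powr (1/\<beta>) * x powr q + 2) powr \<gamma> / x\<^sup>2) \<longlongrightarrow> 0) at_top"
  proof -
    define d where "d = c powr (1/\<beta>) + 2"
    have d: "0 < d" by (simp add: d_def add_nonneg_pos)
    show ?thesis
    proof (rule tendsto_sandwich[OF _ _ tendsto_const])
      show "((\<lambda>x::real. Kv * d powr \<gamma> * x powr (q * \<gamma> - 2)) \<longlongrightarrow> 0) at_top"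
        using q by (intro tendsto_mult_right_zero tendsto_neg_powr filterlim_ident) auto
      show "\<forall>\<^sub>F x in at_top. 0 \<le> Kv * (c powr (1/\<beta>) * x powr q + 2) powr \<gamma> / x\<^sup>2"
        using Kv by simp
      show "\<forall>\<^sub>F x in at_top. Kv * (c powr (1/\<beta>) * x powr q + 2) powr \<gamma> / x\<^sup>2 \<le> Kv * d powr \<gamma> * x powr (q * \<gamma> - 2)"
        using eventually_ge_at_top[of 1]
      proof eventually_elim
        fix x :: real assume x: "1 \<le> x"
        have "1 \<le> x powr q" using x q by (simp add: ge_one_powr_ge_zero)
        then have "c powr (1/\<beta>) * x powr q + 2 \<le> d * x powr q" by (simp add: d_def algebra_simps)
        then have "(c powr (1/\<beta>) * x powr q + 2) powr \<gamma> \<le> (d * x powr q) powr \<gamma>"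
          using \<gamma> by (intro powr_mono2) (auto intro: add_nonneg_nonneg)
        also have "\<dots> = d powr \<gamma> * x powr (q * \<gamma>)" using d by (simp add: powr_mult powr_powr)
        finally have "Kv * (c powr (1/\<beta>) * x powr q + 2) powr \<gamma> / x\<^sup>2 \<le> Kv * (d powr \<gamma> * x powr (q * \<gamma>)) / x\<^sup>2"
          using Kv by (intro divide_right_mono mult_left_mono) auto
        also have "\<dots> = Kv * d powr \<gamma> * x powr (q * \<gamma> - 2)"
          using x by (simp add: powr_diff)
        finally show "Kv * (c powr (1/\<beta>) * x powr q + 2) powr \<gamma> / x\<^sup>2 \<le> Kv * d powr \<gamma> * x powr (q * \<gamma> - 2)" .
      qed
    qed
  qed
  then have "\<forall>\<^sub>F x in at_top. Kv * (c powr (1/\<beta>) * x powr q + 2) powr \<gamma> / x\<^sup>2 < 1/4"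
    by (rule order_tendstoD) simp
  with eventually_ge_at_top[of 1] have "\<forall>\<^sub>F x in at_top. 1 \<le> x \<and> Kv * (c powr (1/\<beta>) * x powr q + 2) powr \<gamma> / x\<^sup>2 < 1/4"
    by eventually_elim simp
  from eventually_compose_filterlim[OF this sd_top] show ?thesis
  proof (eventually_elim, intro allI impI)
    fix N s
    define x where "x = sd N"
    assume "1 \<le> sd N \<and> Kv * (c powr (1/\<beta>) * sd N powr q + 2) powr \<gamma> / (sd N)\<^sup>2 < 1/4"
    then have x: "1 \<le> x" and "Kv * (c powr (1/\<beta>) * x powr q + 2) powr \<gamma> / x\<^sup>2 < 1/4" by (auto simp: x_def)
    then have Kx: "Kv * (c powr (1/\<beta>) * x powr q + 2) powr \<gamma> \<le> x\<^sup>2 / 4" by (simp add: field_simps)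
    have x2: "x\<^sup>2 = V N" by (simp add: x_def sd_def V_nonneg)
    assume "\<bar>s\<bar> \<le> sd N powr (r + \<rho>)"
    then have s: "\<bar>s\<bar> \<le> x powr (r + \<rho>)" by (simp add: x_def)
    define t where "t = s / x"
    have t: "\<bar>t\<bar> \<le> x powr (r - 1 + \<rho>)"
    proof -
      have "\<bar>t\<bar> = \<bar>s\<bar> / x" using x by (simp add: t_def)
      also have "\<dots> \<le> x powr (r + \<rho>) / x" using s x by (intro divide_right_mono) auto
      also have "\<dots> = x powr (r + \<rho> - 1)" using x by (simp add: powr_diff)
      also have "r + \<rho> - 1 = r - 1 + \<rho>" by simp
      finally show ?thesis using r by (simp add: of_nat_diff)
    qed
    define y where "y = c powr (1/\<beta>) * x powr q"
    define a where "a = nat \<lceil>y\<rceil>"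
    have y: "0 \<le> y" by (simp add: y_def)
    have a1: "y \<le> real (Suc a)" "real (Suc a) \<le> y + 2" using y by (auto simp: a_def) linarith+
    have Va: "Kv * real (Suc a) powr \<gamma> \<le> V N / 4"
    proof -
      have "real (Suc a) powr \<gamma> \<le> (y + 2) powr \<gamma>" using a1 \<gamma> by (intro powr_mono2) auto
      then have "Kv * real (Suc a) powr \<gamma> \<le> Kv * (y + 2) powr \<gamma>" using Kv by simp
      with Kx show ?thesis by (simp add: y_def x2)
    qed
    have VN: "1 \<le> V N" using x x2 power_mono[of 1 x 2] by simp
    \<comment> \<open>If a exceeded N, the upper bound on the variance at N would give V N \<le> V N
      / 4.\<close>
    have aN: "a \<le> N"
    proof (rule ccontr)
      assume "\<not> a \<le> N"
      then have "real (Suc N) powr \<gamma> \<le> real (Suc a) powr \<gamma>" using \<gamma> by (intro powr_mono2) auto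
      then have "Kv * real (Suc N) powr \<gamma> \<le> Kv * real (Suc a) powr \<gamma>" using Kv by simp
      with Kv(2)[of N] Va VN show False unfolding \<gamma>_def by linarith
    qed
    have tc: "\<bar>t\<bar> * (640 * C) * real (Suc a) powr - \<beta> \<le> \<epsilon>\<^sup>2 / 1800"
    proof -
      have "y powr \<beta> = c * x powr (r - 1 + \<rho>)"
        using \<beta> c x by (simp add: y_def powr_mult powr_powr q_def)
      then have "c * \<bar>t\<bar> \<le> y powr \<beta>" using t c by simp
      also have "\<dots> \<le> real (Suc a) powr \<beta>" using a1 y \<beta> by (intro powr_mono2) auto
      finally have "c * \<bar>t\<bar> * real (Suc a) powr - \<beta> \<le> real (Suc a) powr \<beta> * real (Suc a) powr - \<beta>"
        by (intro mult_right_mono) auto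
      also have "\<dots> = 1" by (simp add: powr_minus)
      finally have "c * (\<bar>t\<bar> * real (Suc a) powr - \<beta>) \<le> 1" by (simp only: mult.assoc)
      then show ?thesis using \<epsilon> by (simp add: c_def field_simps)
    qed
    have "cmod (char (law N) s) \<le> 3 * exp (- t\<^sup>2 * (\<integral>\<omega>. (Zs N a \<omega>)\<^sup>2 \<partial>M) / 4)"
      unfolding char_law using char_Zs_le[OF aN tc] by (simp add: t_def x_def)
    also have "\<dots> \<le> 3 * exp (- s\<^sup>2 / 16)"
    proof -
      \<comment> \<open>With a quarter of the variance before a, \<open>V_split\<close> leaves at
        least V N / 4 after it, and t^2 V N / 16 = s^2/16.\<close>
      have "V a \<le> V N / 4" using Kv(2)[of a] Va unfolding \<gamma>_def by linarith
      then have "V N / 4 \<le> (\<integral>\<omega>. (Zs N a \<omega>)\<^sup>2 \<partial>M)" using V_split[OF aN] by linarith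
      then have "t\<^sup>2 * (V N / 4) \<le> t\<^sup>2 * (\<integral>\<omega>. (Zs N a \<omega>)\<^sup>2 \<partial>M)" by (intro mult_left_mono) auto
      moreover have "t\<^sup>2 * (V N / 4) = s\<^sup>2 / 4" using x by (simp add: t_def x2[symmetric] power_divide)
      ultimately show ?thesis by simp
    qed
    finally show "cmod (char (law N) s) \<le> 3 * exp (- s\<^sup>2 / 16)" .
  qed
qed

text \<open>At frequencies below a constant one fixed scaling \<open>s0\<close> makes all summands
  small, and the logarithm on the unit disc is expanded to degree r + 2. Its coefficients are O(V),
  so division by the variance leaves \<kappa> bounded uniformly in N; the degree r + 3 remainder,
  also O(V), becomes w^(r+1) |s|^(r+3) after normalisation.\<close>

lemma law_expansion:
  assumes V: "filterlim V at_top sequentially"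
  shows "\<exists>\<kappa> \<Lambda> B \<delta>. 1 \<le> \<Lambda> \<and> 0 \<le> B \<and> 0 < \<delta> \<and> (\<forall>N. \<forall>k\<in>{1..r}. \<bar>\<kappa> N k\<bar> \<le> \<Lambda>) \<and>
    (\<forall>\<^sub>F N in sequentially. \<forall>s. \<bar>s\<bar> \<le> \<delta> * sd N \<longrightarrow> (\<exists>Rm.
        char (law N) s = complex_of_real (exp (- s\<^sup>2 / 2)) * exp (cum_exp (\<kappa> N) r (1 / sd N) (\<i> * s) + Rm) \<and>
        cmod Rm \<le> B * (1 / sd N) ^ (r + 1) * \<bar>s\<bar> ^ (r + 3)))"
proof -
  define s0 where "s0 = \<epsilon>\<^sup>2 / (1800 * C)"
  have s0: "0 < s0" "s0 * C \<le> \<epsilon>\<^sup>2 / 1800" using \<epsilon> C by (auto simp: s0_def)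
  have "\<forall>N. \<exists>L. L holomorphic_on ball 0 1 \<and> (\<forall>z\<in>ball 0 1. exp (L z) = (\<integral>\<omega>. exp (z * of_real (s0 * Zs N 0 \<omega>)) \<partial>M)) \<and>
    (\<forall>z\<in>ball 0 1. cmod (L z) \<le> 10 * s0\<^sup>2 * V N) \<and> (\<forall>x. \<bar>x\<bar> < 1 \<longrightarrow> L (of_real x) \<in> \<real>)"
    using Zs_log_moment[OF s0] by blast
  then obtain L where "\<forall>N. L N holomorphic_on ball 0 1 \<and> (\<forall>z\<in>ball 0 1. exp (L N z) = (\<integral>\<omega>. exp (z * of_real (s0 * Zs N 0 \<omega>)) \<partial>M)) \<and>
    (\<forall>z\<in>ball 0 1. cmod (L N z) \<le> 10 * s0\<^sup>2 * V N) \<and> (\<forall>x. \<bar>x\<bar> < 1 \<longrightarrow> L N (of_real x) \<in> \<real>)"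
    using choice[of "\<lambda>N L. L holomorphic_on ball 0 1 \<and> (\<forall>z\<in>ball 0 1. exp (L z) = (\<integral>\<omega>. exp (z * of_real (s0 * Zs N 0 \<omega>)) \<partial>M)) \<and>
    (\<forall>z\<in>ball 0 1. cmod (L z) \<le> 10 * s0\<^sup>2 * V N) \<and> (\<forall>x. \<bar>x\<bar> < 1 \<longrightarrow> L (of_real x) \<in> \<real>)"] by auto
  then have L: "L N holomorphic_on ball 0 1" "\<And>z. cmod z < 1 \<Longrightarrow> exp (L N z) = (\<integral>\<omega>. exp (z * of_real (s0 * Zs N 0 \<omega>)) \<partial>M)"
    "\<And>z. cmod z < 1 \<Longrightarrow> cmod (L N z) \<le> 10 * s0\<^sup>2 * V N" "\<And>x. \<bar>x\<bar> < 1 \<Longrightarrow> L N (of_real x) \<in> \<real>" for N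
    by auto
  define a where "a N k = taylor_coeff (L N) k" for N k
  define \<kappa> where "\<kappa> N k = Re (a N (k + 2)) / (s0 ^ (k + 2) * (sd N)\<^sup>2)" for N k
  define \<Lambda> where "\<Lambda> = 1 + (\<Sum>k=1..r. 10 * 2 ^ (k + 2) / s0 ^ k)"
  define B where "B = 20 * 2 ^ (r + 3) / s0 ^ (r + 1)"
  \<comment> \<open>Then z = i s / (\<sigma> s0) lies in the disc of radius 1/4, where
    \<open>taylor_remainder\<close> holds.\<close>
  define \<delta> where "\<delta> = s0 / 4"
  have sd2: "(sd N)\<^sup>2 = V N" for N by (simp add: sd_def V_nonneg)
  have a_le: "cmod (a N k) \<le> 10 * s0\<^sup>2 * V N * 2 ^ k" for N k
    unfolding a_def by (rule norm_taylor_coeff_le[OF L(1) L(3)])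
  have a_real: "a N k = of_real (Re (a N k))" for N k
  proof -
    have "a N k \<in> \<real>" unfolding a_def by (rule taylor_coeff_in_Reals[OF L(1) L(4)])
    then show ?thesis by (simp add: of_real_Re)
  qed
  have b0: "bdd_meas M (\<lambda>\<omega>. s0 * Zs N 0 \<omega>)" for N by (intro bdd_meas_intros)
  have e0: "expectation (\<lambda>\<omega>. s0 * Zs N 0 \<omega>) = 0" for N using expectation_Zs[of N 0] by simp
  have a012: "a N 0 = 0" "a N 1 = 0" "a N 2 = of_real (s0\<^sup>2 * V N / 2)" for N
    using log_moment_coeffs[OF b0 e0 L(1) L(2) L(4)]
    by (simp_all add: a_def V_def power_mult_distrib)
  have \<kappa>: "\<bar>\<kappa> N k\<bar> \<le> \<Lambda>" if k: "k \<in> {1..r}" for N k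
  proof -
    have "\<bar>\<kappa> N k\<bar> \<le> 10 * 2 ^ (k + 2) / s0 ^ k"
    \<comment> \<open>The bound is claimed for every N. For zero variance \<kappa> is 0, because
      division by 0 yields 0.\<close>
    proof (cases "V N = 0")
      case False
      have V0: "0 < V N" using False V_nonneg[of N] by simp
      have "\<bar>\<kappa> N k\<bar> = \<bar>Re (a N (k + 2))\<bar> / (s0 ^ (k + 2) * V N)"
        using s0 V0 by (simp add: \<kappa>_def sd2 abs_mult)
      also have "\<dots> \<le> (10 * s0\<^sup>2 * V N * 2 ^ (k + 2)) / (s0 ^ (k + 2) * V N)"
        using s0 V0 a_le[of N "k + 2"] abs_Re_le_cmod[of "a N (k + 2)"] by (intro divide_right_mono) auto
      also have "\<dots> = 10 * 2 ^ (k + 2) / s0 ^ k" using s0 V0 by (simp add: power2_eq_square field_simps)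
      finally show ?thesis .
    qed (use s0 in \<open>simp add: \<kappa>_def sd2\<close>)
    also have "\<dots> \<le> (\<Sum>k=1..r. 10 * 2 ^ (k + 2) / s0 ^ k)"
      using k s0 by (intro member_le_sum[of k "{1..r}" "\<lambda>k. 10 * 2 ^ (k + 2) / s0 ^ k"]) auto
    finally show ?thesis by (simp add: \<Lambda>_def)
  qed
  have main: "\<exists>Rm. char (law N) s = complex_of_real (exp (- s\<^sup>2 / 2)) * exp (cum_exp (\<kappa> N) r (1 / sd N) (\<i> * s) + Rm) \<and>
        cmod Rm \<le> B * (1 / sd N) ^ (r + 1) * \<bar>s\<bar> ^ (r + 3)" if sd: "1 \<le> sd N" and s: "\<bar>s\<bar> \<le> \<delta> * sd N" for N s
  proof -
    define z where "z = \<i> * of_real (s / (sd N * s0))"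
    have nz: "cmod z = \<bar>s\<bar> / (sd N * s0)" using sd s0 by (simp add: z_def norm_mult norm_divide)
    have z: "cmod z \<le> 1/4" using s sd s0 by (simp add: nz \<delta>_def field_simps)
    have "char (law N) s = exp (L N z)"
    proof -
      have "exp (L N z) = (\<integral>\<omega>. exp (z * of_real (s0 * Zs N 0 \<omega>)) \<partial>M)" using z by (intro L(2)) simp
      also have "\<dots> = char (law N) s"
        unfolding char_law using s0 sd by (intro Bochner_Integration.integral_cong) (auto simp: z_def)
      finally show ?thesis by simp
    qed
    define Rm where "Rm = L N z - (\<Sum>k<r+3. a N k * z ^ k)"
    have Rm: "cmod Rm \<le> 2 * (10 * s0\<^sup>2 * V N) * (2 * cmod z) ^ (r + 3)"
      unfolding Rm_def a_def by (rule taylor_remainder[OF L(1) L(3) z])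
    also have "\<dots> = B * (1 / sd N) ^ (r + 1) * \<bar>s\<bar> ^ (r + 3)"
    proof -
      have "r + 3 = (r + 1) + 2" by simp
      then show ?thesis unfolding nz sd2[symmetric] B_def
        using s0 sd by (simp only: power_add power_mult_distrib power_divide) (simp add: field_simps power2_eq_square)
    qed
    finally have Rm_le: "cmod Rm \<le> B * (1 / sd N) ^ (r + 1) * \<bar>s\<bar> ^ (r + 3)" .
    have "(\<Sum>k<r+3. a N k * z ^ k) = a N 2 * z\<^sup>2 + (\<Sum>k=1..r. a N (k + 2) * z ^ (k + 2))"
    proof -
      have set: "{..<r+3} = {0, 1, 2} \<union> (\<lambda>k. k + 2) ` {1..r}"
      proof (intro equalityI subsetI)
        fix k assume "k \<in> {..<r+3}"
        then show "k \<in> {0, 1, 2} \<union> (\<lambda>k. k + 2) ` {1..r}"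
          by (cases "k < 3") (auto intro!: image_eqI[of _ _ "k - 2"])
      qed auto
      have "(\<Sum>k<r+3. a N k * z ^ k) = (\<Sum>k\<in>{0, 1, 2}. a N k * z ^ k) + (\<Sum>k\<in>(\<lambda>k. k + 2) ` {1..r}. a N k * z ^ k)"
        unfolding set by (intro sum.union_disjoint) auto
      also have "(\<Sum>k\<in>(\<lambda>k. k + 2) ` {1..r}. a N k * z ^ k) = (\<Sum>k=1..r. a N (k + 2) * z ^ (k + 2))"
        by (subst sum.reindex) (auto simp: inj_on_def)
      also have "(\<Sum>k\<in>{0, 1, 2}. a N k * z ^ k) = a N 2 * z\<^sup>2" using a012[of N] by simp
      finally show ?thesis .
    qed
    also have "a N 2 * z\<^sup>2 = of_real (- s\<^sup>2 / 2)"
    proof -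
      have "z\<^sup>2 = of_real (- (s / (sd N * s0))\<^sup>2)" unfolding z_def power_mult_distrib by simp
      then have "a N 2 * z\<^sup>2 = of_real (s0\<^sup>2 * V N / 2 * - (s / (sd N * s0))\<^sup>2)"
        unfolding a012(3) by (simp only: of_real_mult)
      also have "s0\<^sup>2 * V N / 2 * - (s / (sd N * s0))\<^sup>2 = - s\<^sup>2 / 2"
        using s0 sd by (simp add: sd2[symmetric] power_divide power_mult_distrib)
      finally show ?thesis .
    qed
    also have "(\<Sum>k=1..r. a N (k + 2) * z ^ (k + 2)) = cum_exp (\<kappa> N) r (1 / sd N) (\<i> * s)"
      unfolding cum_exp_def
    proof (intro sum.cong refl)
      fix k
      have "z = (\<i> * s) * of_real (1 / (sd N * s0))" by (simp add: z_def)
      then have zk: "z ^ (k + 2) = (\<i> * s) ^ (k + 2) * of_real ((1 / (sd N * s0)) ^ (k + 2))"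
        by (simp only: power_mult_distrib of_real_power)
      have "\<kappa> N k * (1 / sd N) ^ k = Re (a N (k + 2)) * (1 / (sd N * s0)) ^ (k + 2)"
        using s0 sd by (simp add: \<kappa>_def power_divide power_mult_distrib power2_eq_square field_simps)
      then have "complex_of_real (\<kappa> N k) * of_real (1 / sd N) ^ k = of_real (Re (a N (k + 2))) * of_real ((1 / (sd N * s0)) ^ (k + 2))"
        by (simp only: of_real_mult[symmetric] of_real_power[symmetric])
      then show "a N (k + 2) * z ^ (k + 2) = complex_of_real (\<kappa> N k) * of_real (1 / sd N) ^ k * (\<i> * s) ^ (k + 2)"
        by (subst a_real) (simp only: zk mult_ac)
    qed
    finally have "L N z = of_real (- s\<^sup>2 / 2) + cum_exp (\<kappa> N) r (1 / sd N) (\<i> * s) + Rm" by (simp add: Rm_def)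
    then have "char (law N) s = exp (of_real (- s\<^sup>2 / 2)) * exp (cum_exp (\<kappa> N) r (1 / sd N) (\<i> * s) + Rm)"
      using \<open>char (law N) s = exp (L N z)\<close> by (simp only: exp_add mult.assoc)
    then show ?thesis using Rm_le unfolding exp_of_real by blast
  qed
  have sd_top: "filterlim sd at_top sequentially"
    unfolding sd_def by (intro filterlim_compose[OF sqrt_at_top V])
  have "\<forall>\<^sub>F N in sequentially. 1 \<le> sd N" using sd_top by (simp add: filterlim_at_top)
  then have "\<forall>\<^sub>F N in sequentially. \<forall>s. \<bar>s\<bar> \<le> \<delta> * sd N \<longrightarrow> (\<exists>Rm.
        char (law N) s = complex_of_real (exp (- s\<^sup>2 / 2)) * exp (cum_exp (\<kappa> N) r (1 / sd N) (\<i> * s) + Rm) \<and>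
        cmod Rm \<le> B * (1 / sd N) ^ (r + 1) * \<bar>s\<bar> ^ (r + 3))"
    by eventually_elim (use main in blast)
  moreover have "1 \<le> \<Lambda>" "0 \<le> B" "0 < \<delta>" using s0 by (auto simp: \<Lambda>_def B_def \<delta>_def intro!: sum_nonneg)
  ultimately show ?thesis using \<kappa> by (intro exI[of _ \<kappa>] exI[of _ \<Lambda>] exI[of _ B] exI[of _ \<delta>]) blast
qed

end

section \<open>Uniformly elliptic chains\<close>

text \<open>The joint law of the past and the next state, and the past composed with the kernel, are
  two measures on one product space. On rectangles they agree by the defining property of
  conditional expectation, hence they coincide, and G is integrated against both.\<close>

lemma markov_of_cond_exp:
  fixes G :: "'w \<times> 'a \<Rightarrow> complex"
  assumes "prob_space M" and sub: "subalgebra M F" and X: "X \<in> F \<rightarrow>\<^sub>M A" and X': "X' \<in> M \<rightarrow>\<^sub>M A'"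
    and \<kappa>: "\<kappa> \<in> A \<rightarrow>\<^sub>M prob_algebra A'"
    and ce: "\<And>B. B \<in> sets A' \<Longrightarrow> AE \<omega> in M. real_cond_exp M F (\<lambda>\<omega>. indicator B (X' \<omega>)) \<omega> = measure (\<kappa> (X \<omega>)) B"
    and G: "bdd_meas (F \<Otimes>\<^sub>M A') G"
  shows "(\<integral>\<omega>. G (\<omega>, X' \<omega>) \<partial>M) = (\<integral>\<omega>. (\<integral>y. G (\<omega>, y) \<partial>\<kappa> (X \<omega>)) \<partial>M)"
proof -
  interpret prob_space M by fact
  interpret finite_measure_subalgebra M F by unfold_locales (rule sub)
  have spF: "space F = space M" and setsF: "sets F \<subseteq> sets M" using sub by (auto simp: subalgebra_def)
  define Mr where "Mr = restr_to_subalg M F"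
  have sets_Mr [measurable_cong]: "sets Mr = sets F" unfolding Mr_def by (rule sets_restr_to_subalg[OF sub])
  have sp_Mr: "space Mr = space M" unfolding Mr_def by (rule space_restr_to_subalg)
  have fin_Mr: "finite_measure Mr" unfolding Mr_def by (rule finite_measure_restr_to_subalg[OF sub]) unfold_locales
  have kx: "prob_space (\<kappa> (X \<omega>))" "sets (\<kappa> (X \<omega>)) = sets A'" "space (\<kappa> (X \<omega>)) = space A'" if "\<omega> \<in> space M" for \<omega>
  proof -
    have "\<kappa> (X \<omega>) \<in> space (prob_algebra A')"
      using measurable_space[OF \<kappa>] measurable_space[OF X] that by (simp add: spF)
    then show "prob_space (\<kappa> (X \<omega>))" "sets (\<kappa> (X \<omega>)) = sets A'" "space (\<kappa> (X \<omega>)) = space A'"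
      by (auto simp: space_prob_algebra dest: sets_eq_imp_space_eq)
  qed
  define k where "k \<omega> = distr (\<kappa> (X \<omega>)) (F \<Otimes>\<^sub>M A') (Pair \<omega>)" for \<omega>
  have \<kappa>X: "(\<lambda>\<omega>. \<kappa> (X \<omega>)) \<in> Mr \<rightarrow>\<^sub>M subprob_algebra A'"
    using measurable_compose[OF X measurable_prob_algebraD[OF \<kappa>]] by (simp cong: measurable_cong_sets)
  have k: "k \<in> Mr \<rightarrow>\<^sub>M subprob_algebra (F \<Otimes>\<^sub>M A')"
    unfolding k_def[abs_def] by (rule measurable_distr2[OF _ \<kappa>X]) measurable
  have X'm: "(\<lambda>\<omega>. (\<omega>, X' \<omega>)) \<in> M \<rightarrow>\<^sub>M F \<Otimes>\<^sub>M A'"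
    using measurable_from_subalg[OF sub measurable_ident] X' by (intro measurable_Pair) (auto simp: id_def)
  have Pair_m: "Pair \<omega> \<in> \<kappa> (X \<omega>) \<rightarrow>\<^sub>M F \<Otimes>\<^sub>M A'" if "\<omega> \<in> space M" for \<omega>
    using that by (simp add: measurable_cong_sets[OF kx(2) refl] spF)
  define \<nu>1 where "\<nu>1 = distr M (F \<Otimes>\<^sub>M A') (\<lambda>\<omega>. (\<omega>, X' \<omega>))"
  define \<nu>2 where "\<nu>2 = Mr \<bind> k"
  have ne: "space Mr \<noteq> {}" using not_empty by (simp add: sp_Mr)
  have rect: "emeasure \<nu>1 (B \<times> D) = emeasure \<nu>2 (B \<times> D)" if B: "B \<in> sets F" and D: "D \<in> sets A'" for B D
  proof -
    have BM: "B \<in> sets M" using B setsF by auto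
    have D': "X' -` D \<inter> space M \<in> sets M" using X' D by (rule measurable_sets)
    have \<kappa>D: "(\<lambda>\<omega>. measure (\<kappa> (X \<omega>)) D) \<in> borel_measurable F"
      using measurable_compose[OF X measurable_compose[OF measurable_prob_algebraD[OF \<kappa>] measurable_measure_subprob_algebra[OF D]]]
      by simp
    then have \<kappa>DM: "(\<lambda>\<omega>. measure (\<kappa> (X \<omega>)) D) \<in> borel_measurable M" by (rule measurable_from_subalg[OF sub])
    have le1: "measure (\<kappa> (X \<omega>)) D \<le> 1" if "\<omega> \<in> space M" for \<omega> using prob_space.prob_le_1[OF kx(1)[OF that]] .
    have "emeasure \<nu>1 (B \<times> D) = emeasure M (B \<inter> (X' -` D \<inter> space M))"
      unfolding \<nu>1_def using B D X'm sets.sets_into_space[OF BM]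
      by (subst emeasure_distr) (auto intro!: arg_cong[where f = "emeasure M"])
    also have "\<dots> = ennreal (\<integral>\<omega>. indicator B \<omega> * indicator D (X' \<omega>) \<partial>M)"
    proof -
      have "(\<integral>\<omega>. (indicator B \<omega> :: real) * indicator D (X' \<omega>) \<partial>M) = (\<integral>\<omega>. indicator (B \<inter> (X' -` D \<inter> space M)) \<omega> \<partial>M)"
        by (intro Bochner_Integration.integral_cong) (auto simp: indicator_def)
      also have "\<dots> = measure M (B \<inter> (X' -` D \<inter> space M))"
        using sets.sets_into_space[OF BM] by (simp add: Int_absorb2 le_infI1)
      finally show ?thesis by (simp add: emeasure_eq_measure)
    qed
    also have "(\<integral>\<omega>. indicator B \<omega> * indicator D (X' \<omega>) \<partial>M) = (\<integral>\<omega>. indicator B \<omega> * measure (\<kappa> (X \<omega>)) D \<partial>M)"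
    proof -
      have iD: "integrable M (\<lambda>\<omega>. indicator D (X' \<omega>) :: real)"
        using X' D by (intro integrable_const_bound[where B = 1]) auto
      have "(\<integral>\<omega>. (indicator B \<omega> :: real) * indicator D (X' \<omega>) \<partial>M) = (\<integral>\<omega>\<in>B. indicator D (X' \<omega>) \<partial>M)"
        by (simp add: set_lebesgue_integral_def)
      also have "\<dots> = (\<integral>\<omega>\<in>B. real_cond_exp M F (\<lambda>\<omega>. indicator D (X' \<omega>)) \<omega> \<partial>M)"
        by (rule real_cond_exp_intA[OF iD B])
      also have "\<dots> = (\<integral>\<omega>. indicator B \<omega> * measure (\<kappa> (X \<omega>)) D \<partial>M)"
        unfolding set_lebesgue_integral_def
      proof (rule integral_cong_AE)
        show "AE \<omega> in M. indicator B \<omega> *\<^sub>R real_cond_exp M F (\<lambda>\<omega>. indicator D (X' \<omega>)) \<omega> = indicator B \<omega> * measure (\<kappa> (X \<omega>)) D"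
          using ce[OF D] by eventually_elim simp
      qed (use BM \<kappa>DM in auto)
      finally show ?thesis .
    qed
    also have "ennreal \<dots> = (\<integral>\<^sup>+\<omega>. ennreal (indicator B \<omega> * measure (\<kappa> (X \<omega>)) D) \<partial>M)"
    proof (rule nn_integral_eq_integral[symmetric])
      show "integrable M (\<lambda>\<omega>. indicator B \<omega> * measure (\<kappa> (X \<omega>)) D)"
        using BM \<kappa>DM le1 by (intro integrable_const_bound[where B = 1]) (auto simp: indicator_def)
    qed auto
    also have "\<dots> = (\<integral>\<^sup>+\<omega>. ennreal (indicator B \<omega> * measure (\<kappa> (X \<omega>)) D) \<partial>Mr)"
      unfolding Mr_def
      by (intro nn_integral_subalgebra2[OF sub, symmetric] measurable_compose[OF _ measurable_ennreal]
          borel_measurable_times borel_measurable_indicator B \<kappa>D)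
    also have "\<dots> = (\<integral>\<^sup>+\<omega>. emeasure (k \<omega>) (B \<times> D) \<partial>Mr)"
    proof (rule nn_integral_cong)
      fix \<omega> assume "\<omega> \<in> space Mr"
      then have \<omega>: "\<omega> \<in> space M" by (simp add: sp_Mr)
      interpret kx: prob_space "\<kappa> (X \<omega>)" by (rule kx[OF \<omega>])
      have "emeasure (k \<omega>) (B \<times> D) = emeasure (\<kappa> (X \<omega>)) (Pair \<omega> -` (B \<times> D) \<inter> space (\<kappa> (X \<omega>)))"
        unfolding k_def using B D by (intro emeasure_distr Pair_m \<omega>) auto
      also have "Pair \<omega> -` (B \<times> D) \<inter> space (\<kappa> (X \<omega>)) = (if \<omega> \<in> B then D else {})"
        using sets.sets_into_space[OF D] by (auto simp: kx[OF \<omega>])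
      finally show "ennreal (indicator B \<omega> * measure (\<kappa> (X \<omega>)) D) = emeasure (k \<omega>) (B \<times> D)"
        by (simp add: kx.emeasure_eq_measure)
    qed
    also have "\<dots> = emeasure \<nu>2 (B \<times> D)"
      unfolding \<nu>2_def using B D by (intro emeasure_bind[symmetric, OF ne k]) auto
    finally show ?thesis .
  qed
  have "\<nu>1 = \<nu>2"
  proof (rule measure_eqI_generator_eq[where E = "{B \<times> D | B D. B \<in> sets F \<and> D \<in> sets A'}" and \<Omega> = "space F \<times> space A'" and A = "\<lambda>_. space F \<times> space A'"])
    show "Int_stable {B \<times> D | B D. B \<in> sets F \<and> D \<in> sets A'}"
      by (rule Int_stable_pair_measure_generator)
    show "{B \<times> D | B D. B \<in> sets F \<and> D \<in> sets A'} \<subseteq> Pow (space F \<times> space A')"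
      by (rule pair_measure_closed)
    show "sets \<nu>1 = sigma_sets (space F \<times> space A') {B \<times> D | B D. B \<in> sets F \<and> D \<in> sets A'}"
      by (simp add: \<nu>1_def sets_pair_measure)
    show "sets \<nu>2 = sigma_sets (space F \<times> space A') {B \<times> D | B D. B \<in> sets F \<and> D \<in> sets A'}"
    proof -
      have "sets \<nu>2 = sets (F \<Otimes>\<^sub>M A')"
        unfolding \<nu>2_def by (rule sets_bind[OF _ ne]) (rule sets_kernel[OF k])
      then show ?thesis by (simp only: sets_pair_measure)
    qed
    show "emeasure \<nu>1 (space F \<times> space A') \<noteq> \<infinity>" for i :: nat
    proof -
      interpret \<nu>1: prob_space \<nu>1 unfolding \<nu>1_def by (rule prob_space_distr[OF X'm])
      show ?thesis by simp
    qed
  qed (use rect in \<open>auto\<close>)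
  obtain Bd where Bd: "G \<in> borel_measurable (F \<Otimes>\<^sub>M A')" "0 \<le> Bd" "\<And>p. p \<in> space (F \<Otimes>\<^sub>M A') \<Longrightarrow> cmod (G p) \<le> Bd"
    using G by (elim bdd_measE) blast
  have real_case: "(\<integral>\<omega>. Gr (\<omega>, X' \<omega>) \<partial>M) = (\<integral>\<omega>. (\<integral>y. Gr (\<omega>, y) \<partial>\<kappa> (X \<omega>)) \<partial>M)"
    if Gr: "Gr \<in> borel_measurable (F \<Otimes>\<^sub>M A')" "\<And>p. p \<in> space (F \<Otimes>\<^sub>M A') \<Longrightarrow> \<bar>Gr p\<bar> \<le> Bd" for Gr :: "'w \<times> 'a \<Rightarrow> real"
  proof -
    have "(\<integral>\<omega>. Gr (\<omega>, X' \<omega>) \<partial>M) = (\<integral>p. Gr p \<partial>\<nu>1)"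
      unfolding \<nu>1_def by (rule integral_distr[OF X'm Gr(1), symmetric])
    also have "\<dots> = (\<integral>p. Gr p \<partial>\<nu>2)" by (simp add: \<open>\<nu>1 = \<nu>2\<close>)
    also have "\<dots> = (\<integral>\<omega>. (\<integral>p. Gr p \<partial>k \<omega>) \<partial>Mr)"
      unfolding \<nu>2_def
    proof (rule integral_bind[OF Gr k fin_Mr, of 1])
      show "AE \<omega> in Mr. emeasure (k \<omega>) (space (k \<omega>)) \<le> ennreal 1"
        using measurable_space[OF k] by (intro AE_I2) (auto simp: space_subprob_algebra subprob_space.emeasure_space_le_1)
    qed
    also have "\<dots> = (\<integral>\<omega>. (\<integral>p. Gr p \<partial>k \<omega>) \<partial>M)"
      unfolding Mr_def
    proof (rule integral_subalgebra2[OF sub])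
      show "(\<lambda>\<omega>. \<integral>p. Gr p \<partial>k \<omega>) \<in> borel_measurable F"
        using measurable_compose[OF k integral_measurable_subprob_algebra[OF Gr(1)]] by (simp cong: measurable_cong_sets)
    qed
    also have "\<dots> = (\<integral>\<omega>. (\<integral>y. Gr (\<omega>, y) \<partial>\<kappa> (X \<omega>)) \<partial>M)"
      unfolding k_def using Gr(1) Pair_m by (intro Bochner_Integration.integral_cong refl integral_distr)
    finally show ?thesis .
  qed
  define H where "H \<omega> = (\<integral>y. G (\<omega>, y) \<partial>\<kappa> (X \<omega>))" for \<omega>
  have Gint: "integrable (\<kappa> (X \<omega>)) (\<lambda>y. G (\<omega>, y))" if \<omega>: "\<omega> \<in> space M" for \<omega>
  proof -
    interpret kx: prob_space "\<kappa> (X \<omega>)" by (rule kx[OF \<omega>])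
    show ?thesis
      using Bd measurable_compose[OF Pair_m[OF \<omega>] Bd(1)] \<omega>
      by (intro kx.integrable_const_bound[where B = Bd]) (auto simp: kx[OF \<omega>] space_pair_measure spF)
  qed
  have H_meas: "H \<in> borel_measurable M"
  proof -
    have "(\<lambda>\<omega>. \<integral>p. G p \<partial>k \<omega>) \<in> borel_measurable F"
      using measurable_compose[OF k integral_measurable_subprob_algebra[OF Bd(1)]] by (simp cong: measurable_cong_sets)
    then have "(\<lambda>\<omega>. \<integral>p. G p \<partial>k \<omega>) \<in> borel_measurable M" by (rule measurable_from_subalg[OF sub])
    also have "?this \<longleftrightarrow> H \<in> borel_measurable M"
      unfolding k_def H_def[abs_def] using Bd(1) Pair_m by (intro measurable_cong integral_distr)
    finally show ?thesis .
  qed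
  have "cmod (H \<omega>) \<le> Bd" if \<omega>: "\<omega> \<in> space M" for \<omega>
    unfolding H_def using Bd \<omega> by (intro prob_space.norm_integral_le kx) (auto simp: kx[OF \<omega>] space_pair_measure spF)
  with H_meas have H_int: "integrable M H" by (intro integrable_const_bound[where B = Bd]) auto
  have GX_int: "integrable M (\<lambda>\<omega>. G (\<omega>, X' \<omega>))"
    using Bd measurable_compose[OF X'm Bd(1)] measurable_space[OF X'] spF
    by (intro integrable_const_bound[where B = Bd]) (auto simp: space_pair_measure)
  have "Re (\<integral>\<omega>. G (\<omega>, X' \<omega>) \<partial>M) = (\<integral>\<omega>. (\<integral>y. Re (G (\<omega>, y)) \<partial>\<kappa> (X \<omega>)) \<partial>M)"
    unfolding integral_Re[OF GX_int, symmetric]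
  proof (rule real_case)
    show "(\<lambda>p. Re (G p)) \<in> borel_measurable (F \<Otimes>\<^sub>M A')" using Bd(1) by measurable
    show "\<bar>Re (G p)\<bar> \<le> Bd" if "p \<in> space (F \<Otimes>\<^sub>M A')" for p
      by (rule order_trans[OF abs_Re_le_cmod Bd(3)[OF that]])
  qed
  also have "\<dots> = (\<integral>\<omega>. Re (H \<omega>) \<partial>M)"
    unfolding H_def by (intro Bochner_Integration.integral_cong refl) (simp add: Gint)
  also have "\<dots> = Re (\<integral>\<omega>. H \<omega> \<partial>M)" by (rule integral_Re[OF H_int])
  finally have re: "Re (\<integral>\<omega>. G (\<omega>, X' \<omega>) \<partial>M) = Re (\<integral>\<omega>. H \<omega> \<partial>M)" .
  have "Im (\<integral>\<omega>. G (\<omega>, X' \<omega>) \<partial>M) = (\<integral>\<omega>. (\<integral>y. Im (G (\<omega>, y)) \<partial>\<kappa> (X \<omega>)) \<partial>M)"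
    unfolding integral_Im[OF GX_int, symmetric]
  proof (rule real_case)
    show "(\<lambda>p. Im (G p)) \<in> borel_measurable (F \<Otimes>\<^sub>M A')" using Bd(1) by measurable
    show "\<bar>Im (G p)\<bar> \<le> Bd" if "p \<in> space (F \<Otimes>\<^sub>M A')" for p
      by (rule order_trans[OF abs_Im_le_cmod Bd(3)[OF that]])
  qed
  also have "\<dots> = (\<integral>\<omega>. Im (H \<omega>) \<partial>M)"
    unfolding H_def by (intro Bochner_Integration.integral_cong refl) (simp add: Gint)
  also have "\<dots> = Im (\<integral>\<omega>. H \<omega> \<partial>M)" by (rule integral_Im[OF H_int])
  finally show ?thesis using re by (simp add: complex_eq_iff H_def)
qed

text \<open>By Fubini the middle state may be integrated first, and then the lower bound on the
  two-step density applies at each endpoint z.\<close>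

lemma minorization_of_density:
  fixes g :: "'a \<Rightarrow> real" and p p' :: "'a \<Rightarrow> 'a \<Rightarrow> real"
  assumes m1: "m1 \<in> space (prob_algebra S1)" and m2: "m2 \<in> space (prob_algebra S2)"
    and x: "x \<in> space S0"
    and p: "case_prod p \<in> borel_measurable (S0 \<Otimes>\<^sub>M S1)" "\<And>y. y \<in> space S1 \<Longrightarrow> 0 \<le> p x y \<and> p x y \<le> c"
    and p': "case_prod p' \<in> borel_measurable (S1 \<Otimes>\<^sub>M S2)" "\<And>y z. y \<in> space S1 \<Longrightarrow> z \<in> space S2 \<Longrightarrow> 0 \<le> p' y z \<and> p' y z \<le> c"
    and K: "K x = density m1 (\<lambda>y. ennreal (p x y))"
    and K': "\<And>y. y \<in> space S1 \<Longrightarrow> K' y = density m2 (\<lambda>z. ennreal (p' y z))"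
    and low: "\<And>z. z \<in> space S2 \<Longrightarrow> \<epsilon> \<le> (\<integral>y. p x y * p' y z \<partial>m1)"
    and g: "bdd_meas S2 g" "\<And>z. z \<in> space S2 \<Longrightarrow> 0 \<le> g z"
  shows "\<epsilon> * (\<integral>z. g z \<partial>m2) \<le> (\<integral>y. (\<integral>z. g z \<partial>K' y) \<partial>K x)"
proof -
  have s1 [measurable_cong]: "sets m1 = sets S1" and "prob_space m1" and sp1: "space m1 = space S1"
    using m1 by (auto simp: space_prob_algebra dest: sets_eq_imp_space_eq)
  have s2 [measurable_cong]: "sets m2 = sets S2" and "prob_space m2" and sp2: "space m2 = space S2"
    using m2 by (auto simp: space_prob_algebra dest: sets_eq_imp_space_eq)
  interpret m1: prob_space m1 by fact
  interpret m2: prob_space m2 by fact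
  interpret pr: pair_prob_space m1 m2 ..
  obtain Bg where Bg: "g \<in> borel_measurable S2" "0 \<le> Bg" "\<And>z. z \<in> space S2 \<Longrightarrow> \<bar>g z\<bar> \<le> Bg"
    using g(1) by (elim bdd_measE) auto
  note Bg(1)[measurable]
  have px [measurable]: "p x \<in> borel_measurable S1"
    using measurable_compose[OF measurable_Pair1'[OF x] p(1)] by simp
  have p'y: "p' y \<in> borel_measurable S2" if "y \<in> space S1" for y
    using measurable_compose[OF measurable_Pair1'[OF that] p'(1)] by simp
  note p'(1)[measurable]
  define F where "F y z = p x y * (p' y z * g z)" for y z
  have F_meas: "case_prod F \<in> borel_measurable (m1 \<Otimes>\<^sub>M m2)"
    unfolding F_def by measurable
  obtain y0 where "y0 \<in> space S1" using m1.not_empty sp1 by auto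
  then have c: "0 \<le> c" using p(2) by force
  have F_le: "\<bar>F y z\<bar> \<le> c * (c * Bg)" if "y \<in> space S1" "z \<in> space S2" for y z
    unfolding F_def abs_mult using p(2) p'(2) Bg that c by (intro mult_mono) auto
  have F_int: "integrable (m1 \<Otimes>\<^sub>M m2) (case_prod F)"
    by (rule pr.P.integrable_const_bound[OF _ F_meas, of "c * (c * Bg)"])
      (auto simp: space_pair_measure sp1 sp2 F_le)
  have inner: "(\<integral>z. g z \<partial>K' y) = (\<integral>z. p' y z * g z \<partial>m2)" if y: "y \<in> space S1" for y
    unfolding K'[OF y] using p'y[OF y] p'(2)[OF y] by (subst integral_real_density) (auto simp: sp2)
  have meas1: "(\<lambda>y. \<integral>z. p' y z * g z \<partial>m2) \<in> borel_measurable m1"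
    by (rule m2.borel_measurable_lebesgue_integral) measurable
  have "\<epsilon> * (\<integral>z. g z \<partial>m2) = (\<integral>z. \<epsilon> * g z \<partial>m2)" by simp
  also have "\<dots> \<le> (\<integral>z. (\<integral>y. F y z \<partial>m1) \<partial>m2)"
  proof (rule integral_mono_AE)
    show "integrable m2 (\<lambda>z. \<epsilon> * g z)"
      using Bg by (intro integrable_mult_right m2.integrable_const_bound[where B = Bg]) (auto simp: sp2)
    show "integrable m2 (\<lambda>z. \<integral>y. F y z \<partial>m1)" using pr.integrable_snd[OF F_int] .
    show "AE z in m2. \<epsilon> * g z \<le> (\<integral>y. F y z \<partial>m1)"
    proof (rule AE_I2)
      fix z assume "z \<in> space m2"
      then have z: "z \<in> space S2" by (simp add: sp2)
      have "(\<integral>y. F y z \<partial>m1) = (\<integral>y. p x y * p' y z * g z \<partial>m1)" by (simp add: F_def mult_ac)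
      also have "\<dots> = (\<integral>y. p x y * p' y z \<partial>m1) * g z" by simp
      finally show "\<epsilon> * g z \<le> (\<integral>y. F y z \<partial>m1)" using low[OF z] g(2)[OF z] by (simp add: mult_right_mono)
    qed
  qed
  also have "\<dots> = (\<integral>y. (\<integral>z. F y z \<partial>m2) \<partial>m1)" by (rule pr.Fubini_integral[OF F_int])
  also have "\<dots> = (\<integral>y. p x y * (\<integral>z. p' y z * g z \<partial>m2) \<partial>m1)" by (simp add: F_def)
  also have "\<dots> = (\<integral>y. p x y * (\<integral>z. g z \<partial>K' y) \<partial>m1)"
    by (intro Bochner_Integration.integral_cong) (auto simp: inner sp1)
  also have "\<dots> = (\<integral>y. (\<integral>z. g z \<partial>K' y) \<partial>K x)"
  proof -
    have "(\<lambda>y. \<integral>z. g z \<partial>K' y) \<in> borel_measurable m1"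
      using meas1 by (rule measurable_cong[THEN iffD1, rotated]) (simp add: inner sp1)
    then show ?thesis unfolding K using p(2) by (subst integral_real_density) (auto simp: sp1)
  qed
  finally show ?thesis .
qed

text \<open>Time is shifted by one, so the reference measure reached after two steps from the
  shifted time n has the original index n + 3. Lowering the ellipticity constant to at most 1/2
  preserves the minorization.\<close>

lemma elliptic_chain_of_markov:
  assumes mc: "is_markov_chain M S \<mu>\<^sub>1 R X" and ue: "uniformly_elliptic S R"
  shows "\<exists>Fn \<nu> \<epsilon>. elliptic_chain M (\<lambda>n. S (Suc n)) (\<lambda>n. R (Suc n)) (\<lambda>n. X (Suc n)) Fn \<nu> \<epsilon>"
proof -
  interpret prob_space M using mc by (simp add: is_markov_chain_def)
  have R: "R j \<in> S j \<rightarrow>\<^sub>M prob_algebra (S (Suc j))" and X: "X j \<in> M \<rightarrow>\<^sub>M S j" if "1 \<le> j" for j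
    using mc that by (auto simp: is_markov_chain_def)
  define path where "path n \<omega> = (\<lambda>i\<in>{1..Suc n}. X i \<omega>)" for n \<omega>
  define Fn where "Fn n = vimage_algebra (space M) (path n) (PiM {1..Suc n} S)" for n
  have ce: "AE \<omega> in M. real_cond_exp M (Fn n) (\<lambda>\<omega>. indicator A (X (Suc (Suc n)) \<omega>)) \<omega> = measure (R (Suc n) (X (Suc n) \<omega>)) A"
    if "A \<in> sets (S (Suc (Suc n)))" for n A
    using mc that unfolding is_markov_chain_def Fn_def path_def by simp
  have sp: "space (Fn n) = space M" for n by (simp add: Fn_def)
  have path_m: "path n \<in> N \<rightarrow>\<^sub>M PiM {1..Suc n} S" if "\<And>i. i \<in> {1..Suc n} \<Longrightarrow> X i \<in> N \<rightarrow>\<^sub>M S i" for n N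
    unfolding path_def[abs_def] using that by (rule measurable_restrict)
  \<comment> \<open>Stated for a general N, so that one argument yields inclusion both in M and in
    the later \<open>Fn n\<close>.\<close>
  have sub: "subalgebra N (Fn n)" if "space N = space M" "\<And>i. i \<in> {1..Suc n} \<Longrightarrow> X i \<in> N \<rightarrow>\<^sub>M S i" for N n
    using path_m[of n N] that unfolding subalgebra_def Fn_def by (simp add: measurable_iff_sets)
  have adapted: "X i \<in> Fn n \<rightarrow>\<^sub>M S i" if "i \<in> {1..Suc n}" for i n
  proof -
    have "path n \<in> Fn n \<rightarrow>\<^sub>M PiM {1..Suc n} S"
      unfolding Fn_def
    proof (rule measurable_vimage_algebra1)
      show "path n \<in> space M \<rightarrow> space (PiM {1..Suc n} S)"
        using measurable_space[OF path_m[of n M]] X by auto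
    qed
    from measurable_compose[OF this measurable_component_singleton[OF that]]
    show ?thesis using that by (simp add: path_def)
  qed
  obtain \<epsilon>0 m p where \<epsilon>0: "0 < \<epsilon>0" and m: "\<And>j. 1 < j \<Longrightarrow> m j \<in> space (prob_algebra (S j))"
    and p: "\<And>j. 1 \<le> j \<Longrightarrow> case_prod (p j) \<in> borel_measurable (S j \<Otimes>\<^sub>M S (Suc j))"
      "\<And>j x y. 1 \<le> j \<Longrightarrow> x \<in> space (S j) \<Longrightarrow> y \<in> space (S (Suc j)) \<Longrightarrow> 0 \<le> p j x y \<and> p j x y \<le> 1 / \<epsilon>0"
      "\<And>j x. 1 \<le> j \<Longrightarrow> x \<in> space (S j) \<Longrightarrow> R j x = density (m (Suc j)) (\<lambda>y. ennreal (p j x y))"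
      "\<And>j x z. 1 \<le> j \<Longrightarrow> x \<in> space (S j) \<Longrightarrow> z \<in> space (S (Suc (Suc j))) \<Longrightarrow> \<epsilon>0 \<le> (\<integral>y. p j x y * p (Suc j) y z \<partial>m (Suc j))"
    using ue unfolding uniformly_elliptic_def by blast
  define \<epsilon> where "\<epsilon> = min \<epsilon>0 (1/2)"
  have "elliptic_chain M (\<lambda>n. S (Suc n)) (\<lambda>n. R (Suc n)) (\<lambda>n. X (Suc n)) Fn (\<lambda>n. m (Suc (Suc (Suc n)))) \<epsilon>"
  proof unfold_locales
    show "R (Suc n) \<in> S (Suc n) \<rightarrow>\<^sub>M prob_algebra (S (Suc (Suc n)))" for n by (rule R) simp
    show sM: "subalgebra M (Fn n)" for n using X by (intro sub) auto
    show "subalgebra (Fn n) (Fn k)" if "k \<le> n" for k n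
      using that by (intro sub adapted sp) auto
    show "X (Suc k) \<in> Fn n \<rightarrow>\<^sub>M S (Suc k)" if "k \<le> n" for k n using that by (intro adapted) auto
    show "(\<integral>\<omega>. G (\<omega>, X (Suc (Suc n)) \<omega>) \<partial>M) = (\<integral>\<omega>. (\<integral>y. G (\<omega>, y) \<partial>R (Suc n) (X (Suc n) \<omega>)) \<partial>M)"
      if "bdd_meas (Fn n \<Otimes>\<^sub>M S (Suc (Suc n))) G" for n and G :: "_ \<Rightarrow> complex"
      by (rule markov_of_cond_exp[OF prob_space_axioms sM[of n] adapted X R ce that]) auto
    show "m (Suc (Suc (Suc n))) \<in> space (prob_algebra (S (Suc (Suc (Suc n)))))" for n by (rule m) simp
    show "0 < \<epsilon>" "\<epsilon> \<le> 1/2" using \<epsilon>0 by (auto simp: \<epsilon>_def)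
    fix n x and g :: "_ \<Rightarrow> real"
    assume x: "x \<in> space (S (Suc n))" and g: "bdd_meas (S (Suc (Suc (Suc n)))) g"
      "\<And>y. y \<in> space (S (Suc (Suc (Suc n)))) \<Longrightarrow> 0 \<le> g y"
    have "\<epsilon>0 * (\<integral>y. g y \<partial>m (Suc (Suc (Suc n)))) \<le> (\<integral>y. (\<integral>z. g z \<partial>R (Suc (Suc n)) y) \<partial>R (Suc n) x)"
      by (rule minorization_of_density[where ?S0.0 = "S (Suc n)" and ?S1.0 = "S (Suc (Suc n))"
          and p = "p (Suc n)" and p' = "p (Suc (Suc n))" and K = "R (Suc n)" and K' = "R (Suc (Suc n))",
          OF m m x p(1) p(2)[OF _ x] p(1) p(2) p(3)[OF _ x] p(3) p(4)[OF _ x] g]) auto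
    moreover have "0 \<le> (\<integral>y. g y \<partial>m (Suc (Suc (Suc n))))"
    proof -
      have "space (m (Suc (Suc (Suc n)))) = space (S (Suc (Suc (Suc n))))"
        using m[of "Suc (Suc (Suc n))"] by (auto simp: space_prob_algebra dest: sets_eq_imp_space_eq)
      then show ?thesis using g(2) by (intro integral_nonneg_AE AE_I2) auto
    qed
    ultimately show "\<epsilon> * (\<integral>y. g y \<partial>m (Suc (Suc (Suc n)))) \<le> (\<integral>y. (\<integral>z. g z \<partial>R (Suc (Suc n)) y) \<partial>R (Suc n) x)"
      using mult_right_mono[of \<epsilon> \<epsilon>0 "\<integral>y. g y \<partial>m (Suc (Suc (Suc n)))"] by (simp add: \<epsilon>_def)
  qed
  then show ?thesis by blast
qed

section \<open>The Edgeworth polynomials\<close>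

lemma degree_hermite_le: "degree (hermite n) \<le> n"
proof (induction n rule: hermite.induct)
  case (3 n)
  have "degree ([:0, 1:] * hermite (Suc n)) \<le> Suc (Suc n)"
    using degree_mult_le[of "[:0, 1:]" "hermite (Suc n)"] 3 by simp
  moreover have "degree (smult (real (Suc n)) (hermite n)) \<le> Suc (Suc n)"
    using degree_smult_le[of "real (Suc n)" "hermite n"] 3 by linarith
  ultimately show ?case unfolding hermite.simps by (intro degree_diff_le)
qed auto

text \<open>The monomial \<open>\<tau> x ^ (3 r)\<close> only serves to give all these polynomials the same degree.\<close>

definition edge_poly :: "(nat \<Rightarrow> real) \<Rightarrow> nat \<Rightarrow> real \<Rightarrow> nat \<Rightarrow> real poly" where
  "edge_poly \<kappa> r \<tau> j = monom \<tau> (3 * r) - (\<Sum>k=1..3*r. smult (edge_weight \<kappa> r j k) (hermite (k - 1)))"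

text \<open>The Hermite polynomials involved have degree at most 3 r - 1, so the monomial is the
  leading term whatever the cumulants are.\<close>

lemma degree_edge_poly:
  assumes "\<tau> \<noteq> 0" "1 \<le> r"
  shows "degree (edge_poly \<kappa> r \<tau> j) = 3 * r"
proof -
  have "degree (\<Sum>k=1..3*r. smult (edge_weight \<kappa> r j k) (hermite (k - 1))) \<le> 3 * r - 1"
  proof (intro degree_sum_le)
    fix k assume "k \<in> {1..3*r}"
    then show "degree (smult (edge_weight \<kappa> r j k) (hermite (k - 1))) \<le> 3 * r - 1"
      using degree_smult_le[of "edge_weight \<kappa> r j k" "hermite (k - 1)"] degree_hermite_le[of "k - 1"] by auto
  qed simp
  also have "\<dots> < degree (monom \<tau> (3 * r))" using assms by (simp add: degree_monom_eq)
  finally have "degree (monom \<tau> (3 * r) + - (\<Sum>k=1..3*r. smult (edge_weight \<kappa> r j k) (hermite (k - 1)))) = degree (monom \<tau> (3 * r))"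
    by (intro degree_add_eq_left) simp
  then show ?thesis using assms by (simp add: edge_poly_def degree_monom_eq)
qed

lemma abs_coeff_le: "\<bar>coeff p i\<bar> \<le> (\<Sum>i\<le>degree p. \<bar>coeff p i\<bar>)" for p :: "real poly"
proof (cases "i \<le> degree p")
  case True
  then show ?thesis by (intro member_le_sum) auto
next
  case False
  then show ?thesis by (simp add: coeff_eq_0 sum_nonneg)
qed

lemma edge_poly_coeff_le:
  assumes \<kappa>: "\<And>k. k \<in> {1..r} \<Longrightarrow> \<bar>\<kappa> k\<bar> \<le> \<Lambda>" and \<Lambda>: "1 \<le> \<Lambda>" and \<tau>: "\<bar>\<tau>\<bar> \<le> 1"
  shows "\<bar>coeff (edge_poly \<kappa> r \<tau> j) i\<bar> \<le> 1 + (\<Sum>k=1..3*r. r * (r * \<Lambda>) ^ r * (\<Sum>i\<le>degree (hermite (k - 1)). \<bar>coeff (hermite (k - 1)) i\<bar>))"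
proof -
  have "\<bar>coeff (edge_poly \<kappa> r \<tau> j) i\<bar> \<le> \<bar>coeff (monom \<tau> (3 * r)) i\<bar> + \<bar>\<Sum>k=1..3*r. edge_weight \<kappa> r j k * coeff (hermite (k - 1)) i\<bar>"
    by (simp add: edge_poly_def coeff_sum)
  also have "\<dots> \<le> 1 + (\<Sum>k=1..3*r. r * (r * \<Lambda>) ^ r * (\<Sum>i\<le>degree (hermite (k - 1)). \<bar>coeff (hermite (k - 1)) i\<bar>))"
  proof (intro add_mono order_trans[OF sum_abs] sum_mono)
    show "\<bar>coeff (monom \<tau> (3 * r)) i\<bar> \<le> 1" using \<tau> by simp
    fix k
    show "\<bar>edge_weight \<kappa> r j k * coeff (hermite (k - 1)) i\<bar> \<le> r * (r * \<Lambda>) ^ r * (\<Sum>i\<le>degree (hermite (k - 1)). \<bar>coeff (hermite (k - 1)) i\<bar>)"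
      unfolding abs_mult using \<Lambda> by (intro mult_mono edge_weight_le \<kappa> \<Lambda> abs_coeff_le) auto
  qed
  finally show ?thesis .
qed

text \<open>The same double sum is sorted by powers of w on the left and by Hermite index on the
  right; the padding monomial is the only difference.\<close>

lemma edge_cdf_eq_edge_poly:
  "cdf std_normal_distribution x + (\<Sum>j=1..r. poly (edge_poly \<kappa> r \<tau> j) x * std_normal_density x * w ^ j)
    = edge_cdf (edge_weights \<kappa> r w) (3 * r) x + (\<Sum>j=1..r. \<tau> * x ^ (3 * r) * std_normal_density x * w ^ j)"
proof -
  have "(\<Sum>j=1..r. poly (edge_poly \<kappa> r \<tau> j) x * std_normal_density x * w ^ j)
    = (\<Sum>j=1..r. \<tau> * x ^ (3 * r) * std_normal_density x * w ^ j) - (\<Sum>j=1..r. \<Sum>k=1..3*r. w ^ j * edge_weight \<kappa> r j k * poly (hermite (k - 1)) x * std_normal_density x)"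
    by (simp add: edge_poly_def poly_sum poly_monom algebra_simps sum_distrib_left sum_subtractf)
  also have "(\<Sum>j=1..r. \<Sum>k=1..3*r. w ^ j * edge_weight \<kappa> r j k * poly (hermite (k - 1)) x * std_normal_density x)
    = (\<Sum>k=1..3*r. edge_weights \<kappa> r w k * poly (hermite (k - 1)) x) * std_normal_density x"
    by (subst sum.swap) (simp add: edge_weights_def sum_distrib_right)
  finally show ?thesis by (simp add: edge_cdf_def)
qed

lemma abs_power_gauss_le: "\<bar>x ^ n * std_normal_density x\<bar> \<le> 1 + 4 ^ n * fact n"
proof -
  have "\<bar>x ^ n * std_normal_density x\<bar> = \<bar>x\<bar> ^ n * std_normal_density x" by (simp add: abs_mult power_abs)
  also have "\<dots> \<le> ((1 + 4 ^ n * fact n) * exp (x\<^sup>2 / 4)) * exp (- x\<^sup>2 / 2)"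
  proof (intro mult_mono abs_power_le_exp)
    have "1 \<le> sqrt (2 * pi)" using pi_ge_two by (intro real_le_rsqrt) auto
    then show "std_normal_density x \<le> exp (- x\<^sup>2 / 2)"
      using mult_right_mono[of "1 / sqrt (2 * pi)" 1 "exp (- x\<^sup>2 / 2)"] by (simp add: std_normal_density_def)
  qed auto
  also have "\<dots> = (1 + 4 ^ n * fact n) * (exp (x\<^sup>2 / 4) * exp (- x\<^sup>2 / 2))" by (simp only: mult.assoc)
  also have "exp (x\<^sup>2 / 4) * exp (- x\<^sup>2 / 2) = exp (- x\<^sup>2 / 4)"
    unfolding exp_add[symmetric] by (rule arg_cong[where f = exp]) simp
  also have "(1 + 4 ^ n * fact n) * exp (- x\<^sup>2 / 4) \<le> (1 + 4 ^ n * fact n) * 1"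
    by (intro mult_left_mono) auto
  finally show ?thesis by simp
qed

section \<open>Assembly and transfer to the original chain\<close>

context decaying_sum begin

text \<open>Equality is required only almost everywhere, because the original summands will be
  replaced by clipped versions. Mean, variance and law are insensitive to this.\<close>

theorem edgeworth_expansion_AE:
  fixes Tn :: "nat \<Rightarrow> 'a \<Rightarrow> real"
  assumes V: "filterlim V at_top sequentially" and r: "1 \<le> r" "real r < 1 / (1 - 2 * \<beta>)"
    and Tm: "\<And>N. Tn N \<in> borel_measurable M" and TZ: "\<And>N. AE \<omega> in M. Tn N \<omega> = Zs N 0 \<omega>"
  shows "edgeworth_expansion M Tn r"
proof -
  have Zm: "Zs N 0 \<in> borel_measurable M" for N by (rule bdd_meas_measurable[OF bdd_meas_Zs])
  have ET: "expectation (Tn N) = 0" for N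
    using integral_cong_AE[OF Tm Zm TZ, of N] expectation_Zs[of N 0] by simp
  have VT: "variance (Tn N) = V N" for N
    unfolding ET V_def using TZ[of N] Tm[of N] Zm[of N] by (intro integral_cong_AE) auto
  have sdT: "std_dev M (Tn N) = sd N" for N by (simp add: std_dev_def VT sd_def)
  have lawT: "distr M borel (normalized M (Tn N)) = law N" for N
    unfolding law_def
  proof (rule distr_cong_AE)
    show "AE \<omega> in M. normalized M (Tn N) \<omega> = Zs N 0 \<omega> / sd N"
      using TZ[of N] by eventually_elim (simp add: normalized_def ET sdT)
    show "normalized M (Tn N) \<in> M \<rightarrow>\<^sub>M borel" unfolding normalized_def[abs_def] using Tm[of N] by measurable
    show "(\<lambda>\<omega>. Zs N 0 \<omega> / sd N) \<in> M \<rightarrow>\<^sub>M borel" using Zm[of N] by measurable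
  qed auto
  define \<gamma> where "\<gamma> = 1 - 2 * \<beta>"
  have \<gamma>: "0 < \<gamma>" "\<gamma> < 1" using \<beta> by (auto simp: \<gamma>_def)
  have r\<gamma>: "r * \<gamma> < 1" using r(2) \<gamma> unfolding \<gamma>_def[symmetric] by (simp add: pos_less_divide_eq)
  \<comment> \<open>The requirement of \<open>law_decay\<close> is equivalent to (r + \<rho>)
    \<gamma> < 1; half of the slack in r \<gamma> < 1 is enough.\<close>
  define \<rho> where "\<rho> = (1 - r * \<gamma>) / 2"
  have \<rho>: "0 < \<rho>" using r\<gamma> by (simp add: \<rho>_def)
  have "\<rho> * \<gamma> \<le> \<rho>" using \<rho> \<gamma> by (intro mult_left_le) auto
  moreover have "r * \<gamma> + \<rho> < 1" using r\<gamma> by (simp add: \<rho>_def field_simps)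
  ultimately have "r * \<gamma> + \<rho> * \<gamma> < 1" by linarith
  then have \<rho>2: "(real r - 1 + \<rho>) * (1 - 2 * \<beta>) < 2 * \<beta>"
    by (simp add: algebra_simps \<gamma>_def)
  have r1: "1 \<le> real r" using r(1) by simp
  obtain \<kappa> \<Lambda> B \<delta> where \<Lambda>: "1 \<le> \<Lambda>" and B: "0 \<le> B" and \<delta>: "0 < \<delta>"
    and \<kappa>: "\<And>N k. k \<in> {1..r} \<Longrightarrow> \<bar>\<kappa> N k\<bar> \<le> \<Lambda>"
    and H1: "\<forall>\<^sub>F N in sequentially. \<forall>s. \<bar>s\<bar> \<le> \<delta> * sd N \<longrightarrow> (\<exists>Rm.
        char (law N) s = complex_of_real (exp (- s\<^sup>2 / 2)) * exp (cum_exp (\<kappa> N) r (1 / sd N) (\<i> * s) + Rm) \<and>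
        cmod Rm \<le> B * (1 / sd N) ^ (r + 1) * \<bar>s\<bar> ^ (r + 3))"
    using law_expansion[OF V, of r] by blast
  have sd_top: "filterlim sd at_top sequentially"
    unfolding sd_def by (intro filterlim_compose[OF sqrt_at_top V])
  \<comment> \<open>The padding coefficient has to be nonzero for every N to fix the degree, bounded
    by 1 for the coefficient bound, and of order \<sigma>^(-r-1) to be negligible. Adding 1 to the
    standard deviation covers the N at which it is small or 0.\<close>
  define \<tau> where "\<tau> N = 1 / (1 + sd N) ^ (r + 1)" for N
  have sd0: "0 \<le> sd N" for N by (simp add: sd_def V_nonneg)
  have \<tau>: "0 < \<tau> N" "\<tau> N \<le> 1" for N
  proof -
    have "1 \<le> (1 + sd N) ^ (r + 1)" using sd0[of N] by (intro one_le_power) auto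
    moreover have "1 / y \<le> 1" "0 < 1 / y" if "1 \<le> y" for y :: real using that by auto
    ultimately show "0 < \<tau> N" "\<tau> N \<le> 1" unfolding \<tau>_def by blast+
  qed
  define Pn where "Pn j N = edge_poly (\<kappa> N) r (\<tau> N) j" for j N
  define A :: real where "A = 1 + 4 ^ (3 * r) * fact (3 * r)"
  have A: "0 < A" by (simp add: A_def add_pos_nonneg)
  define F where "F N t = \<bar>cdf (distr M borel (normalized M (Tn N))) t - cdf std_normal_distribution t
    - (\<Sum>j=1..r. poly (Pn j N) t * std_normal_density t / std_dev M (Tn N) ^ j)\<bar>" for N t
  have key: "\<forall>\<^sub>F N in sequentially. \<forall>t. F N t \<le> e / sd N ^ r" if e: "0 < e" for e
  proof -
    have "\<forall>\<^sub>F N in sequentially. \<forall>x. \<bar>cdf (law N) x - edge_cdf (edge_weights (\<kappa> N) r (1 / sd N)) (3 * r) x\<bar> \<le> (e/2) / sd N ^ r"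
      using e by (intro edgeworth_asymptotic[OF real_distribution_law sd_top r(1) \<rho> \<Lambda> B \<delta> \<kappa> H1 law_decay[OF V r1 \<rho> \<rho>2]]) auto
    \<comment> \<open>This makes r A / \<sigma> at most e/2, which pays for the padding monomials;
      the other half of e is spent on the expansion.\<close>
    moreover have "\<forall>\<^sub>F N in sequentially. max 1 (2 * r * A / e) \<le> sd N"
      using sd_top[unfolded filterlim_at_top] by blast
    ultimately show ?thesis
    proof eventually_elim
      fix N
      assume 1: "\<forall>x. \<bar>cdf (law N) x - edge_cdf (edge_weights (\<kappa> N) r (1 / sd N)) (3 * r) x\<bar> \<le> (e/2) / sd N ^ r"
        and "max 1 (2 * r * A / e) \<le> sd N"
      then have sd: "1 \<le> sd N" "2 * r * A / e \<le> sd N" by auto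
      show "\<forall>t. F N t \<le> e / sd N ^ r"
      proof
        fix x
        let ?E = "\<Sum>j=1..r. \<tau> N * x ^ (3 * r) * std_normal_density x * (1 / sd N) ^ j"
        have "\<bar>?E\<bar> \<le> (\<Sum>j=1..r. \<tau> N * A)"
        proof (intro order_trans[OF sum_abs] sum_mono)
          fix j
          have "\<bar>\<tau> N * x ^ (3 * r) * std_normal_density x * (1 / sd N) ^ j\<bar> = \<tau> N * (\<bar>x ^ (3 * r) * std_normal_density x\<bar> * (1 / sd N) ^ j)"
            using \<tau>[of N] sd by (simp add: abs_mult mult_ac)
          also have "\<dots> \<le> \<tau> N * (A * 1)"
            unfolding A_def using \<tau>[of N] sd
            by (intro mult_left_mono mult_mono abs_power_gauss_le power_le_one) auto
          finally show "\<bar>\<tau> N * x ^ (3 * r) * std_normal_density x * (1 / sd N) ^ j\<bar> \<le> \<tau> N * A" by simp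
        qed
        also have "\<dots> = r * A * \<tau> N" by simp
        also have "\<dots> \<le> r * A * (1 / sd N ^ (r + 1))"
          unfolding \<tau>_def using sd A by (intro mult_left_mono divide_left_mono power_mono mult_pos_pos zero_less_power) auto
        also have "\<dots> = (r * A / sd N) / sd N ^ r" by simp
        also have "\<dots> \<le> (e/2) / sd N ^ r"
          using sd e by (intro divide_right_mono) (auto simp: field_simps)
        finally have 2: "\<bar>?E\<bar> \<le> (e/2) / sd N ^ r" .
        have "(\<Sum>j=1..r. poly (Pn j N) x * std_normal_density x / sd N ^ j) = (\<Sum>j=1..r. poly (Pn j N) x * std_normal_density x * (1 / sd N) ^ j)"
          by (simp add: power_divide)
        then have "F N x = \<bar>(cdf (law N) x - edge_cdf (edge_weights (\<kappa> N) r (1 / sd N)) (3 * r) x) - ?E\<bar>"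
          using edge_cdf_eq_edge_poly[where x = x and r = r and \<kappa> = "\<kappa> N" and \<tau> = "\<tau> N" and w = "1 / sd N"] unfolding F_def lawT sdT Pn_def
          by (intro arg_cong[where f = abs]) linarith
        also have "\<dots> \<le> (e/2) / sd N ^ r + (e/2) / sd N ^ r" using 1[rule_format, of x] 2 by linarith
        also have "\<dots> = e / sd N ^ r" by simp
        finally show "F N x \<le> e / sd N ^ r" .
      qed
    qed
  qed
  have "(\<lambda>N. SUP t. F N t) \<in> o(\<lambda>N. 1 / std_dev M (Tn N) ^ r)"
  proof (rule landau_o.smallI)
    fix e :: real assume "0 < e"
    from key[OF this] show "\<forall>\<^sub>F N in sequentially. norm (SUP t. F N t) \<le> e * norm (1 / std_dev M (Tn N) ^ r)"
    proof eventually_elim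
      fix N assume *: "\<forall>t. F N t \<le> e / sd N ^ r"
      have le: "(SUP t. F N t) \<le> e / sd N ^ r" using * by (intro cSUP_least) auto
      have "0 \<le> F N 0" by (simp add: F_def)
      also have "\<dots> \<le> (SUP t. F N t)" using * by (intro cSUP_upper bdd_aboveI2[of _ _ "e / sd N ^ r"]) auto
      finally show "norm (SUP t. F N t) \<le> e * norm (1 / std_dev M (Tn N) ^ r)" using le sd0[of N] by (simp add: sdT)
    qed
  qed
  moreover have "\<forall>j\<in>{1..r}. \<exists>d. \<forall>N. degree (Pn j N) = d"
  proof
    fix j
    have "degree (Pn j N) = 3 * r" for N unfolding Pn_def using \<tau>(1)[of N] by (intro degree_edge_poly r) auto
    then show "\<exists>d. \<forall>N. degree (Pn j N) = d" by blast
  qed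
  moreover have "\<exists>K. \<forall>j\<in>{1..r}. \<forall>N i. \<bar>coeff (Pn j N) i\<bar> \<le> K"
    unfolding Pn_def using edge_poly_coeff_le[OF \<kappa> \<Lambda>] \<tau>
    by (intro exI[of _ "1 + (\<Sum>k=1..3*r. r * (r * \<Lambda>) ^ r * (\<Sum>i\<le>degree (hermite (k - 1)). \<bar>coeff (hermite (k - 1)) i\<bar>))"])
      (simp add: abs_of_pos)
  ultimately show ?thesis unfolding edgeworth_expansion_def F_def by (intro exI[of _ Pn]) blast
qed

end

text \<open>The decay is assumed for essential suprema, while the chain estimates ask for bounds at
  every point. Clipping f at -b and b enforces them and changes the centred sums only on a null
  set.\<close>

lemma edgeworth_expansion_of_decay:
  fixes M :: "'w measure" and S :: "nat \<Rightarrow> 'a measure" and C \<beta> :: real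
  assumes mc: "is_markov_chain M S \<mu>\<^sub>1 R X" and ue: "uniformly_elliptic S R"
    and f: "\<And>n. n \<ge> 1 \<Longrightarrow> case_prod (f n) \<in> borel_measurable (S n \<Otimes>\<^sub>M S (Suc n))"
    and V: "filterlim (\<lambda>N. prob_space.variance M (centered_sum M X f N)) at_top sequentially"
    and C: "0 < C" and \<beta>: "0 < \<beta>" "\<beta> < 1/2"
    and norm: "\<And>n. n \<ge> 1 \<Longrightarrow> chain_fun_norm M X f n \<le> ereal (C * real n powr (- \<beta>))"
    and r: "1 \<le> r" "real r < 1 / (1 - 2 * \<beta>)"
  shows "edgeworth_expansion M (centered_sum M X f) r"
proof -
  obtain Fn \<nu> \<epsilon> where "elliptic_chain M (\<lambda>n. S (Suc n)) (\<lambda>n. R (Suc n)) (\<lambda>n. X (Suc n)) Fn \<nu> \<epsilon>"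
    using elliptic_chain_of_markov[OF mc ue] by blast
  then interpret ec: elliptic_chain M "\<lambda>n. S (Suc n)" "\<lambda>n. R (Suc n)" "\<lambda>n. X (Suc n)" Fn \<nu> \<epsilon> .
  define b where "b n = C * real (Suc n) powr - \<beta>" for n
  have b: "0 \<le> b n" for n using C by (simp add: b_def)
  define g where "g n p = max (- b n) (min (b n) (f (Suc n) (fst p) (snd p)))" for n p
  have f': "(\<lambda>p. f (Suc n) (fst p) (snd p)) \<in> borel_measurable (S (Suc n) \<Otimes>\<^sub>M S (Suc (Suc n)))" for n
    using f[of "Suc n"] by (simp add: split_beta')
  have g_le: "\<bar>g n p\<bar> \<le> b n" for n p using b[of n] by (auto simp: g_def)
  have g_meas: "bdd_meas (S (Suc n) \<Otimes>\<^sub>M S (Suc (Suc n))) (g n)" for n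
  proof (rule bdd_measI[of _ _ "b n"])
    show "g n \<in> borel_measurable (S (Suc n) \<Otimes>\<^sub>M S (Suc (Suc n)))"
      unfolding g_def[abs_def] using f'[of n] by measurable
  qed (simp add: g_le)
  interpret ds: decaying_sum M "\<lambda>n. S (Suc n)" "\<lambda>n. R (Suc n)" "\<lambda>n. X (Suc n)" Fn \<nu> \<epsilon> g C \<beta>
    by unfold_locales (use g_meas g_le C \<beta> in \<open>auto simp: b_def\<close>)
  have cf_meas: "chain_fun X f (Suc n) \<in> borel_measurable M" for n
    using measurable_compose[OF ec.X2_measurable f'[of n]] by (simp add: chain_fun_def[abs_def])
  have cf_g: "AE \<omega> in M. chain_fun X f (Suc n) \<omega> = g n (X (Suc n) \<omega>, X (Suc (Suc n)) \<omega>)" for n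
  proof -
    have "AE \<omega> in M. ereal \<bar>chain_fun X f (Suc n) \<omega>\<bar> \<le> chain_fun_norm M X f (Suc n)"
      unfolding chain_fun_norm_def by (rule esssup_AE)
    then show ?thesis
    proof eventually_elim
      fix \<omega> assume "ereal \<bar>chain_fun X f (Suc n) \<omega>\<bar> \<le> chain_fun_norm M X f (Suc n)"
      also have "\<dots> \<le> ereal (b n)" unfolding b_def by (rule norm) simp
      finally have "\<bar>chain_fun X f (Suc n) \<omega>\<bar> \<le> b n" by simp
      then show "chain_fun X f (Suc n) \<omega> = g n (X (Suc n) \<omega>, X (Suc (Suc n)) \<omega>)"
        by (auto simp: g_def chain_fun_def)
    qed
  qed
  have g_int: "(\<lambda>\<omega>. g n (X (Suc n) \<omega>, X (Suc (Suc n)) \<omega>)) \<in> borel_measurable M" for n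
    using measurable_compose[OF ec.X2_measurable bdd_meas_measurable[OF g_meas[of n]]] by simp
  have E: "ec.expectation (chain_fun X f (Suc n)) = (\<integral>\<omega>. g n (X (Suc n) \<omega>, X (Suc (Suc n)) \<omega>) \<partial>M)" for n
    using integral_cong_AE[OF cf_meas g_int cf_g] .
  have T_eq: "centered_sum M X f N \<omega> = (\<Sum>k=0..<N. chain_fun X f (Suc k) \<omega> - ec.expectation (chain_fun X f (Suc k)))" for N \<omega>
    unfolding centered_sum_def by (rule sum.reindex_bij_witness[of _ Suc "\<lambda>n. n - 1"]) auto
  have T_meas: "centered_sum M X f N \<in> borel_measurable M" for N
    unfolding T_eq[abs_def] using cf_meas by measurable
  have T_AE: "AE \<omega> in M. centered_sum M X f N \<omega> = ds.Zs N 0 \<omega>" for N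
  proof -
    have "AE \<omega> in M. \<forall>k\<in>{0..<N}. chain_fun X f (Suc k) \<omega> = g k (X (Suc k) \<omega>, X (Suc (Suc k)) \<omega>)"
      by (rule AE_finite_allI) (auto intro: cf_g)
    then show ?thesis
      by eventually_elim (simp add: T_eq ds.Zs_def ds.Y_def E)
  qed
  have "ec.variance (centered_sum M X f N) = ds.V N" for N
  proof -
    have Zm: "ds.Zs N 0 \<in> borel_measurable M" by (rule bdd_meas_measurable[OF ds.bdd_meas_Zs])
    have "ec.expectation (centered_sum M X f N) = 0"
      using integral_cong_AE[OF T_meas Zm T_AE] ds.expectation_Zs[of N 0] by simp
    then show ?thesis
      unfolding ds.V_def using T_AE[of N] T_meas[of N] Zm by (simp, intro integral_cong_AE) auto
  qed
  with V have "filterlim ds.V at_top sequentially" by simp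
  from ds.edgeworth_expansion_AE[OF this r T_meas T_AE] show ?thesis .
qed

theorem theorem4:
  fixes M :: "'w measure"
    and S :: "nat \<Rightarrow> 'a measure"
    and \<mu>\<^sub>1 :: "'a measure"
    and R :: "nat \<Rightarrow> 'a \<Rightarrow> 'a measure"
    and X :: "nat \<Rightarrow> 'w \<Rightarrow> 'a"
    and f :: "nat \<Rightarrow> 'a \<Rightarrow> 'a \<Rightarrow> real"
  assumes "is_markov_chain M S \<mu>\<^sub>1 R X"
    and "uniformly_elliptic S R"
    and "\<And>n. n \<ge> 1 \<Longrightarrow> case_prod (f n) \<in> borel_measurable (S n \<Otimes>\<^sub>M S (Suc n))"
    and "\<exists>B. \<forall>n\<ge>1. \<forall>x\<in>space (S n). \<forall>y\<in>space (S (Suc n)). \<bar>f n x y\<bar> \<le> B"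
    and "filterlim (\<lambda>N. prob_space.variance M (centered_sum M X f N)) at_top sequentially"
  shows "(\<forall>(C::real) (\<beta>::real) (r::nat).
            C > 0 \<and> 0 < \<beta> \<and> \<beta> < 1/2 \<and>
            (\<forall>n\<ge>1. chain_fun_norm M X f n \<le> ereal (C * real n powr (- \<beta>))) \<and>
            r \<ge> 1 \<and> real r < 1 / (1 - 2 * \<beta>) \<longrightarrow>
            edgeworth_expansion M (centered_sum M X f) r) \<and>
         ((\<exists>C::real. \<forall>\<^sub>F n in sequentially.
            chain_fun_norm M X f n \<le> ereal (C * real n powr (- 1/2))) \<longrightarrow>
          (\<forall>r\<ge>1. edgeworth_expansion M (centered_sum M X f) r))"
proof (intro conjI allI impI)
  fix C \<beta> :: real and r :: nat
  assume "C > 0 \<and> 0 < \<beta> \<and> \<beta> < 1/2 \<and>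
            (\<forall>n\<ge>1. chain_fun_norm M X f n \<le> ereal (C * real n powr (- \<beta>))) \<and>
            r \<ge> 1 \<and> real r < 1 / (1 - 2 * \<beta>)"
  then show "edgeworth_expansion M (centered_sum M X f) r"
    using edgeworth_expansion_of_decay[OF assms(1-3,5), of C \<beta> r] by auto
next
  fix r :: nat assume r: "1 \<le> r"
  assume "\<exists>C::real. \<forall>\<^sub>F n in sequentially. chain_fun_norm M X f n \<le> ereal (C * real n powr (- 1/2))"
  then obtain C n0 where C: "\<And>n. n0 \<le> n \<Longrightarrow> chain_fun_norm M X f n \<le> ereal (C * real n powr (- 1/2))"
    by (auto simp: eventually_sequentially)
  obtain B where B: "\<And>n x y. 1 \<le> n \<Longrightarrow> x \<in> space (S n) \<Longrightarrow> y \<in> space (S (Suc n)) \<Longrightarrow> \<bar>f n x y\<bar> \<le> B"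
    using assms(4) by blast
  have X: "X n \<in> M \<rightarrow>\<^sub>M S n" if "1 \<le> n" for n using assms(1) that by (simp add: is_markov_chain_def)
  have B_norm: "chain_fun_norm M X f n \<le> ereal B" if n: "1 \<le> n" for n
    unfolding chain_fun_norm_def
  proof (rule esssup_I)
    have "(\<lambda>\<omega>. (X n \<omega>, X (Suc n) \<omega>)) \<in> M \<rightarrow>\<^sub>M S n \<Otimes>\<^sub>M S (Suc n)" using X n by (intro measurable_Pair) auto
    from measurable_compose[OF this assms(3)[OF n]]
    show "(\<lambda>\<omega>. ereal \<bar>chain_fun X f n \<omega>\<bar>) \<in> borel_measurable M" by (simp add: chain_fun_def)
    show "AE \<omega> in M. ereal \<bar>chain_fun X f n \<omega>\<bar> \<le> ereal B"
      using n measurable_space[OF X[OF n]] measurable_space[OF X[of "Suc n"]]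
      by (intro AE_I2) (auto simp: chain_fun_def intro!: B)
  qed
  \<comment> \<open>Any value close enough to 1/2 would do; for this one 1 / (1 - 2 \<beta>) = 2 (r
    + 1).\<close>
  define \<beta> :: real where "\<beta> = 1/2 - 1 / (4 * (real r + 1))"
  have \<beta>: "0 < \<beta>" "\<beta> < 1/2" using r by (auto simp: \<beta>_def field_simps)
  have r\<beta>: "real r < 1 / (1 - 2 * \<beta>)" using r by (simp add: \<beta>_def field_simps)
  \<comment> \<open>The decay is assumed only eventually. For the finitely many n below n0 the
    uniform bound B is used, at the price of the factor n0^\<beta>.\<close>
  define C' where "C' = 1 + \<bar>C\<bar> + \<bar>B\<bar> * real n0 powr \<beta>"
  have C': "0 < C'" by (simp add: C'_def add_pos_nonneg)
  have "chain_fun_norm M X f n \<le> ereal (C' * real n powr (- \<beta>))" if n: "1 \<le> n" for n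
  proof (cases "n0 \<le> n")
    case True
    have "0 \<le> \<bar>B\<bar> * real n0 powr \<beta>" by simp
    then have "C \<le> C'" unfolding C'_def by linarith
    then have "C * real n powr (- 1/2) \<le> C' * real n powr (- \<beta>)"
      using n \<beta> C' by (intro mult_mono powr_mono) auto
    with C[OF True] show ?thesis by (meson ereal_less_eq(3) order_trans)
  next
    case False
    have "B \<le> \<bar>B\<bar> * (real n powr \<beta> * real n powr (- \<beta>))" using n by (simp add: powr_minus)
    also have "\<dots> = (\<bar>B\<bar> * real n powr \<beta>) * real n powr (- \<beta>)" by (simp only: mult.assoc)
    also have "\<dots> \<le> C' * real n powr (- \<beta>)"
    proof (rule mult_right_mono)
      have "real n powr \<beta> \<le> real n0 powr \<beta>" using False \<beta> by (intro powr_mono2) auto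
      then have "\<bar>B\<bar> * real n powr \<beta> \<le> \<bar>B\<bar> * real n0 powr \<beta>" by (intro mult_left_mono) auto
      then show "\<bar>B\<bar> * real n powr \<beta> \<le> C'" by (simp add: C'_def)
    qed simp
    finally show ?thesis using B_norm[OF n] by (meson ereal_less_eq(3) order_trans)
  qed
  then show "edgeworth_expansion M (centered_sum M X f) r"
    using edgeworth_expansion_of_decay[OF assms(1-3,5) C' \<beta> _ r r\<beta>] by blast
qed

end
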